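(* Let $m$ be a fixed cube-free integer that is not a cube, $K=\mathbb{Q}(\mu_3,m^{1/3})$, $a$ a nonzero integer sixth-power-free in $K$, $\mathsf E_a:y^2=x^3+a$, $\phi$ the $3$-isogeny described in the context, and $S_a(K)=\{\mathfrak q\in\Sigma_K: a\in K_{\mathfrak q}^{*2},\ v_{\mathfrak q}(4a)\not\equiv0\pmod6\}$. \begin{enumerate} \item[(i)] If $a\notin K^{*2}$, then, with $L=K(\sqrt a)$, $\mathrm{Sel}^\phi(\mathsf E_a/K)\subset N(L,S_a,a)$. \item[(ii)] If $a\in K^{*2}$, then $\mathrm{Sel}^\phi(\mathsf E_a/K)\subset N(K,S_a,a)$. \end{enumerate}
   Context: $\Sigma_K$: finite primes of $K$; $K_{\mathfrak q}$, $v_{\mathfrak q}$: completion and valuation. The paper assumes $\mathrm{Gal}(K/\mathbb{Q})\cong S_3$. $\zeta_3$ a primitive cube root of unity, $\mathfrak p=1-\zeta_3$, $\phi(x,y)=\left(\frac{x^3+4a}{\mathfrak p^2x^2},\frac{y(x^3-8a)}{\mathfrak p^3x^3}\right)$, $\ker\phi=\{O,(0,\pm\sqrt a)\}$. With $L=K[x]/(x^2-a)$ and $(L^*/L^{*3})_{N=1}$ the kernel of the norm map to $K^*/K^{*3}$ (norm = product of coordinates when $L=K\times K$), $H^1(G_K,\mathsf E_a[\phi])\cong(L^*/L^{*3})_{N=1}$ via $\mathsf E_a[\phi]\cong\ker(\mathrm{Res}^L_K\mu_3\to\mu_3)$, and for $a\in K^{*2}$ this is identified with $K^*/K^{*3}$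 via $(\overline x,\overline x^{-1})\mapsto\overline x$. $\mathrm{Sel}^\phi(\mathsf E_a/K)$ consists of classes whose restriction at every $\mathfrak q\in\Sigma_K$ lies in the image of the local Kummer map $\mathsf E_a(K_{\mathfrak q})/\phi(\mathsf E_a(K_{\mathfrak q}))\hookrightarrow H^1(G_{K_{\mathfrak q}},\mathsf E_a[\phi])$. For $F\in\{K,L\}$, with $S_a(L)$ the primes of $L$ above $S_a(K)$ and $\mathcal O_{S_a(F)}$ the $S_a(F)$-integers, $N(F,S_a,a)=\{\overline x\in F^*/F^{*3}: x\mathcal O_{S_a(F)}=I^3\text{ for some fractional ideal }I\text{ of }\mathcal O_{S_a(F)}\}$. *)

theory Defs
  imports Complex_Main "HOL-Algebra.Algebraic_Closure_Type" "HOL-Algebra.Generated_Fields"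
begin

text \<open>
  Number fields are subfields of the complex numbers, given by their carrier sets; the algebraic
  closure of a number field is the field of algebraic numbers. Completions are constructed as
  quotient rings, and their algebraic closures are those of HOL-Algebra. Galois cohomology and the
  elliptic curve are therefore developed for an algebraically closed field given as a record.
\<close>


section \<open>Number fields, primes and valuations\<close>

abbreviation CC :: "complex ring" where
  "CC \<equiv> ring_of_type_algebra"

definition pure_cubic_closure :: "int \<Rightarrow> complex set" where
  "pure_cubic_closure m =
     generate_field CC ({z. z ^ 3 = 1} \<union> {complex_of_real (root 3 (real_of_int m))})"

definition adjoin :: "complex set \<Rightarrow> complex \<Rightarrow> complex set" where
  "adjoin K r = generate_field CC (insert r K)"

definition cube_free :: "int \<Rightarrow> bool" where
  "cube_free m \<longleftrightarrow> (\<forall>p. prime p \<longrightarrow> \<not> p ^ 3 dvd m)"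

definition ints_of :: "complex set \<Rightarrow> complex set" where
  "ints_of F = {x \<in> F. algebraic_int x}"

definition sixth_power_free_in :: "complex set \<Rightarrow> complex \<Rightarrow> bool" where
  "sixth_power_free_in F x \<longleftrightarrow>
     (\<forall>d \<in> ints_of F. (\<exists>e \<in> ints_of F. x = d ^ 6 * e) \<longrightarrow> (\<exists>u \<in> ints_of F. d * u = 1))"

text \<open>The finite primes of \<open>F\<close> are the nonzero prime ideals of its ring of integers.\<close>

definition fin_primes :: "complex set \<Rightarrow> complex set set" where
  "fin_primes F = {q. primeideal q (CC\<lparr>carrier := ints_of F\<rparr>) \<and> q \<noteq> {0}}"

text \<open>Products and powers of additive subgroups: the subgroup generated by the products.
  The argument \<open>A\<close> is the base ring, which is the zeroth power.\<close>

definition ideal_mult :: "complex set \<Rightarrow> complex set \<Rightarrow> complex set" where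
  "ideal_mult I J =
     {\<Sum>i<n. x i * y i | (n::nat) x y. \<forall>i<n. x i \<in> I \<and> y i \<in> J}"

primrec ideal_pow :: "complex set \<Rightarrow> complex set \<Rightarrow> nat \<Rightarrow> complex set" where
  "ideal_pow A I 0 = A"
| "ideal_pow A I (Suc n) = ideal_mult I (ideal_pow A I n)"

definition ord_at :: "complex set \<Rightarrow> complex set \<Rightarrow> complex \<Rightarrow> nat" where
  "ord_at F q x = (GREATEST n. x \<in> ideal_pow (ints_of F) q n)"

text \<open>The normalised valuation at \<open>q\<close>, meaningful for nonzero elements of \<open>F\<close> only; every use
  below treats \<open>0\<close> separately.\<close>

definition val :: "complex set \<Rightarrow> complex set \<Rightarrow> complex \<Rightarrow> int" where
  "val F q x = (THE k. \<exists>b \<in> ints_of F - {0}. \<exists>c \<in> ints_of F - {0}.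
     x = b / c \<and> k = int (ord_at F q b) - int (ord_at F q c))"

definition primes_above :: "complex set \<Rightarrow> complex set \<Rightarrow> complex set set \<Rightarrow> complex set set" where
  "primes_above K L S = {Q \<in> fin_primes L. Q \<inter> K \<in> S}"

definition S_ints :: "complex set \<Rightarrow> complex set set \<Rightarrow> complex set" where
  "S_ints F S = {x \<in> F. x = 0 \<or> (\<forall>q \<in> fin_primes F - S. 0 \<le> val F q x)}"

text \<open>Nonzero fractional ideals of a subring \<open>A\<close> of \<open>F\<close>.\<close>

definition fractional_ideal :: "complex set \<Rightarrow> complex set \<Rightarrow> complex set \<Rightarrow> bool" where
  "fractional_ideal F A I \<longleftrightarrow>
     I \<subseteq> F \<and> 0 \<in> I \<and> I \<noteq> {0} \<and>
     (\<forall>x \<in> I. \<forall>y \<in> I. x + y \<in> I) \<and> (\<forall>x \<in> A. \<forall>y \<in> I. x * y \<in> I) \<and>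
     (\<exists>d \<in> A - {0}. \<forall>x \<in> I. d * x \<in> A)"

text \<open>The class of \<open>x\<close> in \<open>F\<^sup>* / F\<^sup>*\<^sup>3\<close>.\<close>

definition cube_class :: "complex set \<Rightarrow> complex \<Rightarrow> complex set" where
  "cube_class F x = {x * c ^ 3 | c. c \<in> F - {0}}"

definition N_group :: "complex set \<Rightarrow> complex set set \<Rightarrow> complex set set" where
  "N_group F S =
     {cube_class F x | x. x \<in> F - {0} \<and>
        (\<exists>I. fractional_ideal F (S_ints F S) I \<and>
             (\<lambda>y. x * y) ` S_ints F S = ideal_pow (S_ints F S) I 3)}"


section \<open>Completions\<close>

text \<open>The completion of \<open>F\<close> at \<open>q\<close>: Cauchy sequences for the \<open>q\<close>-adic topology modulo null
  sequences. The predicate below says that \<open>x\<close> has valuation at least \<open>N\<close>, with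
  \<open>0\<close> of infinite valuation.\<close>

definition val_ge :: "complex set \<Rightarrow> complex set \<Rightarrow> complex \<Rightarrow> int \<Rightarrow> bool" where
  "val_ge F q x N \<longleftrightarrow> x = 0 \<or> N \<le> val F q x"

definition cauchy_ring :: "complex set \<Rightarrow> complex set \<Rightarrow> (nat \<Rightarrow> complex) ring" where
  "cauchy_ring F q =
     \<lparr>carrier = {s. range s \<subseteq> F \<and> (\<forall>N. \<exists>M. \<forall>i\<ge>M. \<forall>j\<ge>M. val_ge F q (s i - s j) N)},
      monoid.mult = (\<lambda>s t n. s n * t n), one = (\<lambda>_. 1),
      zero = (\<lambda>_. 0), add = (\<lambda>s t n. s n + t n)\<rparr>"

definition null_seqs :: "complex set \<Rightarrow> complex set \<Rightarrow> (nat \<Rightarrow> complex) set" where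
  "null_seqs F q =
     {s \<in> carrier (cauchy_ring F q). \<forall>N. \<exists>M. \<forall>i\<ge>M. val_ge F q (s i) N}"

definition completion :: "complex set \<Rightarrow> complex set \<Rightarrow> (nat \<Rightarrow> complex) set ring" where
  "completion F q = cauchy_ring F q Quot null_seqs F q"

definition to_completion :: "complex set \<Rightarrow> complex set \<Rightarrow> complex \<Rightarrow> (nat \<Rightarrow> complex) set" where
  "to_completion F q x = null_seqs F q +>\<^bsub>cauchy_ring F q\<^esub> (\<lambda>_. x)"

type_synonym local_elem = "((nat \<Rightarrow> complex) set list \<times> nat) multiset \<Rightarrow> (nat \<Rightarrow> complex) set"

text \<open>The algebraic closure of the completion, the completion as a subfield of it, and the
  resulting embedding of \<open>F\<close>.\<close>

definition local_closure :: "complex set \<Rightarrow> complex set \<Rightarrow> local_elem ring" where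
  "local_closure F q = field.alg_closure (completion F q)"

definition local_field :: "complex set \<Rightarrow> complex set \<Rightarrow> local_elem set" where
  "local_field F q = ring.indexed_const (completion F q) ` carrier (completion F q)"

definition to_local :: "complex set \<Rightarrow> complex set \<Rightarrow> complex \<Rightarrow> local_elem" where
  "to_local F q x = ring.indexed_const (completion F q) (to_completion F q x)"


section \<open>The curve and its isogeny\<close>

datatype 'c point = Infty | Affine 'c 'c

text \<open>In this section \<open>C\<close> is a field of characteristic zero, \<open>F\<close> a subfield, \<open>a \<noteq> 0\<close> an element
  of \<open>F\<close> and \<open>z\<close> a primitive cube root of unity in \<open>F\<close>.\<close>

definition rdiv :: "'c ring \<Rightarrow> 'c \<Rightarrow> 'c \<Rightarrow> 'c" where
  "rdiv C x y = x \<otimes>\<^bsub>C\<^esub> inv\<^bsub>C\<^esub> y"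

definition curve_points :: "'c ring \<Rightarrow> 'c set \<Rightarrow> 'c \<Rightarrow> 'c point set" where
  "curve_points C F a =
     {Infty} \<union> {Affine x y | x y. x \<in> F \<and> y \<in> F \<and>
        y [^]\<^bsub>C\<^esub> (2::nat) = x [^]\<^bsub>C\<^esub> (3::nat) \<oplus>\<^bsub>C\<^esub> a}"

fun pt_neg :: "'c ring \<Rightarrow> 'c point \<Rightarrow> 'c point" where
  "pt_neg C Infty = Infty"
| "pt_neg C (Affine x y) = Affine x (\<ominus>\<^bsub>C\<^esub> y)"

fun pt_add :: "'c ring \<Rightarrow> 'c point \<Rightarrow> 'c point \<Rightarrow> 'c point" where
  "pt_add C Infty Q = Q"
| "pt_add C (Affine x1 y1) Infty = Affine x1 y1"
| "pt_add C (Affine x1 y1) (Affine x2 y2) =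
     (if x1 = x2 \<and> y1 = \<ominus>\<^bsub>C\<^esub> y2 then Infty
      else
        let l = (if x1 = x2
                 then rdiv C ([(3::nat)] \<cdot>\<^bsub>C\<^esub> (x1 [^]\<^bsub>C\<^esub> (2::nat))) ([(2::nat)] \<cdot>\<^bsub>C\<^esub> y1)
                 else rdiv C (y2 \<ominus>\<^bsub>C\<^esub> y1) (x2 \<ominus>\<^bsub>C\<^esub> x1));
            x3 = (l [^]\<^bsub>C\<^esub> (2::nat) \<ominus>\<^bsub>C\<^esub> x1) \<ominus>\<^bsub>C\<^esub> x2
        in Affine x3 ((l \<otimes>\<^bsub>C\<^esub> (x1 \<ominus>\<^bsub>C\<^esub> x3)) \<ominus>\<^bsub>C\<^esub> y1))"

definition pt_diff :: "'c ring \<Rightarrow> 'c point \<Rightarrow> 'c point \<Rightarrow> 'c point" where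
  "pt_diff C P Q = pt_add C P (pt_neg C Q)"

text \<open>The isogeny
  \<open>\<phi>(x, y) = ((x^3 + 4a) / (p^2 x^2), y (x^3 - 8a) / (p^3 x^3))\<close> with \<open>p = 1 - z\<close>; it sends the
  points with \<open>x = 0\<close> to the point at infinity.\<close>

fun isog :: "'c ring \<Rightarrow> 'c \<Rightarrow> 'c \<Rightarrow> 'c point \<Rightarrow> 'c point" where
  "isog C a z Infty = Infty"
| "isog C a z (Affine x y) =
     (if x = \<zero>\<^bsub>C\<^esub> then Infty
      else
        let p = \<one>\<^bsub>C\<^esub> \<ominus>\<^bsub>C\<^esub> z
        in Affine
          (rdiv C (x [^]\<^bsub>C\<^esub> (3::nat) \<oplus>\<^bsub>C\<^esub> [(4::nat)] \<cdot>\<^bsub>C\<^esub> a)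
                  (p [^]\<^bsub>C\<^esub> (2::nat) \<otimes>\<^bsub>C\<^esub> x [^]\<^bsub>C\<^esub> (2::nat)))
          (rdiv C (y \<otimes>\<^bsub>C\<^esub> (x [^]\<^bsub>C\<^esub> (3::nat) \<ominus>\<^bsub>C\<^esub> [(8::nat)] \<cdot>\<^bsub>C\<^esub> a))
                  (p [^]\<^bsub>C\<^esub> (3::nat) \<otimes>\<^bsub>C\<^esub> x [^]\<^bsub>C\<^esub> (3::nat))))"

definition isog_ker :: "'c ring \<Rightarrow> 'c \<Rightarrow> 'c \<Rightarrow> 'c point set" where
  "isog_ker C a z = {P \<in> curve_points C (carrier C) a. isog C a z P = Infty}"


section \<open>Galois cohomology of the kernel of the isogeny\<close>

text \<open>Here \<open>C\<close> is an algebraic closure of \<open>F\<close>, so \<open>gal C F\<close> is the absolute Galois group of \<open>F\<close>.\<close>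

definition gal :: "'c ring \<Rightarrow> 'c set \<Rightarrow> ('c \<Rightarrow> 'c) set" where
  "gal C F = {s \<in> ring_iso C C \<inter> extensional (carrier C). \<forall>x \<in> F. s x = x}"

text \<open>Continuity of a map from the Galois group, with its Krull topology, to a discrete space.\<close>

definition krull_continuous :: "'c ring \<Rightarrow> 'c set \<Rightarrow> (('c \<Rightarrow> 'c) \<Rightarrow> 'd) \<Rightarrow> bool" where
  "krull_continuous C F c \<longleftrightarrow>
     (\<forall>s \<in> gal C F. \<exists>B. finite B \<and> B \<subseteq> carrier C \<and>
        (\<forall>t \<in> gal C F. (\<forall>x \<in> B. t x = s x) \<longrightarrow> c t = c s))"

definition cocycles :: "'c ring \<Rightarrow> 'c set \<Rightarrow> 'c \<Rightarrow> 'c \<Rightarrow> (('c \<Rightarrow> 'c) \<Rightarrow> 'c point) set" where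
  "cocycles C F a z =
     {c \<in> gal C F \<rightarrow>\<^sub>E isog_ker C a z. krull_continuous C F c \<and>
        (\<forall>s \<in> gal C F. \<forall>t \<in> gal C F.
           c (compose (carrier C) s t) = pt_add C (c s) (map_point s (c t)))}"

definition cohomologous ::
  "'c ring \<Rightarrow> 'c set \<Rightarrow> 'c \<Rightarrow> 'c \<Rightarrow>
     (('c \<Rightarrow> 'c) \<Rightarrow> 'c point) \<Rightarrow> (('c \<Rightarrow> 'c) \<Rightarrow> 'c point) \<Rightarrow> bool" where
  "cohomologous C F a z c d \<longleftrightarrow>
     (\<exists>T \<in> isog_ker C a z. \<forall>s \<in> gal C F.
        d s = pt_add C (c s) (pt_diff C (map_point s T) T))"

definition coh_class ::
  "'c ring \<Rightarrow> 'c set \<Rightarrow> 'c \<Rightarrow> 'c \<Rightarrow> (('c \<Rightarrow> 'c) \<Rightarrow> 'c point) \<Rightarrow> (('c \<Rightarrow> 'c) \<Rightarrow> 'c point) set" where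
  "coh_class C F a z c = {d \<in> cocycles C F a z. cohomologous C F a z c d}"

definition H1 :: "'c ring \<Rightarrow> 'c set \<Rightarrow> 'c \<Rightarrow> 'c \<Rightarrow> (('c \<Rightarrow> 'c) \<Rightarrow> 'c point) set set" where
  "H1 C F a z = coh_class C F a z ` cocycles C F a z"

text \<open>The image of the Kummer map: the connecting homomorphism sends \<open>P = \<phi>(Q)\<close> to the class of
  \<open>\<sigma> \<mapsto> \<sigma>(Q) - Q\<close>.\<close>

definition kummer_image :: "'c ring \<Rightarrow> 'c set \<Rightarrow> 'c \<Rightarrow> 'c \<Rightarrow> (('c \<Rightarrow> 'c) \<Rightarrow> 'c point) set set" where
  "kummer_image C F a z =
     {coh_class C F a z (\<lambda>s \<in> gal C F. pt_diff C (map_point s Q) Q) | Q.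
        Q \<in> curve_points C (carrier C) a \<and> isog C a z Q \<in> curve_points C F a}"


section \<open>The Selmer group\<close>

text \<open>From here on \<open>K\<close> is a number field containing the primitive cube root of unity \<open>z\<close> and the
  nonzero element \<open>a\<close>.\<close>

definition Kbar :: "complex ring" where
  "Kbar = CC\<lparr>carrier := {x. algebraic x}\<rparr>"

text \<open>Embeddings of the algebraic closure of \<open>K\<close> into that of its completion.\<close>

definition closure_embeddings :: "complex set \<Rightarrow> complex set \<Rightarrow> (complex \<Rightarrow> local_elem) set" where
  "closure_embeddings K q =
     {i \<in> ring_hom Kbar (local_closure K q). \<forall>x \<in> K. i x = to_local K q x}"

definition restrict_auto ::
  "(complex \<Rightarrow> local_elem) \<Rightarrow> (local_elem \<Rightarrow> local_elem) \<Rightarrow> complex \<Rightarrow> complex" where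
  "restrict_auto i s = (\<lambda>x \<in> carrier Kbar. inv_into (carrier Kbar) i (s (i x)))"

definition restrict_cocycle ::
  "complex set \<Rightarrow> complex set \<Rightarrow> (complex \<Rightarrow> local_elem) \<Rightarrow>
     ((complex \<Rightarrow> complex) \<Rightarrow> complex point) \<Rightarrow> (local_elem \<Rightarrow> local_elem) \<Rightarrow> local_elem point" where
  "restrict_cocycle K q i c =
     (\<lambda>s \<in> gal (local_closure K q) (local_field K q). map_point i (c (restrict_auto i s)))"

text \<open>Restriction of cohomology classes does not depend on the embedding of algebraic closures,
  so any embedding may be used at each prime, and any cocycle in the class.\<close>

definition selmer ::
  "complex set \<Rightarrow> complex \<Rightarrow> complex \<Rightarrow> ((complex \<Rightarrow> complex) \<Rightarrow> complex point) set set" where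
  "selmer K a z =
     {\<xi> \<in> H1 Kbar K a z. \<forall>q \<in> fin_primes K. \<exists>i \<in> closure_embeddings K q. \<exists>c \<in> \<xi>.
        coh_class (local_closure K q) (local_field K q) (to_local K q a) (to_local K q z)
            (restrict_cocycle K q i c)
          \<in> kummer_image (local_closure K q) (local_field K q) (to_local K q a) (to_local K q z)}"

text \<open>
  The module \<open>Res \<mu>\<^sub>3\<close> attached to the algebra \<open>K[x]/(x^2 - a)\<close> consists of the functions from the
  roots of \<open>x^2 - a\<close> to the cube roots of unity. The isomorphism from the kernel of the isogeny to
  the kernel of \<open>Res \<mu>\<^sub>3 \<rightarrow> \<mu>\<^sub>3\<close> sends \<open>(0, r)\<close> to the function with value \<open>z\<close> at \<open>r\<close> and \<open>z\<^sup>-\<^sup>1\<close> at \<open>-r\<close>.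
  The only other isomorphism is its inverse, which gives the same image of the Selmer group.
\<close>

fun ker_char :: "complex \<Rightarrow> complex point \<Rightarrow> complex \<Rightarrow> complex" where
  "ker_char z Infty r = 1"
| "ker_char z (Affine x y) r = (if r = y then z else inverse z)"

text \<open>
  A pair \<open>(u, v)\<close> stands for the element \<open>u + v x\<close> of \<open>K[x]/(x^2 - a)\<close>, whose norm is
  \<open>u^2 - a v^2\<close> and whose image at the root \<open>r\<close> is \<open>u + v r\<close>. It corresponds to the class of the
  cocycle \<open>c\<close> if, under the above isomorphism, \<open>c\<close> is the cocycle \<open>\<sigma> \<mapsto> \<sigma>(\<theta>) / \<theta>\<close> for a cube root
  \<open>\<theta>\<close> of the element in the algebra tensored with the algebraic closure; the Galois action there is
  \<open>(\<sigma> \<theta>)(\<sigma> r) = \<sigma> (\<theta> r)\<close>.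
\<close>

definition kummer_corresponds ::
  "complex set \<Rightarrow> complex \<Rightarrow> complex \<Rightarrow> complex \<times> complex \<Rightarrow>
     ((complex \<Rightarrow> complex) \<Rightarrow> complex point) \<Rightarrow> bool" where
  "kummer_corresponds K a z w c \<longleftrightarrow>
     (\<exists>\<theta>. (\<forall>r. r ^ 2 = a \<longrightarrow> \<theta> r ^ 3 = fst w + snd w * r) \<and>
          (\<forall>s \<in> gal Kbar K. \<forall>r. r ^ 2 = a \<longrightarrow>
             ker_char z (c s) (s r) = s (\<theta> r) / \<theta> (s r)))"

text \<open>The elements of the algebra whose classes modulo cubes have trivial norm and lie in the
  Selmer group.\<close>

definition selmer_elems :: "complex set \<Rightarrow> complex \<Rightarrow> complex \<Rightarrow> (complex \<times> complex) set" where
  "selmer_elems K a z =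
     {(u, v). u \<in> K \<and> v \<in> K \<and> (\<exists>c \<in> K - {0}. u ^ 2 - a * v ^ 2 = c ^ 3) \<and>
        (\<exists>\<xi> \<in> selmer K a z. \<exists>c \<in> \<xi>. kummer_corresponds K a z (u, v) c)}"

text \<open>
  The Selmer group inside \<open>L\<^sup>* / L\<^sup>*\<^sup>3\<close>, by the evaluation \<open>u + v x \<mapsto> u + v r\<close> at a fixed square root
  \<open>r\<close> of \<open>a\<close>. If \<open>a\<close> is not a square in \<open>K\<close>, this identifies the algebra with the field
  \<open>L = K(r)\<close>. If \<open>a\<close> is a square, the algebra is \<open>K \<times> K\<close>, we take \<open>L = K\<close>, and this is the first
  projection; on classes of trivial norm it is the identification of \<open>(x, x\<^sup>-\<^sup>1)\<close> with \<open>x\<close>.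
\<close>

definition selmer_classes ::
  "complex set \<Rightarrow> complex set \<Rightarrow> complex \<Rightarrow> complex \<Rightarrow> complex \<Rightarrow> complex set set" where
  "selmer_classes K L a z r = (\<lambda>(u, v). cube_class L (u + v * r)) ` selmer_elems K a z"

definition S_primes :: "complex set \<Rightarrow> complex \<Rightarrow> complex set set" where
  "S_primes K a =
     {q \<in> fin_primes K.
        (\<exists>b \<in> carrier (completion K q) - {\<zero>\<^bsub>completion K q\<^esub>}.
            to_completion K q a = b [^]\<^bsub>completion K q\<^esub> (2::nat)) \<and>
        val K q (4 * a) mod 6 \<noteq> 0}"

end

theory Submission
  imports Defs "Jordan_Normal_Form.Char_Poly" "HOL-Algebra.Chinese_Remainder"
begin

text \<open>
  Let \<open>(u, v)\<close> represent a Selmer class and let \<open>q\<close> be a prime of \<open>K\<close> outside \<open>S\<close>. Suppose first that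
  \<open>a = \<rho>\<^sup>2\<close> in the completion. The local class is trivial, in which case \<open>u + v \<rho>\<close> and \<open>u - v \<rho>\<close> are
  cubes, or it comes from a point with image \<open>(X, Y)\<close> under the isogeny. In the second case \<open>Y - \<rho>\<close> has
  a cube root in the function field of the curve, on which the kernel of the isogeny acts through the
  character of the Kummer correspondence; hence \<open>(u + v \<rho>) (Y - \<rho>)\<close> and \<open>(u - v \<rho>) (Y + \<rho>)\<close> are cubes
  in the completion. Now \<open>(Y - \<rho>) (Y + \<rho>) = X\<^sup>3\<close>, and the two factors differ by \<open>2 \<rho>\<close>, whose valuation,
  half that of \<open>4 a\<close>, is divisible by three; therefore so are the valuations of the factors and of
  \<open>u \<plusminus> v \<rho>\<close>. If \<open>a\<close> is not a square in the completion, the prime of \<open>L\<close> above \<open>q\<close> is stable under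
  conjugation, so that twice the valuation of \<open>u + v r\<close> there is that of the norm, which is a cube.
\<close>


section \<open>Algebraic numbers\<close>

text \<open>The divisor of \<open>Y - \<rho>\<close> is three times \<open>(0, \<rho>)\<close> minus
  three times the point at infinity. Its pullback along the isogeny is therefore three times the
  divisor of an explicit function \<open>g\<close>, and translation by a kernel point multiplies
  \<open>g\<close> by a cube root of unity, the Weil pairing of the isogeny. This pairing is what
  makes \<open>g\<close> comparable with the cube root \<theta> of the Kummer correspondence. No
  reduction of the curve enters, only the valuation of \<open>2 \<rho>\<close>, so that the primes
  above 2 and 3 are treated like all others. If \<open>Y\<close> is \<open>\<rho>\<close> or
  \<open>- \<rho>\<close>, one of the two factors vanishes and says nothing; the cube norm then
  carries the divisibility from one conjugate to the other. An element invariant under the local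
  Galois group has to be recognised as an element of the completion, so enough automorphisms must be
  built by extending partial ones. Since the target groups speak of cubes of fractional ideals,
  divisible valuations must also be turned into ideal factorisations; all of the ideal theory rests
  on the finiteness of residue rings.\<close>

lemma eigenvalue_of_stable_family:
  fixes v :: "nat \<Rightarrow> complex" and c :: "nat \<Rightarrow> nat \<Rightarrow> int"
  assumes "k < n" "v k \<noteq> 0" and "\<And>i. i < n \<Longrightarrow> z * v i = (\<Sum>j<n. of_int (c i j) * v j)"
  shows "algebraic_int z"
proof -
  \<comment> \<open>The hypothesis says that the family is an eigenvector of an integer matrix,
    nonzero because of its entry \<open>v k\<close>; the monic characteristic polynomial of this
    matrix witnesses integrality.\<close>
  define A where "A = mat n n (\<lambda>(i,j). c i j)"
  define B where "B = (map_mat of_int A :: complex mat)"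
  have A: "A \<in> carrier_mat n n" and B: "B \<in> carrier_mat n n" by (auto simp: A_def B_def)
  have "eigenvector B (vec n v) z"
    unfolding eigenvector_def
  proof (intro conjI)
    show "vec n v \<in> carrier_vec (dim_row B)" using B by auto
    show "vec n v \<noteq> 0\<^sub>v (dim_row B)"
    proof
      assume "vec n v = 0\<^sub>v (dim_row B)"
      then have "vec n v $ k = 0\<^sub>v (dim_row B) $ k" by simp
      with assms B show False by auto
    qed
    show "B *\<^sub>v vec n v = z \<cdot>\<^sub>v vec n v"
      by (rule eq_vecI) (auto simp: A_def B_def assms scalar_prod_def atLeast0LessThan)
  qed
  then have "poly (char_poly B) z = 0"
    using eigenvalue_root_char_poly[OF B] by (auto simp: eigenvalue_def)
  moreover have "char_poly B = map_poly of_int (char_poly A)"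
    unfolding B_def by (rule of_int_hom.char_poly_hom[OF A])
  moreover have "lead_coeff (char_poly A) = 1"
    using degree_monic_char_poly[OF A] by simp
  ultimately show ?thesis
    unfolding algebraic_int_altdef_ipoly by auto
qed

text \<open>Solving the monic equation for its top power makes the lower powers stable under
  multiplication by \<open>x\<close>; \<open>n > 0\<close> keeps the constant monomial among
  them.\<close>

lemma algebraic_int_power_reduction:
  fixes x :: complex
  assumes "algebraic_int x"
  obtains n :: nat and c :: "nat \<Rightarrow> int" where "n > 0" "x ^ n = (\<Sum>i<n. of_int (c i) * x ^ i)"
proof -
  from assms obtain p where p: "poly (map_poly of_int p) x = 0" "lead_coeff p = 1"
    unfolding algebraic_int_altdef_ipoly by blast
  let ?n = "degree p"
  have "?n > 0"
  proof (rule ccontr)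
    assume "\<not> ?n > 0"
    then obtain d where "p = [:d:]" by (metis degree_eq_zeroE gr0I)
    with p show False by auto
  qed
  have "0 = (\<Sum>i\<le>?n. of_int (coeff p i) * x ^ i)"
    using p(1) by (simp add: poly_altdef degree_map_poly coeff_map_poly)
  also have "\<dots> = x ^ ?n + (\<Sum>i<?n. of_int (coeff p i) * x ^ i)"
    using p(2) by (simp add: lessThan_Suc_atMost[symmetric])
  finally have "x ^ ?n = (\<Sum>i<?n. of_int (- coeff p i) * x ^ i)"
    by (simp add: sum_negf eq_neg_iff_add_eq_0)
  then show thesis by (rule that[OF \<open>?n > 0\<close>])
qed

text \<open>The family of monomials \<open>x^i * y^j\<close> below the degrees of \<open>x\<close> and \<open>y\<close> is stable under both
  factors; pairs \<open>(i, j)\<close> are coded by \<open>i * m + j\<close>.\<close>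

lemma algebraic_int_monomials:
  fixes x y :: complex
  assumes "algebraic_int x" "algebraic_int y"
  obtains N :: nat and v :: "nat \<Rightarrow> complex" and cx cy :: "nat \<Rightarrow> nat \<Rightarrow> int"
    where "0 < N" "v 0 = 1"
    "\<And>i. i < N \<Longrightarrow> x * v i = (\<Sum>j<N. of_int (cx i j) * v j)"
    "\<And>i. i < N \<Longrightarrow> y * v i = (\<Sum>j<N. of_int (cy i j) * v j)"
proof -
  obtain n c where n: "n > 0" "x ^ n = (\<Sum>i<n. of_int (c i) * x ^ i)"
    by (rule algebraic_int_power_reduction[OF assms(1)])
  obtain m d where m: "m > 0" "y ^ m = (\<Sum>i<m. of_int (d i) * y ^ i)"
    by (rule algebraic_int_power_reduction[OF assms(2)])
  define v where "v k = x ^ (k div m) * y ^ (k mod m)" for k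
  let ?N = "n * m"
  have code: "i * m + j < ?N" if "i < n" "j < m" for i j
  proof -
    have "i * m + j < Suc i * m" using that by simp
    also have "\<dots> \<le> n * m" using that by (intro mult_le_mono1) simp
    finally show ?thesis .
  qed
  have v: "v (i * m + j) = x ^ i * y ^ j" if "j < m" for i j
    using that by (simp add: v_def)
  \<comment> \<open>The indices \<open>f l\<close> may repeat, so the coefficients are collected one
    term at a time by updating \<open>e\<close> at a single index.\<close>
  have comb: "\<exists>e. (\<Sum>l<k. of_int (b l) * v (f l)) = (\<Sum>j<?N. of_int (e j) * v j)"
    if "\<And>l. l < k \<Longrightarrow> f l < ?N" for k :: nat and b :: "nat \<Rightarrow> int" and f
    using that
  proof (induction k)
    case 0
    show ?case by (rule exI[of _ "\<lambda>_. 0"]) simp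
  next
    case (Suc k)
    then obtain e where e: "(\<Sum>l<k. of_int (b l) * v (f l)) = (\<Sum>j<?N. of_int (e j) * v j)"
      by force
    have "(\<Sum>j<?N. of_int ((e(f k := e (f k) + b k)) j) * v j)
        = (\<Sum>j<?N. of_int (e j) * v j + (if j = f k then of_int (b k) * v j else 0))"
      by (rule sum.cong) (auto simp: algebra_simps)
    also have "\<dots> = (\<Sum>j<?N. of_int (e j) * v j) + of_int (b k) * v (f k)"
      using Suc.prems[of k] by (simp add: sum.distrib sum.delta)
    finally have "(\<Sum>l<Suc k. of_int (b l) * v (f l)) = (\<Sum>j<?N. of_int ((e(f k := e (f k) + b k)) j) * v j)"
      using e by simp
    then show ?case by blast
  qed
  have comb1: "\<exists>e. v l = (\<Sum>j<?N. of_int (e j) * v j)" if "l < ?N" for l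
    using comb[of 1 "\<lambda>_. l" "\<lambda>_. 1"] that by simp
  have "\<exists>e. x * v k = (\<Sum>j<?N. of_int (e j) * v j)" if k: "k < ?N" for k
  proof -
    let ?i = "k div m" and ?j = "k mod m"
    have i: "?i < n" using k by (simp add: less_mult_imp_div_less)
    have j: "?j < m" using m by simp
    show ?thesis
    proof (cases "Suc ?i < n")
      case True
      have "x * v k = v (Suc ?i * m + ?j)"
        unfolding v[OF j] by (simp add: v_def mult.assoc)
      then show ?thesis using comb1[OF code[OF True j]] by (simp only:)
    next
      case False
      \<comment> \<open>At the last power of \<open>x\<close> the exponent would leave the range;
        the relation for \<open>x ^ n\<close> brings the product back into the family.\<close>
      with i have "n = Suc ?i" by simp
      then have "x ^ n = x * x ^ ?i" by (metis power_Suc)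
      then have "x * v k = x ^ n * y ^ ?j" by (simp add: v_def)
      also have "\<dots> = (\<Sum>l<n. of_int (c l) * v (l * m + ?j))"
        unfolding n(2) sum_distrib_right v[OF j] by (simp add: mult.assoc)
      also have "\<exists>e. \<dots> = (\<Sum>j<?N. of_int (e j) * v j)"
        by (rule comb) (rule code[OF _ j])
      finally show ?thesis .
    qed
  qed
  then obtain cx where cx: "\<And>k. k < ?N \<Longrightarrow> x * v k = (\<Sum>j<?N. of_int (cx k j) * v j)" by metis
  have "\<exists>e. y * v k = (\<Sum>j<?N. of_int (e j) * v j)" if k: "k < ?N" for k
  proof -
    let ?i = "k div m" and ?j = "k mod m"
    have i: "?i < n" using k by (simp add: less_mult_imp_div_less)
    have j: "?j < m" using m by simp
    show ?thesis
    proof (cases "Suc ?j < m")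
      case True
      have "y * v k = v (?i * m + Suc ?j)"
        unfolding v[OF True] by (simp add: v_def mult.left_commute)
      then show ?thesis using comb1[OF code[OF i True]] by (simp only:)
    next
      case False
      with j have "m = Suc ?j" by simp
      then have "y ^ m = y * y ^ ?j" by (metis power_Suc)
      then have "y * v k = x ^ ?i * y ^ m" by (simp add: v_def)
      also have "\<dots> = (\<Sum>l<m. of_int (d l) * v (?i * m + l))"
        unfolding m(2) sum_distrib_left by (intro sum.cong refl) (simp add: v)
      also have "\<exists>e. \<dots> = (\<Sum>j<?N. of_int (e j) * v j)"
        by (rule comb) (rule code[OF i])
      finally show ?thesis .
    qed
  qed
  then obtain cy where cy: "\<And>k. k < ?N \<Longrightarrow> y * v k = (\<Sum>j<?N. of_int (cy k j) * v j)" by metis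
  show thesis
    by (rule that[of ?N v cx cy]) (use n m cx cy in \<open>auto simp: v_def\<close>)
qed

lemma algebraic_int_add:
  fixes x y :: complex
  assumes "algebraic_int x" "algebraic_int y"
  shows "algebraic_int (x + y)"
proof -
  obtain N :: nat and v :: "nat \<Rightarrow> complex" and cx cy :: "nat \<Rightarrow> nat \<Rightarrow> int"
    where *: "0 < N" "v 0 = 1"
    "\<And>i. i < N \<Longrightarrow> x * v i = (\<Sum>j<N. of_int (cx i j) * v j)"
    "\<And>i. i < N \<Longrightarrow> y * v i = (\<Sum>j<N. of_int (cy i j) * v j)"
    by (rule algebraic_int_monomials[OF assms]) (rule that)
  show ?thesis
    by (rule eigenvalue_of_stable_family[of 0 N v _ "\<lambda>i j. cx i j + cy i j"])
       (use * in \<open>auto simp: distrib_right sum.distrib\<close>)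
qed

lemma algebraic_int_mult:
  fixes x y :: complex
  assumes "algebraic_int x" "algebraic_int y"
  shows "algebraic_int (x * y)"
proof -
  obtain N :: nat and v :: "nat \<Rightarrow> complex" and cx cy :: "nat \<Rightarrow> nat \<Rightarrow> int"
    where *: "0 < N" "v 0 = 1"
    "\<And>i. i < N \<Longrightarrow> x * v i = (\<Sum>j<N. of_int (cx i j) * v j)"
    "\<And>i. i < N \<Longrightarrow> y * v i = (\<Sum>j<N. of_int (cy i j) * v j)"
    by (rule algebraic_int_monomials[OF assms]) (rule that)
  show ?thesis
  \<comment> \<open>The matrix of the product is a matrix product, with \<open>cy\<close> on the
    left because \<open>y * v i\<close> is expanded before \<open>x\<close> is applied.\<close>
  proof (rule eigenvalue_of_stable_family[of 0 N v _ "\<lambda>i j. \<Sum>k<N. cy i k * cx k j"])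
    fix i assume i: "i < N"
    have "x * y * v i = (\<Sum>k<N. of_int (cy i k) * (x * v k))"
      using *(4)[OF i] by (simp add: mult.assoc sum_distrib_left) (simp add: mult_ac)
    also have "\<dots> = (\<Sum>k<N. \<Sum>j<N. of_int (cy i k) * of_int (cx k j) * v j)"
      by (intro sum.cong refl) (simp add: *(3) sum_distrib_left mult.assoc)
    also have "\<dots> = (\<Sum>j<N. of_int (\<Sum>k<N. cy i k * cx k j) * v j)"
      by (subst sum.swap) (simp add: sum_distrib_right)
    finally show "x * y * v i = (\<Sum>j<N. of_int (\<Sum>k<N. cy i k * cx k j) * v j)" .
  qed (use * in auto)
qed

lemma algebraic_int_multiple:
  fixes x :: complex
  assumes "algebraic x"
  obtains d :: int where "d \<noteq> 0" "algebraic_int (of_int d * x)"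
proof -
  obtain p where p: "p \<noteq> 0" "poly (map_poly of_int p) x = 0" using algebraicE'[OF assms] .
  let ?n = "degree p" and ?l = "lead_coeff p"
  show thesis
  proof (cases "?n = 0")
    case True
    then obtain d where "p = [:d:]" by (metis degree_eq_zeroE)
    with p show ?thesis by auto
  next
    case False
    \<comment> \<open>With \<open>l\<close> the leading coefficient and \<open>n\<close> the degree,
      \<open>q\<close> is \<open>l^(n-1)\<close> times \<open>p(X / l)\<close>: it is monic with
      integer coefficients and vanishes at \<open>l * x\<close>.\<close>
    define q where "q = monom 1 ?n + (\<Sum>i<?n. monom (coeff p i * ?l ^ (?n - 1 - i)) i)"
    have cq: "coeff q i = (if i = ?n then 1 else if i < ?n then coeff p i * ?l ^ (?n - 1 - i) else 0)" for i
      by (auto simp: q_def coeff_sum sum.delta)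
    have deg: "degree q = ?n"
      proof (rule antisym)
      show "degree q \<le> ?n" by (rule degree_le) (simp add: cq)
      show "?n \<le> degree q" by (rule le_degree) (simp add: cq)
    qed
    have "poly (map_poly of_int q) (of_int ?l * x)
        = (\<Sum>i\<le>?n. of_int (coeff q i) * (of_int ?l * x) ^ i)"
      by (simp add: poly_altdef degree_map_poly coeff_map_poly deg)
    also have "\<dots> = (\<Sum>i\<le>?n. of_int ?l ^ (?n - 1) * (of_int (coeff p i) * x ^ i))"
    proof (intro sum.cong refl)
      fix i assume "i \<in> {..?n}"
      then consider "i = ?n" | "i < ?n" by fastforce
      then show "of_int (coeff q i) * (of_int ?l * x) ^ i
                = of_int ?l ^ (?n - 1) * (of_int (coeff p i) * x ^ i)"
      proof cases
        case 1
        have "(of_int ?l :: complex) ^ ?n = of_int ?l ^ (?n - 1) * of_int ?l"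
          using False by (metis power_minus_mult neq0_conv)
        with 1 show ?thesis by (simp add: cq power_mult_distrib)
      next
        case 2
        have "(of_int ?l :: complex) ^ (?n - 1) = of_int ?l ^ (?n - 1 - i) * of_int ?l ^ i"
          using 2 by (simp flip: power_add)
        with 2 show ?thesis by (simp add: cq power_mult_distrib)
      qed
    qed
    also have "\<dots> = of_int ?l ^ (?n - 1) * poly (map_poly of_int p) x"
      by (simp add: poly_altdef degree_map_poly coeff_map_poly sum_distrib_left)
    finally have "poly (map_poly of_int q) (of_int ?l * x) = 0" using p by simp
    then have "algebraic_int (of_int ?l * x)"
      unfolding algebraic_int_altdef_ipoly using deg by (intro exI[of _ q]) (simp add: cq)
    then show ?thesis using that[of ?l] p by auto
  qed
qed

lemma algebraic_of_multiple:
  fixes x :: complex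
  assumes "algebraic_int (of_int d * x)" "d \<noteq> 0"
  shows "algebraic x"
proof -
  have "algebraic (of_int d * x)" using assms by auto
  then obtain p where p: "p \<noteq> 0" "poly (map_poly of_int p) (of_int d * x) = 0" using algebraicE' by blast
  let ?q = "pcompose (map_poly of_int p) [:0, of_int d:] :: complex poly"
  show ?thesis
  proof (rule algebraicI)
    show "poly ?q x = 0" using p by (simp add: poly_pcompose mult.commute)
    have "map_poly of_int p \<noteq> (0 :: complex poly)"
      using p(1) by (subst map_poly_eq_0_iff) auto
    with assms show "?q \<noteq> 0"
      by (auto simp: pcompose_eq_0_iff)
    show "coeff ?q i \<in> \<int>" for i
      by (intro coeff_pcompose_semiring_closed) (auto simp: coeff_pCons coeff_map_poly split: nat.splits)
  qed
qed

lemma algebraic_add: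
  fixes x y :: complex
  assumes "algebraic x" "algebraic y"
  shows "algebraic (x + y)"
proof -
  obtain d e :: int where d: "d \<noteq> 0" "algebraic_int (of_int d * x)"
    and e: "e \<noteq> 0" "algebraic_int (of_int e * y)"
    using algebraic_int_multiple[OF assms(1)] algebraic_int_multiple[OF assms(2)] by metis
  have "algebraic_int (of_int e * (of_int d * x) + of_int d * (of_int e * y))"
    by (intro algebraic_int_add algebraic_int_mult d e) auto
  also have "of_int e * (of_int d * x) + of_int d * (of_int e * y) = of_int (d * e) * (x + y)"
    by (simp add: algebra_simps)
  finally show ?thesis by (rule algebraic_of_multiple) (use d e in auto)
qed

lemma algebraic_mult:
  fixes x y :: complex
  assumes "algebraic x" "algebraic y"
  shows "algebraic (x * y)"
proof -
  obtain d e :: int where d: "d \<noteq> 0" "algebraic_int (of_int d * x)"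
    and e: "e \<noteq> 0" "algebraic_int (of_int e * y)"
    using algebraic_int_multiple[OF assms(1)] algebraic_int_multiple[OF assms(2)] by metis
  have "algebraic_int ((of_int d * x) * (of_int e * y))"
    by (intro algebraic_int_mult d e)
  also have "(of_int d * x) * (of_int e * y) = of_int (d * e) * (x * y)"
    by (simp add: algebra_simps)
  finally show ?thesis by (rule algebraic_of_multiple) (use d e in auto)
qed


section \<open>Number fields\<close>

interpretation rat_vs: vector_space "\<lambda>(q::rat) (x::complex). of_rat q * x"
  by unfold_locales (auto simp: algebra_simps of_rat_add of_rat_mult)

lemma rat_dependence_cleared:
  fixes u :: "complex \<Rightarrow> rat"
  assumes "finite A" "(\<Sum>x\<in>A. of_rat (u x) * x) = 0" "x0 \<in> A" "u x0 \<noteq> 0"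
  obtains c :: "complex \<Rightarrow> int" where "c x0 \<noteq> 0" "(\<Sum>x\<in>A. of_int (c x) * x) = 0"
proof -
  define n d where "n x = fst (quotient_of (u x))" and "d x = snd (quotient_of (u x))" for x
  have d: "d x > 0" for x unfolding d_def by (rule quotient_of_denom_pos')
  have u: "u x = of_int (n x) / of_int (d x)" for x
    by (rule quotient_of_div) (simp add: n_def d_def)
  define c where "c x = n x * (\<Prod>y\<in>A - {x}. d y)" for x
  have c: "(of_int (c x) :: complex) = of_int (\<Prod>y\<in>A. d y) * of_rat (u x)" if "x \<in> A" for x
  proof -
    have "(\<Prod>y\<in>A. d y) = d x * (\<Prod>y\<in>A - {x}. d y)" using that assms(1) by (rule prod.remove[rotated])
    moreover have "(of_int (d x) :: complex) * of_rat (u x) = of_int (n x)"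
      unfolding u using d[of x] by (simp add: of_rat_divide)
    ultimately show ?thesis by (simp add: c_def)
  qed
  show thesis
  proof (rule that[of c])
    have "n x0 \<noteq> 0" using assms(4) u by auto
    moreover have "(\<Prod>y\<in>A - {x0}. d y) \<noteq> 0" using d assms(1) by (metis finite_Diff less_irrefl prod_zero_iff)
    ultimately show "c x0 \<noteq> 0" by (simp add: c_def)
    have "(\<Sum>x\<in>A. of_int (c x) * x) = (\<Sum>x\<in>A. of_int (\<Prod>y\<in>A. d y) * (of_rat (u x) * x))"
      by (intro sum.cong refl) (simp add: c mult.assoc)
    also have "\<dots> = 0" using assms(2) by (simp flip: sum_distrib_left)
    finally show "(\<Sum>x\<in>A. of_int (c x) * x) = 0" .
  qed
qed

text \<open>Descent on the sum of the absolute values of the coefficients: as long as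
  \<open>p\<close> divides all of them, the relation can be divided by \<open>p\<close>.\<close>

lemma int_dependence_primitive:
  fixes c :: "complex \<Rightarrow> int" and p :: int
  assumes "finite A" "(\<Sum>x\<in>A. of_int (c x) * x) = 0" "\<exists>x\<in>A. c x \<noteq> 0" "p > 1"
  shows "\<exists>c'. (\<Sum>x\<in>A. of_int (c' x) * x) = 0 \<and> (\<exists>x\<in>A. \<not> p dvd c' x)"
  using assms
proof (induction "\<Sum>x\<in>A. nat \<bar>c x\<bar>" arbitrary: c rule: less_induct)
  case less
  show ?case
  proof (cases "\<forall>x\<in>A. p dvd c x")
    case False
    then show ?thesis using less.prems(2) by blast
  next
    case True
    define c' where "c' x = c x div p" for x
    have c': "c x = p * c' x" if "x \<in> A" for x using True that by (simp add: c'_def)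
    have "of_int p * (\<Sum>x\<in>A. of_int (c' x) * x) = (\<Sum>x\<in>A. of_int (c x) * x)"
      unfolding sum_distrib_left by (intro sum.cong refl) (simp add: c' mult.assoc)
    then have 1: "(\<Sum>x\<in>A. of_int (c' x) * x) = 0" using less.prems by auto
    obtain x0 where x0: "x0 \<in> A" "c x0 \<noteq> 0" using less.prems by blast
    have le: "nat \<bar>c' x\<bar> \<le> nat \<bar>c x\<bar>" if "x \<in> A" for x
    proof -
      have "1 * \<bar>c' x\<bar> \<le> p * \<bar>c' x\<bar>" using less.prems(4) by (intro mult_right_mono) auto
      then show ?thesis using c'[OF that] less.prems(4) by (simp add: abs_mult)
    qed
    have "nat \<bar>c' x0\<bar> < nat \<bar>c x0\<bar>"
    proof -
      have "c' x0 \<noteq> 0" using c'[OF x0(1)] x0(2) by auto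
      then have "1 * \<bar>c' x0\<bar> < p * \<bar>c' x0\<bar>" using less.prems(4) by (intro mult_strict_right_mono) auto
      then show ?thesis using c'[OF x0(1)] less.prems(4) by (simp add: abs_mult)
    qed
    then have "(\<Sum>x\<in>A. nat \<bar>c' x\<bar>) < (\<Sum>x\<in>A. nat \<bar>c x\<bar>)"
      using le x0 less.prems(1) by (intro sum_strict_mono_ex1) auto
    moreover have "\<exists>x\<in>A. c' x \<noteq> 0" using x0 c' by force
    ultimately show ?thesis using less.hyps[of c'] 1 less.prems by blast
  qed
qed

locale csubfield =
  fixes F :: "complex set"
  assumes one_mem [simp]: "1 \<in> F"
    and add_mem [intro]: "x \<in> F \<Longrightarrow> y \<in> F \<Longrightarrow> x + y \<in> F"
    and uminus_mem [intro]: "x \<in> F \<Longrightarrow> - x \<in> F"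
    and mult_mem [intro]: "x \<in> F \<Longrightarrow> y \<in> F \<Longrightarrow> x * y \<in> F"
    and inverse_mem [intro]: "x \<in> F \<Longrightarrow> inverse x \<in> F"
begin

lemma zero_mem [simp]: "0 \<in> F"
  using add_mem[OF one_mem uminus_mem[OF one_mem]] by simp

lemma diff_mem [intro]: "x \<in> F \<Longrightarrow> y \<in> F \<Longrightarrow> x - y \<in> F"
  using add_mem[OF _ uminus_mem] by force

lemma divide_mem [intro]: "x \<in> F \<Longrightarrow> y \<in> F \<Longrightarrow> x / y \<in> F"
  unfolding divide_inverse by (intro mult_mem inverse_mem)

lemma power_mem [intro]: "x \<in> F \<Longrightarrow> x ^ n \<in> F"
  by (induction n) auto

lemma sum_mem [intro]: "(\<And>i. i \<in> A \<Longrightarrow> f i \<in> F) \<Longrightarrow> sum f A \<in> F"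
  by (induction A rule: infinite_finite_induct) auto

lemma of_nat_mem [simp]: "of_nat n \<in> F"
  by (induction n) auto

lemma of_int_mem [simp]: "of_int n \<in> F"
  by (cases n rule: int_cases2) auto

lemma of_rat_mem [simp]: "of_rat q \<in> F"
  by (cases q) (auto simp: of_rat_rat)

lemmas closed = add_mem mult_mem diff_mem divide_mem uminus_mem inverse_mem power_mem sum_mem

lemma numeral_mem [simp]: "numeral k \<in> F"
  using of_nat_mem[of "numeral k"] by simp

end

locale number_field = csubfield F for F +
  assumes algebraic_mem: "x \<in> F \<Longrightarrow> algebraic x"
    and finite_span: "\<exists>B. finite B \<and> F \<subseteq> rat_vs.span B"
begin

lemma ints_mem [dest]: "x \<in> ints_of F \<Longrightarrow> x \<in> F"
  by (simp add: ints_of_def)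

lemma ints_zero [simp]: "0 \<in> ints_of F"
  and ints_one [simp]: "1 \<in> ints_of F"
  and ints_of_int [simp]: "of_int n \<in> ints_of F"
  by (auto simp: ints_of_def)

lemma ints_add [intro]: "x \<in> ints_of F \<Longrightarrow> y \<in> ints_of F \<Longrightarrow> x + y \<in> ints_of F"
  and ints_mult [intro]: "x \<in> ints_of F \<Longrightarrow> y \<in> ints_of F \<Longrightarrow> x * y \<in> ints_of F"
  and ints_uminus [intro]: "x \<in> ints_of F \<Longrightarrow> - x \<in> ints_of F"
  by (auto simp: ints_of_def intro: algebraic_int_add algebraic_int_mult)

lemma ints_diff [intro]: "x \<in> ints_of F \<Longrightarrow> y \<in> ints_of F \<Longrightarrow> x - y \<in> ints_of F"
  using ints_add[OF _ ints_uminus] by force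

lemma ints_power [intro]: "x \<in> ints_of F \<Longrightarrow> x ^ n \<in> ints_of F"
  by (induction n) auto

lemma ints_sum [intro]: "(\<And>i. i \<in> A \<Longrightarrow> f i \<in> ints_of F) \<Longrightarrow> sum f A \<in> ints_of F"
  by (induction A rule: infinite_finite_induct) auto

lemmas ints_closed = ints_add ints_mult ints_diff ints_uminus ints_power ints_sum

lemma ints_denominator:
  assumes "x \<in> F"
  obtains d :: int where "d \<noteq> 0" "of_int d * x \<in> ints_of F"
proof -
  obtain d :: int where "d \<noteq> 0" "algebraic_int (of_int d * x)"
    using algebraic_int_multiple[OF algebraic_mem[OF assms]] .
  moreover have "of_int d * x \<in> F" using assms by (intro mult_mem) auto
  ultimately show thesis using that by (auto simp: ints_of_def)
qed

lemma ints_divides_int: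
  assumes "x \<in> ints_of F" "x \<noteq> 0"
  obtains d :: int and y where "d \<noteq> 0" "y \<in> ints_of F" "of_int d = x * y"
proof -
  obtain d :: int where "d \<noteq> 0" "of_int d * inverse x \<in> ints_of F"
    using ints_denominator[of "inverse x"] assms by blast
  then show thesis using that[of d "of_int d * inverse x"] assms by auto
qed

text \<open>This special monic equation is the one that a coincidence between two powers modulo some
  element produces.\<close>

lemma ints_integrally_closed:
  assumes "y \<in> F" "i < j" "y ^ j - y ^ i \<in> ints_of F"
  shows "y \<in> ints_of F"
proof -
  let ?p = "monom 1 j - monom 1 i :: complex poly"
  have deg: "degree ?p = j"
  proof (rule antisym)
    show "degree ?p \<le> j" using assms(2) by (intro degree_le) auto
    show "j \<le> degree ?p" using assms(2) by (intro le_degree) auto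
  qed
  have "algebraic_int y"
  proof (rule algebraic_int_root)
    show "algebraic_int (y ^ j - y ^ i)" using assms by (simp add: ints_of_def)
    show "poly ?p y = y ^ j - y ^ i" by (simp add: poly_monom)
    show "\<forall>k. coeff ?p k \<in> \<int>" by simp
    show "lead_coeff ?p = 1" unfolding deg using assms(2) by simp
    show "degree ?p > 0" unfolding deg using assms(2) by simp
  qed
  then show ?thesis using assms by (simp add: ints_of_def)
qed

text \<open>Linear independence over the field with \<open>p\<close> elements of the classes of
  \<open>A\<close> modulo \<open>p\<close>, when \<open>p\<close> is prime, expressed with integer
  lifts of the coefficients.\<close>

definition ind_mod :: "int \<Rightarrow> complex set \<Rightarrow> bool" where
  "ind_mod p A \<longleftrightarrow> finite A \<and> A \<subseteq> ints_of F \<and>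
     (\<forall>c. (\<exists>y\<in>ints_of F. (\<Sum>x\<in>A. of_int (c x) * x) = of_int p * y) \<longrightarrow> (\<forall>x\<in>A. p dvd c x))"

lemma ind_modD:
  assumes "ind_mod p A" "y \<in> ints_of F" "(\<Sum>x\<in>A. of_int (c x) * x) = of_int p * y" "x \<in> A"
  shows "p dvd c x"
proof -
  have "\<exists>y\<in>ints_of F. (\<Sum>x\<in>A. of_int (c x) * x) = of_int p * y" using assms(2,3) ..
  then show ?thesis using assms(1,4) unfolding ind_mod_def by simp
qed

text \<open>Independence modulo \<open>p\<close> implies independence over the rationals: a rational
  relation can be cleared of denominators and made primitive at \<open>p\<close>, which contradicts
  independence with right-hand side 0. A finite spanning set of \<open>F\<close> then bounds the
  size.\<close>

lemma ind_mod_bound: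
  assumes "p > 1"
  shows "\<exists>d. \<forall>A. ind_mod p A \<longrightarrow> card A < d"
proof -
  obtain B where B: "finite B" "F \<subseteq> rat_vs.span B" using finite_span by blast
  have "card A \<le> card B" if A: "ind_mod p A" for A
  proof (rule ccontr)
    assume "\<not> card A \<le> card B"
    moreover have "finite A" "A \<subseteq> rat_vs.span B" using A B by (auto simp: ind_mod_def)
    ultimately have "rat_vs.dependent A" using rat_vs.independent_span_bound[OF B(1)] by blast
    then obtain u x0 where u: "x0 \<in> A" "u x0 \<noteq> 0" "(\<Sum>x\<in>A. of_rat (u x) * x) = 0"
      using \<open>finite A\<close> by (auto simp: rat_vs.dependent_finite)
    obtain c where "c x0 \<noteq> 0" "(\<Sum>x\<in>A. of_int (c x) * x) = 0"
      using rat_dependence_cleared[OF \<open>finite A\<close> u(3,1,2)] .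
    then have "\<exists>c'. (\<Sum>x\<in>A. of_int (c' x) * x) = 0 \<and> (\<exists>x\<in>A. \<not> p dvd c' x)"
      using int_dependence_primitive[OF \<open>finite A\<close> _ _ assms] u(1) by auto
    then obtain c' where c': "(\<Sum>x\<in>A. of_int (c' x) * x) = 0" "\<exists>x\<in>A. \<not> p dvd c' x"
      by (elim exE conjE)
    then have "(\<Sum>x\<in>A. of_int (c' x) * x) = of_int p * 0" by simp
    then have "\<forall>x\<in>A. p dvd c' x" using ind_modD[OF A ints_zero] by simp
    then show False using c'(2) by simp
  qed
  then have "\<forall>A. ind_mod p A \<longrightarrow> card A < Suc (card B)" by (simp add: le_imp_less_Suc)
  then show ?thesis by (rule exI)
qed

text \<open>A largest set that is independent modulo \<open>p\<close> spans the ring of integers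
  modulo \<open>p\<close>, so its combinations with coefficients in \<open>{0..<p}\<close> represent
  all residues.\<close>

lemma finite_residues_prime:
  assumes "prime (p::int)"
  obtains R where "finite R" "R \<subseteq> ints_of F"
    "\<And>x. x \<in> ints_of F \<Longrightarrow> \<exists>r\<in>R. \<exists>y\<in>ints_of F. x = r + of_int p * y"
proof -
  have p: "p > 1" using assms by (rule prime_gt_1_int)
  from ind_mod_bound[OF p] obtain d where d: "\<forall>A. ind_mod p A \<longrightarrow> card A < d" ..
  have "ind_mod p {}" by (simp add: ind_mod_def)
  from ex_has_greatest_nat[OF this d]
  obtain A where A: "ind_mod p A" "\<forall>B. ind_mod p B \<longrightarrow> card B \<le> card A" by (elim exE conjE)
  have fA: "finite A" and AO: "A \<subseteq> ints_of F" using A(1) by (auto simp: ind_mod_def)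
  define R where "R = (\<lambda>e. \<Sum>x\<in>A. of_int (e x) * x) ` (A \<rightarrow>\<^sub>E {0..<p})"
  show thesis
  proof (rule that)
    show "finite R" unfolding R_def by (rule finite_imageI, rule finite_PiE[OF fA]) simp
    show "R \<subseteq> ints_of F" unfolding R_def using AO by (auto intro!: ints_sum ints_mult)
    fix x assume x: "x \<in> ints_of F"
    have "\<exists>e y. y \<in> ints_of F \<and> x = (\<Sum>z\<in>A. of_int (e z) * z) + of_int p * y"
    proof (cases "x \<in> A")
      case True
      have "(\<Sum>z\<in>A. of_int (if z = x then 1 else 0) * z) = (\<Sum>z\<in>A. if z = x then z else 0)"
        by (intro sum.cong) auto
      also have "\<dots> = x" using True fA by simp
      finally show ?thesis by (intro exI[of _ "\<lambda>z. if z = x then 1 else 0"] exI[of _ 0]) simp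
    next
      case False
      then have "\<not> ind_mod p (insert x A)"
        using A(2)[rule_format, of "insert x A"] fA by auto
      then have "\<exists>c. \<exists>w\<in>ints_of F. (\<Sum>z\<in>insert x A. of_int (c z) * z) = of_int p * w \<and>
          \<not> (\<forall>z\<in>insert x A. p dvd c z)"
        using fA AO x unfolding ind_mod_def by simp
      then obtain c w where c: "w \<in> ints_of F" "(\<Sum>z\<in>insert x A. of_int (c z) * z) = of_int p * w"
        "\<not> (\<forall>z\<in>insert x A. p dvd c z)"
        by (elim exE bexE conjE)
      have eq: "of_int (c x) * x + (\<Sum>z\<in>A. of_int (c z) * z) = of_int p * w"
        using c(2) False fA by simp
      have "\<not> p dvd c x"
      proof
        assume *: "p dvd c x"
        then obtain k where k: "c x = p * k" by blast
        have "(\<Sum>z\<in>A. of_int (c z) * z) = of_int p * (w - of_int k * x)"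
          using eq k by (simp add: algebra_simps)
        moreover have "w - of_int k * x \<in> ints_of F" using c(1) x by (intro ints_closed) auto
        ultimately have "\<forall>z\<in>A. p dvd c z" using ind_modD[OF A(1)] by simp
        with c(3) * show False by auto
      qed
      \<comment> \<open>The coefficient of \<open>x\<close> in the relation is a unit modulo
        \<open>p\<close>; its inverse \<open>e\<close> solves the relation for
        \<open>x\<close>.\<close>
      then have "coprime p (c x)" using assms by (simp add: prime_imp_coprime)
      then obtain f e where "f * p + e * c x = 1"
        using bezout_int[of p "c x"] by (auto simp: coprime_iff_gcd_eq_1)
      then have fe: "of_int f * of_int p + of_int e * of_int (c x) = (1::complex)"
        by (metis of_int_1 of_int_add of_int_mult)
      have "x = (of_int f * of_int p + of_int e * of_int (c x)) * x"
        unfolding fe by simp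
      also have "\<dots> = of_int f * of_int p * x + of_int e * (of_int (c x) * x)"
        by (simp only: distrib_right mult.assoc)
      also have "\<dots> = of_int f * of_int p * x + of_int e * (of_int p * w - (\<Sum>z\<in>A. of_int (c z) * z))"
        using eq by (simp add: eq_diff_eq)
      also have "\<dots> = of_int f * of_int p * x + ((\<Sum>z\<in>A. of_int (- e * c z) * z) + of_int e * of_int p * w)"
        by (simp add: right_diff_distrib sum_distrib_left sum_negf mult.assoc)
      also have "\<dots> = (\<Sum>z\<in>A. of_int (- e * c z) * z) + of_int p * (of_int f * x + of_int e * w)"
        by (simp add: distrib_left mult.assoc mult.left_commute)
      finally have "x = (\<Sum>z\<in>A. of_int (- e * c z) * z) + of_int p * (of_int f * x + of_int e * w)" .
      moreover have "of_int f * x + of_int e * w \<in> ints_of F" using c(1) x by (intro ints_closed) auto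
      ultimately show ?thesis by (intro exI[of _ "\<lambda>z. - e * c z"] exI conjI)
    qed
    then obtain e y where y: "y \<in> ints_of F" and xe: "x = (\<Sum>z\<in>A. of_int (e z) * z) + of_int p * y"
      by (elim exE conjE)
    define e' where "e' = (\<lambda>z\<in>A. e z mod p)"
    have "(\<Sum>z\<in>A. of_int (e z) * z) = (\<Sum>z\<in>A. of_int (e' z) * z + of_int p * (of_int (e z div p) * z))"
    proof (intro sum.cong refl)
      fix z assume "z \<in> A"
      then have "e z = e' z + p * (e z div p)" by (simp add: e'_def)
      then have "(of_int (e z) :: complex) = of_int (e' z) + of_int p * of_int (e z div p)"
        by (metis of_int_add of_int_mult)
      then show "of_int (e z) * z = of_int (e' z) * z + of_int p * (of_int (e z div p) * z)"
        by (simp add: algebra_simps)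
    qed
    then have "x = (\<Sum>z\<in>A. of_int (e' z) * z) + of_int p * ((\<Sum>z\<in>A. of_int (e z div p) * z) + y)"
      unfolding xe by (simp add: sum.distrib sum_distrib_left distrib_left)
    moreover have "(\<Sum>z\<in>A. of_int (e z div p) * z) + y \<in> ints_of F" using y AO by (intro ints_closed) auto
    moreover have "(\<Sum>z\<in>A. of_int (e' z) * z) \<in> R"
      unfolding R_def using p by (intro imageI) (auto simp: e'_def)
    ultimately show "\<exists>r\<in>R. \<exists>y\<in>ints_of F. x = r + of_int p * y" by blast
  qed
qed

text \<open>Residues modulo \<open>p * m\<close> are the sums \<open>a + p * b\<close> with
  \<open>a\<close> a residue modulo \<open>p\<close> and \<open>b\<close> one modulo
  \<open>m\<close>.\<close>

lemma finite_residues_int: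
  assumes "n > 0"
  shows "\<exists>R. finite R \<and> R \<subseteq> ints_of F \<and>
    (\<forall>x\<in>ints_of F. \<exists>r\<in>R. \<exists>y\<in>ints_of F. x = r + of_nat n * y)"
  using assms
proof (induction n rule: less_induct)
  case (less n)
  show ?case
  proof (cases "n = 1")
    case True
    then show ?thesis by (intro exI[of _ "{0}"]) auto
  next
    case False
    then obtain p m where p: "prime p" "n = p * m" using prime_factor_nat[OF False] by (auto elim: dvdE)
    then have m: "0 < m" "m < n" using less.prems prime_gt_1_nat[of p] by auto
    obtain R where R: "finite R" "R \<subseteq> ints_of F"
      "\<forall>x\<in>ints_of F. \<exists>r\<in>R. \<exists>y\<in>ints_of F. x = r + of_nat m * y"
      using less.IH[OF m(2,1)] by (elim exE conjE)
    have "prime (int p)" using p by simp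
    then obtain R' where R': "finite R'" "R' \<subseteq> ints_of F"
      "\<And>x. x \<in> ints_of F \<Longrightarrow> \<exists>r\<in>R'. \<exists>y\<in>ints_of F. x = r + of_int (int p) * y"
      by (rule finite_residues_prime) blast
    let ?S = "(\<lambda>(a, b). a + of_nat p * b) ` (R' \<times> R)"
    show ?thesis
    proof (intro exI[of _ ?S] conjI ballI)
      show "finite ?S" using R R' by auto
      show "?S \<subseteq> ints_of F" using R R' ints_of_int[of "int p"] by auto
      fix x assume "x \<in> ints_of F"
      then obtain a y where a: "a \<in> R'" "y \<in> ints_of F" "x = a + of_int (int p) * y" using R'(3) by blast
      then obtain b z where b: "b \<in> R" "z \<in> ints_of F" "y = b + of_nat m * z" using R(3) by blast
      have "x = (a + of_nat p * b) + of_nat n * z" using a(3) b(3) p(2) by (simp add: algebra_simps)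
      moreover have "a + of_nat p * b \<in> ?S" using a(1) b(1) by (intro image_eqI[of _ _ "(a, b)"]) auto
      ultimately show "\<exists>r\<in>?S. \<exists>y\<in>ints_of F. x = r + of_nat n * y" using b(2) by (intro bexI)
    qed
  qed
qed

text \<open>Every nonzero integer of \<open>F\<close> divides a nonzero rational integer, whose
  residues suffice. This finiteness later gives the Noetherian property, the maximality of nonzero
  primes and the integrality criteria.\<close>

lemma finite_residues:
  assumes "\<alpha> \<in> ints_of F" "\<alpha> \<noteq> 0"
  obtains R where "finite R" "R \<subseteq> ints_of F"
    "\<And>x. x \<in> ints_of F \<Longrightarrow> \<exists>r\<in>R. \<exists>y\<in>ints_of F. x = r + \<alpha> * y"
proof -
  obtain d :: int and b where d: "d \<noteq> 0" "b \<in> ints_of F" "of_int d = \<alpha> * b"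
    using ints_divides_int[OF assms] .
  define n where "n = nat \<bar>d\<bar>"
  have "n > 0" using d by (simp add: n_def)
  have "int n = \<bar>d\<bar>" by (simp add: n_def)
  also have "\<dots> = sgn d * d" by (simp add: abs_sgn mult.commute)
  finally have "int n = sgn d * d" .
  then have "(of_nat n :: complex) = of_int (sgn d) * of_int d" by (metis of_int_mult of_int_of_nat_eq)
  then have n: "(of_nat n :: complex) = \<alpha> * (of_int (sgn d) * b)" using d(3) by simp
  obtain R where R: "finite R" "R \<subseteq> ints_of F"
    "\<forall>x\<in>ints_of F. \<exists>r\<in>R. \<exists>y\<in>ints_of F. x = r + of_nat n * y"
    using finite_residues_int[OF \<open>n > 0\<close>] by (elim exE conjE)
  show thesis
  proof (rule that[OF R(1,2)])
    fix x assume "x \<in> ints_of F"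
    then obtain r y where r: "r \<in> R" "y \<in> ints_of F" "x = r + of_nat n * y" using R(3) by blast
    have "x = r + \<alpha> * (of_int (sgn d) * b * y)" unfolding r(3) n by (simp add: mult.assoc)
    moreover have "of_int (sgn d) * b * y \<in> ints_of F" using d(2) r(2) by (intro ints_closed) auto
    ultimately show "\<exists>r\<in>R. \<exists>y\<in>ints_of F. x = r + \<alpha> * y" using r(1) by (intro bexI)
  qed
qed

end

text \<open>The combinations of the powers of \<open>t\<close> below \<open>n\<close> already form a
  field. The powers need not be independent over \<open>F\<close>, so no minimal polynomial is
  involved.\<close>

lemma (in number_field) number_field_adjoin_int:
  assumes "algebraic_int t"
  shows "\<exists>E. number_field E \<and> F \<subseteq> E \<and> t \<in> E"
proof -
  obtain n :: nat and c :: "nat \<Rightarrow> int" where n: "n > 0" "t ^ n = (\<Sum>i<n. of_int (c i) * t ^ i)"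
    by (rule algebraic_int_power_reduction[OF assms])
  define E where "E = {x. \<exists>e. (\<forall>i. e i \<in> F) \<and> x = (\<Sum>i<n. e i * t ^ i)}"
  have E: "x \<in> E \<longleftrightarrow> (\<exists>e. (\<forall>i. e i \<in> F) \<and> x = (\<Sum>i<n. e i * t ^ i))" for x
    unfolding E_def mem_Collect_eq by (rule refl)
  have E_E: thesis if "x \<in> E" "\<And>e. \<forall>i. e i \<in> F \<Longrightarrow> x = (\<Sum>i<n. e i * t ^ i) \<Longrightarrow> thesis" for x thesis
  proof -
    from that(1)[unfolded E] obtain e where "(\<forall>i. e i \<in> F) \<and> x = (\<Sum>i<n. e i * t ^ i)" ..
    then show thesis using that(2)[of e] by simp
  qed
  have add: "x + y \<in> E" if "x \<in> E" "y \<in> E" for x y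
  proof -
    from that(1)[unfolded E] obtain e where "(\<forall>i. e i \<in> F) \<and> x = (\<Sum>i<n. e i * t ^ i)" ..
    moreover from that(2)[unfolded E] obtain f where "(\<forall>i. f i \<in> F) \<and> y = (\<Sum>i<n. f i * t ^ i)" ..
    ultimately have "(\<forall>i. e i + f i \<in> F) \<and> x + y = (\<Sum>i<n. (e i + f i) * t ^ i)"
      by (simp add: sum.distrib distrib_right add_mem)
    then show ?thesis unfolding E by (rule exI[of _ "\<lambda>i. e i + f i"])
  qed
  have scale: "a * x \<in> E" if "a \<in> F" "x \<in> E" for a x
  proof -
    from that(2)[unfolded E] obtain e where "(\<forall>i. e i \<in> F) \<and> x = (\<Sum>i<n. e i * t ^ i)" ..
    then have "(\<forall>i. a * e i \<in> F) \<and> a * x = (\<Sum>i<n. (a * e i) * t ^ i)"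
      using that(1) by (simp add: sum_distrib_left mult.assoc mult_mem)
    then show ?thesis unfolding E by (rule exI[of _ "\<lambda>i. a * e i"])
  qed
  have sum: "sum f A \<in> E" if "finite A" "\<And>i. i \<in> A \<Longrightarrow> f i \<in> E" for f :: "nat \<Rightarrow> complex" and A
    using that
  proof (induction A)
    case empty
    show ?case unfolding E by (intro exI[of _ "\<lambda>_. 0"]) auto
  qed (auto intro: add)
  have low: "t ^ i \<in> E" if "i < n" for i
  proof -
    have "(\<Sum>j<n. (if j = i then 1 else 0) * t ^ j) = (\<Sum>j<n. if j = i then t ^ j else 0)"
      by (intro sum.cong) auto
    also have "\<dots> = t ^ i" using that by simp
    finally show ?thesis unfolding E by (intro exI[of _ "\<lambda>j. if j = i then 1 else 0"]) auto
  qed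
  have tn: "t ^ n \<in> E" unfolding n(2) by (intro sum scale low) auto
  have t_mult: "t * x \<in> E" if "x \<in> E" for x
  proof -
    from that(1) obtain e where e: "\<forall>i. e i \<in> F" "x = (\<Sum>i<n. e i * t ^ i)" by (rule E_E)
    have "t * x = (\<Sum>i<n. e i * t ^ Suc i)" unfolding e(2) sum_distrib_left
      by (intro sum.cong) auto
    also have "\<dots> \<in> E"
    proof (intro sum scale)
      fix i assume "i \<in> {..<n}"
      then consider "Suc i < n" | "Suc i = n" by force
      then show "t ^ Suc i \<in> E"
      proof cases
        case 2
        then show ?thesis using tn by simp
      qed (rule low)
    qed (use e in auto)
    finally show ?thesis .
  qed
  have t_pow: "t ^ i * x \<in> E" if "x \<in> E" for i x
    by (induction i) (use that t_mult in \<open>auto simp: mult.assoc\<close>)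
  have mult: "x * y \<in> E" if "x \<in> E" "y \<in> E" for x y
  proof -
    from that(1) obtain e where e: "\<forall>i. e i \<in> F" "x = (\<Sum>i<n. e i * t ^ i)" by (rule E_E)
    have "x * y = (\<Sum>i<n. e i * (t ^ i * y))" unfolding e(2) sum_distrib_right by (simp add: mult.assoc)
    also have "\<dots> \<in> E" by (intro sum scale t_pow that) (use e in auto)
    finally show ?thesis .
  qed
  have FE: "F \<subseteq> E"
  proof
    fix x assume "x \<in> F"
    then show "x \<in> E" using scale[OF _ low[of 0], of x] n by simp
  qed
  have alg: "algebraic x" if "x \<in> E" for x
  proof -
    from that(1) obtain e where e: "\<forall>i. e i \<in> F" "x = (\<Sum>i<n. e i * t ^ i)" by (rule E_E)
    have t: "algebraic t" using assms by (rule algebraic_int_imp_algebraic)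
    have ti: "algebraic (t ^ i)" for i
    proof (induction i)
      case (Suc i)
      show ?case unfolding power_Suc by (rule algebraic_mult[OF t Suc])
    qed simp
    have "algebraic (\<Sum>i<k. e i * t ^ i)" for k
    proof (induction k)
      case (Suc k)
      show ?case unfolding sum.lessThan_Suc
        by (intro algebraic_add algebraic_mult algebraic_mem ti Suc) (use e(1) in simp)
    qed simp
    then show ?thesis unfolding e(2) .
  qed
  \<comment> \<open>An integer polynomial with nonzero constant term \<open>c0\<close> that kills
    \<open>x\<close> reads \<open>c0 + x * q(x) = 0\<close>, so the inverse is
    \<open>- q(x) / c0\<close>.\<close>
  have inv: "inverse x \<in> E" if "x \<in> E" for x
  proof (cases "x = 0")
    case False
    have "algebraic x" using that by (rule alg)
    then obtain p where p: "coeff p 0 \<noteq> 0" "poly (map_poly of_int p) x = 0"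
      by (rule algebraicE'_nonzero[OF _ False])
    obtain c0 q where q: "p = pCons c0 q" by (cases p)
    have pm: "poly (map_poly of_int q) x \<in> E" for q :: "int poly"
    proof (induction q)
      case 0
      show ?case using FE by auto
    next
      case (pCons a q)
      have "of_int a \<in> E" using FE by auto
      then show ?case using pCons that by (auto simp: map_poly_pCons intro: add mult)
    qed
    have c0: "c0 \<noteq> 0" using p q by simp
    have "of_int c0 + x * poly (map_poly of_int q) x = 0"
      using p by (simp add: q map_poly_pCons)
    then have "x * poly (map_poly of_int q) x = - of_int c0" by (simp add: add_eq_0_iff)
    moreover have "x * (- inverse (of_int c0) * poly (map_poly of_int q) x)
        = - inverse (of_int c0) * (x * poly (map_poly of_int q) x)" by (simp add: mult_ac)
    ultimately have "x * (- inverse (of_int c0) * poly (map_poly of_int q) x) = 1"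
      using c0 by simp
    then have "inverse x = - inverse (of_int c0) * poly (map_poly of_int q) x"
      by (rule inverse_unique)
    also have "\<dots> \<in> E" by (intro scale pm uminus_mem inverse_mem of_int_mem)
    finally show ?thesis .
  qed (use FE in auto)
  have fin: "\<exists>B. finite B \<and> E \<subseteq> rat_vs.span B"
  proof -
    obtain B where B: "finite B" "F \<subseteq> rat_vs.span B" using finite_span by blast
    let ?C = "(\<lambda>(b, i). b * t ^ i) ` (B \<times> {..<n})"
    have *: "e * t ^ i \<in> rat_vs.span ?C" if "e \<in> F" "i < n" for e i
    proof -
      have "e \<in> rat_vs.span B" using that B by blast
      then show ?thesis
      proof (induction rule: rat_vs.span_induct_alt)
        case base
        show ?case using rat_vs.span_zero by simp
      next
        case (step q b y)
        have "b * t ^ i \<in> rat_vs.span ?C" using step that by (intro rat_vs.span_base) auto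
        then have "of_rat q * (b * t ^ i) + y * t ^ i \<in> rat_vs.span ?C"
          using step by (intro rat_vs.span_add rat_vs.span_scale)
        then show ?case by (simp add: algebra_simps)
      qed
    qed
    have "E \<subseteq> rat_vs.span ?C"
    proof
      fix x assume "x \<in> E"
      then obtain e where e: "\<forall>i. e i \<in> F" "x = (\<Sum>i<n. e i * t ^ i)" by (rule E_E)
      show "x \<in> rat_vs.span ?C" unfolding e(2) by (intro rat_vs.span_sum *) (use e in auto)
    qed
    then show ?thesis using B(1) by (intro exI[of _ ?C]) auto
  qed
  have neg: "- x \<in> E" if "x \<in> E" for x
    using scale[OF uminus_mem[OF one_mem] that] by simp
  have "1 \<in> E" using FE one_mem by blast
  then have "t \<in> E" using t_mult[of 1] by simp
  have "number_field E"
  proof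
    show "1 \<in> E" by fact
    show "\<exists>B. finite B \<and> E \<subseteq> rat_vs.span B" by fact
  qed (rule add neg mult inv alg; assumption)+
  then show ?thesis using FE \<open>t \<in> E\<close> by blast
qed

lemma (in number_field) number_field_adjoin:
  assumes "finite T" "\<And>t. t \<in> T \<Longrightarrow> algebraic t"
  shows "\<exists>E. number_field E \<and> F \<union> T \<subseteq> E"
  using assms
proof (induction T)
  case empty
  show ?case using number_field_axioms by auto
next
  case (insert t T)
  then obtain E where E: "number_field E" "F \<union> T \<subseteq> E" by auto
  interpret E: number_field E by fact
  obtain d :: int where d: "d \<noteq> 0" "algebraic_int (of_int d * t)"
    using algebraic_int_multiple[of t] insert.prems by auto
  obtain E' where E': "number_field E'" "E \<subseteq> E'" "of_int d * t \<in> E'"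
    using E.number_field_adjoin_int[OF d(2)] by blast
  interpret E': number_field E' by fact
  have "inverse (of_int d) * (of_int d * t) \<in> E'"
    by (rule E'.mult_mem[OF E'.inverse_mem[OF E'.of_int_mem] E'(3)])
  moreover have "inverse (of_int d) * (of_int d * t) = t" using d(1) by simp
  ultimately have "t \<in> E'" by (simp only:)
  then show ?case using E E' by blast
qed

lemma number_field_Rats: "number_field (range of_rat)"
proof
  show "\<exists>B. finite B \<and> range of_rat \<subseteq> rat_vs.span B"
  proof (intro exI[of _ "{1}"] conjI subsetI)
    fix x :: complex assume "x \<in> range of_rat"
    then obtain q :: rat where q: "x = of_rat q" by blast
    have "of_rat q * 1 \<in> rat_vs.span {1}" by (intro rat_vs.span_scale rat_vs.span_base) auto
    then show "x \<in> rat_vs.span {1}" by (simp add: q)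
  qed simp
  show "1 \<in> range of_rat" by (metis of_rat_1 rangeI)
qed (auto intro!: rat_imp_algebraic simp flip: of_rat_add of_rat_mult of_rat_minus of_rat_inverse simp: Rats_def)

lemma number_field_subset:
  assumes "number_field E" "csubfield F" "F \<subseteq> E"
  shows "number_field F"
proof -
  interpret E: number_field E by fact
  interpret csubfield F by fact
  show ?thesis
    by unfold_locales (use E.algebraic_mem E.finite_span assms(3) in blast)+
qed


section \<open>Prime ideals and valuations\<close>

lemma CC_simps [simp]:
  "carrier CC = UNIV" "x \<otimes>\<^bsub>CC\<^esub> y = x * y" "x \<oplus>\<^bsub>CC\<^esub> y = x + y" "\<zero>\<^bsub>CC\<^esub> = 0" "\<one>\<^bsub>CC\<^esub> = 1"
  by (simp_all add: ring_of_type_algebra_def)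

section \<open>Products of additive subgroups\<close>

lemma ideal_mult_prod: "x \<in> I \<Longrightarrow> y \<in> J \<Longrightarrow> x * y \<in> ideal_mult I J"
  unfolding ideal_mult_def by (intro CollectI exI[of _ 1] exI[of _ "\<lambda>_. x"] exI[of _ "\<lambda>_. y"]) auto

lemma ideal_mult_zero: "0 \<in> ideal_mult I J"
  unfolding ideal_mult_def by (intro CollectI exI[of _ 0]) auto

lemma ideal_mult_add:
  assumes "a \<in> ideal_mult I J" "b \<in> ideal_mult I J"
  shows "a + b \<in> ideal_mult I J"
proof -
  from assms(1) obtain n :: nat and x y where a: "a = (\<Sum>i<n. x i * y i)" "\<forall>i<n. x i \<in> I \<and> y i \<in> J"
    unfolding ideal_mult_def by (elim CollectE exE conjE)
  from assms(2) obtain m :: nat and u v where b: "b = (\<Sum>i<m. u i * v i)" "\<forall>i<m. u i \<in> I \<and> v i \<in> J"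
    unfolding ideal_mult_def by (elim CollectE exE conjE)
  define f g where "f i = (if i < n then x i else u (i - n))"
    and "g i = (if i < n then y i else v (i - n))" for i
  have "(\<Sum>i<n + m. f i * g i) = (\<Sum>i<n. f i * g i) + (\<Sum>i = n..<n + m. f i * g i)"
    by (simp add: lessThan_atLeast0 sum.atLeastLessThan_concat)
  also have "(\<Sum>i = n..<n + m. f i * g i) = (\<Sum>i<m. f (i + n) * g (i + n))"
    using sum.shift_bounds_nat_ivl[of "\<lambda>i. f i * g i" 0 n m] by (simp add: add.commute lessThan_atLeast0)
  also have "\<dots> = b" by (simp add: b f_def g_def)
  also have "(\<Sum>i<n. f i * g i) = a" by (simp add: a f_def g_def)
  finally have "a + b = (\<Sum>i<n + m. f i * g i)" ..
  moreover have "\<forall>i<n + m. f i \<in> I \<and> g i \<in> J" using a b by (auto simp: f_def g_def)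
  ultimately show ?thesis unfolding ideal_mult_def by (intro CollectI exI conjI)
qed

lemma ideal_mult_induct [consumes 1, case_names zero add prod]:
  assumes "a \<in> ideal_mult I J" "P 0" "\<And>x y. P x \<Longrightarrow> P y \<Longrightarrow> P (x + y)"
    "\<And>x y. x \<in> I \<Longrightarrow> y \<in> J \<Longrightarrow> P (x * y)"
  shows "P a"
proof -
  from assms(1) obtain n :: nat and x y where a: "a = (\<Sum>i<n. x i * y i)" "\<forall>i<n. x i \<in> I \<and> y i \<in> J"
    unfolding ideal_mult_def by (elim CollectE exE conjE)
  have "k \<le> n \<Longrightarrow> P (\<Sum>i<k. x i * y i)" for k
    by (induction k) (use a assms in auto)
  then show ?thesis using a by simp
qed

lemma ideal_mult_subset:
  assumes "0 \<in> A" "\<And>x y. x \<in> A \<Longrightarrow> y \<in> A \<Longrightarrow> x + y \<in> A" "\<And>x y. x \<in> I \<Longrightarrow> y \<in> J \<Longrightarrow> x * y \<in> A"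
  shows "ideal_mult I J \<subseteq> A"
proof
  fix a assume "a \<in> ideal_mult I J"
  then show "a \<in> A" by (induction rule: ideal_mult_induct) (use assms in auto)
qed

lemma ideal_mult_mono: "I \<subseteq> I' \<Longrightarrow> J \<subseteq> J' \<Longrightarrow> ideal_mult I J \<subseteq> ideal_mult I' J'"
  by (rule ideal_mult_subset) (auto intro: ideal_mult_zero ideal_mult_add ideal_mult_prod)

lemma ideal_mult_commute: "ideal_mult I J = ideal_mult J I"
proof -
  have "ideal_mult I J \<subseteq> ideal_mult J I" for I J
  proof (rule ideal_mult_subset)
    fix x y assume "x \<in> I" "y \<in> J"
    then show "x * y \<in> ideal_mult J I" using ideal_mult_prod[of y J x I] by (simp add: mult.commute)
  qed (auto intro: ideal_mult_zero ideal_mult_add)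
  then show ?thesis by blast
qed

lemma ideal_mult_assoc: "ideal_mult (ideal_mult I J) K = ideal_mult I (ideal_mult J K)"
proof -
  have *: "ideal_mult (ideal_mult I J) K \<subseteq> ideal_mult I (ideal_mult J K)" for I J K
  proof (rule ideal_mult_subset)
    fix x y assume "x \<in> ideal_mult I J" "y \<in> K"
    then show "x * y \<in> ideal_mult I (ideal_mult J K)"
    proof (induction rule: ideal_mult_induct)
      case (prod u v)
      then show ?case by (simp add: mult.assoc ideal_mult_prod)
    qed (auto simp: distrib_right intro: ideal_mult_zero ideal_mult_add)
  qed (auto intro: ideal_mult_zero ideal_mult_add)
  have "ideal_mult I (ideal_mult J K) \<subseteq> ideal_mult (ideal_mult I J) K"
    using *[of K J I] by (simp add: ideal_mult_commute)
  then show ?thesis using * by blast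
qed

section \<open>Ideals and primes of the ring of integers\<close>

context number_field
begin

abbreviation integers ("\<O>") where "\<O> \<equiv> ints_of F"

definition is_ideal :: "complex set \<Rightarrow> bool" where
  "is_ideal A \<longleftrightarrow> A \<subseteq> \<O> \<and> 0 \<in> A \<and> (\<forall>x\<in>A. \<forall>y\<in>A. x + y \<in> A) \<and> (\<forall>x\<in>\<O>. \<forall>y\<in>A. x * y \<in> A)"

definition is_prime :: "complex set \<Rightarrow> bool" where
  "is_prime Q \<longleftrightarrow> is_ideal Q \<and> Q \<noteq> {0} \<and> 1 \<notin> Q \<and> (\<forall>x\<in>\<O>. \<forall>y\<in>\<O>. x * y \<in> Q \<longrightarrow> x \<in> Q \<or> y \<in> Q)"

lemma ideal_ints: "is_ideal A \<Longrightarrow> x \<in> A \<Longrightarrow> x \<in> \<O>"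
  and ideal_zero: "is_ideal A \<Longrightarrow> 0 \<in> A"
  and ideal_add: "is_ideal A \<Longrightarrow> x \<in> A \<Longrightarrow> y \<in> A \<Longrightarrow> x + y \<in> A"
  and ideal_scale: "is_ideal A \<Longrightarrow> x \<in> \<O> \<Longrightarrow> y \<in> A \<Longrightarrow> x * y \<in> A"
  by (auto simp: is_ideal_def)

lemma ideal_scale': "is_ideal A \<Longrightarrow> x \<in> A \<Longrightarrow> y \<in> \<O> \<Longrightarrow> x * y \<in> A"
  using ideal_scale[of A y x] by (simp add: mult.commute)

lemma ideal_uminus: "is_ideal A \<Longrightarrow> x \<in> A \<Longrightarrow> - x \<in> A"
  using ideal_scale[of A "-1" x] by (simp add: ints_uminus)

lemma ideal_diff: "is_ideal A \<Longrightarrow> x \<in> A \<Longrightarrow> y \<in> A \<Longrightarrow> x - y \<in> A"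
  using ideal_add[of A x "- y"] ideal_uminus by simp

lemma is_ideal_ints: "is_ideal \<O>"
  by (auto simp: is_ideal_def)

lemma ideal_eq_ints: "is_ideal A \<Longrightarrow> 1 \<in> A \<Longrightarrow> A = \<O>"
  using ideal_scale'[of A 1] ideal_ints by auto

lemma nonzero_ideal_elt:
  assumes "is_ideal A" "A \<noteq> {0}"
  obtains x where "x \<in> A" "x \<noteq> 0" "x \<in> \<O>"
  using assms ideal_zero[of A] ideal_ints[of A] by blast

lemma is_ideal_mult:
  assumes "is_ideal A" "is_ideal B"
  shows "is_ideal (ideal_mult A B)"
  unfolding is_ideal_def
proof (intro conjI ballI)
  show "ideal_mult A B \<subseteq> \<O>"
    by (rule ideal_mult_subset) (use assms ideal_ints in auto)
  fix x y assume "x \<in> \<O>" "y \<in> ideal_mult A B"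
  from this(2,1) show "x * y \<in> ideal_mult A B"
  proof (induction rule: ideal_mult_induct)
    case (prod u v)
    then show ?case using ideal_scale[OF assms(1) prod(3,1)]
      by (simp add: mult.assoc[symmetric] ideal_mult_prod)
  qed (auto simp: distrib_left intro: ideal_mult_zero ideal_mult_add)
qed (auto intro: ideal_mult_zero ideal_mult_add)

lemma ideal_mult_nonzero:
  assumes "is_ideal A" "is_ideal B" "A \<noteq> {0}" "B \<noteq> {0}"
  shows "ideal_mult A B \<noteq> {0}"
proof -
  obtain x where "x \<in> A" "x \<noteq> 0" using nonzero_ideal_elt[OF assms(1,3)] by blast
  moreover obtain y where "y \<in> B" "y \<noteq> 0" using nonzero_ideal_elt[OF assms(2,4)] by blast
  ultimately have "x * y \<in> ideal_mult A B" "x * y \<noteq> 0" by (auto intro: ideal_mult_prod)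
  then show ?thesis by blast
qed

lemma ideal_mult_ints: "is_ideal A \<Longrightarrow> ideal_mult A \<O> = A"
proof
  assume A: "is_ideal A"
  show "ideal_mult A \<O> \<subseteq> A"
    by (rule ideal_mult_subset) (use ideal_zero[OF A] ideal_add[OF A] ideal_scale'[OF A] in auto)
  show "A \<subseteq> ideal_mult A \<O>"
  proof
    fix x assume "x \<in> A"
    then show "x \<in> ideal_mult A \<O>" using ideal_mult_prod[of x A 1 \<O>] by simp
  qed
qed

text \<open>The bridge from the prime ideals of the ring record in the definitions to the plain set
  predicates used in the proof.\<close>

lemma fin_primes_iff: "Q \<in> fin_primes F \<longleftrightarrow> is_prime Q"
proof -
  let ?R = "CC\<lparr>carrier := \<O>\<rparr>"
  have simps: "carrier ?R = \<O>" "x \<otimes>\<^bsub>?R\<^esub> y = x * y" "x \<oplus>\<^bsub>?R\<^esub> y = x + y" "\<zero>\<^bsub>?R\<^esub> = 0" "\<one>\<^bsub>?R\<^esub> = 1" for x y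
    by auto
  have cr: "cring ?R"
  proof (intro cringI abelian_groupI comm_monoidI)
    fix x assume "x \<in> carrier ?R"
    then show "\<exists>y\<in>carrier ?R. y \<oplus>\<^bsub>?R\<^esub> x = \<zero>\<^bsub>?R\<^esub>"
      unfolding simps by (intro bexI[of _ "- x"]) auto
  qed (auto simp: simps algebra_simps)
  interpret R: cring ?R by (rule cr)
  have minus: "\<ominus>\<^bsub>?R\<^esub> x = - x" if "x \<in> \<O>" for x
    by (rule R.minus_equality) (use that in \<open>auto simp: simps\<close>)
  have ideal: "ideal Q ?R \<longleftrightarrow> is_ideal Q"
  proof
    assume "ideal Q ?R"
    then interpret ideal Q ?R .
    show "is_ideal Q" unfolding is_ideal_def
      using a_subset zero_closed a_closed I_l_closed unfolding simps by auto
  next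
    assume Q: "is_ideal Q"
    show "ideal Q ?R"
    proof (intro idealI R.ring_axioms)
      show "subgroup Q (add_monoid ?R)"
      proof
        show "Q \<subseteq> carrier (add_monoid ?R)" using ideal_ints[OF Q] by (auto simp: simps)
        show "\<one>\<^bsub>add_monoid ?R\<^esub> \<in> Q" using ideal_zero[OF Q] by (simp add: simps)
        fix x y assume x: "x \<in> Q" and y: "y \<in> Q"
        show "x \<otimes>\<^bsub>add_monoid ?R\<^esub> y \<in> Q" using ideal_add[OF Q x y] by (simp add: simps)
        show "inv\<^bsub>add_monoid ?R\<^esub> x \<in> Q"
          using minus[OF ideal_ints[OF Q x]] ideal_uminus[OF Q x] by (simp add: a_inv_def)
      qed
    qed (use ideal_scale[OF Q] ideal_scale'[OF Q] in \<open>auto simp: simps\<close>)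
  qed
  show ?thesis
  proof
    assume "Q \<in> fin_primes F"
    then have "primeideal Q ?R" and "Q \<noteq> {0}" by (auto simp: fin_primes_def)
    interpret primeideal Q ?R by fact
    have Q: "is_ideal Q" using ideal_axioms ideal by simp
    moreover have "1 \<notin> Q" using ideal_eq_ints[OF Q] I_notcarr unfolding simps by auto
    ultimately show "is_prime Q" using I_prime \<open>Q \<noteq> {0}\<close> unfolding is_prime_def simps by auto
  next
    assume Q: "is_prime Q"
    have "primeideal Q ?R"
    proof (intro primeidealI cr)
      show "ideal Q ?R" using Q ideal by (simp add: is_prime_def)
    qed (use Q in \<open>auto simp: is_prime_def simps\<close>)
    then show "Q \<in> fin_primes F" using Q by (simp add: fin_primes_def is_prime_def)
  qed
qed

text \<open>An ideal that contains \<alpha> is determined by the finitely many representatives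
  modulo \<alpha> that lie in it.\<close>

lemma finite_ideals_above:
  assumes "is_ideal A" "A \<noteq> {0}"
  shows "finite {B. is_ideal B \<and> A \<subseteq> B}"
proof -
  obtain \<alpha> where \<alpha>: "\<alpha> \<in> A" "\<alpha> \<noteq> 0" "\<alpha> \<in> \<O>" using nonzero_ideal_elt[OF assms] .
  obtain R where R: "finite R" "R \<subseteq> \<O>" "\<And>x. x \<in> \<O> \<Longrightarrow> \<exists>r\<in>R. \<exists>y\<in>\<O>. x = r + \<alpha> * y"
    using finite_residues[OF \<alpha>(3,2)] by metis
  have sub: "B \<subseteq> C" if B: "is_ideal B" "A \<subseteq> B" and C: "is_ideal C" "A \<subseteq> C" and eq: "B \<inter> R = C \<inter> R" for B C
  proof
    fix x assume x: "x \<in> B"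
    then obtain r y where r: "r \<in> R" "y \<in> \<O>" "x = r + \<alpha> * y" using R(3) ideal_ints[OF B(1)] by blast
    have "\<alpha> * y \<in> B" "\<alpha> * y \<in> C" using \<alpha>(1) r(2) B C ideal_scale' by auto
    then have "r \<in> B" using ideal_diff[OF B(1) x, of "\<alpha> * y"] r(3) by simp
    then have "r \<in> C" using eq r(1) by blast
    then show "x \<in> C" using r(3) \<open>\<alpha> * y \<in> C\<close> ideal_add[OF C(1)] by simp
  qed
  have "inj_on (\<lambda>B. B \<inter> R) {B. is_ideal B \<and> A \<subseteq> B}"
  proof (rule inj_onI)
    fix B C assume "B \<in> {B. is_ideal B \<and> A \<subseteq> B}" "C \<in> {B. is_ideal B \<and> A \<subseteq> B}" "B \<inter> R = C \<inter> R"
    then show "B = C" using sub[of B C] sub[of C B] by auto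
  qed
  moreover have "finite ((\<lambda>B. B \<inter> R) ` {B. is_ideal B \<and> A \<subseteq> B})"
    by (rule finite_subset[of _ "Pow R"]) (use R(1) in auto)
  ultimately show ?thesis by (rule finite_imageD[rotated])
qed

lemma maximal_ideal_exists:
  assumes "A \<in> \<C>" "\<And>B. B \<in> \<C> \<Longrightarrow> is_ideal B" "A \<noteq> {0}"
  obtains M where "M \<in> \<C>" "A \<subseteq> M" "\<And>B. B \<in> \<C> \<Longrightarrow> M \<subseteq> B \<Longrightarrow> B = M"
proof -
  let ?D = "{B \<in> \<C>. A \<subseteq> B}"
  have "finite ?D"
    by (rule finite_subset[OF _ finite_ideals_above[OF assms(2)[OF assms(1)] assms(3)]]) (use assms(2) in auto)
  moreover have "?D \<noteq> {}" using assms(1) by auto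
  ultimately obtain M where M: "M \<in> ?D" "\<forall>B\<in>?D. M \<subseteq> B \<longrightarrow> M = B"
    using finite_has_maximal[of ?D] by blast
  show thesis
  proof (rule that[of M])
    show "M \<in> \<C>" "A \<subseteq> M" using M(1) by auto
    fix B assume "B \<in> \<C>" "M \<subseteq> B"
    then show "B = M" using M by auto
  qed
qed

text \<open>Only finitely many ideals lie above a nonzero one, so a counterexample is contained in a
  maximal counterexample.\<close>

lemma ideal_noetherian_induct [consumes 2, case_names ideal]:
  assumes "is_ideal A" "A \<noteq> {0}"
    and step: "\<And>A. is_ideal A \<Longrightarrow> A \<noteq> {0} \<Longrightarrow>
      (\<And>B. is_ideal B \<Longrightarrow> A \<subset> B \<Longrightarrow> P B) \<Longrightarrow> P A"
  shows "P A"
proof (rule ccontr)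
  assume "\<not> P A"
  obtain M where M: "M \<in> {B. is_ideal B \<and> \<not> P B}" "A \<subseteq> M"
    "\<And>B. B \<in> {B. is_ideal B \<and> \<not> P B} \<Longrightarrow> M \<subseteq> B \<Longrightarrow> B = M"
    by (rule maximal_ideal_exists[of A "{B. is_ideal B \<and> \<not> P B}"]) (use assms(1,2) \<open>\<not> P A\<close> in auto)
  have "M \<noteq> {0}" using M(2) assms(1,2) ideal_zero by blast
  have "P M"
  proof (rule step)
    fix B assume B: "is_ideal B" "M \<subset> B"
    then show "P B" using M(3)[of B] by blast
  qed (use M(1) \<open>M \<noteq> {0}\<close> in auto)
  then show False using M(1) by simp
qed

lemma is_ideal_adjoin:
  assumes "is_ideal A" "x \<in> \<O>"
  shows "is_ideal {a + x * b | a b. a \<in> A \<and> b \<in> \<O>}" (is "is_ideal ?B")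
    and "A \<subseteq> {a + x * b | a b. a \<in> A \<and> b \<in> \<O>}" and "x \<in> {a + x * b | a b. a \<in> A \<and> b \<in> \<O>}"
proof -
  have I: "a + x * b \<in> ?B" if "a \<in> A" "b \<in> \<O>" for a b using that by blast
  show "A \<subseteq> ?B"
  proof
    fix a assume "a \<in> A" then show "a \<in> ?B" using I[of a 0] by simp
  qed
  show "x \<in> ?B" using I[OF ideal_zero[OF assms(1)], of 1] by simp
  show "is_ideal ?B" unfolding is_ideal_def
  proof (intro conjI ballI)
    show "?B \<subseteq> \<O>" using assms ideal_ints[OF assms(1)] by auto
    show "0 \<in> ?B" using I[OF ideal_zero[OF assms(1)], of 0] by simp
  next
    fix u v assume "u \<in> ?B" "v \<in> ?B"
    then obtain a b c d where *: "a \<in> A" "b \<in> \<O>" "u = a + x * b" "c \<in> A" "d \<in> \<O>" "v = c + x * d" by blast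
    have "u + v = (a + c) + x * (b + d)" using * by (simp add: algebra_simps)
    then show "u + v \<in> ?B" using I[OF ideal_add[OF assms(1) *(1,4)] ints_add[OF *(2,5)]] by simp
  next
    fix u v assume u: "u \<in> \<O>" and "v \<in> ?B"
    then obtain c d where *: "c \<in> A" "d \<in> \<O>" "v = c + x * d" by blast
    have "u * v = (u * c) + x * (u * d)" using * by (simp add: algebra_simps)
    then show "u * v \<in> ?B" using I[OF ideal_scale[OF assms(1) u *(1)] ints_mult[OF u *(2)]] by simp
  qed
qed

lemma nat_pigeonhole:
  fixes f :: "nat \<Rightarrow> complex"
  assumes "finite R" "\<And>n. f n \<in> R"
  obtains i j where "i < j" "f i = f j"
proof -
  have "\<not> inj f" using assms by (metis finite_subset image_subsetI finite_imageD infinite_UNIV_nat)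
  then obtain i j where "i \<noteq> j" "f i = f j" by (auto simp: inj_def)
  then show thesis using that[of i j] that[of j i] by (cases "i < j") auto
qed

text \<open>By the pigeonhole principle two of the products \<open>y ^ n * \<alpha>\<close> agree
  modulo \<alpha>; dividing their difference by \<alpha> shows that \<open>y ^ j - y ^ i\<close> is
  integral.\<close>

lemma integral_of_powers:
  assumes "y \<in> F" "\<alpha> \<in> \<O>" "\<alpha> \<noteq> 0" "\<And>n. y ^ n * \<alpha> \<in> \<O>"
  shows "y \<in> \<O>"
proof -
  obtain R where R: "finite R" "R \<subseteq> \<O>" "\<And>x. x \<in> \<O> \<Longrightarrow> \<exists>r\<in>R. \<exists>y\<in>\<O>. x = r + \<alpha> * y"
    using finite_residues[OF assms(2,3)] by metis
  then have "\<forall>n. \<exists>r. r \<in> R \<and> (\<exists>z\<in>\<O>. y ^ n * \<alpha> = r + \<alpha> * z)" using assms(4) by meson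
  then obtain f where f: "\<And>n. f n \<in> R" "\<And>n. \<exists>z\<in>\<O>. y ^ n * \<alpha> = f n + \<alpha> * z" by metis
  obtain i j where ij: "i < j" "f i = f j" using nat_pigeonhole[OF R(1) f(1)] .
  obtain u where u: "u \<in> \<O>" "y ^ i * \<alpha> = f i + \<alpha> * u" using f(2) by blast
  obtain v where v: "v \<in> \<O>" "y ^ j * \<alpha> = f j + \<alpha> * v" using f(2) by blast
  have "\<alpha> * (y ^ j - y ^ i) = \<alpha> * (v - u)" using u v ij by (simp add: algebra_simps)
  then have "y ^ j - y ^ i = v - u" using assms(3) by simp
  then show ?thesis using ints_integrally_closed[OF assms(1) ij(1)] u v by auto
qed

lemma integral_of_stable_ideal:
  assumes "is_ideal A" "A \<noteq> {0}" "y \<in> F" "\<And>x. x \<in> A \<Longrightarrow> y * x \<in> A"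
  shows "y \<in> \<O>"
proof -
  obtain \<alpha> where \<alpha>: "\<alpha> \<in> A" "\<alpha> \<noteq> 0" "\<alpha> \<in> \<O>" using nonzero_ideal_elt[OF assms(1,2)] .
  have "y ^ n * \<alpha> \<in> A" for n by (induction n) (use \<alpha> assms(4) in \<open>auto simp: mult.assoc\<close>)
  then show ?thesis using integral_of_powers[OF assms(3) \<alpha>(3,2)] ideal_ints[OF assms(1)] by blast
qed

text \<open>Two powers of \<open>x\<close> agree modulo an element of \<open>Q\<close>, so
  \<open>x ^ i * (1 - x ^ Suc k)\<close> lies in \<open>Q\<close>. No power of \<open>x\<close>
  does, hence \<open>1 - x ^ Suc k\<close> does, and \<open>x ^ k\<close> is an inverse of
  \<open>x\<close> modulo \<open>Q\<close>.\<close>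

lemma prime_maximal:
  assumes "is_prime Q" "x \<in> \<O>" "x \<notin> Q"
  obtains t q where "t \<in> \<O>" "q \<in> Q" "t * x + q = 1"
proof -
  have Q: "is_ideal Q" "Q \<noteq> {0}" using assms by (auto simp: is_prime_def)
  obtain \<alpha> where \<alpha>: "\<alpha> \<in> Q" "\<alpha> \<noteq> 0" "\<alpha> \<in> \<O>" using nonzero_ideal_elt[OF Q] .
  obtain R where R: "finite R" "R \<subseteq> \<O>" "\<And>x. x \<in> \<O> \<Longrightarrow> \<exists>r\<in>R. \<exists>y\<in>\<O>. x = r + \<alpha> * y"
    using finite_residues[OF \<alpha>(3,2)] by metis
  then have "\<forall>n. \<exists>r. r \<in> R \<and> (\<exists>z\<in>\<O>. x ^ n = r + \<alpha> * z)" using ints_power[OF assms(2)] by meson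
  then obtain f where f: "\<And>n. f n \<in> R" "\<And>n. \<exists>z\<in>\<O>. x ^ n = f n + \<alpha> * z" by metis
  obtain i j where ij: "i < j" "f i = f j" using nat_pigeonhole[OF R(1) f(1)] .
  obtain u where u: "u \<in> \<O>" "x ^ i = f i + \<alpha> * u" using f(2) by blast
  obtain v where v: "v \<in> \<O>" "x ^ j = f j + \<alpha> * v" using f(2) by blast
  obtain k where k: "j = i + Suc k" using ij(1) less_natE by auto
  have "x ^ i * (1 - x ^ Suc k) = \<alpha> * (u - v)" using u v ij k by (simp add: algebra_simps power_add)
  also have "\<dots> \<in> Q" using u v \<alpha> by (intro ideal_scale'[OF Q(1)]) auto
  finally have "x ^ i * (1 - x ^ Suc k) \<in> Q" .
  moreover have pow: "x ^ n \<notin> Q" for n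
    by (induction n) (use assms ints_power[OF assms(2)] in \<open>auto simp: is_prime_def\<close>)
  ultimately have "1 - x ^ Suc k \<in> Q"
    using assms(1) ints_power[OF assms(2)] ints_diff[OF ints_one ints_power[OF assms(2)]]
    unfolding is_prime_def by blast
  then show thesis using that[of "x ^ k" "1 - x ^ Suc k"] ints_power[OF assms(2)] by simp
qed

lemma prime_subset_eq:
  assumes "is_prime P" "is_prime Q" "P \<subseteq> Q"
  shows "P = Q"
proof (rule ccontr)
  assume "P \<noteq> Q"
  then obtain x where x: "x \<in> Q" "x \<notin> P" using assms(3) by blast
  have Q: "is_ideal Q" using assms by (simp add: is_prime_def)
  obtain t p where "t \<in> \<O>" "p \<in> P" "t * x + p = 1" using prime_maximal[OF assms(1) ideal_ints[OF Q x(1)] x(2)] .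
  then have "1 \<in> Q" using ideal_add[OF Q ideal_scale[OF Q _ x(1)]] assms(3) by (metis subsetD)
  then show False using assms(2) by (simp add: is_prime_def)
qed

lemma prime_above_exists:
  assumes "is_ideal A" "A \<noteq> {0}" "1 \<notin> A"
  obtains Q where "is_prime Q" "A \<subseteq> Q"
proof -
  let ?C = "{B. is_ideal B \<and> 1 \<notin> B}"
  obtain M where M: "M \<in> ?C" "A \<subseteq> M" "\<And>B. B \<in> ?C \<Longrightarrow> M \<subseteq> B \<Longrightarrow> B = M"
    by (rule maximal_ideal_exists[of A ?C]) (use assms in auto)
  have MI: "is_ideal M" using M by simp
  have one: "\<exists>m\<in>M. \<exists>b\<in>\<O>. 1 = m + x * b" if x: "x \<in> \<O>" "x \<notin> M" for x
  proof (rule ccontr)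
    assume *: "\<not> ?thesis"
    let ?B = "{a + x * b | a b. a \<in> M \<and> b \<in> \<O>}"
    have "?B \<in> ?C" using is_ideal_adjoin(1)[OF MI x(1)] * by blast
    then have "?B = M" using M(3) is_ideal_adjoin(2)[OF MI x(1)] by blast
    then show False using is_ideal_adjoin(3)[OF MI x(1)] x(2) by blast
  qed
  have "is_prime M" unfolding is_prime_def
  proof (intro conjI ballI impI)
    show "M \<noteq> {0}" using M(2) assms(1,2) ideal_zero by blast
    fix x y assume x: "x \<in> \<O>" and y: "y \<in> \<O>" and xy: "x * y \<in> M"
    show "x \<in> M \<or> y \<in> M"
    proof (rule ccontr)
      assume "\<not> ?thesis"
      then obtain m b n c where *: "m \<in> M" "b \<in> \<O>" "1 = m + x * b" "n \<in> M" "c \<in> \<O>" "1 = n + y * c"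
        using one[OF x] one[OF y] by blast
      have "1 = (m + x * b) * (n + y * c)" using *(3,6) by simp
      also have "\<dots> = m * (n + y * c) + (x * b * n + x * y * (b * c))" by (simp add: algebra_simps)
      also have "\<dots> \<in> M"
        by (intro ideal_add[OF MI] ideal_scale[OF MI _ *(4)] ideal_scale'[OF MI *(1)] ideal_scale'[OF MI xy])
          (use * x y ideal_ints[OF MI] in auto)
      finally show False using M(1) by simp
    qed
  qed (use M MI in auto)
  then show thesis using that M(2) by blast
qed


text \<open>The product ideal of the list is replaced by the products of one element from each
  prime. If \<open>x * y\<close> lies in \<open>A\<close> but neither factor does, the lists for
  \<open>A + (x)\<close> and \<open>A + (y)\<close> are concatenated.\<close>

lemma ideal_contains_prime_product:
  assumes "is_ideal A" "A \<noteq> {0}"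
  shows "\<exists>ps. (\<forall>P\<in>set ps. is_prime P) \<and> (\<forall>xs. list_all2 (\<in>) xs ps \<longrightarrow> prod_list xs \<in> A)"
  using assms
proof (induction rule: ideal_noetherian_induct)
  case (ideal A)
  show ?case
  proof (cases "1 \<in> A \<or> is_prime A")
    case True
    then show ?thesis
    proof
      assume "1 \<in> A"
      then show ?thesis by (intro exI[of _ "[]"]) auto
    next
      assume "is_prime A"
      then show ?thesis by (intro exI[of _ "[A]"]) (auto simp: list_all2_Cons2)
    qed
  next
    case False
    then obtain x y where xy: "x \<in> \<O>" "y \<in> \<O>" "x * y \<in> A" "x \<notin> A" "y \<notin> A"
      using ideal(1,2) unfolding is_prime_def by blast
    let ?B = "\<lambda>x. {a + x * b | a b. a \<in> A \<and> b \<in> \<O>}"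
    have ex: "\<exists>ps. (\<forall>P\<in>set ps. is_prime P) \<and> (\<forall>xs. list_all2 (\<in>) xs ps \<longrightarrow> prod_list xs \<in> ?B x)"
      if "x \<in> \<O>" "x \<notin> A" for x
      using is_ideal_adjoin[OF ideal(1) that(1)] that(2) by (intro ideal(3)) blast+
    obtain ps where ps: "\<forall>P\<in>set ps. is_prime P" "\<forall>xs. list_all2 (\<in>) xs ps \<longrightarrow> prod_list xs \<in> ?B x"
      using ex[OF xy(1,4)] by (elim exE conjE)
    obtain qs where qs: "\<forall>P\<in>set qs. is_prime P" "\<forall>xs. list_all2 (\<in>) xs qs \<longrightarrow> prod_list xs \<in> ?B y"
      using ex[OF xy(2,5)] by (elim exE conjE)
    have "prod_list xs \<in> A" if xs: "list_all2 (\<in>) xs (ps @ qs)" for xs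
    proof -
      obtain us vs where uv: "xs = us @ vs" "list_all2 (\<in>) us ps" "list_all2 (\<in>) vs qs"
        using xs unfolding list_all2_append2 by blast
      obtain a b where ab: "a \<in> A" "b \<in> \<O>" "prod_list us = a + x * b" using ps(2) uv(2) by blast
      obtain c d where cd: "c \<in> A" "d \<in> \<O>" "prod_list vs = c + y * d" using qs(2) uv(3) by blast
      have "prod_list xs = a * (c + y * d) + (x * b * c + x * y * (b * d))"
        using uv ab cd by (simp add: algebra_simps)
      also have "\<dots> \<in> A"
        by (intro ideal_add[OF ideal(1)] ideal_scale[OF ideal(1) _ cd(1)] ideal_scale'[OF ideal(1) ab(1)]
            ideal_scale'[OF ideal(1) xy(3)] ints_closed) (use ab cd xy ideal_ints[OF ideal(1)] in auto)
      finally show ?thesis .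
    qed
    then show ?thesis using ps(1) qs(1) by (intro exI[of _ "ps @ qs"]) auto
  qed
qed

lemma is_ideal_principal: "\<alpha> \<in> \<O> \<Longrightarrow> is_ideal ((*) \<alpha> ` \<O>)"
  unfolding is_ideal_def
proof (intro conjI ballI)
  assume \<alpha>: "\<alpha> \<in> \<O>"
  then show "(*) \<alpha> ` \<O> \<subseteq> \<O>" by auto
  show "0 \<in> (*) \<alpha> ` \<O>" by (rule image_eqI[of _ _ 0]) auto
  fix x y assume "y \<in> (*) \<alpha> ` \<O>"
  then obtain v where v: "v \<in> \<O>" "y = \<alpha> * v" by blast
  { assume "x \<in> (*) \<alpha> ` \<O>"
    then obtain u where u: "u \<in> \<O>" "x = \<alpha> * u" by blast
    show "x + y \<in> (*) \<alpha> ` \<O>"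
      by (rule image_eqI[of _ _ "u + v"]) (use u v in \<open>auto simp: algebra_simps\<close>) }
  { assume "x \<in> \<O>"
    then show "x * y \<in> (*) \<alpha> ` \<O>"
      by (intro image_eqI[of _ _ "x * v"]) (use v in auto) }
qed

lemma prime_prod_list:
  assumes "is_prime Q" "\<forall>x\<in>set xs. x \<in> \<O> \<and> x \<notin> Q"
  shows "prod_list xs \<in> \<O> \<and> prod_list xs \<notin> Q"
  using assms(2)
proof (induction xs)
  case Nil
  then show ?case using assms(1) by (simp add: is_prime_def)
next
  case (Cons a xs)
  then show ?case using assms(1) unfolding is_prime_def by (simp add: ints_mult) blast
qed

text \<open>An element of the inverse of \<open>Q\<close> that is not integral: divide a product of primes
  that lies in \<open>Q\<close> as economically as possible by an element of \<open>Q\<close>.\<close>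

lemma prime_inverse_element:
  assumes "is_prime Q"
  shows "\<exists>\<gamma>. \<gamma> \<in> F \<and> \<gamma> \<notin> \<O> \<and> (\<forall>q\<in>Q. \<gamma> * q \<in> \<O>)"
proof -
  have Q: "is_ideal Q" "Q \<noteq> {0}" using assms by (auto simp: is_prime_def)
  obtain \<alpha> where \<alpha>: "\<alpha> \<in> Q" "\<alpha> \<noteq> 0" "\<alpha> \<in> \<O>" using nonzero_ideal_elt[OF Q] .
  let ?A = "(*) \<alpha> ` \<O>"
  have A: "is_ideal ?A" by (rule is_ideal_principal[OF \<alpha>(3)])
  have "\<alpha> \<in> ?A" by (rule image_eqI[of _ _ 1]) auto
  then have A0: "?A \<noteq> {0}" using \<alpha>(2) by blast
  have AQ: "?A \<subseteq> Q" using ideal_scale'[OF Q(1) \<alpha>(1)] by blast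
  let ?P = "\<lambda>ps. (\<forall>P\<in>set ps. is_prime P) \<and> (\<forall>xs. list_all2 (\<in>) xs ps \<longrightarrow> prod_list xs \<in> ?A)"
  obtain ps0 where "?P ps0" using ideal_contains_prime_product[OF A A0] ..
  then have "\<exists>ps. ?P ps \<and> (\<forall>qs. ?P qs \<longrightarrow> length ps \<le> length qs)"
    by (rule ex_has_least_nat)
  then obtain ps where ps': "?P ps \<and> (\<forall>qs. ?P qs \<longrightarrow> length ps \<le> length qs)" ..
  note ps = conjunct1[OF ps'] conjunct2[OF ps']
  \<comment> \<open>Otherwise one element outside \<open>Q\<close> could be chosen from each prime
    of the list; their product would avoid \<open>Q\<close>, although it lies in the principal ideal
    inside \<open>Q\<close>.\<close>
  have "\<exists>P\<in>set ps. P \<subseteq> Q"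
  proof (rule ccontr)
    assume "\<not> ?thesis"
    then have ex: "\<forall>P\<in>set ps. \<exists>x. x \<in> P \<and> x \<notin> Q" by blast
    have sel: "(SOME x. x \<in> P \<and> x \<notin> Q) \<in> P \<and> (SOME x. x \<in> P \<and> x \<notin> Q) \<notin> Q" if "P \<in> set ps" for P
    proof -
      have "\<exists>x. x \<in> P \<and> x \<notin> Q" using ex that by blast
      then show ?thesis by (rule someI_ex)
    qed
    let ?xs = "map (\<lambda>P. SOME x. x \<in> P \<and> x \<notin> Q) ps"
    have "list_all2 (\<in>) ?xs ps" using sel by (simp add: list.rel_map list_all2_same)
    then have "prod_list ?xs \<in> Q" using ps(1) AQ by blast
    moreover have "\<forall>x\<in>set ?xs. x \<in> \<O> \<and> x \<notin> Q"
    proof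
      fix x assume "x \<in> set ?xs"
      then obtain P where P: "P \<in> set ps" "x = (SOME x. x \<in> P \<and> x \<notin> Q)" by auto
      then have "is_ideal P" using ps(1) by (simp add: is_prime_def)
      then show "x \<in> \<O> \<and> x \<notin> Q" using sel[OF P(1)] P(2) ideal_ints by metis
    qed
    ultimately show False using prime_prod_list[OF assms] by blast
  qed
  then obtain P where "P \<in> set ps" "P \<subseteq> Q" by blast
  then have "Q \<in> set ps" using prime_subset_eq[OF _ assms, of P] ps(1) by blast
  then obtain us vs where uv: "ps = us @ Q # vs" by (auto simp: in_set_conv_decomp)
  \<comment> \<open>By minimal length, removing \<open>Q\<close> from the list leaves some product
    outside the principal ideal of \<alpha>. Multiplied by any element of \<open>Q\<close> it falls
    back in, so its quotient by \<alpha> is the required element.\<close>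
  have "\<not> ?P (us @ vs)"
  proof
    assume "?P (us @ vs)"
    with spec[OF ps(2)] have "length ps \<le> length (us @ vs)" by (rule mp)
    then show False using uv by simp
  qed
  moreover have "\<forall>P\<in>set (us @ vs). is_prime P" using ps(1) uv by simp
  ultimately obtain xs where xs: "list_all2 (\<in>) xs (us @ vs)" "prod_list xs \<notin> ?A" by meson
  obtain xs1 xs2 where x12: "xs = xs1 @ xs2" "list_all2 (\<in>) xs1 us" "list_all2 (\<in>) xs2 vs"
    using xs(1) unfolding list_all2_append2 by blast
  let ?\<beta> = "prod_list xs"
  have ints: "prod_list ys \<in> \<O>" if "list_all2 (\<in>) ys qs" "\<forall>P\<in>set qs. is_prime P" for ys qs
    using that by (induction rule: list_all2_induct) (auto simp: is_prime_def dest: ideal_ints)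
  have \<beta>: "?\<beta> \<in> \<O>" by (rule ints[OF xs(1)]) (use ps(1) uv in auto)
  have \<beta>Q: "?\<beta> * q \<in> ?A" if "q \<in> Q" for q
  proof -
    have "list_all2 (\<in>) (xs1 @ q # xs2) ps" unfolding uv
      by (rule list_all2_appendI) (use x12 that in auto)
    then have "prod_list (xs1 @ q # xs2) \<in> ?A" using ps(1) by blast
    also have "prod_list (xs1 @ q # xs2) = ?\<beta> * q" by (simp add: x12 mult_ac)
    finally show ?thesis .
  qed
  show ?thesis
  proof (intro exI[of _ "?\<beta> / \<alpha>"] conjI ballI)
    show "?\<beta> / \<alpha> \<in> F" using \<beta> \<alpha>(3) by (intro divide_mem) auto
    show "?\<beta> / \<alpha> \<notin> \<O>"
    proof
      assume "?\<beta> / \<alpha> \<in> \<O>"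
      then have "\<alpha> * (?\<beta> / \<alpha>) \<in> ?A" by blast
      then show False using xs(2) \<alpha>(2) by simp
    qed
    fix q assume "q \<in> Q"
    then obtain t where "t \<in> \<O>" "?\<beta> * q = \<alpha> * t" using \<beta>Q by blast
    then show "?\<beta> / \<alpha> * q \<in> \<O>" using \<alpha>(2) by simp
  qed
qed

text \<open>If \<gamma> mapped \<open>Q\<close> into itself, it would be integral. Hence some \<pi>
  in \<open>Q\<close> makes \<open>\<gamma> * \<pi>\<close> an integer outside \<open>Q\<close>, so
  that \<gamma> and \<pi> are inverse to each other up to a unit at \<open>Q\<close>.\<close>

lemma prime_inverse_unif:
  assumes "is_prime Q"
  shows "\<exists>\<gamma>. \<gamma> \<in> F \<and> \<gamma> \<notin> \<O> \<and> (\<forall>q\<in>Q. \<gamma> * q \<in> \<O>) \<and> (\<exists>\<pi>\<in>Q. \<gamma> * \<pi> \<notin> Q)"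
proof -
  obtain \<gamma> where \<gamma>: "\<gamma> \<in> F" "\<gamma> \<notin> \<O>" "\<forall>q\<in>Q. \<gamma> * q \<in> \<O>" using prime_inverse_element[OF assms] by blast
  have Q: "is_ideal Q" "Q \<noteq> {0}" using assms by (auto simp: is_prime_def)
  have "\<exists>\<pi>\<in>Q. \<gamma> * \<pi> \<notin> Q" using integral_of_stable_ideal[OF Q \<gamma>(1)] \<gamma>(2) by blast
  then show ?thesis using \<gamma> by blast
qed

end

section \<open>The valuation at a prime\<close>

locale prime_ideal = number_field +
  fixes Q :: "complex set"
  assumes prime: "Q \<in> fin_primes F"
begin

text \<open>An element of valuation -1 at \<open>Q\<close> that has no pole at any other prime. It
  takes the place of localisation: powers of \<open>Q\<close> are recognised by multiplying with
  powers of \<gamma>.\<close>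

definition "\<gamma> = (SOME \<gamma>. \<gamma> \<in> F \<and> \<gamma> \<notin> \<O> \<and> (\<forall>q\<in>Q. \<gamma> * q \<in> \<O>) \<and> (\<exists>\<pi>\<in>Q. \<gamma> * \<pi> \<notin> Q))"

lemma is_prime: "is_prime Q" and Q_ideal: "is_ideal Q" and Q_nonzero: "Q \<noteq> {0}" and one_notin: "1 \<notin> Q"
  using prime by (auto simp: fin_primes_iff is_prime_def)

lemma prime_cases: "x * y \<in> Q \<Longrightarrow> x \<in> \<O> \<Longrightarrow> y \<in> \<O> \<Longrightarrow> x \<in> Q \<or> y \<in> Q"
  using is_prime by (auto simp: is_prime_def)

lemma Q_ints: "x \<in> Q \<Longrightarrow> x \<in> \<O>"
  by (rule ideal_ints[OF Q_ideal])

lemma gamma: "\<gamma> \<in> F" "\<gamma> \<notin> \<O>" "q \<in> Q \<Longrightarrow> \<gamma> * q \<in> \<O>" "\<exists>\<pi>\<in>Q. \<gamma> * \<pi> \<notin> Q"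
  using someI_ex[OF prime_inverse_unif[OF is_prime]] unfolding \<gamma>_def[symmetric] by auto

abbreviation pow :: "nat \<Rightarrow> complex set" where "pow n \<equiv> ideal_pow \<O> Q n"

lemma pow_ideal: "is_ideal (pow n)"
  by (induction n) (auto intro: is_ideal_ints is_ideal_mult Q_ideal)

lemma pow_antimono: "pow (Suc n) \<subseteq> pow n"
proof -
  have "ideal_mult Q (pow n) \<subseteq> ideal_mult \<O> (pow n)"
    by (rule ideal_mult_mono) (use Q_ints in auto)
  also have "\<dots> = pow n" using ideal_mult_ints[OF pow_ideal] by (simp add: ideal_mult_commute)
  finally show ?thesis by simp
qed

lemma pow_mono: "m \<le> n \<Longrightarrow> pow n \<subseteq> pow m"
  by (induction n rule: dec_induct) (use pow_antimono in blast)+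

lemma pow_one: "pow 1 = Q"
  by (simp add: ideal_mult_ints[OF Q_ideal])

text \<open>With \<open>t * s + q = 1\<close> and \<open>q\<close> in \<open>Q\<close>, membership
  of \<open>x\<close> climbs one power at a time: if \<open>x\<close> lies in \<open>pow n\<close>,
  both \<open>t * (x * s)\<close> and \<open>q * x\<close> lie in
  \<open>pow (Suc n)\<close>.\<close>

lemma pow_primary:
  assumes "x \<in> \<O>" "s \<in> \<O>" "s \<notin> Q" "x * s \<in> pow n"
  shows "x \<in> pow n"
proof -
  obtain t q where tq: "t \<in> \<O>" "q \<in> Q" "t * s + q = 1" using prime_maximal[OF is_prime assms(2,3)] .
  show ?thesis using assms(4)
  proof (induction n)
    case (Suc n)
    then have "x \<in> pow n" using pow_antimono by blast
    then have "q * x \<in> pow (Suc n)" using tq(2) by (simp add: ideal_mult_prod)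
    moreover have "t * (x * s) \<in> pow (Suc n)" using ideal_scale[OF pow_ideal tq(1) Suc.prems] .
    ultimately have "t * (x * s) + q * x \<in> pow (Suc n)" by (intro ideal_add[OF pow_ideal])
    also have "t * (x * s) + q * x = (t * s + q) * x" by (simp add: algebra_simps)
    finally show ?case using tq by simp
  qed (use assms in simp)
qed

lemma pow_elt: "x \<in> Q \<Longrightarrow> x ^ n \<in> pow n"
  by (induction n) (auto intro: ideal_mult_prod)

text \<open>For the converse, multiplying the integer \<open>x * \<gamma> ^ n\<close> by
  \<open>\<pi> ^ n\<close> gives \<open>x * (\<gamma> * \<pi>) ^ n\<close> in \<open>pow n\<close>,
  and the power of \<open>\<gamma> * \<pi>\<close>, which lies outside \<open>Q\<close>, can be
  cancelled.\<close>

lemma pow_iff: "x \<in> pow n \<longleftrightarrow> x \<in> \<O> \<and> x * \<gamma> ^ n \<in> \<O>"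
proof
  assume x: "x \<in> pow n"
  have "\<gamma> ^ n * x \<in> \<O>" using x
  proof (induction n arbitrary: x)
    case (Suc n)
    from Suc.prems have "x \<in> ideal_mult Q (pow n)" by simp
    then show ?case
    proof (induction rule: ideal_mult_induct)
      case (prod q y)
      have "(\<gamma> * q) * (\<gamma> ^ n * y) \<in> \<O>" using gamma(3)[OF prod(1)] Suc.IH[OF prod(2)] by (rule ints_mult)
      then show ?case by (simp add: mult_ac)
    qed (auto simp: distrib_left)
  qed simp
  then show "x \<in> \<O> \<and> x * \<gamma> ^ n \<in> \<O>" using ideal_ints[OF pow_ideal x] by (simp add: mult.commute)
next
  assume x: "x \<in> \<O> \<and> x * \<gamma> ^ n \<in> \<O>"
  obtain \<pi> where \<pi>: "\<pi> \<in> Q" "\<gamma> * \<pi> \<notin> Q" using gamma(4) by blast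
  let ?s = "(\<gamma> * \<pi>) ^ n"
  have s: "?s \<in> \<O>" using gamma(3)[OF \<pi>(1)] by (rule ints_power)
  have sQ: "?s \<notin> Q"
    using prime_prod_list[OF is_prime, of "replicate n (\<gamma> * \<pi>)"] gamma(3)[OF \<pi>(1)] \<pi>(2) by simp
  have "(x * \<gamma> ^ n) * \<pi> ^ n \<in> pow n" using x by (intro ideal_scale[OF pow_ideal _ pow_elt[OF \<pi>(1)]]) simp
  then have "x * ?s \<in> pow n" by (simp add: power_mult_distrib mult.assoc)
  then show "x \<in> pow n" using pow_primary x s sQ by blast
qed

text \<open>The exact order of \<open>x\<close>, in a form that is additive under products because
  \<open>Q\<close> is prime.\<close>

definition has_ord :: "complex \<Rightarrow> nat \<Rightarrow> bool" where
  "has_ord x n \<longleftrightarrow> x * \<gamma> ^ n \<in> \<O> \<and> x * \<gamma> ^ n \<notin> Q"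

lemma has_ord_pow_iff:
  assumes "x \<in> \<O>" "has_ord x n"
  shows "x \<in> pow k \<longleftrightarrow> k \<le> n"
proof
  assume "k \<le> n"
  have "x \<in> pow n" using assms by (simp add: pow_iff has_ord_def)
  then show "x \<in> pow k" using pow_mono[OF \<open>k \<le> n\<close>] by blast
next
  assume x: "x \<in> pow k"
  show "k \<le> n"
  proof (rule ccontr)
    assume "\<not> k \<le> n"
    then have "x \<in> pow (Suc n)" using x pow_mono[of "Suc n" k] by auto
    then have "x * \<gamma> ^ n \<in> pow 1"
      using assms(2) unfolding pow_iff has_ord_def by (simp add: mult_ac)
    then show False using assms(2) unfolding pow_one has_ord_def by simp
  qed
qed

text \<open>Without an exact order all products \<open>\<gamma> ^ n * x\<close> would be integral,
  which would make \<gamma> itself integral.\<close>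

lemma has_ord_exists:
  assumes "x \<in> \<O>" "x \<noteq> 0"
  shows "\<exists>n. has_ord x n"
proof (rule ccontr)
  assume *: "\<not> ?thesis"
  have "x \<in> pow n" for n
  proof (induction n)
    case (Suc n)
    then have 1: "x * \<gamma> ^ n \<in> \<O>" by (simp add: pow_iff)
    then have "x * \<gamma> ^ n \<in> Q" using * by (auto simp: has_ord_def)
    then have "\<gamma> * (x * \<gamma> ^ n) \<in> \<O>" by (rule gamma(3))
    then have "x * \<gamma> ^ Suc n \<in> \<O>" by (simp add: mult_ac)
    then show ?case unfolding pow_iff using assms(1) by blast
  qed (use assms in simp)
  then have "\<gamma> ^ n * x \<in> \<O>" for n by (simp add: pow_iff mult.commute)
  then have "\<gamma> \<in> \<O>" by (rule integral_of_powers[OF gamma(1) assms])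
  then show False using gamma(2) by simp
qed

lemma ord_at_eq:
  assumes "x \<in> \<O>" "has_ord x n"
  shows "ord_at F Q x = n"
  unfolding ord_at_def by (rule Greatest_equality) (use has_ord_pow_iff[OF assms] in auto)

lemma has_ord: "x \<in> \<O> \<Longrightarrow> x \<noteq> 0 \<Longrightarrow> has_ord x (ord_at F Q x)"
  using has_ord_exists[of x] ord_at_eq[of x] by auto

lemma has_ord_mult:
  assumes "has_ord x m" "has_ord y n"
  shows "has_ord (x * y) (m + n)"
proof -
  have "x * y * \<gamma> ^ (m + n) = (x * \<gamma> ^ m) * (y * \<gamma> ^ n)" by (simp add: power_add mult_ac)
  then show ?thesis using assms prime_cases[of "x * \<gamma> ^ m" "y * \<gamma> ^ n"] ints_mult
    unfolding has_ord_def by metis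
qed

lemma ord_at_mult:
  assumes "x \<in> \<O>" "x \<noteq> 0" "y \<in> \<O>" "y \<noteq> 0"
  shows "ord_at F Q (x * y) = ord_at F Q x + ord_at F Q y"
  by (rule ord_at_eq) (use assms has_ord_mult has_ord in auto)

lemma fraction:
  assumes "x \<in> F"
  obtains b c where "b \<in> \<O>" "c \<in> \<O>" "c \<noteq> 0" "x = b / c"
proof -
  obtain d :: int where "d \<noteq> 0" "of_int d * x \<in> \<O>" using ints_denominator[OF assms] .
  then show thesis using that[of "of_int d * x" "of_int d"] by simp
qed

lemma val_fraction:
  assumes b: "b \<in> \<O>" "b \<noteq> 0" and c: "c \<in> \<O>" "c \<noteq> 0"
  shows "val F Q (b / c) = int (ord_at F Q b) - int (ord_at F Q c)"
  unfolding val_def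
proof (rule the_equality)
  show "\<exists>b'\<in>\<O> - {0}. \<exists>c'\<in>\<O> - {0}. b / c = b' / c' \<and>
     int (ord_at F Q b) - int (ord_at F Q c) = int (ord_at F Q b') - int (ord_at F Q c')"
    using assms by (intro bexI[of _ b] bexI[of _ c]) auto
  fix k assume "\<exists>b'\<in>\<O> - {0}. \<exists>c'\<in>\<O> - {0}. b / c = b' / c' \<and> k = int (ord_at F Q b') - int (ord_at F Q c')"
  then obtain b' c' where *: "b' \<in> \<O>" "b' \<noteq> 0" "c' \<in> \<O>" "c' \<noteq> 0" "b / c = b' / c'"
    "k = int (ord_at F Q b') - int (ord_at F Q c')" by blast
  have "b * c' = b' * c" using *(5) c *(4) by (simp add: field_simps)
  then have "ord_at F Q b + ord_at F Q c' = ord_at F Q b' + ord_at F Q c"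
    using ord_at_mult assms * by metis
  then show "k = int (ord_at F Q b) - int (ord_at F Q c)" using *(6) by linarith
qed

lemma val_ints: "x \<in> \<O> \<Longrightarrow> x \<noteq> 0 \<Longrightarrow> val F Q x = int (ord_at F Q x)"
proof -
  assume x: "x \<in> \<O>" "x \<noteq> 0"
  have "has_ord 1 0" using one_notin by (simp add: has_ord_def)
  then have "ord_at F Q 1 = 0" using ord_at_eq[of 1] by simp
  then show ?thesis using val_fraction[OF x, of 1] by simp
qed

lemma val_nonneg_ints: "x \<in> \<O> \<Longrightarrow> x \<noteq> 0 \<Longrightarrow> 0 \<le> val F Q x"
  by (simp add: val_ints)

lemma pow_iff_val: "x \<in> \<O> \<Longrightarrow> x \<noteq> 0 \<Longrightarrow> x \<in> pow n \<longleftrightarrow> int n \<le> val F Q x"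
  using has_ord_pow_iff[OF _ has_ord] by (simp add: val_ints)

lemma mem_iff_val: "x \<in> \<O> \<Longrightarrow> x \<noteq> 0 \<Longrightarrow> x \<in> Q \<longleftrightarrow> 1 \<le> val F Q x"
  using pow_iff_val[of x 1] unfolding pow_one by simp

lemma val_one [simp]: "val F Q 1 = 0"
proof -
  have "\<not> 1 \<le> val F Q 1" using mem_iff_val[of 1] one_notin by simp
  then show ?thesis using val_nonneg_ints[of 1] by simp
qed

lemma val_mult:
  assumes "x \<in> F" "x \<noteq> 0" "y \<in> F" "y \<noteq> 0"
  shows "val F Q (x * y) = val F Q x + val F Q y"
proof -
  obtain b c where x: "b \<in> \<O>" "c \<in> \<O>" "c \<noteq> 0" "x = b / c" using fraction[OF assms(1)] .
  obtain d e where y: "d \<in> \<O>" "e \<in> \<O>" "e \<noteq> 0" "y = d / e" using fraction[OF assms(3)] .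
  have nz: "b \<noteq> 0" "d \<noteq> 0" using assms x y by auto
  have "x * y = (b * d) / (c * e)" using x y by simp
  then have "val F Q (x * y) = int (ord_at F Q (b * d)) - int (ord_at F Q (c * e))"
    using val_fraction[of "b * d" "c * e"] x y nz by auto
  also have "\<dots> = val F Q x + val F Q y"
    using x y nz by (simp add: val_fraction ord_at_mult)
  finally show ?thesis .
qed

lemma val_uminus_one: "val F Q (- 1) = 0"
proof -
  have "val F Q ((- 1) * (- 1)) = val F Q (- 1) + val F Q (- 1)"
    by (rule val_mult) (auto intro: uminus_mem)
  then show ?thesis by simp
qed

lemma val_uminus: "x \<in> F \<Longrightarrow> x \<noteq> 0 \<Longrightarrow> val F Q (- x) = val F Q x"
  using val_mult[of "-1" x] val_uminus_one uminus_mem[OF one_mem] by simp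

lemma val_inverse: "x \<in> F \<Longrightarrow> x \<noteq> 0 \<Longrightarrow> val F Q (inverse x) = - val F Q x"
  using val_mult[of x "inverse x"] inverse_mem by simp

lemma val_divide: "x \<in> F \<Longrightarrow> x \<noteq> 0 \<Longrightarrow> y \<in> F \<Longrightarrow> y \<noteq> 0 \<Longrightarrow> val F Q (x / y) = val F Q x - val F Q y"
  unfolding divide_inverse using val_mult[of x "inverse y"] val_inverse[of y] inverse_mem by simp

lemma val_power: "x \<in> F \<Longrightarrow> x \<noteq> 0 \<Longrightarrow> val F Q (x ^ n) = int n * val F Q x"
  by (induction n) (auto simp: val_mult power_mem algebra_simps)

lemma val_add:
  assumes "x \<in> F" "x \<noteq> 0" "y \<in> F" "y \<noteq> 0" "x + y \<noteq> 0" "k \<le> val F Q x" "k \<le> val F Q y"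
  shows "k \<le> val F Q (x + y)"
proof -
  obtain b c where x: "b \<in> \<O>" "c \<in> \<O>" "c \<noteq> 0" "x = b / c" using fraction[OF assms(1)] .
  obtain d e where y: "d \<in> \<O>" "e \<in> \<O>" "e \<noteq> 0" "y = d / e" using fraction[OF assms(3)] .
  let ?m = "c * e" and ?x = "b * e" and ?y = "d * c"
  have O: "?m \<in> \<O>" "?x \<in> \<O>" "?y \<in> \<O>" using x y by auto
  have eq: "x = ?x / ?m" "y = ?y / ?m" "x + y = (?x + ?y) / ?m" using x y by (auto simp: field_simps)
  have nz: "?m \<noteq> 0" "?x \<noteq> 0" "?y \<noteq> 0" "?x + ?y \<noteq> 0" using assms eq by auto
  have v: "val F Q (z / ?m) = val F Q z - val F Q ?m" if "z \<in> \<O>" "z \<noteq> 0" for z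
    using that O nz by (intro val_divide) auto
  \<comment> \<open>Over the common denominator \<open>?m\<close> the claim concerns integral
    numerators. Their valuations are nonnegative, so truncating the bound to a natural number loses
    nothing.\<close>
  let ?n = "nat (k + val F Q ?m)"
  have le: "int ?n \<le> val F Q z" if z: "z \<in> \<O>" "z \<noteq> 0" "k \<le> val F Q (z / ?m)" for z
    using z(3) val_nonneg_ints[OF z(1,2)] unfolding v[OF z(1,2)] by linarith
  have "k \<le> val F Q (?x / ?m)" "k \<le> val F Q (?y / ?m)" using assms(6,7) eq(1,2) by simp_all
  then have "?x \<in> pow ?n" "?y \<in> pow ?n"
    using le[OF O(2) nz(2)] le[OF O(3) nz(3)] by (simp_all only: pow_iff_val[OF O(2) nz(2)] pow_iff_val[OF O(3) nz(3)])
  then have *: "?x + ?y \<in> pow ?n" by (rule ideal_add[OF pow_ideal])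
  have xy: "?x + ?y \<in> \<O>" by (intro ints_add O)
  have "int ?n \<le> val F Q (?x + ?y)" using * pow_iff_val[OF xy nz(4)] by simp
  then show ?thesis unfolding eq(3) v[OF xy nz(4)] by linarith
qed

lemma val_surj_one: "\<exists>\<pi>\<in>F. \<pi> \<noteq> 0 \<and> val F Q \<pi> = 1"
proof -
  obtain \<pi> where \<pi>: "\<pi> \<in> Q" "\<gamma> * \<pi> \<notin> Q" using gamma(4) by blast
  have "\<pi> \<noteq> 0" using \<pi>(2) ideal_zero[OF Q_ideal] by auto
  moreover have "has_ord \<pi> 1" using \<pi> gamma(3)[OF \<pi>(1)] by (simp add: has_ord_def mult.commute)
  ultimately show ?thesis using Q_ints[OF \<pi>(1)] ord_at_eq[of \<pi> 1] by (auto simp: val_ints)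
qed

text \<open>Numerator and denominator of any integral fraction for \<open>x\<close> have the same
  order \<open>n\<close>; multiplying both by \<open>\<gamma> ^ n\<close> moves them out of
  \<open>Q\<close>.\<close>

lemma val_zero_fraction:
  assumes "x \<in> F" "x \<noteq> 0" "val F Q x = 0"
  obtains b c where "b \<in> \<O>" "c \<in> \<O>" "b \<notin> Q" "c \<notin> Q" "x = b / c"
proof -
  obtain b c where x: "b \<in> \<O>" "c \<in> \<O>" "c \<noteq> 0" "x = b / c" using fraction[OF assms(1)] .
  have "b \<noteq> 0" using x assms by auto
  let ?n = "ord_at F Q b"
  have "ord_at F Q c = ?n" using assms(3) val_fraction[OF x(1) \<open>b \<noteq> 0\<close> x(2,3)] x(4) by simp
  then have "has_ord b ?n" "has_ord c ?n" using has_ord x \<open>b \<noteq> 0\<close> by metis+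
  moreover have "\<gamma> \<noteq> 0" using gamma(2) by auto
  ultimately show thesis using that[of "b * \<gamma> ^ ?n" "c * \<gamma> ^ ?n"] x by (auto simp: has_ord_def)
qed

lemma val_ge_zero [simp]: "val_ge F Q 0 N"
  by (simp add: val_ge_def)

lemma val_ge_add: "x \<in> F \<Longrightarrow> y \<in> F \<Longrightarrow> val_ge F Q x N \<Longrightarrow> val_ge F Q y N \<Longrightarrow> val_ge F Q (x + y) N"
  by (cases "x = 0 \<or> y = 0 \<or> x + y = 0") (auto simp: val_ge_def intro: val_add)

lemma val_ge_uminus: "x \<in> F \<Longrightarrow> val_ge F Q x N \<Longrightarrow> val_ge F Q (- x) N"
  by (cases "x = 0") (simp_all add: val_ge_def val_uminus)

lemma val_ge_mult: "x \<in> F \<Longrightarrow> y \<in> F \<Longrightarrow> val_ge F Q x M \<Longrightarrow> val_ge F Q y N \<Longrightarrow> val_ge F Q (x * y) (M + N)"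
  by (cases "x = 0 \<or> y = 0") (auto simp: val_ge_def val_mult)

lemma val_ge_mono: "val_ge F Q x N \<Longrightarrow> M \<le> N \<Longrightarrow> val_ge F Q x M"
  by (auto simp: val_ge_def)

text \<open>The isosceles principle of ultrametrics: if \<open>y\<close> had larger valuation than
  \<open>x\<close>, then \<open>x = y + (x - y)\<close> would have valuation above its own.\<close>

lemma val_close:
  assumes "x \<in> F" "x \<noteq> 0" "y \<in> F" "val_ge F Q (x - y) (val F Q x + 1)"
  shows "y \<noteq> 0" "val F Q y = val F Q x"
proof -
  have d: "x - y \<in> F" using assms by auto
  show y: "y \<noteq> 0" using assms by (auto simp: val_ge_def)
  have yx: "y - x \<in> F" "val_ge F Q (y - x) (val F Q x + 1)" using val_ge_uminus[OF d assms(4)] assms by auto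
  have "val_ge F Q (x + (y - x)) (val F Q x)"
    by (rule val_ge_add) (use assms yx val_ge_mono[OF yx(2)] in \<open>auto simp: val_ge_def\<close>)
  then have le: "val F Q x \<le> val F Q y" using y by (simp add: val_ge_def)
  show "val F Q y = val F Q x"
  proof (rule ccontr)
    assume "val F Q y \<noteq> val F Q x"
    then have "val_ge F Q (y + (x - y)) (val F Q x + 1)"
      using le assms d by (intro val_ge_add) (auto simp: val_ge_def)
    then show False using assms(2) by (simp add: val_ge_def)
  qed
qed

end

lemma ideal_mult_left_commute: "ideal_mult I (ideal_mult J K) = ideal_mult J (ideal_mult I K)"
  by (metis ideal_mult_assoc ideal_mult_commute)

context prime_ideal
begin

text \<open>\<open>B\<close> is the ideal quotient of \<open>A\<close> by \<open>Q\<close>. It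
  contains \<open>\<gamma> * A\<close>, so \<open>A = B\<close> would make \<gamma> integral; the
  relation \<open>t * (\<gamma> * \<pi>) + q = 1\<close> writes every element of \<open>A\<close> as
  an element of the product. The strict inclusion is what Noetherian induction needs.\<close>

lemma ideal_quotient:
  assumes A: "is_ideal A" "A \<noteq> {0}" "A \<subseteq> Q"
  shows "\<exists>B. is_ideal B \<and> A \<subset> B \<and> A = ideal_mult Q B"
proof -
  define B where "B = {y \<in> F. \<forall>q\<in>Q. y * q \<in> A}"
  have BO: "B \<subseteq> \<O>"
  proof
    fix y assume y: "y \<in> B"
    then have "\<And>q. q \<in> Q \<Longrightarrow> y * q \<in> Q" using A(3) by (auto simp: B_def)
    then show "y \<in> \<O>" using integral_of_stable_ideal[OF Q_ideal Q_nonzero] y by (auto simp: B_def)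
  qed
  have AB: "A \<subseteq> B"
    using ideal_scale'[OF A(1)] Q_ints ints_mem[OF ideal_ints[OF A(1)]] by (auto simp: B_def)
  have B: "is_ideal B" unfolding is_ideal_def
  proof (intro conjI ballI BO)
    show "0 \<in> B" using ideal_zero[OF A(1)] by (simp add: B_def)
    fix x y assume "x \<in> B" "y \<in> B"
    then show "x + y \<in> B" using ideal_add[OF A(1)] by (auto simp: B_def distrib_right)
  next
    fix x y assume "x \<in> \<O>" "y \<in> B"
    then show "x * y \<in> B" using ideal_scale[OF A(1)] by (auto simp: B_def mult.assoc)
  qed
  have gA: "\<gamma> * x \<in> B" if "x \<in> A" for x
  proof -
    have "\<gamma> * x * q \<in> A" if "q \<in> Q" for q
      using ideal_scale[OF A(1) gamma(3)[OF that] \<open>x \<in> A\<close>] by (simp add: mult_ac)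
    moreover have "\<gamma> * x \<in> F" using gamma(1) ideal_ints[OF A(1) that] by auto
    ultimately show ?thesis by (simp add: B_def)
  qed
  have "A \<noteq> B"
  proof
    assume "A = B"
    then have "\<gamma> \<in> \<O>" using integral_of_stable_ideal[OF A(1,2) gamma(1)] gA by blast
    then show False using gamma(2) by simp
  qed
  moreover have "A = ideal_mult Q B"
  proof
    show "ideal_mult Q B \<subseteq> A"
      by (rule ideal_mult_subset)
        (use ideal_zero[OF A(1)] ideal_add[OF A(1)] in \<open>auto simp: B_def mult.commute\<close>)
    show "A \<subseteq> ideal_mult Q B"
    proof
      fix x assume x: "x \<in> A"
      obtain \<pi> where \<pi>: "\<pi> \<in> Q" "\<gamma> * \<pi> \<notin> Q" using gamma(4) by blast
      obtain t q where tq: "t \<in> \<O>" "q \<in> Q" "t * (\<gamma> * \<pi>) + q = 1"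
        using prime_maximal[OF is_prime gamma(3)[OF \<pi>(1)] \<pi>(2)] .
      have "\<pi> * (t * (\<gamma> * x)) \<in> ideal_mult Q B"
        using \<pi>(1) ideal_scale[OF B tq(1) gA[OF x]] by (rule ideal_mult_prod)
      moreover have "q * x \<in> ideal_mult Q B" using tq(2) x AB by (intro ideal_mult_prod) auto
      ultimately have "\<pi> * (t * (\<gamma> * x)) + q * x \<in> ideal_mult Q B" by (rule ideal_mult_add)
      also have "\<pi> * (t * (\<gamma> * x)) + q * x = (t * (\<gamma> * \<pi>) + q) * x" by (simp add: algebra_simps)
      finally show "x \<in> ideal_mult Q B" using tq by simp
    qed
  qed
  ultimately show ?thesis using B AB by blast
qed

text \<open>If \<open>\<pi> * x\<close> lies in \<open>pow (Suc n)\<close>, then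
  \<open>x * (\<gamma> * \<pi>)\<close> lies in \<open>pow n\<close>, and the factor
  \<open>\<gamma> * \<pi>\<close> is cancelled as a unit at \<open>Q\<close>.\<close>

lemma ideal_mult_subset_pow_Suc:
  assumes "is_ideal B"
  shows "ideal_mult Q B \<subseteq> pow (Suc n) \<longleftrightarrow> B \<subseteq> pow n"
proof
  assume "B \<subseteq> pow n"
  then show "ideal_mult Q B \<subseteq> pow (Suc n)" by (simp add: ideal_mult_mono)
next
  assume *: "ideal_mult Q B \<subseteq> pow (Suc n)"
  show "B \<subseteq> pow n"
  proof
    fix x assume x: "x \<in> B"
    obtain \<pi> where \<pi>: "\<pi> \<in> Q" "\<gamma> * \<pi> \<notin> Q" using gamma(4) by blast
    have "\<pi> * x \<in> pow (Suc n)" using ideal_mult_prod[OF \<pi>(1) x] * by blast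
    then have "\<pi> * x * \<gamma> ^ Suc n \<in> \<O>" unfolding pow_iff by blast
    then have "x * (\<gamma> * \<pi>) * \<gamma> ^ n \<in> \<O>" by (simp add: mult_ac)
    then have "x * (\<gamma> * \<pi>) \<in> pow n"
      using ideal_ints[OF assms x] gamma(3)[OF \<pi>(1)] unfolding pow_iff by blast
    then show "x \<in> pow n" using pow_primary[OF ideal_ints[OF assms x] gamma(3)[OF \<pi>(1)] \<pi>(2)] by blast
  qed
qed

lemma prime_notin:
  assumes "P \<in> fin_primes F" "P \<noteq> Q"
  obtains s where "s \<in> P" "s \<notin> Q" "s \<in> \<O>"
proof -
  have P: "is_prime P" using assms(1) by (simp add: fin_primes_iff)
  then have "\<not> P \<subseteq> Q" using prime_subset_eq[OF P is_prime] assms(2) by blast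
  then show thesis using that P unfolding is_prime_def by (meson ideal_ints subsetI)
qed

lemma ideal_mult_subset_pow_other:
  assumes "is_ideal B" "P \<in> fin_primes F" "P \<noteq> Q"
  shows "ideal_mult P B \<subseteq> pow n \<longleftrightarrow> B \<subseteq> pow n"
proof
  have P: "is_ideal P" using assms(2) by (simp add: fin_primes_iff is_prime_def)
  assume "B \<subseteq> pow n"
  then show "ideal_mult P B \<subseteq> pow n"
    by (intro ideal_mult_subset)
      (use ideal_zero[OF pow_ideal] ideal_add[OF pow_ideal] ideal_scale[OF pow_ideal ideal_ints[OF P]] in auto)
next
  assume *: "ideal_mult P B \<subseteq> pow n"
  obtain s where s: "s \<in> P" "s \<notin> Q" "s \<in> \<O>" using prime_notin[OF assms(2,3)] .
  show "B \<subseteq> pow n"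
  proof
    fix x assume x: "x \<in> B"
    then have "x * s \<in> pow n" using ideal_mult_prod[OF s(1) x] * by (auto simp: mult.commute)
    then show "x \<in> pow n" using pow_primary[OF ideal_ints[OF assms(1) x] s(3,2)] by blast
  qed
qed

text \<open>An element that \<open>P\<close> multiplies into the integers can have a pole only at
  \<open>P\<close>. This makes the \<gamma> of a prime in \<open>S\<close> an
  \<open>S\<close>-integer.\<close>

lemma val_gamma_other:
  assumes "P \<in> fin_primes F" "P \<noteq> Q" "y \<in> F" "y \<noteq> 0" "\<And>q. q \<in> P \<Longrightarrow> y * q \<in> \<O>"
  shows "0 \<le> val F Q y"
proof -
  obtain s where s: "s \<in> P" "s \<notin> Q" "s \<in> \<O>" using prime_notin[OF assms(1,2)] .
  have s0: "s \<noteq> 0" using s(2) ideal_zero[OF Q_ideal] by auto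
  have "val F Q s = 0" using mem_iff_val[OF s(3) s0] val_nonneg_ints[OF s(3) s0] s(2) by simp
  moreover have "0 \<le> val F Q (y * s)" using assms(4) s0 by (intro val_nonneg_ints assms(5)[OF s(1)]) simp
  moreover have "val F Q (y * s) = val F Q y + val F Q s" using assms(3,4) s(3) s0 by (intro val_mult) auto
  ultimately show ?thesis by simp
qed

end

section \<open>\<open>S\<close>-integers, and ideals that are cubes away from
  \<open>S\<close>\<close>

context number_field
begin

lemma prime_idealI: "Q \<in> fin_primes F \<Longrightarrow> prime_ideal F Q"
  by unfold_locales

lemma S_ints_iff: "x \<in> S_ints F S \<longleftrightarrow> x \<in> F \<and> (\<forall>q\<in>fin_primes F - S. val_ge F q x 0)"
  by (auto simp: S_ints_def val_ge_def)

lemma S_ints_add: "x \<in> S_ints F S \<Longrightarrow> y \<in> S_ints F S \<Longrightarrow> x + y \<in> S_ints F S"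
  using prime_ideal.val_ge_add[OF prime_idealI] by (auto simp: S_ints_iff)

lemma S_ints_mult: "x \<in> S_ints F S \<Longrightarrow> y \<in> S_ints F S \<Longrightarrow> x * y \<in> S_ints F S"
  using prime_ideal.val_ge_mult[OF prime_idealI, of _ x y 0 0] by (auto simp: S_ints_iff)

lemma ints_subset_S_ints: "\<O> \<subseteq> S_ints F S"
  using prime_ideal.val_nonneg_ints[OF prime_idealI] by (auto simp: S_ints_def)

lemma S_ints_zero: "0 \<in> S_ints F S" and S_ints_one: "1 \<in> S_ints F S"
  by (auto intro!: subsetD[OF ints_subset_S_ints])

lemma S_ints_square: "ideal_mult (S_ints F S) (S_ints F S) = S_ints F S"
proof
  show "ideal_mult (S_ints F S) (S_ints F S) \<subseteq> S_ints F S"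
    by (rule ideal_mult_subset) (auto intro: S_ints_zero S_ints_add S_ints_mult)
  show "S_ints F S \<subseteq> ideal_mult (S_ints F S) (S_ints F S)"
    using ideal_mult_prod[OF S_ints_one] by fastforce
qed

text \<open>A prime in \<open>S\<close> becomes the unit ideal: its \<gamma> is an
  \<open>S\<close>-integer, and \<open>t * (\<gamma> * \<pi>) + q = 1\<close> exhibits 1 in the
  extended ideal.\<close>

lemma prime_S_ints:
  assumes "P \<in> fin_primes F" "P \<in> S"
  shows "ideal_mult P (S_ints F S) = S_ints F S"
proof
  interpret P: prime_ideal F P by (rule prime_idealI[OF assms(1)])
  have PO: "P \<subseteq> S_ints F S" using P.Q_ints ints_subset_S_ints by blast
  show "ideal_mult P (S_ints F S) \<subseteq> S_ints F S"
    using ideal_mult_mono[OF PO order_refl, of "S_ints F S"] by (simp add: S_ints_square)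
  have g: "P.\<gamma> \<in> S_ints F S" unfolding S_ints_def
  proof (intro CollectI conjI disjI2 ballI P.gamma(1))
    fix q assume q: "q \<in> fin_primes F - S"
    have "P.\<gamma> \<noteq> 0" using P.gamma(2) by auto
    then show "0 \<le> val F q P.\<gamma>"
      using prime_ideal.val_gamma_other[OF prime_idealI assms(1) _ P.gamma(1)] P.gamma(3) q assms(2) by blast
  qed
  obtain \<pi> where \<pi>: "\<pi> \<in> P" "P.\<gamma> * \<pi> \<notin> P" using P.gamma(4) by blast
  obtain t q where tq: "t \<in> \<O>" "q \<in> P" "t * (P.\<gamma> * \<pi>) + q = 1"
    using prime_maximal[OF P.is_prime P.gamma(3)[OF \<pi>(1)] \<pi>(2)] .
  show "S_ints F S \<subseteq> ideal_mult P (S_ints F S)"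
  proof
    fix z assume z: "z \<in> S_ints F S"
    have "\<pi> * (t * (P.\<gamma> * z)) \<in> ideal_mult P (S_ints F S)"
      by (intro ideal_mult_prod \<pi>(1) S_ints_mult g z subsetD[OF ints_subset_S_ints tq(1)])
    moreover have "q * z \<in> ideal_mult P (S_ints F S)" by (intro ideal_mult_prod tq(2) z)
    ultimately have "\<pi> * (t * (P.\<gamma> * z)) + q * z \<in> ideal_mult P (S_ints F S)" by (rule ideal_mult_add)
    also have "\<pi> * (t * (P.\<gamma> * z)) + q * z = (t * (P.\<gamma> * \<pi>) + q) * z" by (simp add: algebra_simps)
    finally show "z \<in> ideal_mult P (S_ints F S)" using tq by simp
  qed
qed

text \<open>\<open>A\<close> is divisible to an order that is a multiple of three by each prime outside \<open>S\<close>.\<close>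

definition cubic_outside :: "complex set set \<Rightarrow> complex set \<Rightarrow> bool" where
  "cubic_outside S A \<longleftrightarrow> (\<forall>Q\<in>fin_primes F - S. \<forall>n.
     A \<subseteq> ideal_pow \<O> Q (3 * n + 1) \<longrightarrow> A \<subseteq> ideal_pow \<O> Q (3 * n + 3))"

text \<open>Noetherian induction on \<open>A\<close>, dividing by a prime above it: once if the
  prime lies in \<open>S\<close>, where it is invisible to the \<open>S\<close>-integers, and three
  times otherwise. Both divisions preserve \<open>cubic_outside\<close>.\<close>

lemma cubic_outside_cube:
  assumes "is_ideal A" "A \<noteq> {0}" "cubic_outside S A"
  shows "\<exists>I. is_ideal I \<and> I \<noteq> {0} \<and>
    ideal_mult A (S_ints F S) = ideal_mult (ideal_mult I (ideal_mult I I)) (S_ints F S)"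
  using assms
proof (induction rule: ideal_noetherian_induct)
  case (ideal A)
  show ?case
  proof (cases "1 \<in> A")
    case True
    then have "A = \<O>" by (rule ideal_eq_ints[OF ideal(1)])
    moreover have "\<O> \<noteq> {0}" using ints_one by force
    ultimately show ?thesis
      using is_ideal_ints by (intro exI[of _ \<O>]) (auto simp: ideal_mult_ints[OF is_ideal_ints])
  next
    case False
    then obtain P where "is_prime P" and AP: "A \<subseteq> P" using prime_above_exists[OF ideal(1,2)] by blast
    then have P: "P \<in> fin_primes F" by (simp add: fin_primes_iff)
    interpret P: prime_ideal F P by (rule prime_idealI[OF P])
    have nz: "B \<noteq> {0}" if "A \<subset> B" for B using that ideal(1,2) ideal_zero by blast
    show ?thesis
    proof (cases "P \<in> S")
      case True
      obtain B where B: "is_ideal B" "A \<subset> B" "A = ideal_mult P B"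
        using P.ideal_quotient[OF ideal(1,2) AP] by blast
      have "cubic_outside S B" unfolding cubic_outside_def
      proof (intro ballI)
        fix Q assume Q: "Q \<in> fin_primes F - S"
        then interpret Q: prime_ideal F Q using prime_idealI by blast
        have "P \<noteq> Q" using True Q by blast
        then show "\<forall>n. B \<subseteq> Q.pow (3 * n + 1) \<longrightarrow> B \<subseteq> Q.pow (3 * n + 3)"
          using ideal.prems Q B(3) Q.ideal_mult_subset_pow_other[OF B(1) P]
          unfolding cubic_outside_def by metis
      qed
      then obtain I where I: "is_ideal I" "I \<noteq> {0}"
        "ideal_mult B (S_ints F S) = ideal_mult (ideal_mult I (ideal_mult I I)) (S_ints F S)"
        using ideal(3)[OF B(1,2)] by blast
      have "ideal_mult A (S_ints F S) = ideal_mult B (ideal_mult P (S_ints F S))"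
        unfolding B(3) by (metis ideal_mult_assoc ideal_mult_commute)
      then show ?thesis using I prime_S_ints[OF P True] by auto
    next
      case False
      \<comment> \<open>The instance \<open>n = 0\<close> of \<open>cubic_outside\<close>: one
        factor \<open>P\<close> forces three.\<close>
      have "A \<subseteq> P.pow (3 * 0 + 3)"
        using ideal.prems P False AP P.pow_one unfolding cubic_outside_def by (metis DiffI add_0 mult_0_right)
      then have A3: "A \<subseteq> P.pow (Suc (Suc (Suc 0)))" by (simp add: numeral_3_eq_3)
      obtain B where B: "is_ideal B" "A \<subset> B" "A = ideal_mult P B"
        using P.ideal_quotient[OF ideal(1,2) AP] by blast
      have B2: "B \<subseteq> P.pow (Suc (Suc 0))" using A3 P.ideal_mult_subset_pow_Suc[OF B(1)] B(3) by metis
      then have "B \<subseteq> P" using P.pow_mono[of 1 "Suc (Suc 0)"] P.pow_one by auto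
      then obtain C where C: "is_ideal C" "B \<subset> C" "B = ideal_mult P C"
        using P.ideal_quotient[OF B(1) nz[OF B(2)]] by blast
      have "C \<subseteq> P.pow (Suc 0)" using B2 P.ideal_mult_subset_pow_Suc[OF C(1)] C(3) by metis
      then have "C \<subseteq> P" using P.pow_one by simp
      moreover have "A \<subset> C" using B C by blast
      ultimately obtain D where D: "is_ideal D" "C \<subset> D" "C = ideal_mult P D"
        using P.ideal_quotient[OF C(1) nz] by blast
      have AD: "A = ideal_mult P (ideal_mult P (ideal_mult P D))" using B(3) C(3) D(3) by simp
      have "cubic_outside S D" unfolding cubic_outside_def
      proof (intro ballI allI impI)
        fix Q n assume Q: "Q \<in> fin_primes F - S" and le: "D \<subseteq> ideal_pow \<O> Q (3 * n + 1)"
        then interpret Q: prime_ideal F Q using prime_idealI by blast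
        show "D \<subseteq> ideal_pow \<O> Q (3 * n + 3)"
        proof (cases "P = Q")
          case True
          have shift: "A \<subseteq> P.pow (Suc (Suc (Suc k))) \<longleftrightarrow> D \<subseteq> P.pow k" for k
            using P.ideal_mult_subset_pow_Suc[OF B(1)] P.ideal_mult_subset_pow_Suc[OF C(1)]
              P.ideal_mult_subset_pow_Suc[OF D(1)] B(3) C(3) D(3) by metis
          have "A \<subseteq> P.pow (3 * Suc n + 1)" using shift[of "3 * n + 1"] le True by (simp add: numeral_3_eq_3)
          then have "A \<subseteq> P.pow (3 * Suc n + 3)"
            using ideal.prems Q True unfolding cubic_outside_def by blast
          moreover have "3 * Suc n + 3 = Suc (Suc (Suc (3 * n + 3)))" by simp
          ultimately show ?thesis using shift[of "3 * n + 3"] True by metis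
        next
          case False
          have other: "A \<subseteq> Q.pow k \<longleftrightarrow> D \<subseteq> Q.pow k" for k
            using Q.ideal_mult_subset_pow_other[OF B(1) P False] Q.ideal_mult_subset_pow_other[OF C(1) P False]
              Q.ideal_mult_subset_pow_other[OF D(1) P False] B(3) C(3) D(3) by metis
          have "A \<subseteq> Q.pow (3 * n + 1)" using other le by blast
          then have "A \<subseteq> Q.pow (3 * n + 3)" using ideal.prems Q unfolding cubic_outside_def by blast
          then show ?thesis using other by blast
        qed
      qed
      moreover have "A \<subset> D" using \<open>A \<subset> C\<close> D(2) by blast
      ultimately obtain I where I: "is_ideal I" "I \<noteq> {0}"
        "ideal_mult D (S_ints F S) = ideal_mult (ideal_mult I (ideal_mult I I)) (S_ints F S)"
        using ideal(3)[OF D(1)] by blast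
      have "ideal_mult A (S_ints F S) = ideal_mult P (ideal_mult P (ideal_mult P (ideal_mult D (S_ints F S))))"
        unfolding AD by (simp only: ideal_mult_assoc)
      also have "\<dots> = ideal_mult (ideal_mult (ideal_mult P I) (ideal_mult (ideal_mult P I) (ideal_mult P I))) (S_ints F S)"
        unfolding I(3) by (simp only: ideal_mult_assoc ideal_mult_left_commute[of I P])
      finally show ?thesis
        using is_ideal_mult[OF P.Q_ideal I(1)] ideal_mult_nonzero[OF P.Q_ideal I(1) P.Q_nonzero I(2)] by blast
    qed
  qed
qed

lemma cube_class_cube:
  assumes "x \<in> F" "d \<in> F" "d \<noteq> 0"
  shows "cube_class F (x * d ^ 3) = cube_class F x"
proof -
  have "cube_class F (x * d ^ 3) \<subseteq> cube_class F x" if "d \<in> F" "d \<noteq> 0" for x d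
  proof
    fix y assume "y \<in> cube_class F (x * d ^ 3)"
    then obtain c where c: "c \<in> F" "c \<noteq> 0" "y = x * d ^ 3 * c ^ 3" by (auto simp: cube_class_def)
    then have "y = x * (d * c) ^ 3" by (simp add: power_mult_distrib)
    then show "y \<in> cube_class F x" using c that unfolding cube_class_def
      by (intro CollectI exI[of _ "d * c"]) auto
  qed
  from this[of d x] this[of "inverse d" "x * d ^ 3"] show ?thesis
    using assms by (auto simp: power_inverse mult.assoc inverse_mem)
qed

text \<open>The form in which the target groups are reached: valuations divisible by three outside
  \<open>S\<close> suffice. An ideal \<open>I\<close> whose cube agrees with the principal ideal
  over the \<open>S\<close>-integers is extended to the \<open>S\<close>-integers, where it remains
  integral.\<close>

lemma N_groupI:
  assumes x: "x \<in> F" "x \<noteq> 0" and val: "\<And>Q. Q \<in> fin_primes F - S \<Longrightarrow> 3 dvd val F Q x"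
  shows "cube_class F x \<in> N_group F S"
proof -
  let ?S = "S_ints F S"
  obtain d :: int where d: "d \<noteq> 0" "of_int d * x \<in> \<O>" using ints_denominator[OF x(1)] .
  \<comment> \<open>Multiplying by the cube of a denominator makes \<open>x\<close> integral without
    changing its class modulo cubes or its valuations modulo three.\<close>
  define y where "y = x * of_int d ^ 3"
  have "y = of_int (d ^ 2) * (of_int d * x)"
    by (simp add: y_def power3_eq_cube power2_eq_square mult_ac)
  then have yO: "y \<in> \<O>" using d(2) by (metis ints_mult ints_of_int)
  have y0: "y \<noteq> 0" using x d by (simp add: y_def)
  let ?A = "(*) y ` \<O>"
  have A: "is_ideal ?A" by (rule is_ideal_principal[OF yO])
  have yA: "y \<in> ?A" by (rule image_eqI[of _ _ 1]) auto
  have "cubic_outside S ?A" unfolding cubic_outside_def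
  proof (intro ballI allI impI)
    fix Q n assume Q: "Q \<in> fin_primes F - S" and le: "?A \<subseteq> ideal_pow \<O> Q (3 * n + 1)"
    then interpret Q: prime_ideal F Q using prime_idealI by blast
    have "val F Q y = val F Q x + 3 * val F Q (of_int d)"
      unfolding y_def using x d(1) by (simp add: Q.val_mult Q.val_power power_mem)
    then have "3 dvd val F Q y" using val[OF Q] by simp
    moreover have "int (3 * n + 1) \<le> val F Q y"
      using Q.pow_iff_val[OF yO y0] le yA by blast
    ultimately have "int (3 * n + 3) \<le> val F Q y" by presburger
    then have "y \<in> Q.pow (3 * n + 3)" using Q.pow_iff_val[OF yO y0] by blast
    then show "?A \<subseteq> Q.pow (3 * n + 3)" using ideal_scale'[OF Q.pow_ideal] by blast
  qed
  then obtain I where I: "is_ideal I" "I \<noteq> {0}"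
    "ideal_mult ?A ?S = ideal_mult (ideal_mult I (ideal_mult I I)) ?S"
    using cubic_outside_cube[OF A] yA y0 by blast
  let ?J = "ideal_mult I ?S"
  have JS: "?J \<subseteq> ?S"
    using ideal_mult_mono[OF _ order_refl, of I ?S ?S] ideal_ints[OF I(1)] ints_subset_S_ints
    by (force simp: S_ints_square)
  have "(\<lambda>z. y * z) ` ?S = ideal_mult ?A ?S"
  proof
    show "(\<lambda>z. y * z) ` ?S \<subseteq> ideal_mult ?A ?S" using ideal_mult_prod[OF yA] by blast
    show "ideal_mult ?A ?S \<subseteq> (\<lambda>z. y * z) ` ?S"
    proof (rule ideal_mult_subset)
      show "0 \<in> (\<lambda>z. y * z) ` ?S" using S_ints_zero by force
      fix u v
      { assume "u \<in> (\<lambda>z. y * z) ` ?S" "v \<in> (\<lambda>z. y * z) ` ?S"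
        then obtain b c where "b \<in> ?S" "c \<in> ?S" "u = y * b" "v = y * c" by blast
        then show "u + v \<in> (\<lambda>z. y * z) ` ?S"
          by (intro image_eqI[of _ _ "b + c"]) (auto simp: distrib_left S_ints_add) }
      { assume "u \<in> ?A" "v \<in> ?S"
        then obtain b where "b \<in> \<O>" "u = y * b" by blast
        then show "u * v \<in> (\<lambda>z. y * z) ` ?S"
          using \<open>v \<in> ?S\<close> ints_subset_S_ints
          by (intro image_eqI[of _ _ "b * v"]) (auto simp: mult.assoc intro!: S_ints_mult) }
    qed
  qed
  also have "\<dots> = ideal_pow ?S ?J 3"
  proof -
    have "ideal_pow ?S ?J 3 = ideal_mult ?J (ideal_mult ?J (ideal_mult ?J ?S))"
      by (simp add: numeral_3_eq_3)
    also have "ideal_mult ?J ?S = ideal_mult I ?S" by (simp add: ideal_mult_assoc S_ints_square)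
    also have "ideal_mult ?J (ideal_mult I ?S) = ideal_mult I (ideal_mult I ?S)"
      by (simp only: ideal_mult_assoc ideal_mult_left_commute[of ?S I] S_ints_square)
    also have "ideal_mult ?J (ideal_mult I (ideal_mult I ?S)) = ideal_mult I (ideal_mult I (ideal_mult I ?S))"
      by (simp only: ideal_mult_assoc ideal_mult_left_commute[of ?S I] S_ints_square)
    finally show ?thesis using I(3) by (simp add: ideal_mult_assoc)
  qed
  finally have eq: "(\<lambda>z. y * z) ` ?S = ideal_pow ?S ?J 3" .
  have "fractional_ideal F ?S ?J" unfolding fractional_ideal_def
  proof (intro conjI ballI)
    show "?J \<subseteq> F" using JS by (auto simp: S_ints_def)
    obtain i where i: "i \<in> I" "i \<noteq> 0" using nonzero_ideal_elt[OF I(1,2)] by blast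
    have "i \<in> ?J" using ideal_mult_prod[OF i(1) S_ints_one] by simp
    then show "?J \<noteq> {0}" using i(2) by blast
    show "\<exists>d\<in>?S - {0}. \<forall>x\<in>?J. d * x \<in> ?S" using JS S_ints_one by (intro bexI[of _ 1]) auto
    fix u v assume "u \<in> ?S" "v \<in> ?J"
    then have "u * v \<in> ideal_mult ?S ?J" by (rule ideal_mult_prod)
    also have "ideal_mult ?S ?J = ?J" by (simp only: ideal_mult_left_commute[of ?S I] S_ints_square)
    finally show "u * v \<in> ?J" .
  qed (auto intro: ideal_mult_zero ideal_mult_add)
  then have "cube_class F y \<in> N_group F S"
    unfolding N_group_def using yO y0 eq by blast
  also have "cube_class F y = cube_class F x"
    unfolding y_def by (rule cube_class_cube) (use x d in auto)
  finally show ?thesis .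
qed

end


section \<open>Completions\<close>

context prime_ideal
begin

abbreviation CR where "CR \<equiv> cauchy_ring F Q"
abbreviation NS where "NS \<equiv> null_seqs F Q"
abbreviation Kq where "Kq \<equiv> completion F Q"

definition cls :: "(nat \<Rightarrow> complex) \<Rightarrow> (nat \<Rightarrow> complex) set" where
  "cls s = NS +>\<^bsub>CR\<^esub> s"

lemma CR_simps [simp]:
  "s \<otimes>\<^bsub>CR\<^esub> t = (\<lambda>n. s n * t n)" "s \<oplus>\<^bsub>CR\<^esub> t = (\<lambda>n. s n + t n)"
  "\<zero>\<^bsub>CR\<^esub> = (\<lambda>_. 0)" "\<one>\<^bsub>CR\<^esub> = (\<lambda>_. 1)"
  by (simp_all add: cauchy_ring_def)

lemma CR_iff:
  "s \<in> carrier CR \<longleftrightarrow> (\<forall>n. s n \<in> F) \<and> (\<forall>N. \<exists>M. \<forall>i\<ge>M. \<forall>j\<ge>M. val_ge F Q (s i - s j) N)"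
  by (auto simp: cauchy_ring_def)

lemma CR_mem: "s \<in> carrier CR \<Longrightarrow> s n \<in> F"
  by (simp add: CR_iff)

lemma CR_cauchy:
  assumes "s \<in> carrier CR"
  shows "\<exists>M. \<forall>i\<ge>M. \<forall>j\<ge>M. val_ge F Q (s i - s j) N"
  using assms unfolding CR_iff by blast

lemma NS_iff: "s \<in> NS \<longleftrightarrow> s \<in> carrier CR \<and> (\<forall>N. \<exists>M. \<forall>i\<ge>M. val_ge F Q (s i) N)"
  by (simp add: null_seqs_def)

lemma CR_const: "x \<in> F \<Longrightarrow> (\<lambda>_. x) \<in> carrier CR"
  by (simp add: CR_iff)

lemma CR_add:
  assumes s: "s \<in> carrier CR" and t: "t \<in> carrier CR"
  shows "(\<lambda>n. s n + t n) \<in> carrier CR"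
  unfolding CR_iff
proof (intro conjI allI)
  show "s n + t n \<in> F" for n using CR_mem[OF s] CR_mem[OF t] by auto
  fix N
  obtain M1 where M1: "\<And>i j. i \<ge> M1 \<Longrightarrow> j \<ge> M1 \<Longrightarrow> val_ge F Q (s i - s j) N" using CR_cauchy[OF s] by blast
  obtain M2 where M2: "\<And>i j. i \<ge> M2 \<Longrightarrow> j \<ge> M2 \<Longrightarrow> val_ge F Q (t i - t j) N" using CR_cauchy[OF t] by blast
  show "\<exists>M. \<forall>i\<ge>M. \<forall>j\<ge>M. val_ge F Q (s i + t i - (s j + t j)) N"
  proof (intro exI[of _ "max M1 M2"] allI impI)
    fix i j assume ij: "max M1 M2 \<le> i" "max M1 M2 \<le> j"
    have "val_ge F Q ((s i - s j) + (t i - t j)) N"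
      by (intro val_ge_add M1 M2 diff_mem CR_mem[OF s] CR_mem[OF t]) (use ij in auto)
    then show "val_ge F Q (s i + t i - (s j + t j)) N" by (simp add: algebra_simps)
  qed
qed

lemma CR_uminus:
  assumes s: "s \<in> carrier CR"
  shows "(\<lambda>n. - s n) \<in> carrier CR"
  unfolding CR_iff
proof (intro conjI allI)
  show "- s n \<in> F" for n using CR_mem[OF s] by auto
  fix N
  obtain M where M: "\<And>i j. i \<ge> M \<Longrightarrow> j \<ge> M \<Longrightarrow> val_ge F Q (s i - s j) N" using CR_cauchy[OF s] by blast
  show "\<exists>M. \<forall>i\<ge>M. \<forall>j\<ge>M. val_ge F Q (- s i - - s j) N"
  proof (intro exI[of _ M] allI impI)
    fix i j assume "M \<le> i" "M \<le> j"
    then show "val_ge F Q (- s i - - s j) N" using M[of j i] by simp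
  qed
qed

lemma CR_bounded:
  assumes s: "s \<in> carrier CR"
  obtains B M where "\<And>i. i \<ge> M \<Longrightarrow> val_ge F Q (s i) B"
proof -
  obtain M where M: "\<And>i j. i \<ge> M \<Longrightarrow> j \<ge> M \<Longrightarrow> val_ge F Q (s i - s j) 0" using CR_cauchy[OF s] by blast
  show thesis
  proof (rule that[of M "min 0 (val F Q (s M))"])
    fix i assume i: "M \<le> i"
    have "val_ge F Q ((s i - s M) + s M) (min 0 (val F Q (s M)))"
      by (rule val_ge_add)
        (use CR_mem[OF s] val_ge_mono[OF M[OF i order_refl]] in \<open>auto simp: val_ge_def\<close>)
    then show "val_ge F Q (s i) (min 0 (val F Q (s M)))" by simp
  qed
qed

lemma CR_mult:
  assumes s: "s \<in> carrier CR" and t: "t \<in> carrier CR"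
  shows "(\<lambda>n. s n * t n) \<in> carrier CR"
  unfolding CR_iff
proof (intro conjI allI)
  show "s n * t n \<in> F" for n using CR_mem[OF s] CR_mem[OF t] by auto
  fix N
  obtain B1 K1 where B1: "\<And>i. i \<ge> K1 \<Longrightarrow> val_ge F Q (s i) B1" using CR_bounded[OF s] by blast
  obtain B2 K2 where B2: "\<And>i. i \<ge> K2 \<Longrightarrow> val_ge F Q (t i) B2" using CR_bounded[OF t] by blast
  obtain M1 where M1: "\<And>i j. i \<ge> M1 \<Longrightarrow> j \<ge> M1 \<Longrightarrow> val_ge F Q (s i - s j) (N - B2)" using CR_cauchy[OF s] by blast
  obtain M2 where M2: "\<And>i j. i \<ge> M2 \<Longrightarrow> j \<ge> M2 \<Longrightarrow> val_ge F Q (t i - t j) (N - B1)" using CR_cauchy[OF t] by blast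
  show "\<exists>M. \<forall>i\<ge>M. \<forall>j\<ge>M. val_ge F Q (s i * t i - s j * t j) N"
  proof (intro exI[of _ "max (max K1 K2) (max M1 M2)"] allI impI)
    fix i j assume ij: "max (max K1 K2) (max M1 M2) \<le> i" "max (max K1 K2) (max M1 M2) \<le> j"
    have "val_ge F Q (s i * (t i - t j)) (B1 + (N - B1))"
      by (intro val_ge_mult B1 M2 diff_mem CR_mem[OF s] CR_mem[OF t]) (use ij in auto)
    moreover have "val_ge F Q ((s i - s j) * t j) ((N - B2) + B2)"
      by (intro val_ge_mult B2 M1 diff_mem CR_mem[OF s] CR_mem[OF t]) (use ij in auto)
    ultimately have "val_ge F Q (s i * (t i - t j) + (s i - s j) * t j) N"
      by (intro val_ge_add mult_mem diff_mem CR_mem[OF s] CR_mem[OF t]) auto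
    then show "val_ge F Q (s i * t i - s j * t j) N" by (simp add: algebra_simps)
  qed
qed

lemma CR_cring: "cring CR"
proof (intro cringI abelian_groupI comm_monoidI)
  fix s assume s: "s \<in> carrier CR"
  show "\<exists>t\<in>carrier CR. t \<oplus>\<^bsub>CR\<^esub> s = \<zero>\<^bsub>CR\<^esub>"
    by (rule bexI[of _ "\<lambda>n. - s n"]) (use CR_uminus[OF s] in auto)
qed (auto simp: CR_add CR_mult CR_const algebra_simps)

sublocale CR: cring CR by (rule CR_cring)

lemma CR_minus: "s \<in> carrier CR \<Longrightarrow> \<ominus>\<^bsub>CR\<^esub> s = (\<lambda>n. - s n)"
  by (rule CR.minus_equality) (auto simp: CR_uminus)

lemma CR_diff: "s \<in> carrier CR \<Longrightarrow> t \<in> carrier CR \<Longrightarrow> s \<ominus>\<^bsub>CR\<^esub> t = (\<lambda>n. s n - t n)"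
  by (simp add: a_minus_def CR_minus)

lemma NS_ideal: "ideal NS CR"
proof (intro idealI CR.ring_axioms)
  have l: "(\<lambda>n. s n * t n) \<in> NS" if s: "s \<in> NS" and t: "t \<in> carrier CR" for s t
  proof -
    have sR: "s \<in> carrier CR" using s by (simp add: NS_iff)
    have "\<exists>M. \<forall>i\<ge>M. val_ge F Q (s i * t i) N" for N
    proof -
      obtain B K where B: "\<And>i. i \<ge> K \<Longrightarrow> val_ge F Q (t i) B" using CR_bounded[OF t] by blast
      obtain M where M: "\<And>i. i \<ge> M \<Longrightarrow> val_ge F Q (s i) (N - B)" using s unfolding NS_iff by blast
      show ?thesis
      proof (intro exI[of _ "max K M"] allI impI)
        fix i assume i: "max K M \<le> i"
        have "val_ge F Q (s i * t i) ((N - B) + B)"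
          by (intro val_ge_mult B M CR_mem[OF sR] CR_mem[OF t]) (use i in auto)
        then show "val_ge F Q (s i * t i) N" by simp
      qed
    qed
    then show ?thesis using CR_mult[OF sR t] by (simp add: NS_iff)
  qed
  show "s \<otimes>\<^bsub>CR\<^esub> t \<in> NS" if "s \<in> NS" "t \<in> carrier CR" for s t using l[OF that] by simp
  show "t \<otimes>\<^bsub>CR\<^esub> s \<in> NS" if "s \<in> NS" "t \<in> carrier CR" for s t using l[OF that] by (simp add: mult.commute)
  show "subgroup NS (add_monoid CR)"
  proof
    show "NS \<subseteq> carrier (add_monoid CR)" by (auto simp: NS_iff)
    show "\<one>\<^bsub>add_monoid CR\<^esub> \<in> NS" using CR_const[of 0] by (simp add: NS_iff)
    fix s assume s: "s \<in> NS"
    then have sR: "s \<in> carrier CR" by (simp add: NS_iff)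
    have "(\<lambda>n. s n * - 1) \<in> NS" using l[OF s CR_const[of "- 1"]] uminus_mem[OF one_mem] by simp
    then show "inv\<^bsub>add_monoid CR\<^esub> s \<in> NS" using CR_minus[OF sR] by (simp add: a_inv_def)
    fix t assume t: "t \<in> NS"
    then have tR: "t \<in> carrier CR" by (simp add: NS_iff)
    have "\<exists>M. \<forall>i\<ge>M. val_ge F Q (s i + t i) N" for N
    proof -
      obtain M1 where M1: "\<And>i. i \<ge> M1 \<Longrightarrow> val_ge F Q (s i) N" using s unfolding NS_iff by blast
      obtain M2 where M2: "\<And>i. i \<ge> M2 \<Longrightarrow> val_ge F Q (t i) N" using t unfolding NS_iff by blast
      show ?thesis
        by (intro exI[of _ "max M1 M2"] allI impI val_ge_add CR_mem[OF sR] CR_mem[OF tR] M1 M2) auto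
    qed
    then show "s \<otimes>\<^bsub>add_monoid CR\<^esub> t \<in> NS" using CR_add[OF sR tR] by (simp add: NS_iff)
  qed
qed

sublocale NS: ideal NS CR by (rule NS_ideal)

text \<open>Some late term has valuation below \<open>N\<close>, while the differences of late terms
  have valuation at least \<open>N\<close>; hence all late terms share that valuation.\<close>

lemma nonnull_eventually:
  assumes s: "s \<in> carrier CR" "s \<notin> NS"
  shows "\<exists>k M. \<forall>i\<ge>M. s i \<noteq> 0 \<and> val F Q (s i) = k"
proof -
  obtain N where N: "\<And>M. \<exists>i\<ge>M. \<not> val_ge F Q (s i) N" using s unfolding NS_iff by blast
  obtain M where M: "\<And>i j. i \<ge> M \<Longrightarrow> j \<ge> M \<Longrightarrow> val_ge F Q (s i - s j) N" using CR_cauchy[OF s(1)] by blast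
  obtain i where i: "i \<ge> M" "\<not> val_ge F Q (s i) N" using N by blast
  then have si: "s i \<noteq> 0" "val F Q (s i) + 1 \<le> N" by (auto simp: val_ge_def)
  show ?thesis
  proof (intro exI[of _ "val F Q (s i)"] exI[of _ M] allI impI)
    fix j assume "M \<le> j"
    then have "val_ge F Q (s i - s j) (val F Q (s i) + 1)" using val_ge_mono[OF M[OF i(1)] si(2)] by simp
    then show "s j \<noteq> 0 \<and> val F Q (s j) = val F Q (s i)"
      using val_close[OF CR_mem[OF s(1)] si(1) CR_mem[OF s(1)]] by (intro conjI)
  qed
qed

lemma not_null_of_val:
  assumes "\<And>i. i \<ge> M \<Longrightarrow> s i \<noteq> 0 \<and> val F Q (s i) = k"
  shows "s \<notin> NS"
proof
  assume "s \<in> NS"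
  then obtain M' where "\<And>i. i \<ge> M' \<Longrightarrow> val_ge F Q (s i) (k + 1)" unfolding NS_iff by blast
  from this[of "max M M'"] assms[of "max M M'"] show False by (simp add: val_ge_def)
qed

lemma CR_inverse:
  assumes s: "s \<in> carrier CR" "s \<notin> NS"
  shows "(\<lambda>n. inverse (s n)) \<in> carrier CR" "(\<lambda>n. s n * inverse (s n) - 1) \<in> NS"
proof -
  obtain k K where k: "\<And>i. i \<ge> K \<Longrightarrow> s i \<noteq> 0 \<and> val F Q (s i) = k" using nonnull_eventually[OF s] by blast
  show t: "(\<lambda>n. inverse (s n)) \<in> carrier CR" unfolding CR_iff
  proof (intro conjI allI)
    show "inverse (s n) \<in> F" for n using CR_mem[OF s(1)] by auto
    fix N
    \<comment> \<open>The difference of the inverses is \<open>(s j - s i) / (s i * s j)\<close>,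
      which costs \<open>2 * k\<close>. Early terms may vanish; their inverse is 0 and does not
      affect the tail.\<close>
    obtain M where M: "\<And>i j. i \<ge> M \<Longrightarrow> j \<ge> M \<Longrightarrow> val_ge F Q (s i - s j) (N + 2 * k)" using CR_cauchy[OF s(1)] by blast
    show "\<exists>M. \<forall>i\<ge>M. \<forall>j\<ge>M. val_ge F Q (inverse (s i) - inverse (s j)) N"
    proof (intro exI[of _ "max K M"] allI impI)
      fix i j assume ij: "max K M \<le> i" "max K M \<le> j"
      have v: "val_ge F Q (inverse (s l)) (- k)" if "l \<ge> max K M" for l
        using k[of l] that val_inverse[OF CR_mem[OF s(1)], of l] by (simp add: val_ge_def)
      have "val_ge F Q ((s j - s i) * (inverse (s i) * inverse (s j))) ((N + 2 * k) + (- k + - k))"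
        by (intro val_ge_mult v M ij mult_mem inverse_mem diff_mem CR_mem[OF s(1)]) (use ij in auto)
      also have "(s j - s i) * (inverse (s i) * inverse (s j)) = inverse (s i) - inverse (s j)"
        using k[of i] k[of j] ij by (simp add: field_simps)
      finally show "val_ge F Q (inverse (s i) - inverse (s j)) N" by simp
    qed
  qed
  have "(\<lambda>n. s n * inverse (s n) + - 1) \<in> carrier CR"
    by (intro CR_add CR_mult s t CR_const uminus_mem) simp
  then show "(\<lambda>n. s n * inverse (s n) - 1) \<in> NS"
    unfolding NS_iff using k by (auto intro!: exI[of _ K])
qed

lemma NS_maximal: "maximalideal NS CR"
proof (rule maximalidealI[OF NS_ideal])
  have one: "(\<lambda>_. 1) \<notin> NS" by (rule not_null_of_val[of 0 _ 0]) simp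
  have oneR: "(\<lambda>_. 1) \<in> carrier CR" by (rule CR_const) simp
  show "carrier CR \<noteq> NS" using one oneR by blast
  fix J assume J: "ideal J CR" "NS \<subseteq> J" "J \<subseteq> carrier CR"
  interpret J: ideal J CR by fact
  show "J = NS \<or> J = carrier CR"
  proof (cases "J = NS")
    case False
    then obtain s where s: "s \<in> J" "s \<notin> NS" using J(2) by blast
    then have sR: "s \<in> carrier CR" using J(3) by blast
    have "s \<otimes>\<^bsub>CR\<^esub> (\<lambda>n. inverse (s n)) \<in> J" by (rule J.I_r_closed[OF s(1) CR_inverse(1)[OF sR s(2)]])
    moreover have "(\<lambda>n. s n * inverse (s n) - 1) \<in> J" using CR_inverse(2)[OF sR s(2)] J(2) by blast
    ultimately have "s \<otimes>\<^bsub>CR\<^esub> (\<lambda>n. inverse (s n)) \<oplus>\<^bsub>CR\<^esub> (\<ominus>\<^bsub>CR\<^esub> (\<lambda>n. s n * inverse (s n) - 1)) \<in> J"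
      by (intro J.a_closed J.a_inv_closed)
    moreover have "s \<otimes>\<^bsub>CR\<^esub> (\<lambda>n. inverse (s n)) \<oplus>\<^bsub>CR\<^esub> (\<ominus>\<^bsub>CR\<^esub> (\<lambda>n. s n * inverse (s n) - 1)) = \<one>\<^bsub>CR\<^esub>"
      using CR_inverse(2)[OF sR s(2)] by (subst CR_minus) (auto simp: NS_iff)
    ultimately show ?thesis using J.one_imp_carrier by simp
  qed simp
qed

lemma completion_field: "field Kq"
  unfolding completion_def using maximalideal.quotient_is_field[OF NS_maximal CR_cring] .

sublocale Kq: field Kq by (rule completion_field)

lemma cls_hom: "ring_hom_ring CR Kq cls"
  unfolding completion_def cls_def[abs_def] by (rule NS.rcos_ring_hom_ring)

sublocale cls: ring_hom_ring CR Kq cls by (rule cls_hom)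

lemma cls_mem: "s \<in> carrier CR \<Longrightarrow> cls s \<in> carrier Kq"
  by (rule cls.hom_closed)

lemma cls_add: "s \<in> carrier CR \<Longrightarrow> t \<in> carrier CR \<Longrightarrow> cls s \<oplus>\<^bsub>Kq\<^esub> cls t = cls (\<lambda>n. s n + t n)"
  using cls.hom_add[of s t] by simp

lemma cls_mult: "s \<in> carrier CR \<Longrightarrow> t \<in> carrier CR \<Longrightarrow> cls s \<otimes>\<^bsub>Kq\<^esub> cls t = cls (\<lambda>n. s n * t n)"
  using cls.hom_mult[of s t] by simp

lemma cls_zero: "cls (\<lambda>_. 0) = \<zero>\<^bsub>Kq\<^esub>"
  using cls.hom_zero by simp

lemma cls_eq_iff:
  assumes "s \<in> carrier CR" "t \<in> carrier CR"
  shows "cls s = cls t \<longleftrightarrow> (\<lambda>n. s n - t n) \<in> NS"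
  using CR.quotient_eq_iff_same_a_r_cos[OF NS_ideal assms] CR_diff[OF assms] by (simp add: cls_def)

lemma cls_eq_zero_iff: "s \<in> carrier CR \<Longrightarrow> cls s = \<zero>\<^bsub>Kq\<^esub> \<longleftrightarrow> s \<in> NS"
  using cls_eq_iff[of s "\<lambda>_. 0"] CR_const[of 0] cls_zero by simp

lemma cls_surj:
  assumes "c \<in> carrier Kq"
  obtains s where "s \<in> carrier CR" "c = cls s"
  using assms unfolding completion_def FactRing_def A_RCOSETS_def' cls_def by auto

lemma to_completion_eq: "to_completion F Q x = cls (\<lambda>_. x)"
  by (simp add: to_completion_def cls_def)

text \<open>The extension of the valuation to the completion, as the eventual valuation of a
  representing sequence. It has no meaning at zero, whence the nonvanishing hypotheses
  below.\<close>

definition lval :: "(nat \<Rightarrow> complex) set \<Rightarrow> int" where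
  "lval c = (THE k. \<exists>s\<in>carrier CR. c = cls s \<and> (\<exists>M. \<forall>i\<ge>M. s i \<noteq> 0 \<and> val F Q (s i) = k))"

lemma lval_cls:
  assumes s: "s \<in> carrier CR" and k: "\<And>i. i \<ge> M \<Longrightarrow> s i \<noteq> 0 \<and> val F Q (s i) = k"
  shows "lval (cls s) = k"
  unfolding lval_def
proof (rule the_equality)
  show "\<exists>t\<in>carrier CR. cls s = cls t \<and> (\<exists>M. \<forall>i\<ge>M. t i \<noteq> 0 \<and> val F Q (t i) = k)" using assms by blast
  fix l assume "\<exists>t\<in>carrier CR. cls s = cls t \<and> (\<exists>M. \<forall>i\<ge>M. t i \<noteq> 0 \<and> val F Q (t i) = l)"
  then obtain t M' where t: "t \<in> carrier CR" "cls s = cls t" "\<And>i. i \<ge> M' \<Longrightarrow> t i \<noteq> 0 \<and> val F Q (t i) = l"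
    by blast
  have "(\<lambda>n. s n - t n) \<in> NS" using cls_eq_iff[OF s t(1)] t(2) by simp
  then obtain M'' where M'': "\<And>i. i \<ge> M'' \<Longrightarrow> val_ge F Q (s i - t i) (k + 1)" unfolding NS_iff by blast
  let ?i = "max M (max M' M'')"
  have "val F Q (t ?i) = val F Q (s ?i)"
    using val_close(2)[OF CR_mem[OF s] _ CR_mem[OF t(1)], of ?i ?i] k[of ?i] M''[of ?i] by simp
  then show "l = k" using t(3)[of ?i] k[of ?i] by simp
qed

lemma cls_nonzero:
  assumes "s \<in> carrier CR" "cls s \<noteq> \<zero>\<^bsub>Kq\<^esub>"
  obtains M where "\<And>i. i \<ge> M \<Longrightarrow> s i \<noteq> 0 \<and> val F Q (s i) = lval (cls s)"
proof -
  have "s \<notin> NS" using assms cls_eq_zero_iff by blast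
  then obtain k M where k: "\<And>i. i \<ge> M \<Longrightarrow> s i \<noteq> 0 \<and> val F Q (s i) = k"
    using nonnull_eventually[OF assms(1)] by blast
  then have "lval (cls s) = k" by (rule lval_cls[OF assms(1)])
  then show thesis using that[of M] k by simp
qed

lemma lval_mult:
  assumes c: "c \<in> carrier Kq" "c \<noteq> \<zero>\<^bsub>Kq\<^esub>" and d: "d \<in> carrier Kq" "d \<noteq> \<zero>\<^bsub>Kq\<^esub>"
  shows "lval (c \<otimes>\<^bsub>Kq\<^esub> d) = lval c + lval d"
proof -
  obtain s where s: "s \<in> carrier CR" "c = cls s" using cls_surj[OF c(1)] .
  obtain t where t: "t \<in> carrier CR" "d = cls t" using cls_surj[OF d(1)] .
  obtain M1 where M1: "\<And>i. i \<ge> M1 \<Longrightarrow> s i \<noteq> 0 \<and> val F Q (s i) = lval c"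
    using cls_nonzero[OF s(1)] c(2) s(2) by blast
  obtain M2 where M2: "\<And>i. i \<ge> M2 \<Longrightarrow> t i \<noteq> 0 \<and> val F Q (t i) = lval d"
    using cls_nonzero[OF t(1)] d(2) t(2) by blast
  have "lval (cls (\<lambda>n. s n * t n)) = lval c + lval d"
  proof (rule lval_cls[OF CR_mult[OF s(1) t(1)]])
    fix i assume "max M1 M2 \<le> i"
    then have i: "s i \<noteq> 0" "val F Q (s i) = lval c" "t i \<noteq> 0" "val F Q (t i) = lval d"
      using M1[of i] M2[of i] by auto
    show "s i * t i \<noteq> 0 \<and> val F Q (s i * t i) = lval c + lval d"
      using i val_mult[OF CR_mem[OF s(1)] i(1) CR_mem[OF t(1)] i(3)] by simp
  qed
  then show ?thesis using s t by (simp add: cls_mult)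
qed

lemma lval_add_less:
  assumes c: "c \<in> carrier Kq" "c \<noteq> \<zero>\<^bsub>Kq\<^esub>" and d: "d \<in> carrier Kq" "d \<noteq> \<zero>\<^bsub>Kq\<^esub>" and "lval c < lval d"
  shows "lval (c \<oplus>\<^bsub>Kq\<^esub> d) = lval c"
proof -
  obtain s where s: "s \<in> carrier CR" "c = cls s" using cls_surj[OF c(1)] .
  obtain t where t: "t \<in> carrier CR" "d = cls t" using cls_surj[OF d(1)] .
  obtain M1 where M1: "\<And>i. i \<ge> M1 \<Longrightarrow> s i \<noteq> 0 \<and> val F Q (s i) = lval c"
    using cls_nonzero[OF s(1)] c(2) s(2) by blast
  obtain M2 where M2: "\<And>i. i \<ge> M2 \<Longrightarrow> t i \<noteq> 0 \<and> val F Q (t i) = lval d"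
    using cls_nonzero[OF t(1)] d(2) t(2) by blast
  have "lval (cls (\<lambda>n. s n + t n)) = lval c"
  proof (rule lval_cls[OF CR_add[OF s(1) t(1)]])
    fix i assume "max M1 M2 \<le> i"
    then have i: "s i \<noteq> 0" "val F Q (s i) = lval c" "t i \<noteq> 0" "val F Q (t i) = lval d"
      using M1[of i] M2[of i] by auto
    have "val_ge F Q (s i - (s i + t i)) (val F Q (s i) + 1)"
      using val_ge_uminus[OF CR_mem[OF t(1)], of i "val F Q (s i) + 1"] i assms(5) by (simp add: val_ge_def)
    then show "s i + t i \<noteq> 0 \<and> val F Q (s i + t i) = lval c"
      using val_close[OF CR_mem[OF s(1)] i(1), of "s i + t i"] CR_mem[OF s(1)] CR_mem[OF t(1)] i(2) by auto
  qed
  then show ?thesis using s t by (simp add: cls_add)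
qed

lemma lval_to_completion:
  assumes "x \<in> F" "x \<noteq> 0"
  shows "lval (to_completion F Q x) = val F Q x" "to_completion F Q x \<noteq> \<zero>\<^bsub>Kq\<^esub>"
proof -
  show "lval (to_completion F Q x) = val F Q x"
    unfolding to_completion_eq by (rule lval_cls[OF CR_const[OF assms(1)], of 0]) (use assms in simp)
  have "(\<lambda>_. x) \<notin> NS" by (rule not_null_of_val[of 0]) (use assms in simp)
  then show "to_completion F Q x \<noteq> \<zero>\<^bsub>Kq\<^esub>"
    unfolding to_completion_eq using cls_eq_zero_iff[OF CR_const[OF assms(1)]] by simp
qed

lemma to_completion_mem: "x \<in> F \<Longrightarrow> to_completion F Q x \<in> carrier Kq"
  unfolding to_completion_eq by (rule cls_mem[OF CR_const])

lemma to_completion_add: "x \<in> F \<Longrightarrow> y \<in> F \<Longrightarrow>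
    to_completion F Q (x + y) = to_completion F Q x \<oplus>\<^bsub>Kq\<^esub> to_completion F Q y"
  and to_completion_mult: "x \<in> F \<Longrightarrow> y \<in> F \<Longrightarrow>
    to_completion F Q (x * y) = to_completion F Q x \<otimes>\<^bsub>Kq\<^esub> to_completion F Q y"
  unfolding to_completion_eq by (simp_all add: cls_add cls_mult CR_const)

lemma to_completion_zero: "to_completion F Q 0 = \<zero>\<^bsub>Kq\<^esub>"
  unfolding to_completion_eq by (rule cls_zero)

lemma lval_cube:
  assumes "c \<in> carrier Kq" "c \<noteq> \<zero>\<^bsub>Kq\<^esub>"
  shows "lval (c \<otimes>\<^bsub>Kq\<^esub> (c \<otimes>\<^bsub>Kq\<^esub> c)) = 3 * lval c"
  using assms by (simp add: lval_mult Kq.integral_iff)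

text \<open>If the product of two elements is a cube and the valuation of their difference is divisible by
  three, then so are their valuations: either they differ, and the smaller one is that of the
  difference or the two add up, or they agree and their double is divisible by three.\<close>

lemma dvd_lval_of_product_cube:
  assumes A: "A \<in> carrier Kq" "A \<noteq> \<zero>\<^bsub>Kq\<^esub>" and T: "T \<in> carrier Kq" "T \<noteq> \<zero>\<^bsub>Kq\<^esub>" "3 dvd lval T"
    and B: "A \<oplus>\<^bsub>Kq\<^esub> T \<noteq> \<zero>\<^bsub>Kq\<^esub>"
    and c: "c \<in> carrier Kq" "A \<otimes>\<^bsub>Kq\<^esub> (A \<oplus>\<^bsub>Kq\<^esub> T) = c \<otimes>\<^bsub>Kq\<^esub> (c \<otimes>\<^bsub>Kq\<^esub> c)"
  shows "3 dvd lval A"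
proof -
  have BK: "A \<oplus>\<^bsub>Kq\<^esub> T \<in> carrier Kq" using A T by simp
  have "A \<otimes>\<^bsub>Kq\<^esub> (A \<oplus>\<^bsub>Kq\<^esub> T) \<noteq> \<zero>\<^bsub>Kq\<^esub>" using A B BK Kq.integral_iff by simp
  then have "c \<noteq> \<zero>\<^bsub>Kq\<^esub>" unfolding c(2) using Kq.l_null[of "\<zero>\<^bsub>Kq\<^esub>"] by (metis Kq.zero_closed)
  then have sum: "lval A + lval (A \<oplus>\<^bsub>Kq\<^esub> T) = 3 * lval c"
    using lval_mult[OF A BK B] lval_cube[OF c(1)] c(2) by simp
  consider "lval A < lval T" | "lval A = lval T" | "lval T < lval A" by linarith
  then show ?thesis
  proof cases
    case 1
    then have "2 * lval A = 3 * lval c" using sum lval_add_less[OF A T(1,2)] by simp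
    then show ?thesis by presburger
  next
    case 2
    then show ?thesis using T(3) by simp
  next
    case 3
    then have "lval (A \<oplus>\<^bsub>Kq\<^esub> T) = lval T" using lval_add_less[OF T(1,2) A] A T by (simp add: Kq.a_comm)
    then show ?thesis using sum T(3) by presburger
  qed
qed

end


section \<open>Galois theory of cube roots\<close>

text \<open>Evaluation of a list of coefficients, constant coefficient first (the library's evaluation of
  polynomials starts with the leading coefficient).\<close>

primrec (in ring) horner :: "'a list \<Rightarrow> 'a \<Rightarrow> 'a" where
  "horner [] b = \<zero>"
| "horner (c # p) b = c \<oplus> b \<otimes> horner p b"

context cring
begin

lemma horner_closed: "set p \<subseteq> carrier R \<Longrightarrow> b \<in> carrier R \<Longrightarrow> horner p b \<in> carrier R"
  by (induction p) auto

lemma horner_append: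
  "set p \<subseteq> carrier R \<Longrightarrow> set q \<subseteq> carrier R \<Longrightarrow> b \<in> carrier R \<Longrightarrow>
    horner (p @ q) b = horner p b \<oplus> b [^] length p \<otimes> horner q b"
proof (induction p)
  case (Cons c p)
  let ?q = "horner q b" and ?p = "horner p b" and ?b = "b [^] length p"
  have cl: "?q \<in> carrier R" "?p \<in> carrier R" "?b \<in> carrier R" "c \<in> carrier R" "b \<in> carrier R"
    using Cons.prems by (auto intro: horner_closed)
  have "horner ((c # p) @ q) b = c \<oplus> b \<otimes> (?p \<oplus> ?b \<otimes> ?q)" using Cons by simp
  also have "\<dots> = (c \<oplus> b \<otimes> ?p) \<oplus> (b \<otimes> ?b) \<otimes> ?q" using cl by algebra
  also have "b \<otimes> ?b = b [^] length (c # p)" using cl by (simp add: m_comm)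
  finally show ?case by simp
qed (simp add: horner_closed)

lemma horner_scale:
  "set p \<subseteq> carrier R \<Longrightarrow> d \<in> carrier R \<Longrightarrow> b \<in> carrier R \<Longrightarrow>
    horner (map ((\<otimes>) d) p) b = d \<otimes> horner p b"
proof (induction p)
  case (Cons c p)
  let ?p = "horner p b"
  have cl: "?p \<in> carrier R" "c \<in> carrier R" using Cons.prems by (auto intro: horner_closed)
  have "horner (map ((\<otimes>) d) (c # p)) b = d \<otimes> c \<oplus> b \<otimes> (d \<otimes> ?p)" using Cons by simp
  also have "\<dots> = d \<otimes> (c \<oplus> b \<otimes> ?p)" using cl Cons.prems(2,3) by algebra
  finally show ?case by simp
qed simp

lemma horner_add:
  "length p = length q \<Longrightarrow> set p \<subseteq> carrier R \<Longrightarrow> set q \<subseteq> carrier R \<Longrightarrow> b \<in> carrier R \<Longrightarrow>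
    horner (map2 (\<oplus>) p q) b = horner p b \<oplus> horner q b"
proof (induction p q rule: list_induct2)
  case (Cons c p d q)
  let ?p = "horner p b" and ?q = "horner q b"
  have cl: "?p \<in> carrier R" "?q \<in> carrier R" "c \<in> carrier R" "d \<in> carrier R"
    using Cons.prems by (auto intro: horner_closed)
  have "horner (map2 (\<oplus>) (c # p) (d # q)) b = (c \<oplus> d) \<oplus> b \<otimes> (?p \<oplus> ?q)" using Cons by simp
  also have "\<dots> = (c \<oplus> b \<otimes> ?p) \<oplus> (d \<oplus> b \<otimes> ?q)" using cl Cons.prems(3) by algebra
  finally show ?case by simp
qed simp

lemma horner_replicate: "b \<in> carrier R \<Longrightarrow> horner (replicate n \<zero>) b = \<zero>"
  by (induction n) auto

lemma horner_mem:
  assumes "subring G R" "set p \<subseteq> G" "b \<in> G"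
  shows "horner p b \<in> G"
  using assms(2)
  by (induction p) (use assms(1,3) in \<open>auto intro: subringE(2) subringE(6) subringE(7)\<close>)

text \<open>The subring generated by \<open>G\<close> and \<open>b\<close>. Applied to a graph and a
  pair \<open>(b, b')\<close>, it is the graph obtained by also sending \<open>b\<close> to
  \<open>b'\<close>.\<close>

definition simple_ext :: "'a set \<Rightarrow> 'a \<Rightarrow> 'a set" where
  "simple_ext G b = {horner p b | p. set p \<subseteq> G}"

lemma simple_extI: "set p \<subseteq> G \<Longrightarrow> horner p b \<in> simple_ext G b"
  unfolding simple_ext_def by blast

lemma simple_extE:
  assumes "x \<in> simple_ext G b"
  obtains p where "set p \<subseteq> G" "x = horner p b"
  using assms unfolding simple_ext_def by blast

lemma simple_ext_base:
  assumes G: "subring G R" and b: "b \<in> carrier R"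
  shows "G \<subseteq> simple_ext G b" "b \<in> simple_ext G b" "simple_ext G b \<subseteq> carrier R"
proof -
  have GR: "G \<subseteq> carrier R" by (rule subringE(1)[OF G])
  show "G \<subseteq> simple_ext G b"
  proof
    fix g assume "g \<in> G"
    then show "g \<in> simple_ext G b" using simple_extI[of "[g]" G b] GR b by auto
  qed
  show "b \<in> simple_ext G b"
    using simple_extI[of "[\<zero>, \<one>]" G b] subringE(2,3)[OF G] b by simp
  show "simple_ext G b \<subseteq> carrier R"
    using GR b unfolding simple_ext_def by (auto intro: horner_closed)
qed

lemma simple_ext_add:
  assumes G: "subring G R" and b: "b \<in> carrier R" and x: "x \<in> simple_ext G b" and y: "y \<in> simple_ext G b"
  shows "x \<oplus> y \<in> simple_ext G b"
proof -
  have GR: "G \<subseteq> carrier R" by (rule subringE(1)[OF G])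
  obtain p where p: "set p \<subseteq> G" "x = horner p b" using x by (rule simple_extE)
  obtain q where q: "set q \<subseteq> G" "y = horner q b" using y by (rule simple_extE)
  have pad: "horner (u @ replicate k \<zero>) b = horner u b" if "set u \<subseteq> G" for u k
  proof -
    have "set u \<subseteq> carrier R" using that GR by blast
    moreover have "set (replicate k \<zero>) \<subseteq> carrier R" by (simp add: set_replicate_conv_if)
    ultimately show ?thesis using b by (simp add: horner_append horner_replicate horner_closed)
  qed
  let ?p = "p @ replicate (length q) \<zero>" and ?q = "q @ replicate (length p) \<zero>"
  have pq: "set ?p \<subseteq> G" "set ?q \<subseteq> G"
    using p q subringE(2)[OF G] by (auto simp: set_replicate_conv_if)
  have "horner (map2 (\<oplus>) ?p ?q) b = horner ?p b \<oplus> horner ?q b"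
    by (rule horner_add) (use pq GR b in auto)
  also have "\<dots> = x \<oplus> y" using pad p q by simp
  finally have "x \<oplus> y = horner (map2 (\<oplus>) ?p ?q) b" ..
  moreover have "set (map2 (\<oplus>) ?p ?q) \<subseteq> G"
  proof
    fix z assume "z \<in> set (map2 (\<oplus>) ?p ?q)"
    then obtain c d where "(c, d) \<in> set (zip ?p ?q)" "z = c \<oplus> d" by auto
    then show "z \<in> G" using pq subringE(7)[OF G] by (metis set_zip_leftD set_zip_rightD subsetD)
  qed
  ultimately show ?thesis by (metis simple_extI)
qed

lemma simple_ext_mult:
  assumes G: "subring G R" and b: "b \<in> carrier R" and x: "x \<in> simple_ext G b" and y: "y \<in> simple_ext G b"
  shows "x \<otimes> y \<in> simple_ext G b"
proof -
  have GR: "G \<subseteq> carrier R" by (rule subringE(1)[OF G])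
  obtain p where p: "set p \<subseteq> G" "x = horner p b" using x by (rule simple_extE)
  have scale: "g \<otimes> z \<in> simple_ext G b" if g: "g \<in> G" and z: "z \<in> simple_ext G b" for g z
  proof -
    obtain q where q: "set q \<subseteq> G" "z = horner q b" using z by (rule simple_extE)
    have "g \<otimes> z = horner (map ((\<otimes>) g) q) b"
      unfolding q(2) by (rule horner_scale[symmetric]) (use q g GR b in auto)
    moreover have "set (map ((\<otimes>) g) q) \<subseteq> G" using q(1) g subringE(6)[OF G] by auto
    ultimately show ?thesis by (metis simple_extI)
  qed
  have shift: "b \<otimes> z \<in> simple_ext G b" if z: "z \<in> simple_ext G b" for z
  proof -
    obtain q where q: "set q \<subseteq> G" "z = horner q b" using z by (rule simple_extE)
    have "horner q b \<in> carrier R" using q GR b by (intro horner_closed) auto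
    then have "b \<otimes> z = horner (\<zero> # q) b" using q b by simp
    moreover have "set (\<zero> # q) \<subseteq> G" using q subringE(2)[OF G] by simp
    ultimately show ?thesis by (metis simple_extI)
  qed
  have yR: "y \<in> carrier R" using y simple_ext_base(3)[OF G b] by blast
  have "horner p b \<otimes> y \<in> simple_ext G b" using p(1)
  proof (induction p)
    case Nil
    then show ?case using simple_extI[of "[]" G b] yR by simp
  next
    case (Cons c p)
    have cl: "horner p b \<in> carrier R" "c \<in> carrier R"
      using Cons.prems GR b by (auto intro!: horner_closed)
    have "horner (c # p) b \<otimes> y = c \<otimes> y \<oplus> b \<otimes> (horner p b \<otimes> y)"
      using cl b yR by (simp add: l_distr m_assoc)
    then show ?case using Cons scale[of c y] shift y simple_ext_add[OF G b] by simp
  qed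
  then show ?thesis using p by simp
qed

lemma simple_ext_subring:
  assumes G: "subring G R" and b: "b \<in> carrier R"
  shows "subring (simple_ext G b) R"
proof (rule subringI)
  note base = simple_ext_base[OF G b]
  show "simple_ext G b \<subseteq> carrier R" "\<one> \<in> simple_ext G b" using base subringE(3)[OF G] by auto
  show "x \<otimes> y \<in> simple_ext G b" "x \<oplus> y \<in> simple_ext G b" if "x \<in> simple_ext G b" "y \<in> simple_ext G b" for x y
    using that simple_ext_add[OF G b] simple_ext_mult[OF G b] by auto
  fix x assume x: "x \<in> simple_ext G b"
  have "\<ominus> \<one> \<in> G" using subringE(3,5)[OF G] by auto
  then have "(\<ominus> \<one>) \<otimes> x \<in> simple_ext G b" using base x simple_ext_mult[OF G b] by blast
  then show "\<ominus> x \<in> simple_ext G b" using x base(3) by (simp add: l_minus subset_iff)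
qed

text \<open>Pseudo-division by a shortest relation: \<open>G\<close> is only a subring, so each step
  multiplies by the leading coefficient \<open>d\<close> instead of dividing by it. For graphs
  \<open>f\<close> is the first projection: a relation known only in the first coordinate is turned
  into a statement about pairs.\<close>

lemma minimal_relation_kills:
  assumes S: "cring S" and f: "f \<in> Ring.ring_hom R S" and b: "b \<in> carrier R" and G: "subring G R"
    and inj: "\<And>g. g \<in> G \<Longrightarrow> f g = \<zero>\<^bsub>S\<^esub> \<Longrightarrow> g = \<zero>"
    and w: "set (w @ [d]) \<subseteq> G" "f (horner (w @ [d]) b) = \<zero>\<^bsub>S\<^esub>"
    and min: "\<And>p c. set (p @ [c]) \<subseteq> G \<Longrightarrow> c \<noteq> \<zero> \<Longrightarrow> f (horner (p @ [c]) b) = \<zero>\<^bsub>S\<^esub> \<Longrightarrow> length w \<le> length p"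
    and p: "set p \<subseteq> G" "f (horner p b) = \<zero>\<^bsub>S\<^esub>"
  shows "\<exists>k q. d [^] (k::nat) \<otimes> horner p b = q \<otimes> horner (w @ [d]) b \<and> q \<in> carrier R"
  using p
proof (induction p rule: length_induct)
  case (1 p)
  interpret f: ring_hom_ring R S f using S f cring.axioms(1) by (intro ring_hom_ringI2 ring_axioms) auto
  have GR: "G \<subseteq> carrier R" by (rule subringE(1)[OF G])
  have dG: "d \<in> G" and wG: "set w \<subseteq> G" using w by auto
  have dR: "d \<in> carrier R" using dG GR by blast
  let ?w = "horner (w @ [d]) b"
  have wR: "?w \<in> carrier R" using w GR b by (intro horner_closed) auto
  show ?case
  proof (cases p rule: rev_cases)
    case Nil
    then show ?thesis using wR by (intro exI[of _ 0] exI[of _ "\<zero>"]) simp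
  next
    case (snoc p' c)
    have cG: "c \<in> G" and p'G: "set p' \<subseteq> G" using 1(2) snoc by auto
    have cR: "c \<in> carrier R" and p'R: "set p' \<subseteq> carrier R" using cG p'G GR by auto
    have pR: "horner p b \<in> carrier R" using 1(2) GR b by (intro horner_closed) auto
    show ?thesis
    proof (cases "c = \<zero>")
      case True
      have "horner p b = horner p' b"
        using horner_append[OF p'R _ b, of "[c]"] horner_closed[OF p'R b] cR b by (simp add: snoc True)
      then show ?thesis using 1(1)[rule_format, of p'] p'G 1(3) snoc by simp
    next
      case False
      then have le: "length w \<le> length p'" using min[of p' c] 1(2,3) snoc by simp
      define m where "m = length p' - length w"
      have m: "length p' = m + length w" using le by (simp add: m_def)
      let ?z = "replicate m \<zero>"
      have zR: "set ?z \<subseteq> carrier R" and zG: "set ?z \<subseteq> G"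
        using subringE(2)[OF G] by (auto simp: set_replicate_conv_if)
      have wR': "set w \<subseteq> carrier R" using wG GR by blast
      \<comment> \<open>\<open>u\<close> stands for \<open>d * p - c * X^m * (w @ [d])\<close>,
        whose leading terms cancel; hence only \<open>p'\<close> and \<open>w\<close> appear and
        \<open>u\<close> is shorter than \<open>p\<close>.\<close>
      define u where "u = map2 (\<oplus>) (map ((\<otimes>) d) p') (map ((\<otimes>) (\<ominus> c)) (?z @ w))"
      have ncG: "\<ominus> c \<in> G" using subringE(5)[OF G] cG by blast
      have hw: "horner w b \<in> carrier R" and hp: "horner p' b \<in> carrier R"
        using horner_closed[OF _ b] wR' p'R by auto
      have bm: "b [^] m \<in> carrier R" "b [^] length w \<in> carrier R" using b by auto
      have "horner u b = horner (map ((\<otimes>) d) p') b \<oplus> horner (map ((\<otimes>) (\<ominus> c)) (?z @ w)) b"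
        unfolding u_def by (rule horner_add) (use m dR cR p'R wR' zR b in auto)
      also have "\<dots> = d \<otimes> horner p' b \<oplus> (\<ominus> c) \<otimes> (b [^] m \<otimes> horner w b)"
        using horner_scale[OF p'R dR b] horner_scale[of "?z @ w" "\<ominus> c" b] horner_append[OF zR wR' b]
          cR b wR' zR hw by (simp add: horner_replicate)
      finally have u: "horner u b = d \<otimes> horner p' b \<oplus> (\<ominus> c) \<otimes> (b [^] m \<otimes> horner w b)" .
      have hp2: "horner p b = horner p' b \<oplus> (b [^] m \<otimes> b [^] length w) \<otimes> c"
        using horner_append[OF p'R _ b, of "[c]"] cR b by (simp add: snoc m nat_pow_mult)
      have hw2: "?w = horner w b \<oplus> b [^] length w \<otimes> d"
        using horner_append[OF wR' _ b, of "[d]"] dR b by simp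
      have eq: "horner u b = d \<otimes> horner p b \<oplus> \<ominus> (c \<otimes> b [^] m) \<otimes> ?w"
        unfolding u hp2 hw2 using dR cR hw hp bm by algebra
      have uG: "set u \<subseteq> G"
      proof
        fix x assume "x \<in> set u"
        then obtain z where z: "z \<in> set (zip (map ((\<otimes>) d) p') (map ((\<otimes>) (\<ominus> c)) (?z @ w)))"
          "x = (\<lambda>(x, y). x \<oplus> y) z"
          unfolding u_def set_map by (elim imageE)
        obtain x1 x2 where "z = (x1, x2)" by (cases z)
        with z have x: "x = x1 \<oplus> x2"
          "(x1, x2) \<in> set (zip (map ((\<otimes>) d) p') (map ((\<otimes>) (\<ominus> c)) (?z @ w)))" by simp_all
        have "x1 \<in> G" using set_zip_leftD[OF x(2)] subringE(6)[OF G dG] p'G by auto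
        moreover have "x2 \<in> G" using set_zip_rightD[OF x(2)] subringE(6)[OF G ncG] zG wG by auto
        ultimately show "x \<in> G" using x(1) subringE(7)[OF G] by blast
      qed
      have "f (horner u b) = \<zero>\<^bsub>S\<^esub>"
      proof -
        have cb: "\<ominus> (c \<otimes> b [^] m) \<in> carrier R" using cR bm by simp
        have "f (horner u b) = f d \<otimes>\<^bsub>S\<^esub> f (horner p b) \<oplus>\<^bsub>S\<^esub> f (\<ominus> (c \<otimes> b [^] m)) \<otimes>\<^bsub>S\<^esub> f ?w"
          unfolding eq using dR pR wR cb by simp
        then show ?thesis using 1(3) w(2) dR cb by (simp del: f.hom_a_inv)
      qed
      moreover have "length u < length p" using m by (simp add: u_def snoc)
      ultimately obtain k q where kq: "d [^] (k::nat) \<otimes> horner u b = q \<otimes> ?w" "q \<in> carrier R"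
        using 1(1)[rule_format, of u] uG by blast
      have dk: "d [^] k \<in> carrier R" using dR by simp
      have "d [^] Suc k \<otimes> horner p b = d [^] k \<otimes> (d \<otimes> horner p b)" using dR pR by (simp add: m_assoc)
      also have "d \<otimes> horner p b = horner u b \<oplus> (c \<otimes> b [^] m) \<otimes> ?w"
        unfolding eq using dR pR cR bm wR by algebra
      also have "d [^] k \<otimes> \<dots> = d [^] k \<otimes> horner u b \<oplus> d [^] k \<otimes> ((c \<otimes> b [^] m) \<otimes> ?w)"
        using dk cR bm wR uG GR b by (intro r_distr) (auto intro!: horner_closed)
      also have "\<dots> = (q \<oplus> d [^] k \<otimes> (c \<otimes> b [^] m)) \<otimes> ?w"
        unfolding kq(1) using dk cR bm wR kq(2) by algebra
      finally show ?thesis using dk cR bm kq(2)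
        by (intro exI[of _ "Suc k"] exI[of _ "q \<oplus> d [^] k \<otimes> (c \<otimes> b [^] m)"]) simp
    qed
  qed
qed

end

lemma (in ring) horner_rev:
  "set p \<subseteq> carrier R \<Longrightarrow> b \<in> carrier R \<Longrightarrow> horner (p @ [c]) b = horner p b \<oplus> b [^] length p \<otimes> c"
  if "c \<in> carrier R"
proof (induction p)
  case Nil
  then show ?case using that by simp
next
  case (Cons a p)
  have "horner p b \<in> carrier R" using Cons.prems by (induction p) auto
  then show ?case using Cons that
    by (simp add: r_distr m_assoc[symmetric] a_assoc nat_pow_Suc2[symmetric] del: nat_pow_Suc)
qed

section \<open>Extension of homomorphisms to automorphisms of an algebraic closure\<close>

context algebraic_closure
begin

text \<open>Partial homomorphisms are represented by their graphs inside this product, so that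
  unions of chains and adjunctions of elements become statements about subrings.\<close>

abbreviation D where "D \<equiv> RDirProd L L"

lemma D_simps [simp]:
  "carrier D = carrier L \<times> carrier L"
  "(x, y) \<otimes>\<^bsub>D\<^esub> (x', y') = (x \<otimes> x', y \<otimes> y')"
  "(x, y) \<oplus>\<^bsub>D\<^esub> (x', y') = (x \<oplus> x', y \<oplus> y')"
  "\<zero>\<^bsub>D\<^esub> = (\<zero>, \<zero>)" "\<one>\<^bsub>D\<^esub> = (\<one>, \<one>)"
  by (auto simp: RDirProd_def DirProd_def monoid.defs)

lemma D_cring: "cring D"
proof -
  interpret D: ring D by (rule RDirProd_ring[OF ring_axioms ring_axioms])
  show ?thesis
    by unfold_locales (auto simp: m_comm)
qed

sublocale D: cring D by (rule D_cring)

lemma D_minus: "x \<in> carrier L \<Longrightarrow> y \<in> carrier L \<Longrightarrow> \<ominus>\<^bsub>D\<^esub> (x, y) = (\<ominus> x, \<ominus> y)"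
  by (rule D.minus_equality) (auto simp: l_neg)

lemma fst_hom: "fst \<in> Ring.ring_hom D L"
  by (rule ring_hom_memI) (auto simp: split_paired_all)

lemma horner_D:
  "set p \<subseteq> carrier L \<times> carrier L \<Longrightarrow> b \<in> carrier L \<Longrightarrow> b' \<in> carrier L \<Longrightarrow>
    D.horner p (b, b') = (horner (map fst p) b, horner (map snd p) b')"
  by (induction p) auto

lemma K_sub: "x \<in> K \<Longrightarrow> x \<in> carrier L"
  using subfieldE(3)[OF subfield_axioms] by blast

lemma algebraic_relation:
  assumes "x \<in> carrier L"
  shows "\<exists>w c. set (w @ [c]) \<subseteq> K \<and> c \<noteq> \<zero> \<and> horner (w @ [c]) x = \<zero>"
proof -
  have K: "subring K L" by (rule subfieldE(1)[OF subfield_axioms])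
  obtain p where p: "p \<in> carrier (K[X])" "p \<noteq> []" "eval p x = \<zero>"
    using algebraicE[OF K assms algebraic_extension[OF assms]] by metis
  have rev: "set q \<subseteq> carrier L \<Longrightarrow> horner (rev q) x = eval q x" for q
    by (induction q) (use assms in \<open>auto simp: horner_rev a_comm m_comm eval_in_carrier\<close>)
  obtain c q where q: "p = c # q" using p(2) by (cases p) auto
  have pK: "set p \<subseteq> K" and c0: "c \<noteq> \<zero>"
    using p(1) q unfolding univ_poly_carrier[symmetric] polynomial_def by auto
  have "set p \<subseteq> carrier L" using pK K_sub by blast
  then have "horner (rev p) x = \<zero>" using rev[of p] p(3) by simp
  then show ?thesis using pK c0 q by (intro exI[of _ "rev q"] exI[of _ c]) auto
qed

lemma horner_root_exists:
  assumes "set (w @ [c]) \<subseteq> carrier L" "c \<noteq> \<zero>" "w \<noteq> []"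
  shows "\<exists>x\<in>carrier L. horner (w @ [c]) x = \<zero>"
proof -
  let ?p = "c # rev w"
  have pc: "?p \<in> carrier (poly_ring L)"
    using assms unfolding univ_poly_carrier[symmetric] polynomial_def by auto
  have "splitted ?p" using roots_over_carrier[OF pc] .
  then have "size (roots ?p) = length w" by (simp add: splitted_def)
  then have "roots ?p \<noteq> {#}" using assms(3) by auto
  then obtain x where "x \<in># roots ?p" by blast
  then have x: "x \<in> carrier L" "eval ?p x = \<zero>"
    using roots_mem_iff_is_root[OF pc] by (auto simp: is_root_def)
  have rev: "set q \<subseteq> carrier L \<Longrightarrow> horner (rev q) x = eval q x" for q
    by (induction q) (use x(1) in \<open>auto simp: horner_rev a_comm m_comm eval_in_carrier\<close>)
  have "horner (rev ?p) x = \<zero>" using rev[of ?p] assms(1) x(2) by auto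
  then show ?thesis using x(1) by auto
qed

text \<open>Graphs of ring homomorphisms over \<open>K\<close> from subrings of \<open>L\<close> to \<open>L\<close>.\<close>

definition pgraph :: "('a \<times> 'a) set \<Rightarrow> bool" where
  "pgraph G \<longleftrightarrow> subring G D \<and> (\<forall>x\<in>K. (x, x) \<in> G) \<and> (\<forall>y. (\<zero>, y) \<in> G \<longrightarrow> y = \<zero>)"

lemma pgraph_subring: "pgraph G \<Longrightarrow> subring G D"
  by (simp add: pgraph_def)

lemma pgraph_mem: "pgraph G \<Longrightarrow> (x, y) \<in> G \<Longrightarrow> x \<in> carrier L \<and> y \<in> carrier L"
  using subringE(1)[OF pgraph_subring] by fastforce

text \<open>Suppose that a nonzero \<open>x\<close> is sent to 0. Applying the homomorphism to an
  algebraic relation of \<open>x\<close> over \<open>K\<close> shows that its constant coefficient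
  is 0; dividing by \<open>x\<close> and repeating removes all coefficients, although the leading
  one is nonzero.\<close>

lemma pgraph_inj:
  assumes G: "pgraph G" and x: "(x, \<zero>) \<in> G"
  shows "x = \<zero>"
proof (rule ccontr)
  assume x0: "x \<noteq> \<zero>"
  have sub: "subring G D" by (rule pgraph_subring[OF G])
  have xL: "x \<in> carrier L" using pgraph_mem[OF G x] by simp
  have "set w \<subseteq> K \<Longrightarrow> horner w x = \<zero> \<Longrightarrow> set w \<subseteq> {\<zero>}" for w
  proof (induction w)
    case (Cons c w)
    let ?w = "map (\<lambda>c. (c, c)) w"
    have wK: "set w \<subseteq> K" and cK: "c \<in> K" using Cons.prems by auto
    have wL: "set ?w \<subseteq> carrier L \<times> carrier L" using wK K_sub by auto
    have hL: "horner w x \<in> carrier L" "horner w \<zero> \<in> carrier L"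
      using wK K_sub xL by (auto intro!: horner_closed)
    have "D.horner ?w (x, \<zero>) \<in> G"
      by (rule D.horner_mem[OF sub _ x]) (use G wK in \<open>auto simp: pgraph_def\<close>)
    then have "(x, \<zero>) \<otimes>\<^bsub>D\<^esub> D.horner ?w (x, \<zero>) \<in> G" by (rule subringE(6)[OF sub x])
    then have "(x \<otimes> horner w x, \<zero>) \<in> G" using horner_D[OF wL xL, of \<zero>] hL by (simp add: comp_def)
    moreover have "(c, c) \<in> G" using G cK by (simp add: pgraph_def)
    ultimately have "(c, c) \<oplus>\<^bsub>D\<^esub> (x \<otimes> horner w x, \<zero>) \<in> G" by (intro subringE(7)[OF sub])
    then have "(\<zero>, c) \<in> G" using Cons.prems(2) K_sub[OF cK] by simp
    then have c: "c = \<zero>" using G by (simp add: pgraph_def)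
    then have "x \<otimes> horner w x = \<zero>" using Cons.prems(2) hL xL by simp
    then have "horner w x = \<zero>" using x0 xL hL integral by blast
    then show ?case using Cons.IH wK c by simp
  qed simp
  moreover obtain w c where "set (w @ [c]) \<subseteq> K" "c \<noteq> \<zero>" "horner (w @ [c]) x = \<zero>"
    using algebraic_relation[OF xL] by blast
  ultimately show False by fastforce
qed

lemma pgraph_zero:
  assumes "pgraph G" "g \<in> G" "fst g = \<zero>"
  shows "g = \<zero>\<^bsub>D\<^esub>"
  using assms by (cases g) (auto simp: pgraph_def)

lemma D_pow: "x \<in> carrier L \<Longrightarrow> y \<in> carrier L \<Longrightarrow> (x, y) [^]\<^bsub>D\<^esub> (k::nat) = (x [^] k, y [^] k)"
  by (induction k) auto

text \<open>The point is that the extension stays single-valued. If \<open>(0, y)\<close> is a value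
  at \<open>(b, b')\<close>, pseudo-division gives \<open>d^k * (0, y) = 0\<close>; by injectivity
  the second component of \<open>d\<close> is nonzero, so \<open>y = 0\<close>.\<close>

lemma pgraph_extend:
  assumes G: "pgraph G" and b: "b \<in> carrier L" "b' \<in> carrier L"
    and w: "set (w @ [d]) \<subseteq> G" "d \<noteq> \<zero>\<^bsub>D\<^esub>" "D.horner (w @ [d]) (b, b') = \<zero>\<^bsub>D\<^esub>"
    and min: "\<And>p c. set (p @ [c]) \<subseteq> G \<Longrightarrow> c \<noteq> \<zero>\<^bsub>D\<^esub> \<Longrightarrow> fst (D.horner (p @ [c]) (b, b')) = \<zero> \<Longrightarrow>
      length w \<le> length p"
  shows "pgraph (D.simple_ext G (b, b'))"
  unfolding pgraph_def
proof (intro conjI ballI allI impI)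
  have sub: "subring G D" by (rule pgraph_subring[OF G])
  have bD: "(b, b') \<in> carrier D" using b by simp
  show "subring (D.simple_ext G (b, b')) D" by (rule D.simple_ext_subring[OF sub bD])
  show "(x, x) \<in> D.simple_ext G (b, b')" if "x \<in> K" for x
    using D.simple_ext_base(1)[OF sub bD] G that by (auto simp: pgraph_def)
  fix y assume y: "(\<zero>, y) \<in> D.simple_ext G (b, b')"
  then have yL: "y \<in> carrier L" using D.simple_ext_base(3)[OF sub bD] by auto
  obtain p where p: "set p \<subseteq> G" "(\<zero>, y) = D.horner p (b, b')" using y by (rule D.simple_extE)
  have "\<exists>k q. d [^]\<^bsub>D\<^esub> (k::nat) \<otimes>\<^bsub>D\<^esub> D.horner p (b, b') = q \<otimes>\<^bsub>D\<^esub> D.horner (w @ [d]) (b, b') \<and> q \<in> carrier D"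
  proof (rule D.minimal_relation_kills[OF cring_axioms fst_hom bD sub])
    show "g = \<zero>\<^bsub>D\<^esub>" if "g \<in> G" "fst g = \<zero>" for g using pgraph_zero[OF G that] .
    show "fst (D.horner (w @ [d]) (b, b')) = \<zero>" using w(3) by simp
    show "fst (D.horner p (b, b')) = \<zero>" using p(2) by (metis fst_conv)
  qed (use w(1) min p(1) in auto)
  then obtain k :: nat and q where q: "d [^]\<^bsub>D\<^esub> k \<otimes>\<^bsub>D\<^esub> (\<zero>, y) = \<zero>\<^bsub>D\<^esub>" "q \<in> carrier D"
    using w(3) p(2) D.r_null by metis
  obtain d1 d2 where d: "d = (d1, d2)" by (cases d)
  have dG: "(d1, d2) \<in> G" using w(1) d by simp
  have dL: "d1 \<in> carrier L" "d2 \<in> carrier L" using pgraph_mem[OF G dG] by auto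
  have d2: "d2 \<noteq> \<zero>"
  proof
    assume "d2 = \<zero>"
    then have "d1 = \<zero>" using pgraph_inj[OF G] dG by simp
    then show False using \<open>d2 = \<zero>\<close> w(2) d by simp
  qed
  have "d2 [^] k \<otimes> y = \<zero>" using q(1) dL yL by (simp add: d D_pow)
  moreover have "d2 [^] k \<noteq> \<zero>"
    by (induction k) (use d2 dL integral in auto)
  ultimately show "y = \<zero>" using integral dL yL by (metis nat_pow_closed)
qed

text \<open>A shortest relation of \<open>b\<close> over the domain is carried by the graph to the
  second coordinates, where its leading coefficient stays nonzero. It has a root \<open>b'\<close>
  there, and adjoining \<open>(b, b')\<close> cannot enlarge a maximal graph.\<close>

lemma pgraph_maximal_total:
  assumes G: "pgraph G" and max: "\<And>G'. pgraph G' \<Longrightarrow> G \<subseteq> G' \<Longrightarrow> G' = G" and b: "b \<in> carrier L"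
  shows "\<exists>y. (b, y) \<in> G"
proof -
  have sub: "subring G D" by (rule pgraph_subring[OF G])
  have GL: "G \<subseteq> carrier L \<times> carrier L" using subringE(1)[OF sub] by simp
  let ?P = "\<lambda>(w, d). set (w @ [d]) \<subseteq> G \<and> d \<noteq> \<zero>\<^bsub>D\<^esub> \<and> horner (map fst (w @ [d])) b = \<zero>"
  obtain w0 c0 where w0: "set (w0 @ [c0]) \<subseteq> K" "c0 \<noteq> \<zero>" "horner (w0 @ [c0]) b = \<zero>"
    using algebraic_relation[OF b] by blast
  have "map fst (map (\<lambda>c. (c, c)) w0 @ [(c0, c0)]) = w0 @ [c0]" by (simp add: comp_def)
  then have "?P (map (\<lambda>c. (c, c)) w0, (c0, c0))" using G w0 by (auto simp: pgraph_def)
  from ex_has_least_nat[of ?P, OF this, of "\<lambda>(w, d). length w"]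
  obtain wd where wd: "?P wd \<and> (\<forall>y. ?P y \<longrightarrow> (case wd of (w, d) \<Rightarrow> length w) \<le> (case y of (w, d) \<Rightarrow> length w))" ..
  obtain w d where wd_eq: "wd = (w, d)" by (cases wd)
  have w: "set (w @ [d]) \<subseteq> G" "d \<noteq> \<zero>\<^bsub>D\<^esub>" "horner (map fst (w @ [d])) b = \<zero>"
    using conjunct1[OF wd] by (simp_all add: wd_eq)
  have min: "length w \<le> length p"
    if "set (p @ [c]) \<subseteq> G" "c \<noteq> \<zero>\<^bsub>D\<^esub>" "horner (map fst (p @ [c])) b = \<zero>" for p c
    using spec[OF conjunct2[OF wd], of "(p, c)"] that by (simp add: wd_eq)
  obtain d1 d2 where d: "d = (d1, d2)" by (cases d)
  have dG: "(d1, d2) \<in> G" using w(1) d by simp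
  have dL: "d1 \<in> carrier L" "d2 \<in> carrier L" using pgraph_mem[OF G dG] by auto
  have d1: "d1 \<noteq> \<zero>" using pgraph_zero[OF G dG] w(2) d by auto
  have d2: "d2 \<noteq> \<zero>" using pgraph_inj[OF G] dG d1 by blast
  have "w \<noteq> []"
  proof
    assume "w = []"
    then show False using w(3) d d1 dL b by simp
  qed
  have wL: "set (w @ [d]) \<subseteq> carrier L \<times> carrier L" using w(1) GL by blast
  have "set (map snd w @ [d2]) \<subseteq> carrier L" using wL d by auto
  then obtain b' where b': "b' \<in> carrier L" "horner (map snd w @ [d2]) b' = \<zero>"
    using horner_root_exists[OF _ d2, of "map snd w"] \<open>w \<noteq> []\<close> by auto
  have "pgraph (D.simple_ext G (b, b'))"
  proof (rule pgraph_extend[OF G b b'(1) w(1,2)])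
    show "D.horner (w @ [d]) (b, b') = \<zero>\<^bsub>D\<^esub>"
      unfolding horner_D[OF wL b b'(1)] using w(3) b'(2) d by simp
    fix p c assume p: "set (p @ [c]) \<subseteq> G" "c \<noteq> \<zero>\<^bsub>D\<^esub>" "fst (D.horner (p @ [c]) (b, b')) = \<zero>"
    have "set (p @ [c]) \<subseteq> carrier L \<times> carrier L" using p(1) GL by blast
    then show "length w \<le> length p" using min[OF p(1,2)] p(3) horner_D[OF _ b b'(1)] by simp
  qed
  then have "D.simple_ext G (b, b') = G" using max D.simple_ext_base(1)[OF sub] b b'(1) by simp
  then show ?thesis using D.simple_ext_base(2)[OF sub, of "(b, b')"] b b'(1) by auto
qed

lemma pgraph_chain_union:
  assumes "\<C> \<noteq> {}" "subset.chain {G. pgraph G \<and> G0 \<subseteq> G} \<C>"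
  shows "\<Union>\<C> \<in> {G. pgraph G \<and> G0 \<subseteq> G}"
proof -
  have C: "\<And>G. G \<in> \<C> \<Longrightarrow> pgraph G" "\<And>G. G \<in> \<C> \<Longrightarrow> G0 \<subseteq> G"
    "\<And>G G'. G \<in> \<C> \<Longrightarrow> G' \<in> \<C> \<Longrightarrow> G \<subseteq> G' \<or> G' \<subseteq> G"
    using assms(2) unfolding subset_chain_def by auto
  obtain G1 where G1: "G1 \<in> \<C>" using assms(1) by blast
  have two: "\<exists>G\<in>\<C>. x \<in> G \<and> y \<in> G" if "x \<in> \<Union>\<C>" "y \<in> \<Union>\<C>" for x y
    using that C(3) by blast
  have "subring (\<Union>\<C>) D"
  proof (rule D.subringI)
    show "\<Union>\<C> \<subseteq> carrier D" using C(1) subringE(1)[OF pgraph_subring] by blast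
    show "\<one>\<^bsub>D\<^esub> \<in> \<Union>\<C>" using G1 subringE(3)[OF pgraph_subring[OF C(1)[OF G1]]] by blast
    fix x assume "x \<in> \<Union>\<C>"
    then show "\<ominus>\<^bsub>D\<^esub> x \<in> \<Union>\<C>" using C(1) subringE(5)[OF pgraph_subring] by blast
    fix y assume "y \<in> \<Union>\<C>"
    then obtain G where G: "G \<in> \<C>" "x \<in> G" "y \<in> G" using two \<open>x \<in> \<Union>\<C>\<close> by blast
    then show "x \<otimes>\<^bsub>D\<^esub> y \<in> \<Union>\<C>" "x \<oplus>\<^bsub>D\<^esub> y \<in> \<Union>\<C>"
      using subringE(6,7)[OF pgraph_subring[OF C(1)[OF G(1)]] G(2,3)] by blast+
  qed
  then have "pgraph (\<Union>\<C>)" using C(1) G1 unfolding pgraph_def by blast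
  then show ?thesis using C(2) G1 by blast
qed

text \<open>A maximal graph above \<open>G0\<close>, given by Zorn's lemma, is everywhere defined,
  hence the graph of an endomorphism fixing \<open>K\<close>.\<close>

lemma automorphism_of_pgraph:
  assumes G0: "pgraph G0" "(t, t') \<in> G0"
  shows "\<exists>s\<in>ring_iso L L \<inter> extensional (carrier L). (\<forall>x\<in>K. s x = x) \<and> s t = t'"
proof -
  let ?A = "{G. pgraph G \<and> G0 \<subseteq> G}"
  have "\<exists>M\<in>?A. \<forall>G\<in>?A. M \<subseteq> G \<longrightarrow> G = M"
  proof (rule subset_Zorn_nonempty)
    show "?A \<noteq> {}" using G0(1) by blast
  qed (rule pgraph_chain_union)
  then obtain G where GA: "G \<in> ?A" and GM: "\<forall>G'\<in>?A. G \<subseteq> G' \<longrightarrow> G' = G" ..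
  have G: "pgraph G" "G0 \<subseteq> G" using GA by auto
  have max: "G' = G" if "pgraph G'" "G \<subseteq> G'" for G'
    using bspec[OF GM, of G'] that G(2) by auto
  have sub: "subring G D" by (rule pgraph_subring[OF G(1)])
  have uniq: "y = y'" if "(x, y) \<in> G" "(x, y') \<in> G" for x y y'
  proof -
    have m: "x \<in> carrier L" "y \<in> carrier L" "y' \<in> carrier L" using pgraph_mem[OF G(1)] that by auto
    have "(x, y) \<oplus>\<^bsub>D\<^esub> (\<ominus>\<^bsub>D\<^esub> (x, y')) \<in> G" using that subringE(5,7)[OF sub] by blast
    then have "(\<zero>, y \<oplus> \<ominus> y') \<in> G" using m by (simp add: D_minus r_neg)
    then have "y \<oplus> \<ominus> y' = \<zero>" using G(1) by (simp add: pgraph_def)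
    then show ?thesis using m by (metis minus_equality minus_minus a_inv_closed)
  qed
  define s where "s = (\<lambda>x\<in>carrier L. THE y. (x, y) \<in> G)"
  have s: "(x, s x) \<in> G" if "x \<in> carrier L" for x
  proof -
    have "\<exists>y. (x, y) \<in> G" using pgraph_maximal_total[OF G(1) max that] .
    then obtain y where y: "(x, y) \<in> G" ..
    have "(x, THE y. (x, y) \<in> G) \<in> G" by (rule theI[of "\<lambda>y. (x, y) \<in> G", OF y]) (rule uniq[OF _ y])
    then show ?thesis using that by (simp add: s_def)
  qed
  have sI: "s x = y" if "(x, y) \<in> G" for x y
    using uniq[OF s that] pgraph_mem[OF G(1) that] by blast
  have sL: "s x \<in> carrier L" if "x \<in> carrier L" for x using pgraph_mem[OF G(1) s[OF that]] by blast
  have sK: "s x = x" if "x \<in> K" for x using sI G(1) that by (simp add: pgraph_def)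
  have hom: "s \<in> Ring.ring_hom L L"
  proof (rule ring_hom_memI)
    fix x y assume x: "x \<in> carrier L" and y: "y \<in> carrier L"
    show "s x \<in> carrier L" using sL[OF x] .
    show "s (x \<otimes> y) = s x \<otimes> s y" using subringE(6)[OF sub s[OF x] s[OF y]] by (intro sI) simp
    show "s (x \<oplus> y) = s x \<oplus> s y" using subringE(7)[OF sub s[OF x] s[OF y]] by (intro sI) simp
  next
    show "s \<one> = \<one>" using subringE(3)[OF sub] by (intro sI) simp
  qed
  have inj: "inj_on s (carrier L)"
  proof (rule inj_onI)
    fix x y assume x: "x \<in> carrier L" and y: "y \<in> carrier L" and eq: "s x = s y"
    have "(x, s x) \<oplus>\<^bsub>D\<^esub> (\<ominus>\<^bsub>D\<^esub> (y, s y)) \<in> G" using s[OF x] s[OF y] subringE(5,7)[OF sub] by blast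
    then have "(x \<oplus> \<ominus> y, \<zero>) \<in> G" using x y sL[OF y] eq by (simp add: D_minus r_neg)
    then have "x \<oplus> \<ominus> y = \<zero>" by (rule pgraph_inj[OF G(1)])
    then show "x = y" using x y by (metis minus_equality minus_minus a_inv_closed)
  qed
  \<comment> \<open>The endomorphism maps the finite root set of a relation over \<open>K\<close>
    injectively into itself, hence onto itself, and \<open>b\<close> is one of these roots.\<close>
  have surj: "b \<in> s ` carrier L" if b: "b \<in> carrier L" for b
  proof -
    obtain w c where w: "set (w @ [c]) \<subseteq> K" "c \<noteq> \<zero>" "horner (w @ [c]) b = \<zero>"
      using algebraic_relation[OF b] by blast
    let ?Z = "{x \<in> carrier L. horner (w @ [c]) x = \<zero>}"
    have wL: "set (w @ [c]) \<subseteq> carrier L" using w(1) K_sub by blast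
    have "finite ?Z"
    proof -
      let ?p = "c # rev w"
      have pc: "?p \<in> carrier (poly_ring L)"
        using wL w(2) unfolding univ_poly_carrier[symmetric] polynomial_def by auto
      have rev: "set q \<subseteq> carrier L \<Longrightarrow> horner (rev q) x = eval q x" if "x \<in> carrier L" for q x
        by (induction q) (use that in \<open>auto simp: horner_rev a_comm m_comm eval_in_carrier\<close>)
      have "?Z \<subseteq> {x. is_root ?p x}"
        using rev[of _ ?p] wL by (auto simp: is_root_def)
      then show ?thesis using finite_number_of_roots[OF pc] finite_subset by blast
    qed
    moreover have "s ` ?Z \<subseteq> ?Z"
    proof
      fix y assume "y \<in> s ` ?Z"
      then obtain x where x: "x \<in> carrier L" "horner (w @ [c]) x = \<zero>" "y = s x" by blast
      let ?w = "map (\<lambda>c. (c, c)) (w @ [c])"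
      have "D.horner ?w (x, s x) \<in> G"
        by (rule D.horner_mem[OF sub _ s[OF x(1)]]) (use G(1) w(1) in \<open>auto simp: pgraph_def\<close>)
      moreover have "D.horner ?w (x, s x) = (horner (w @ [c]) x, horner (w @ [c]) (s x))"
        using wL x(1) sL[OF x(1)] by (subst horner_D) (auto simp: comp_def)
      ultimately have "(\<zero>, horner (w @ [c]) (s x)) \<in> G" using x(2) by simp
      then have "horner (w @ [c]) (s x) = \<zero>" using G(1) by (simp add: pgraph_def)
      then show "y \<in> ?Z" using x(3) sL[OF x(1)] by simp
    qed
    moreover have "inj_on s ?Z" using inj by (rule inj_on_subset) auto
    ultimately have "s ` ?Z = ?Z" by (rule endo_inj_surj)
    then show ?thesis using b w(3) by blast
  qed
  have "bij_betw s (carrier L) (carrier L)"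
    unfolding bij_betw_def using inj surj sL by blast
  then have "s \<in> ring_iso L L \<inter> extensional (carrier L)" unfolding ring_iso_def using hom by (auto simp: s_def)
  moreover have "s t = t'" using sI G0(2) G(2) by blast
  ultimately show ?thesis using sK by blast
qed

lemma pgraph_diag: "pgraph {(x, x) | x. x \<in> K}"
  unfolding pgraph_def
proof (intro conjI)
  have K: "subring K L" by (rule subfieldE(1)[OF subfield_axioms])
  show "subring {(x, x) | x. x \<in> K} D"
  proof (rule D.subringI)
    show "{(x, x) | x. x \<in> K} \<subseteq> carrier D" using K_sub by auto
    show "\<one>\<^bsub>D\<^esub> \<in> {(x, x) | x. x \<in> K}" using subringE(3)[OF K] by auto
    fix a assume "a \<in> {(x, x) | x. x \<in> K}"
    then obtain x where x: "x \<in> K" "a = (x, x)" by blast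
    then show "\<ominus>\<^bsub>D\<^esub> a \<in> {(x, x) | x. x \<in> K}" using subringE(5)[OF K] K_sub by (auto simp: D_minus)
    fix b assume "b \<in> {(x, x) | x. x \<in> K}"
    then obtain y where y: "y \<in> K" "b = (y, y)" by blast
    show "a \<otimes>\<^bsub>D\<^esub> b \<in> {(x, x) | x. x \<in> K}" using subringE(6)[OF K x(1) y(1)] x y by simp
    show "a \<oplus>\<^bsub>D\<^esub> b \<in> {(x, x) | x. x \<in> K}" using subringE(7)[OF K x(1) y(1)] x y by simp
  qed
qed auto

text \<open>Since \<open>t'\<close> satisfies a shortest relation of \<open>t\<close> over
  \<open>K\<close>, sending \<open>t\<close> to \<open>t'\<close> is a partial homomorphism. It
  extends to an automorphism over \<open>K\<close>, which by hypothesis fixes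
  \<open>t\<close>.\<close>

lemma fixed_conjugate:
  assumes t: "t \<in> carrier L" "t' \<in> carrier L"
    and fixed: "\<forall>s\<in>ring_iso L L \<inter> extensional (carrier L). (\<forall>x\<in>K. s x = x) \<longrightarrow> s t = t"
    and w: "set (w @ [c]) \<subseteq> K" "c \<noteq> \<zero>" "horner (w @ [c]) t = \<zero>" "horner (w @ [c]) t' = \<zero>"
    and min: "\<forall>p d. set (p @ [d]) \<subseteq> K \<longrightarrow> d \<noteq> \<zero> \<longrightarrow> horner (p @ [d]) t = \<zero> \<longrightarrow> length w \<le> length p"
  shows "t' = t"
proof -
  let ?G = "{(x, x) | x. x \<in> K}"
  let ?d = "map (\<lambda>x. (x, x))"
  have sub: "subring ?G D" by (rule pgraph_subring[OF pgraph_diag])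
  have "pgraph (D.simple_ext ?G (t, t'))"
  proof (rule pgraph_extend[OF pgraph_diag t, of "?d w" "(c, c)"])
    show "set (?d w @ [(c, c)]) \<subseteq> ?G" using w(1) by auto
    show "(c, c) \<noteq> \<zero>\<^bsub>D\<^esub>" using w(2) by simp
    have "set (?d (w @ [c])) \<subseteq> carrier L \<times> carrier L" using w(1) K_sub by auto
    from horner_D[OF this t] show "D.horner (?d w @ [(c, c)]) (t, t') = \<zero>\<^bsub>D\<^esub>"
      using w(3,4) by (simp add: comp_def)
    fix p d assume p: "set (p @ [d]) \<subseteq> ?G" "d \<noteq> \<zero>\<^bsub>D\<^esub>" "fst (D.horner (p @ [d]) (t, t')) = \<zero>"
    have pL: "set (p @ [d]) \<subseteq> carrier L \<times> carrier L" using p(1) K_sub by fastforce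
    have "length w \<le> length (map fst p)"
    proof (rule min[rule_format, of "map fst p" "fst d"])
      show "set (map fst p @ [fst d]) \<subseteq> K" using p(1) by fastforce
      show "fst d \<noteq> \<zero>" using p(1,2) by auto
      show "horner (map fst p @ [fst d]) t = \<zero>" using p(3) unfolding horner_D[OF pL t] by simp
    qed
    then show "length (?d w) \<le> length p" by simp
  qed
  moreover have "(t, t') \<in> D.simple_ext ?G (t, t')" using D.simple_ext_base(2)[OF sub] t by simp
  ultimately have "\<exists>s\<in>ring_iso L L \<inter> extensional (carrier L). (\<forall>x\<in>K. s x = x) \<and> s t = t'"
    by (rule automorphism_of_pgraph)
  then show ?thesis using fixed by auto
qed

text \<open>Kummer theory in degree three. The minimal relation of \<open>t\<close> over \<open>K\<close> has degree at most three.
  In degree two the other root of the relation, in degree three \<open>z t\<close>, is a different conjugate.\<close>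

lemma fixed_cube_root_mem:
  assumes t: "t \<in> carrier L" "t \<otimes> (t \<otimes> t) \<in> K"
    and z: "z \<in> K" "z \<otimes> (z \<otimes> z) = \<one>" "z \<noteq> \<one>" and two: "\<one> \<oplus> \<one> \<noteq> \<zero>"
    and fixed: "\<forall>s\<in>ring_iso L L \<inter> extensional (carrier L). (\<forall>x\<in>K. s x = x) \<longrightarrow> s t = t"
  shows "t \<in> K"
proof (rule ccontr)
  assume tK: "t \<notin> K"
  have K: "subring K L" by (rule subfieldE(1)[OF subfield_axioms])
  have inv: "inv c \<in> K" "inv c \<otimes> c = \<one>" if "c \<in> K" "c \<noteq> \<zero>" for c
    using subfield_m_inv[OF subfield_axioms, of c] that by auto
  have K0: "\<zero> \<in> K" and K1: "\<one> \<in> K" using subringE(2,3)[OF K] by auto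
  note Kc = subringE(5)[OF K] subringE(6)[OF K] subringE(7)[OF K]
  let ?e = "t \<otimes> (t \<otimes> t)"
  let ?P = "\<lambda>(w, c). set (w @ [c]) \<subseteq> K \<and> c \<noteq> \<zero> \<and> horner (w @ [c]) t = \<zero>"
  let ?w3 = "[\<ominus> ?e, \<zero>, \<zero>]"
  have w3h: "horner (?w3 @ [\<one>]) x = \<ominus> ?e \<oplus> x \<otimes> (x \<otimes> x)" if "x \<in> carrier L" for x
    using that t by simp
  have w3: "?P (?w3, \<one>)" using w3h[OF t(1)] t K0 K1 Kc(1) by (simp add: l_neg)
  from ex_has_least_nat[of ?P, OF this, of "\<lambda>(w, d). length w"]
  obtain wc where wc: "?P wc \<and> (\<forall>y. ?P y \<longrightarrow> (case wc of (w, d) \<Rightarrow> length w) \<le> (case y of (w, d) \<Rightarrow> length w))" ..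
  obtain w c where wc_eq: "wc = (w, c)" by (cases wc)
  have w: "set (w @ [c]) \<subseteq> K" "c \<noteq> \<zero>" "horner (w @ [c]) t = \<zero>"
    using conjunct1[OF wc] by (simp_all add: wc_eq)
  have min: "length w \<le> length p"
    if "set (p @ [d]) \<subseteq> K" "d \<noteq> \<zero>" "horner (p @ [d]) t = \<zero>" for p d
    using spec[OF conjunct2[OF wc], of "(p, d)"] that by (simp add: wc_eq)
  then have minA: "\<forall>p d. set (p @ [d]) \<subseteq> K \<longrightarrow> d \<noteq> \<zero> \<longrightarrow> horner (p @ [d]) t = \<zero> \<longrightarrow> length w \<le> length p"
    by (intro allI impI)
  have cK: "c \<in> K" using w(1) by simp
  have cL: "c \<in> carrier L" by (rule K_sub[OF cK])
  have icL: "inv c \<in> carrier L" using K_sub inv(1)[OF cK w(2)] by blast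
  have ic: "inv c \<otimes> c = \<one>" by (rule inv(2)[OF cK w(2)])
  have "length w \<le> 3" using min[of ?w3 \<one>] w3 by simp
  then consider "length w = 0" | "length w = 1" | "length w = 2" | "length w = 3" by linarith
  then show False
  proof cases
    case 1
    then show False using w(2,3) cL t by simp
  next
    case 2
    then obtain a where a: "w = [a]" by (auto simp: length_Suc_conv)
    then have aK: "a \<in> K" using w(1) by simp
    have "a \<oplus> t \<otimes> c = \<zero>" using w(3) a K_sub[OF aK] cL t by simp
    then have tc: "t \<otimes> c = \<ominus> a" using K_sub[OF aK] cL t(1) by (simp add: minus_equality[symmetric] a_comm)
    have "t = t \<otimes> (inv c \<otimes> c)" using ic t(1) by simp
    also have "\<dots> = (t \<otimes> c) \<otimes> inv c" using cL icL t(1) by algebra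
    finally have "t = (t \<otimes> c) \<otimes> inv c" .
    then show False using tK tc Kc(1)[OF aK] inv(1)[OF cK w(2)] Kc(2) by metis
  next
    case 3
    then obtain a0 a1 where a: "w = [a0, a1]" by (auto simp: length_Suc_conv numeral_2_eq_2)
    then have aK: "a0 \<in> K" "a1 \<in> K" using w(1) by auto
    note aL = K_sub[OF aK(1)] K_sub[OF aK(2)]
    have h: "horner (w @ [c]) x = a0 \<oplus> x \<otimes> (a1 \<oplus> x \<otimes> c)" if "x \<in> carrier L" for x
      using that aL cL by (simp add: a)
    \<comment> \<open>\<open>u\<close> is the sum of the two roots, so \<open>u - t\<close> is the
      other root. If it equals \<open>t\<close>, then \<open>t\<close> is half of \<open>u\<close>,
      which lies in \<open>K\<close> because 2 is invertible.\<close>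
    define u where "u = \<ominus> (inv c \<otimes> a1)"
    have uK: "u \<in> K" unfolding u_def by (intro Kc(1) Kc(2) inv(1)[OF cK w(2)] aK)
    have uL: "u \<in> carrier L" by (rule K_sub[OF uK])
    have uc: "c \<otimes> u = \<ominus> a1"
    proof -
      have "c \<otimes> u = \<ominus> ((inv c \<otimes> c) \<otimes> a1)" unfolding u_def using cL icL aL by algebra
      then show ?thesis using ic aL by simp
    qed
    let ?t' = "u \<oplus> \<ominus> t"
    have t'L: "?t' \<in> carrier L" using uL t(1) by simp
    have "a0 \<oplus> ?t' \<otimes> (a1 \<oplus> ?t' \<otimes> c) = a0 \<oplus> ?t' \<otimes> (a1 \<oplus> c \<otimes> u \<oplus> \<ominus> (c \<otimes> t))"
      using uL t(1) cL aL by algebra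
    also have "\<dots> = a0 \<oplus> ?t' \<otimes> \<ominus> (c \<otimes> t)" unfolding uc using uL t(1) cL aL by algebra
    also have "\<dots> = a0 \<oplus> (\<ominus> (c \<otimes> u) \<otimes> t \<oplus> t \<otimes> (t \<otimes> c))" using uL t(1) cL aL by algebra
    also have "\<dots> = a0 \<oplus> t \<otimes> (a1 \<oplus> t \<otimes> c)" unfolding uc using uL t(1) cL aL by algebra
    also have "\<dots> = \<zero>" using w(3) h[OF t(1)] by simp
    finally have "horner (w @ [c]) ?t' = \<zero>" using h[OF t'L] by simp
    have *: "?t' = t"
      by (rule fixed_conjugate[OF t(1) t'L fixed w _ minA]) fact
    have "u = ?t' \<oplus> t" using uL t(1) by algebra
    then have "u = t \<oplus> t" unfolding * .
    also have "\<dots> = (\<one> \<oplus> \<one>) \<otimes> t" using t(1) by algebra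
    finally have "u = (\<one> \<oplus> \<one>) \<otimes> t" .
    moreover have 2: "\<one> \<oplus> \<one> \<in> K" using Kc(3)[OF K1 K1] .
    ultimately have "inv (\<one> \<oplus> \<one>) \<otimes> u = t"
      using inv[OF 2 two] t(1) K_sub by (simp add: m_assoc[symmetric])
    then show False using tK Kc(2)[OF inv(1)[OF 2 two] uK] by simp
  next
    case 4
    have zL: "z \<in> carrier L" by (rule K_sub[OF z(1)])
    let ?t' = "z \<otimes> t"
    have t'L: "?t' \<in> carrier L" using zL t(1) by simp
    have "?t' \<otimes> (?t' \<otimes> ?t') = (z \<otimes> (z \<otimes> z)) \<otimes> ?e" using zL t(1) by algebra
    then have "horner (?w3 @ [\<one>]) ?t' = \<zero>" using w3h[OF t'L] z(2) t by (simp add: l_neg)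
    note h0 = this
    have min3: "\<forall>p d. set (p @ [d]) \<subseteq> K \<longrightarrow> d \<noteq> \<zero> \<longrightarrow> horner (p @ [d]) t = \<zero> \<longrightarrow> length ?w3 \<le> length p"
    proof -
      have l: "length ?w3 = length w" using 4 by simp
      show ?thesis unfolding l by (rule minA)
    qed
    have *: "?t' = t"
    proof (rule fixed_conjugate[OF t(1) t'L fixed _ _ _ h0 min3])
      show "set (?w3 @ [\<one>]) \<subseteq> K" "\<one> \<noteq> \<zero>" "horner (?w3 @ [\<one>]) t = \<zero>" using w3 by simp_all
    qed
    have "(z \<oplus> \<ominus> \<one>) \<otimes> t = z \<otimes> t \<oplus> \<ominus> t" using zL t(1) by algebra
    then have "(z \<oplus> \<ominus> \<one>) \<otimes> t = \<zero>" unfolding * using t(1) by (simp add: r_neg)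
    then have "z \<oplus> \<ominus> \<one> = \<zero> \<or> t = \<zero>" using integral[of "z \<oplus> \<ominus> \<one>" t] zL t(1) by simp
    moreover have "z = \<one>" if "z \<oplus> \<ominus> \<one> = \<zero>"
      using that zL by (simp add: a_minus_def[symmetric])
    ultimately show False using z(3) tK K0 by blast
  qed
qed

end


section \<open>The isogeny\<close>

locale plain_field = field C for C :: "'c ring" (structure)
begin

lemma eq_of_minus_zero: "x \<in> carrier C \<Longrightarrow> y \<in> carrier C \<Longrightarrow> x \<oplus> \<ominus> y = \<zero> \<Longrightarrow> x = y"
  by (simp add: a_minus_def[symmetric])

lemma pow2: "x \<in> carrier C \<Longrightarrow> x [^] (2::nat) = x \<otimes> x"
  by (simp add: numeral_2_eq_2)

lemma pow3: "x \<in> carrier C \<Longrightarrow> x [^] (3::nat) = x \<otimes> (x \<otimes> x)"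
  by (simp add: numeral_3_eq_3 m_assoc)

lemma square_eq_cases:
  assumes "x \<in> carrier C" "y \<in> carrier C" "x \<otimes> x = y \<otimes> y"
  shows "x = y \<or> x = \<ominus> y"
proof -
  have "(x \<oplus> \<ominus> y) \<otimes> (x \<oplus> y) = x \<otimes> x \<oplus> \<ominus> (y \<otimes> y)" using assms(1,2) by algebra
  then have "(x \<oplus> \<ominus> y) \<otimes> (x \<oplus> y) = \<zero>" using assms by (simp add: r_neg)
  then have "x \<oplus> \<ominus> y = \<zero> \<or> x \<oplus> y = \<zero>" using assms(1,2) integral by simp
  then show ?thesis using eq_of_minus_zero[of x y] eq_of_minus_zero[of x "\<ominus> y"] assms(1,2) by auto
qed

lemma rdiv_closed: "x \<in> carrier C \<Longrightarrow> y \<in> carrier C \<Longrightarrow> y \<noteq> \<zero> \<Longrightarrow> rdiv C x y \<in> carrier C"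
  and rdiv_mult: "x \<in> carrier C \<Longrightarrow> y \<in> carrier C \<Longrightarrow> y \<noteq> \<zero> \<Longrightarrow> y \<otimes> rdiv C x y = x"
proof -
  assume x: "x \<in> carrier C" and y: "y \<in> carrier C" "y \<noteq> \<zero>"
  have u: "y \<in> Units C" using y by (simp add: field_Units)
  show "rdiv C x y \<in> carrier C" using x Units_inv_closed[OF u] by (simp add: rdiv_def)
  have "y \<otimes> rdiv C x y = x \<otimes> (y \<otimes> inv y)"
    unfolding rdiv_def using x y(1) Units_inv_closed[OF u] by algebra
  then show "y \<otimes> rdiv C x y = x" using u x by simp
qed

lemma isog_ker_iff:
  assumes "a \<in> carrier C"
  shows "P \<in> isog_ker C a z \<longleftrightarrow> P = Infty \<or> (\<exists>y\<in>carrier C. P = Affine \<zero> y \<and> y \<otimes> y = a)"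
proof (cases P)
  case (Affine x y)
  have "isog C a z (Affine x y) = Infty \<longleftrightarrow> x = \<zero>" by (simp add: Let_def)
  then show ?thesis unfolding Affine isog_ker_def curve_points_def
    using assms by (auto simp: pow2 pow3)
qed (simp add: isog_ker_def curve_points_def)

lemma pt_add_Infty: "pt_add C P Infty = P"
  by (cases P) auto

lemma pt_diff_self: "P = Infty \<or> (\<exists>x y. P = Affine x y \<and> y \<in> carrier C) \<Longrightarrow> pt_diff C P P = Infty"
  by (auto simp: pt_diff_def)

lemma pt_diff_eq_Infty:
  assumes "pt_diff C (Affine x' y') (Affine x y) = Infty" "y \<in> carrier C"
  shows "x' = x" "y' = y"
  using assms by (auto simp: pt_diff_def Let_def split: if_splits)

lemma nat_zero: "[(n::nat)] \<cdot> \<zero> = \<zero>"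
  by (induction n) auto

lemma add_pow_closed: "x \<in> carrier C \<Longrightarrow> [(n::nat)] \<cdot> x \<in> carrier C"
  by (rule add.nat_pow_closed)

lemma twice: "x \<in> carrier C \<Longrightarrow> [(2::nat)] \<cdot> x = x \<oplus> x"
  by (simp add: numeral_2_eq_2)

lemma double_nonzero:
  assumes "y \<in> carrier C" "y \<noteq> \<ominus> y"
  shows "y \<oplus> y \<noteq> \<zero>"
  using assms eq_of_minus_zero[of y "\<ominus> y"] by auto

text \<open>The tangent at a point with abscissa 0 has slope 0, so doubling such a point gives its
  negative: the kernel has order three.\<close>

lemma kernel_add:
  assumes y: "y1 \<in> carrier C" "y2 \<in> carrier C" "y1 \<otimes> y1 = y2 \<otimes> y2"
  shows "pt_add C (Affine \<zero> y1) (Affine \<zero> y2) = (if y1 = \<ominus> y2 then Infty else Affine \<zero> (\<ominus> y1))"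
proof (cases "y1 = \<ominus> y2")
  case False
  then have eq: "y1 = y2" using square_eq_cases[OF y] by simp
  then have nz: "[(2::nat)] \<cdot> y1 \<noteq> \<zero>" using False y(1) double_nonzero by (simp add: twice)
  have "rdiv C ([(3::nat)] \<cdot> (\<zero> [^] (2::nat))) ([(2::nat)] \<cdot> y1) = \<zero>"
    unfolding rdiv_def using nz y(1) add_pow_closed[of y1 2] by (simp add: pow2 nat_zero field_Units)
  then show ?thesis using False y(1) eq by (simp add: Let_def pow2 a_minus_def)
qed simp

text \<open>The points \<open>(x', y')\<close> and \<open>(x, -y)\<close> lie on a line of slope
  \<open>l\<close> whose third intersection with the curve is \<open>(0, -t)\<close>, the negative
  of their sum. The relations are the line equations at the two points and the sum of the abscissas;
  for \<open>x' = x\<close> the line is the tangent.\<close>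

lemma slope_relations:
  assumes c: "x \<in> carrier C" "y \<in> carrier C" "x' \<in> carrier C" "y' \<in> carrier C" "t \<in> carrier C"
    and y: "y \<otimes> y = x \<otimes> (x \<otimes> x) \<oplus> a" "y' \<otimes> y' = x' \<otimes> (x' \<otimes> x') \<oplus> a"
    and d: "pt_diff C (Affine x' y') (Affine x y) = Affine \<zero> t"
  obtains l where "l \<in> carrier C" "l \<otimes> x = t \<oplus> \<ominus> y" "l \<otimes> x' = t \<oplus> y'" "l \<otimes> l = x \<oplus> x'"
proof -
  define l where "l = (if x' = x then rdiv C ([(3::nat)] \<cdot> (x' [^] (2::nat))) ([(2::nat)] \<cdot> y')
                   else rdiv C (\<ominus> y \<ominus> y') (x \<ominus> x'))"
  have ne: "\<not> (x' = x \<and> y' = y)" using d c by (auto simp: pt_diff_def)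
  then have "(l [^] (2::nat) \<ominus> x') \<ominus> x = \<zero> \<and> (l \<otimes> (x' \<ominus> ((l [^] (2::nat) \<ominus> x') \<ominus> x))) \<ominus> y' = t"
    using d c by (auto simp: pt_diff_def Let_def l_def split: if_splits)
  note eqs = conjunct1[OF this] conjunct2[OF this]
  have opp: "y' = \<ominus> y" if "x' = x" using square_eq_cases[of y' y] y that ne c by auto
  have l: "l \<in> carrier C"
  proof (cases "x' = x")
    case True
    have "y' \<noteq> \<ominus> y'" using opp[OF True] ne True c by auto
    then have "[(2::nat)] \<cdot> y' \<noteq> \<zero>" using double_nonzero c by (simp add: twice)
    then show ?thesis unfolding l_def using c True by (auto intro!: rdiv_closed add_pow_closed)
  next
    case False
    then have "x \<ominus> x' \<noteq> \<zero>" using c by auto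
    then show ?thesis unfolding l_def using c False by (auto intro!: rdiv_closed)
  qed
  have l2: "l \<otimes> l = x \<oplus> x'"
  proof -
    have "l \<otimes> l \<oplus> \<ominus> (x \<oplus> x') = (l [^] (2::nat) \<ominus> x') \<ominus> x"
      unfolding pow2[OF l] using l c by algebra
    then show ?thesis using eqs(1) eq_of_minus_zero[of "l \<otimes> l" "x \<oplus> x'"] l c by simp
  qed
  have lx': "l \<otimes> x' = t \<oplus> y'"
  proof -
    have "l \<otimes> x' \<ominus> y' = t" using eqs(2) unfolding eqs(1) using l c by (simp add: a_minus_def)
    then have "t \<oplus> y' = (l \<otimes> x' \<ominus> y') \<oplus> y'" by simp
    also have "\<dots> = l \<otimes> x'" using l c by algebra
    finally show ?thesis ..
  qed
  have lx: "l \<otimes> x = t \<oplus> \<ominus> y"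
  proof (cases "x' = x")
    case True
    then show ?thesis using lx' opp by simp
  next
    case False
    then have "x \<ominus> x' \<noteq> \<zero>" using c by auto
    then have "(x \<ominus> x') \<otimes> l = \<ominus> y \<ominus> y'" unfolding l_def using False c by (simp add: rdiv_mult)
    moreover have "l \<otimes> x = (x \<ominus> x') \<otimes> l \<oplus> l \<otimes> x'" using l c by algebra
    ultimately have "l \<otimes> x = (\<ominus> y \<ominus> y') \<oplus> (t \<oplus> y')" using lx' by simp
    also have "\<dots> = t \<oplus> \<ominus> y" using c by algebra
    finally show ?thesis .
  qed
  show thesis by (rule that[OF l lx lx' l2])
qed

text \<open>Translation by a kernel point multiplies the cube root of \<open>Y - t\<close> by a cube root of unity.\<close>

lemma translation_by_kernel:
  assumes c: "x \<in> carrier C" "y \<in> carrier C" "x' \<in> carrier C" "y' \<in> carrier C" "t \<in> carrier C" "w \<in> carrier C"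
    and x: "x \<noteq> \<zero>"
    and y: "y \<otimes> y = x \<otimes> (x \<otimes> x) \<oplus> t \<otimes> t" "y' \<otimes> y' = x' \<otimes> (x' \<otimes> x') \<oplus> t \<otimes> t"
    and w: "w \<otimes> w = \<ominus> \<one> \<oplus> \<ominus> w"
    and d: "pt_diff C (Affine x' y') (Affine x y) = Affine \<zero> t"
  shows "(w \<otimes> (y' \<oplus> \<ominus> ((w \<otimes> w \<oplus> \<ominus> w) \<otimes> t))) \<otimes> x = (y \<oplus> \<ominus> ((w \<otimes> w \<oplus> \<ominus> w) \<otimes> t)) \<otimes> x'"
proof -
  obtain l where l: "l \<in> carrier C" "l \<otimes> x = t \<oplus> \<ominus> y" "l \<otimes> x' = t \<oplus> y'" "l \<otimes> l = x \<oplus> x'"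
    by (rule slope_relations[OF c(1-5) y d])
  have y_eq: "y = t \<oplus> \<ominus> (l \<otimes> x)" unfolding l(2) using c by algebra
  have y'_eq: "y' = l \<otimes> x' \<oplus> \<ominus> t" unfolding l(3) using c by algebra
  \<comment> \<open>Substituting \<open>y = t - l * x\<close> into the curve and cancelling
    \<open>x\<close> gives \<open>x * x = l * l * x - 2 * t * l\<close>; with
    \<open>l * l = x + x'\<close> this is the product of the abscissas.\<close>
  have xx': "x \<otimes> x' = (t \<oplus> t) \<otimes> l"
  proof -
    have "x \<otimes> (x \<otimes> x') = x \<otimes> (x \<otimes> (x \<oplus> x')) \<oplus> \<ominus> (x \<otimes> (x \<otimes> x))" using c by algebra
    also have "\<dots> = x \<otimes> (x \<otimes> (l \<otimes> l)) \<oplus> \<ominus> (x \<otimes> (x \<otimes> x) \<oplus> t \<otimes> t) \<oplus> t \<otimes> t"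
      unfolding l(4) using c by algebra
    also have "\<dots> = x \<otimes> (x \<otimes> (l \<otimes> l)) \<oplus> \<ominus> ((t \<oplus> \<ominus> (l \<otimes> x)) \<otimes> (t \<oplus> \<ominus> (l \<otimes> x))) \<oplus> t \<otimes> t"
      unfolding y(1)[symmetric] y_eq[symmetric] ..
    also have "\<dots> = x \<otimes> ((t \<oplus> t) \<otimes> l)" using c l(1) by algebra
    finally have "x \<otimes> (x \<otimes> x') = x \<otimes> ((t \<oplus> t) \<otimes> l)" .
    then show ?thesis using m_lcancel[OF x, of "x \<otimes> x'" "(t \<oplus> t) \<otimes> l"] c l(1) by simp
  qed
  \<comment> \<open>The element \<open>1 + 2 w\<close> is a square root of -3, and
    \<open>w^2 - w\<close> is its negative.\<close>
  let ?u = "\<one> \<oplus> w \<oplus> w"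
  have alpha: "w \<otimes> w \<oplus> \<ominus> w = \<ominus> ?u" unfolding w using c by algebra
  have w2: "w \<otimes> (w \<otimes> v) = \<ominus> v \<oplus> \<ominus> (w \<otimes> v)" if "v \<in> carrier C" for v
  proof -
    have "w \<otimes> (w \<otimes> v) = (w \<otimes> w) \<otimes> v" using c that by algebra
    also have "\<dots> = \<ominus> v \<oplus> \<ominus> (w \<otimes> v)" unfolding w using c that by algebra
    finally show ?thesis .
  qed
  have x'_eq: "x' = l \<otimes> l \<oplus> \<ominus> x" unfolding l(4) using c by algebra
  have "(w \<otimes> (y' \<oplus> \<ominus> (\<ominus> ?u \<otimes> t))) \<otimes> x = w \<otimes> (l \<otimes> (x \<otimes> x')) \<oplus> w \<otimes> (w \<otimes> ((t \<oplus> t) \<otimes> x))"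
    unfolding y'_eq using c l(1) by algebra
  also have "\<dots> = w \<otimes> (l \<otimes> ((t \<oplus> t) \<otimes> l)) \<oplus> (\<ominus> ((t \<oplus> t) \<otimes> x) \<oplus> \<ominus> (w \<otimes> ((t \<oplus> t) \<otimes> x)))"
    unfolding xx' using w2[of "(t \<oplus> t) \<otimes> x"] c by simp
  also have "\<dots> = (\<one> \<oplus> w) \<otimes> ((t \<oplus> t) \<otimes> (l \<otimes> l \<oplus> \<ominus> x)) \<oplus> \<ominus> (l \<otimes> ((t \<oplus> t) \<otimes> l))"
  proof -
    have *: "w \<otimes> (l \<otimes> (u \<otimes> l)) \<oplus> (\<ominus> (u \<otimes> x) \<oplus> \<ominus> (w \<otimes> (u \<otimes> x)))
        = (\<one> \<oplus> w) \<otimes> (u \<otimes> (l \<otimes> l \<oplus> \<ominus> x)) \<oplus> \<ominus> (l \<otimes> (u \<otimes> l))" if "u \<in> carrier C" for u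
      using c l(1) that by algebra
    show ?thesis by (rule *) (use c in simp)
  qed
  also have "\<dots> = (\<one> \<oplus> w) \<otimes> ((t \<oplus> t) \<otimes> x') \<oplus> \<ominus> (l \<otimes> (x \<otimes> x'))"
    unfolding xx' x'_eq[symmetric] ..
  also have "\<dots> = ((t \<oplus> \<ominus> (l \<otimes> x)) \<oplus> \<ominus> (\<ominus> ?u \<otimes> t)) \<otimes> x'"
    using c l(1) by algebra
  finally show ?thesis unfolding alpha y_eq[symmetric] .
qed

text \<open>The preimages of \<open>(0, t)\<close> under the isogeny are the points with
  \<open>x^3 = - 4 t^2\<close> and \<open>y = (z^2 - z) t\<close>, and the kernel lies over
  infinity. The function \<open>(y - (z^2 - z) t) / x\<close> vanishes simply at these preimages and
  has simple poles at the kernel, so its cube has the divisor of the pullback of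
  \<open>Y - t\<close>; the factor \<open>1 - z\<close> adjusts the constant.\<close>

lemma isog_cube:
  assumes c: "x \<in> carrier C" "y \<in> carrier C" "t \<in> carrier C" "z \<in> carrier C" and x: "x \<noteq> \<zero>"
    and y: "y \<otimes> y = x \<otimes> (x \<otimes> x) \<oplus> t \<otimes> t"
    and z: "z \<otimes> z = \<ominus> \<one> \<oplus> \<ominus> z" "\<one> \<ominus> z \<noteq> \<zero>"
    and P: "isog C (t \<otimes> t) z (Affine x y) = Affine u v"
    and g: "g = rdiv C (y \<oplus> \<ominus> ((z \<otimes> z \<oplus> \<ominus> z) \<otimes> t)) ((\<one> \<ominus> z) \<otimes> x)"
  shows "g \<otimes> (g \<otimes> g) = v \<oplus> \<ominus> t" "g \<in> carrier C"
proof -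
  define p where "p = \<one> \<ominus> z"
  define al where "al = z \<otimes> z \<oplus> \<ominus> z"
  define q where "q = p \<otimes> x"
  define n where "n = y \<oplus> \<ominus> (al \<otimes> t)"
  have pc: "p \<in> carrier C" "al \<in> carrier C" "n \<in> carrier C" "q \<in> carrier C"
    using c by (auto simp: p_def al_def n_def q_def)
  have p0: "p \<noteq> \<zero>" using z(2) by (simp add: p_def)
  have q0: "q \<noteq> \<zero>" using x p0 c pc integral_iff by (simp add: q_def)
  have g': "g = rdiv C n q" unfolding g n_def q_def p_def al_def ..
  show gc: "g \<in> carrier C" unfolding g' by (rule rdiv_closed[OF pc(3,4) q0])
  have qg: "q \<otimes> g = n" unfolding g' by (rule rdiv_mult[OF pc(3,4) q0])
  define d where "d = q \<otimes> (q \<otimes> q)"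
  define m where "m = y \<otimes> (x [^] (3::nat) \<ominus> [(8::nat)] \<cdot> (t \<otimes> t))"
  have d_eq: "p [^] (3::nat) \<otimes> x [^] (3::nat) = d"
    unfolding d_def q_def pow3[OF pc(1)] pow3[OF c(1)] using pc c by (simp add: m_ac)
  have v: "v = rdiv C m d" using P x unfolding d_eq[symmetric] m_def p_def by (simp add: Let_def)
  have d0: "d \<noteq> \<zero>" unfolding d_def using q0 pc integral_iff by simp
  have dc: "d \<in> carrier C" and mc: "m \<in> carrier C"
    using c pc by (auto simp: d_def m_def intro: add_pow_closed)
  have vc: "v \<in> carrier C" unfolding v by (rule rdiv_closed[OF mc dc d0])
  have dv: "d \<otimes> v = m" unfolding v by (rule rdiv_mult[OF mc dc d0])
  have al: "al = \<ominus> (\<one> \<oplus> z \<oplus> z)" unfolding al_def z(1) using c by algebra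
  have al2: "al \<otimes> al = \<ominus> (\<one> \<oplus> \<one> \<oplus> \<one>)"
  proof -
    have "al \<otimes> al = \<one> \<oplus> (z \<oplus> z \<oplus> z \<oplus> z) \<oplus> (z \<otimes> z \<oplus> z \<otimes> z \<oplus> z \<otimes> z \<oplus> z \<otimes> z)"
      unfolding al using c by algebra
    also have "\<dots> = \<ominus> (\<one> \<oplus> \<one> \<oplus> \<one>)" unfolding z(1) using c by algebra
    finally show ?thesis .
  qed
  define b where "b = al \<oplus> al \<oplus> al"
  have bc: "b \<in> carrier C" using pc by (simp add: b_def)
  \<comment> \<open>\<open>p^3\<close> equals \<open>3 (z^2 - z)\<close>, so the constant of the
    isogeny is the coefficient \<open>b\<close> that appears when \<open>y - al * t\<close> is
    cubed.\<close>
  have p3: "p \<otimes> (p \<otimes> p) = b"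
  proof -
    have "p \<otimes> p = \<one> \<oplus> \<ominus> z \<oplus> \<ominus> z \<oplus> z \<otimes> z" unfolding p_def using c by algebra
    also have "\<dots> = \<ominus> (z \<oplus> z \<oplus> z)" unfolding z(1) using c by algebra
    finally have pp: "p \<otimes> p = \<ominus> (z \<oplus> z \<oplus> z)" .
    have "p \<otimes> (p \<otimes> p) = z \<otimes> z \<oplus> z \<otimes> z \<oplus> z \<otimes> z \<oplus> \<ominus> (z \<oplus> z \<oplus> z)"
      unfolding pp unfolding p_def using c by algebra
    also have "\<dots> = b" unfolding b_def al_def using c by algebra
    finally show ?thesis .
  qed
  have x3: "x \<otimes> (x \<otimes> x) = y \<otimes> y \<oplus> \<ominus> (t \<otimes> t)" unfolding y using c by algebra
  define T where "T = t \<otimes> t"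
  have Tc: "T \<in> carrier C" using c by (simp add: T_def)
  have eight: "[(8::nat)] \<cdot> T = T \<oplus> T \<oplus> T \<oplus> T \<oplus> T \<oplus> T \<oplus> T \<oplus> T"
    using Tc by (simp add: eval_nat_numeral)
  have nine: "(al \<otimes> al) \<otimes> w = \<ominus> (w \<oplus> w \<oplus> w)" if "w \<in> carrier C" for w
    unfolding al2 using that by algebra
  \<comment> \<open>With denominators cleared, everything is expressed in \<open>y\<close> and
    \<open>t\<close>. Since \<open>al^2 = -3\<close> and \<open>x^3 = y^2 - t^2\<close>, the cube of
    \<open>y - al * t\<close> is \<open>y (y^2 - 9 t^2) - 3 al (y^2 - t^2) t\<close>; the first term
    is the numerator \<open>m\<close> of \<open>v\<close>, the second is
    \<open>d * t\<close>.\<close>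
  have "d \<otimes> (g \<otimes> (g \<otimes> g)) = (q \<otimes> g) \<otimes> ((q \<otimes> g) \<otimes> (q \<otimes> g))" unfolding d_def using pc gc by (simp add: m_ac)
  also have "\<dots> = n \<otimes> (n \<otimes> n)" unfolding qg ..
  also have "\<dots> = y \<otimes> (y \<otimes> y) \<oplus> \<ominus> (b \<otimes> ((y \<otimes> y) \<otimes> t))
      \<oplus> ((al \<otimes> al) \<otimes> (T \<otimes> y) \<oplus> (al \<otimes> al) \<otimes> (T \<otimes> y) \<oplus> (al \<otimes> al) \<otimes> (T \<otimes> y)) \<oplus> \<ominus> ((al \<otimes> al) \<otimes> (al \<otimes> (T \<otimes> t)))"
  proof -
    have cube: "(y \<oplus> \<ominus> k) \<otimes> ((y \<oplus> \<ominus> k) \<otimes> (y \<oplus> \<ominus> k)) = y \<otimes> (y \<otimes> y) \<oplus> \<ominus> (k \<otimes> (y \<otimes> y) \<oplus> k \<otimes> (y \<otimes> y) \<oplus> k \<otimes> (y \<otimes> y))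
      \<oplus> (k \<otimes> k \<otimes> y \<oplus> k \<otimes> k \<otimes> y \<oplus> k \<otimes> k \<otimes> y) \<oplus> \<ominus> (k \<otimes> k \<otimes> k)" if "k \<in> carrier C" for k
    proof -
      define u where "u = (y \<oplus> \<ominus> k) \<otimes> (y \<oplus> \<ominus> k)"
      have u: "u = y \<otimes> y \<oplus> \<ominus> (k \<otimes> y) \<oplus> \<ominus> (k \<otimes> y) \<oplus> k \<otimes> k"
        unfolding u_def using c(2) that by algebra
      have "u \<in> carrier C" unfolding u_def using c(2) that by simp
      then have "(y \<oplus> \<ominus> k) \<otimes> u = y \<otimes> u \<oplus> \<ominus> (k \<otimes> u)" using c(2) that by algebra
      also have "y \<otimes> u = y \<otimes> (y \<otimes> y) \<oplus> \<ominus> (k \<otimes> (y \<otimes> y)) \<oplus> \<ominus> (k \<otimes> (y \<otimes> y)) \<oplus> k \<otimes> k \<otimes> y"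
        unfolding u using c(2) that by algebra
      also have "k \<otimes> u = k \<otimes> (y \<otimes> y) \<oplus> \<ominus> (k \<otimes> k \<otimes> y) \<oplus> \<ominus> (k \<otimes> k \<otimes> y) \<oplus> k \<otimes> k \<otimes> k"
        unfolding u using c(2) that by algebra
      finally have "(y \<oplus> \<ominus> k) \<otimes> u = y \<otimes> (y \<otimes> y) \<oplus> \<ominus> (k \<otimes> (y \<otimes> y)) \<oplus> \<ominus> (k \<otimes> (y \<otimes> y)) \<oplus> k \<otimes> k \<otimes> y
        \<oplus> \<ominus> (k \<otimes> (y \<otimes> y) \<oplus> \<ominus> (k \<otimes> k \<otimes> y) \<oplus> \<ominus> (k \<otimes> k \<otimes> y) \<oplus> k \<otimes> k \<otimes> k)" .
      moreover have "A \<oplus> \<ominus> B \<oplus> \<ominus> B \<oplus> E \<oplus> \<ominus> (B \<oplus> \<ominus> E \<oplus> \<ominus> E \<oplus> G) = A \<oplus> \<ominus> (B \<oplus> B \<oplus> B) \<oplus> (E \<oplus> E \<oplus> E) \<oplus> \<ominus> G"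
        if "A \<in> carrier C" "B \<in> carrier C" "E \<in> carrier C" "G \<in> carrier C" for A B E G
        using that by algebra
      ultimately show ?thesis unfolding u_def using c(2) that by simp
    qed
    have "al \<otimes> t \<otimes> (y \<otimes> y) \<oplus> al \<otimes> t \<otimes> (y \<otimes> y) \<oplus> al \<otimes> t \<otimes> (y \<otimes> y) = b \<otimes> ((y \<otimes> y) \<otimes> t)"
      unfolding b_def using c pc(2) by algebra
    moreover have "al \<otimes> t \<otimes> (al \<otimes> t) \<otimes> y = (al \<otimes> al) \<otimes> (T \<otimes> y)"
      unfolding T_def using c pc(2) by (simp add: m_ac)
    moreover have "al \<otimes> t \<otimes> (al \<otimes> t) \<otimes> (al \<otimes> t) = (al \<otimes> al) \<otimes> (al \<otimes> (T \<otimes> t))"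
      unfolding T_def using c pc(2) by (simp add: m_ac)
    ultimately show ?thesis unfolding n_def using cube[of "al \<otimes> t"] c pc(2) by simp
  qed
  also have "\<dots> = y \<otimes> (y \<otimes> y) \<oplus> \<ominus> (b \<otimes> ((y \<otimes> y) \<otimes> t))
      \<oplus> (\<ominus> (T \<otimes> y \<oplus> T \<otimes> y \<oplus> T \<otimes> y) \<oplus> \<ominus> (T \<otimes> y \<oplus> T \<otimes> y \<oplus> T \<otimes> y) \<oplus> \<ominus> (T \<otimes> y \<oplus> T \<otimes> y \<oplus> T \<otimes> y))
      \<oplus> b \<otimes> (T \<otimes> t)"
  proof -
    have "al \<otimes> (T \<otimes> t) \<oplus> al \<otimes> (T \<otimes> t) \<oplus> al \<otimes> (T \<otimes> t) = b \<otimes> (T \<otimes> t)"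
      unfolding b_def using c pc(2) Tc by algebra
    then show ?thesis
      unfolding nine[OF m_closed[OF Tc c(2)]] nine[OF m_closed[OF pc(2) m_closed[OF Tc c(3)]]]
      using bc Tc c(3) by simp
  qed
  also have "\<dots> = y \<otimes> ((y \<otimes> y \<oplus> \<ominus> T) \<ominus> (T \<oplus> T \<oplus> T \<oplus> T \<oplus> T \<oplus> T \<oplus> T \<oplus> T))
      \<oplus> \<ominus> (b \<otimes> (y \<otimes> y \<oplus> \<ominus> T) \<otimes> t)"
  proof -
    have "y \<otimes> ((y \<otimes> y \<oplus> \<ominus> T) \<ominus> (T \<oplus> T \<oplus> T \<oplus> T \<oplus> T \<oplus> T \<oplus> T \<oplus> T))
      = y \<otimes> (y \<otimes> y) \<oplus> (\<ominus> (T \<otimes> y \<oplus> T \<otimes> y \<oplus> T \<otimes> y) \<oplus> \<ominus> (T \<otimes> y \<oplus> T \<otimes> y \<oplus> T \<otimes> y) \<oplus> \<ominus> (T \<otimes> y \<oplus> T \<otimes> y \<oplus> T \<otimes> y))"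
    proof -
      have 1: "y \<otimes> ((y \<otimes> y \<oplus> \<ominus> T) \<ominus> E) = y \<otimes> (y \<otimes> y) \<oplus> (\<ominus> (T \<otimes> y) \<oplus> \<ominus> (E \<otimes> y))" if "E \<in> carrier C" for E
        using c(2) Tc that by algebra
      have 2: "(T \<oplus> T \<oplus> T \<oplus> T \<oplus> T \<oplus> T \<oplus> T \<oplus> T) \<otimes> y
        = T \<otimes> y \<oplus> T \<otimes> y \<oplus> T \<otimes> y \<oplus> T \<otimes> y \<oplus> T \<otimes> y \<oplus> T \<otimes> y \<oplus> T \<otimes> y \<oplus> T \<otimes> y"
        using c(2) Tc by (simp add: l_distr)
      have 3: "\<ominus> V \<oplus> \<ominus> (V \<oplus> V \<oplus> V \<oplus> V \<oplus> V \<oplus> V \<oplus> V \<oplus> V)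
        = \<ominus> (V \<oplus> V \<oplus> V) \<oplus> \<ominus> (V \<oplus> V \<oplus> V) \<oplus> \<ominus> (V \<oplus> V \<oplus> V)" if "V \<in> carrier C" for V
        using that by (simp add: minus_add a_assoc)
      show ?thesis using 1[of "T \<oplus> T \<oplus> T \<oplus> T \<oplus> T \<oplus> T \<oplus> T \<oplus> T"] 3[of "T \<otimes> y"] c(2) Tc unfolding 2 by simp
    qed
    moreover have "b \<otimes> (y \<otimes> y \<oplus> \<ominus> T) \<otimes> t = b \<otimes> ((y \<otimes> y) \<otimes> t) \<oplus> \<ominus> (b \<otimes> (T \<otimes> t))"
      using c Tc bc by algebra
    moreover have "A \<oplus> \<ominus> B \<oplus> W \<oplus> V = A \<oplus> W \<oplus> \<ominus> (B \<oplus> \<ominus> V)"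
      if "A \<in> carrier C" "B \<in> carrier C" "W \<in> carrier C" "V \<in> carrier C" for A B W V
      using that by algebra
    ultimately show ?thesis using c Tc bc by simp
  qed
  also have "\<dots> = m \<oplus> \<ominus> (d \<otimes> t)"
  proof -
    have "m = y \<otimes> ((y \<otimes> y \<oplus> \<ominus> T) \<ominus> (T \<oplus> T \<oplus> T \<oplus> T \<oplus> T \<oplus> T \<oplus> T \<oplus> T))"
      unfolding m_def pow3[OF c(1)] x3 T_def[symmetric] eight by (rule refl)
    moreover have "d = b \<otimes> (y \<otimes> y \<oplus> \<ominus> T)"
      unfolding d_eq[symmetric] pow3[OF pc(1)] pow3[OF c(1)] p3 x3 T_def by (rule refl)
    ultimately show ?thesis by simp
  qed
  also have "\<dots> = d \<otimes> (v \<oplus> \<ominus> t)" unfolding dv[symmetric] using dc vc c by algebra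
  finally have "d \<otimes> (g \<otimes> (g \<otimes> g)) = d \<otimes> (v \<oplus> \<ominus> t)" .
  then show "g \<otimes> (g \<otimes> g) = v \<oplus> \<ominus> t"
    using m_lcancel[OF d0 dc, of "g \<otimes> (g \<otimes> g)" "v \<oplus> \<ominus> t"] gc vc c by simp
qed

end


section \<open>The local condition\<close>

lemma Kbar_simps [simp]:
  "carrier Kbar = {x. algebraic x}" "x \<otimes>\<^bsub>Kbar\<^esub> y = x * y" "x \<oplus>\<^bsub>Kbar\<^esub> y = x + y"
  "\<zero>\<^bsub>Kbar\<^esub> = 0" "\<one>\<^bsub>Kbar\<^esub> = 1"
  by (simp_all add: Kbar_def)

lemma Kbar_field: "field Kbar"
proof (rule cring.cring_fieldI)
  show cr: "cring Kbar"
  proof (intro cringI abelian_groupI comm_monoidI)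
    fix x assume "x \<in> carrier Kbar"
    then show "\<exists>y\<in>carrier Kbar. y \<oplus>\<^bsub>Kbar\<^esub> x = \<zero>\<^bsub>Kbar\<^esub>" by (intro bexI[of _ "- x"]) auto
  qed (auto simp: algebra_simps intro: algebraic_add algebraic_mult)
  show "Units Kbar = carrier Kbar - {\<zero>\<^bsub>Kbar\<^esub>}"
  proof
    show "Units Kbar \<subseteq> carrier Kbar - {\<zero>\<^bsub>Kbar\<^esub>}" by (auto simp: Units_def)
    show "carrier Kbar - {\<zero>\<^bsub>Kbar\<^esub>} \<subseteq> Units Kbar"
    proof
      fix x assume x: "x \<in> carrier Kbar - {\<zero>\<^bsub>Kbar\<^esub>}"
      then have "algebraic (inverse x)" by auto
      with x show "x \<in> Units Kbar" unfolding Units_def by (auto intro!: exI[of _ "inverse x"])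
    qed
  qed
qed

lemma Kbar_plain: "plain_field Kbar"
  by (rule plain_field.intro[OF Kbar_field])

lemma Kbar_ring: "ring Kbar"
  using Kbar_field by (intro cring.axioms(1) domain.axioms(1) field.axioms(1))

lemma Kbar_minus: "algebraic x \<Longrightarrow> \<ominus>\<^bsub>Kbar\<^esub> x = - x"
  using abelian_group.minus_equality[OF ring.is_abelian_group[OF Kbar_ring], of "- x" x] by simp

lemma Kbar_ker_iff:
  assumes "algebraic a"
  shows "P \<in> isog_ker Kbar a z \<longleftrightarrow> P = Infty \<or> (\<exists>y. algebraic y \<and> P = Affine 0 y \<and> y * y = a)"
  using plain_field.isog_ker_iff[OF Kbar_plain, of a P z] assms by auto

section \<open>Restriction of automorphisms and cocycles to the completion\<close>

locale local_embedding = prime_ideal +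
  fixes i :: "complex \<Rightarrow> local_elem"
  assumes embedding: "i \<in> closure_embeddings F Q"
begin

abbreviation LC where "LC \<equiv> local_closure F Q"
abbreviation LF where "LF \<equiv> local_field F Q"
abbreviation iota where "iota \<equiv> ring.indexed_const Kq"

lemma LC_closure: "algebraic_closure LC LF" and iota_hom: "iota \<in> Ring.ring_hom Kq LC"
  unfolding local_closure_def local_field_def using Kq.alg_closureE by simp_all

sublocale LC: algebraic_closure LC LF by (rule LC_closure)

sublocale LC: plain_field LC by (rule plain_field.intro[OF LC.field_axioms])

lemma iota_closed: "c \<in> carrier Kq \<Longrightarrow> iota c \<in> carrier LC"
  and iota_add: "c \<in> carrier Kq \<Longrightarrow> d \<in> carrier Kq \<Longrightarrow> iota (c \<oplus>\<^bsub>Kq\<^esub> d) = iota c \<oplus>\<^bsub>LC\<^esub> iota d"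
  and iota_mult: "c \<in> carrier Kq \<Longrightarrow> d \<in> carrier Kq \<Longrightarrow> iota (c \<otimes>\<^bsub>Kq\<^esub> d) = iota c \<otimes>\<^bsub>LC\<^esub> iota d"
  using ring_hom_closed[OF iota_hom] ring_hom_add[OF iota_hom] ring_hom_mult[OF iota_hom] by simp_all

lemma iota_inj: "c \<in> carrier Kq \<Longrightarrow> d \<in> carrier Kq \<Longrightarrow> iota c = iota d \<Longrightarrow> c = d"
  using Kq.indexed_const_inj_on by (auto dest: inj_onD)

lemma iota_LF: "c \<in> carrier Kq \<Longrightarrow> iota c \<in> LF"
  by (simp add: local_field_def)

lemma LF_iota:
  assumes "x \<in> LF"
  obtains c where "c \<in> carrier Kq" "x = iota c"
  using assms unfolding local_field_def by blast

lemma i_hom: "i \<in> Ring.ring_hom Kbar LC" and i_F: "x \<in> F \<Longrightarrow> i x = to_local F Q x"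
  using embedding by (auto simp: closure_embeddings_def)

sublocale i: ring_hom_ring Kbar LC i
  by (rule ring_hom_ringI2[OF Kbar_ring LC.ring_axioms i_hom])

lemma i_F_iota: "x \<in> F \<Longrightarrow> i x = iota (to_completion F Q x)"
  by (simp add: i_F to_local_def)

lemma i_F_mem: "x \<in> F \<Longrightarrow> i x \<in> LF"
  by (simp add: i_F_iota iota_LF to_completion_mem)

lemma i_closed: "algebraic x \<Longrightarrow> i x \<in> carrier LC"
  and i_add: "algebraic x \<Longrightarrow> algebraic y \<Longrightarrow> i (x + y) = i x \<oplus>\<^bsub>LC\<^esub> i y"
  and i_mult: "algebraic x \<Longrightarrow> algebraic y \<Longrightarrow> i (x * y) = i x \<otimes>\<^bsub>LC\<^esub> i y"
  using i.hom_closed[of x] i.hom_add[of x y] i.hom_mult[of x y] by auto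

lemma i_zero: "i 0 = \<zero>\<^bsub>LC\<^esub>" and i_one: "i 1 = \<one>\<^bsub>LC\<^esub>"
  using i.hom_zero i.hom_one by auto

lemma i_minus: "algebraic x \<Longrightarrow> i (- x) = \<ominus>\<^bsub>LC\<^esub> i x"
  using i.hom_a_inv[of x] by (simp add: Kbar_minus)

lemma i_inj:
  assumes "algebraic x" "algebraic y" "i x = i y"
  shows "x = y"
proof -
  have "inj_on i (carrier Kbar)"
  proof (rule i.non_trivial_field_hom_imp_inj[OF Kbar_field])
    have "i 1 \<in> i ` carrier Kbar" by simp
    then have "\<one>\<^bsub>LC\<^esub> \<in> i ` carrier Kbar" unfolding i_one .
    then show "i ` carrier Kbar \<noteq> {\<zero>\<^bsub>LC\<^esub>}" using LC.one_not_zero by blast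
  qed
  then show ?thesis using assms by (auto dest: inj_onD)
qed

definition ieval :: "complex poly \<Rightarrow> local_elem \<Rightarrow> local_elem" where
  "ieval f y = LC.horner (map i (coeffs f)) y"

lemma ieval_0: "ieval 0 y = \<zero>\<^bsub>LC\<^esub>"
  by (simp add: ieval_def)

lemma ieval_pCons: "y \<in> carrier LC \<Longrightarrow> ieval (pCons c f) y = i c \<oplus>\<^bsub>LC\<^esub> y \<otimes>\<^bsub>LC\<^esub> ieval f y"
  by (auto simp: ieval_def cCons_def i_zero)

definition alg_coeffs :: "complex poly \<Rightarrow> bool" where
  "alg_coeffs f \<longleftrightarrow> (\<forall>n. algebraic (coeff f n))"

lemma alg_coeffs_pCons: "alg_coeffs (pCons c f) \<longleftrightarrow> algebraic c \<and> alg_coeffs f"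
  unfolding alg_coeffs_def by (metis coeff_pCons_0 coeff_pCons_Suc not0_implies_Suc)

lemma alg_coeffs_poly: "alg_coeffs f \<Longrightarrow> algebraic x \<Longrightarrow> algebraic (poly f x)"
  by (induction f) (auto simp: alg_coeffs_pCons intro: algebraic_add algebraic_mult)

lemma alg_coeffs_synthetic_div: "alg_coeffs f \<Longrightarrow> algebraic x \<Longrightarrow> alg_coeffs (synthetic_div f x)"
proof (induction f)
  case 0
  show ?case by (simp add: alg_coeffs_def)
qed (simp add: alg_coeffs_pCons alg_coeffs_poly)

lemma ieval_closed: "alg_coeffs f \<Longrightarrow> y \<in> carrier LC \<Longrightarrow> ieval f y \<in> carrier LC"
  by (induction f) (auto simp: ieval_0 ieval_pCons alg_coeffs_pCons i_closed)

lemma ieval_i: "alg_coeffs f \<Longrightarrow> algebraic x \<Longrightarrow> ieval f (i x) = i (poly f x)"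
  by (induction f)
    (auto simp: ieval_0 ieval_pCons alg_coeffs_pCons i_closed i_zero i_add i_mult alg_coeffs_poly algebraic_mult)

lemma ieval_synthetic_div:
  assumes "alg_coeffs f" "algebraic x" "y \<in> carrier LC"
  shows "ieval f y = (y \<oplus>\<^bsub>LC\<^esub> \<ominus>\<^bsub>LC\<^esub> i x) \<otimes>\<^bsub>LC\<^esub> ieval (synthetic_div f x) y \<oplus>\<^bsub>LC\<^esub> i (poly f x)"
  using assms(1)
proof (induction f)
  case 0
  show ?case using assms by (simp add: ieval_0 i_zero i_closed)
next
  case (pCons c f)
  have f: "alg_coeffs f" "algebraic c" using pCons.prems by (auto simp: alg_coeffs_pCons)
  let ?S = "ieval (synthetic_div f x) y" and ?P = "i (poly f x)" and ?x = "i x" and ?c = "i c"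
  have cl: "?S \<in> carrier LC" "?P \<in> carrier LC" "?x \<in> carrier LC" "?c \<in> carrier LC"
    using f assms by (auto intro!: ieval_closed i_closed alg_coeffs_synthetic_div alg_coeffs_poly)
  have ip: "i (c + x * poly f x) = ?c \<oplus>\<^bsub>LC\<^esub> ?x \<otimes>\<^bsub>LC\<^esub> ?P"
    using f assms by (simp add: i_add i_mult alg_coeffs_poly algebraic_mult)
  have "ieval (pCons c f) y = ?c \<oplus>\<^bsub>LC\<^esub> y \<otimes>\<^bsub>LC\<^esub> ((y \<oplus>\<^bsub>LC\<^esub> \<ominus>\<^bsub>LC\<^esub> ?x) \<otimes>\<^bsub>LC\<^esub> ?S \<oplus>\<^bsub>LC\<^esub> ?P)"
    using pCons.IH f assms by (simp add: ieval_pCons)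
  also have "\<dots> = (y \<oplus>\<^bsub>LC\<^esub> \<ominus>\<^bsub>LC\<^esub> ?x) \<otimes>\<^bsub>LC\<^esub> (?P \<oplus>\<^bsub>LC\<^esub> y \<otimes>\<^bsub>LC\<^esub> ?S) \<oplus>\<^bsub>LC\<^esub> (?c \<oplus>\<^bsub>LC\<^esub> ?x \<otimes>\<^bsub>LC\<^esub> ?P)"
    using cl assms(3) by algebra
  finally show ?case using assms(3) ip by (simp add: ieval_pCons)
qed

text \<open>The polynomial splits into linear factors over the complex numbers, with algebraic roots
  by hypothesis. Transporting one factor at a time through \<open>i\<close> shows that no further
  roots appear in the local closure.\<close>

lemma ieval_root:
  assumes "f \<noteq> 0" "alg_coeffs f" "\<And>x. poly f x = 0 \<Longrightarrow> algebraic x" "y \<in> carrier LC" "ieval f y = \<zero>\<^bsub>LC\<^esub>"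
  shows "\<exists>x. algebraic x \<and> y = i x"
  using assms(1-3,5)
proof (induction "degree f" arbitrary: f rule: less_induct)
  case less
  show ?case
  proof (cases "degree f = 0")
    case True
    then obtain c where c: "f = [:c:]" by (metis degree_eq_zeroE)
    have "algebraic c" using less.prems(2) by (simp add: c alg_coeffs_pCons)
    then have "i c = i 0" using less.prems(4) assms(4) by (simp add: c ieval_pCons ieval_0 i_closed i_zero)
    then have "c = 0" using i_inj \<open>algebraic c\<close> by simp
    then show ?thesis using less.prems(1) c by simp
  next
    case False
    then have "\<not> constant (poly f)" by (simp add: constant_degree)
    then obtain x where x: "poly f x = 0" using fundamental_theorem_of_algebra by blast
    have ax: "algebraic x" using less.prems(3) x .
    let ?g = "synthetic_div f x"
    have fg: "f = [:- x, 1:] * ?g" using synthetic_div_correct'[of x f] x by simp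
    have g: "?g \<noteq> 0" using fg less.prems(1) by auto
    have ga: "alg_coeffs ?g" using alg_coeffs_synthetic_div less.prems(2) ax by blast
    have gy: "ieval ?g y \<in> carrier LC" by (rule ieval_closed[OF ga assms(4)])
    have "(y \<oplus>\<^bsub>LC\<^esub> \<ominus>\<^bsub>LC\<^esub> i x) \<otimes>\<^bsub>LC\<^esub> ieval ?g y = \<zero>\<^bsub>LC\<^esub>"
      using ieval_synthetic_div[OF less.prems(2) ax assms(4)] less.prems(4) x gy assms(4) i_closed[OF ax]
      by (simp add: i_zero)
    then consider "y \<oplus>\<^bsub>LC\<^esub> \<ominus>\<^bsub>LC\<^esub> i x = \<zero>\<^bsub>LC\<^esub>" | "ieval ?g y = \<zero>\<^bsub>LC\<^esub>"
      using LC.integral gy assms(4) i_closed[OF ax] by auto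
    then show ?thesis
    proof cases
      case 1
      then show ?thesis using LC.eq_of_minus_zero[OF assms(4) i_closed[OF ax]] ax by blast
    next
      case 2
      have "degree ?g < degree f" using False by (simp add: degree_synthetic_div)
      moreover have "algebraic x'" if "poly ?g x' = 0" for x'
      proof (rule less.prems(3))
        show "poly f x' = 0" using that by (subst fg) simp
      qed
      ultimately show ?thesis using less.hyps[OF _ g ga _ 2] by blast
    qed
  qed
qed

lemma galD:
  assumes "s \<in> gal LC LF"
  shows "x \<in> carrier LC \<Longrightarrow> s x \<in> carrier LC"
    and "x \<in> carrier LC \<Longrightarrow> y \<in> carrier LC \<Longrightarrow> s (x \<oplus>\<^bsub>LC\<^esub> y) = s x \<oplus>\<^bsub>LC\<^esub> s y"
    and "x \<in> carrier LC \<Longrightarrow> y \<in> carrier LC \<Longrightarrow> s (x \<otimes>\<^bsub>LC\<^esub> y) = s x \<otimes>\<^bsub>LC\<^esub> s y"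
    and "x \<in> LF \<Longrightarrow> s x = x"
    and "inj_on s (carrier LC)" and "s \<in> extensional (carrier LC)"
    and "s ` carrier LC = carrier LC"
    and "s \<in> Ring.ring_hom LC LC"
  using assms unfolding gal_def ring_iso_def Ring.ring_hom_def bij_betw_def by auto

lemma LF_zero: "\<zero>\<^bsub>LC\<^esub> \<in> LF" and LF_one: "\<one>\<^bsub>LC\<^esub> \<in> LF"
  using i_F_mem[of 0] i_F_mem[of 1] by (auto simp: i_zero i_one)

lemma gal_ieval:
  assumes s: "s \<in> gal LC LF" and f: "\<And>n. coeff f n \<in> \<int>" and y: "y \<in> carrier LC"
  shows "s (ieval f y) = ieval f (s y)"
  using f
proof (induction f)
  case 0
  show ?case using galD(4)[OF s LF_zero] by (simp add: ieval_0)
next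
  case (pCons c f)
  have c: "c \<in> \<int>" using pCons.prems[of 0] by simp
  have fi: "\<And>n. coeff f n \<in> \<int>" using pCons.prems[of "Suc _"] by simp
  then have fa: "alg_coeffs f" unfolding alg_coeffs_def using int_imp_algebraic_int by blast
  have "c \<in> F" using c by (auto elim: Ints_cases)
  then have "i c \<in> LF" "i c \<in> carrier LC" using i_F_mem algebraic_mem i_closed by auto
  then show ?case using pCons.IH[OF fi] galD[OF s] y ieval_closed[OF fa y] by (simp add: ieval_pCons)
qed

text \<open>A local automorphism permutes the roots of an integer polynomial, and all of these come
  from algebraic numbers. Hence the image of \<open>i\<close> is stable, and the inverse in
  \<open>restrict_auto\<close> is a true inverse there.\<close>

lemma gal_i:
  assumes s: "s \<in> gal LC LF" and x: "algebraic x"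
  shows "\<exists>x'. algebraic x' \<and> s (i x) = i x'"
proof -
  obtain f where f: "\<And>n. coeff f n \<in> \<int>" "f \<noteq> 0" "poly f x = 0" using x by (elim algebraicE) blast
  have fa: "alg_coeffs f" unfolding alg_coeffs_def using f(1) int_imp_algebraic_int by blast
  have "s (ieval f (i x)) = ieval f (s (i x))" by (rule gal_ieval[OF s f(1) i_closed[OF x]])
  moreover have "s (ieval f (i x)) = \<zero>\<^bsub>LC\<^esub>"
    using ieval_i[OF fa x] f(3) galD(4)[OF s LF_zero] by (simp add: i_zero)
  ultimately have "ieval f (s (i x)) = \<zero>\<^bsub>LC\<^esub>" by simp
  moreover have "algebraic w" if "poly f w = 0" for w using f(1,2) that by (intro algebraicI)
  ultimately show ?thesis using ieval_root[OF f(2) fa _ galD(1)[OF s i_closed[OF x]]] by blast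
qed

lemma restrict_auto:
  assumes s: "s \<in> gal LC LF" and x: "algebraic x"
  shows "algebraic (restrict_auto i s x)" "i (restrict_auto i s x) = s (i x)"
proof -
  obtain x' where "algebraic x'" "s (i x) = i x'" using gal_i[OF s x] by blast
  then have "s (i x) \<in> i ` carrier Kbar" by auto
  from inv_into_into[OF this] f_inv_into_f[OF this]
  show "algebraic (restrict_auto i s x)" "i (restrict_auto i s x) = s (i x)"
    using x by (auto simp: restrict_auto_def)
qed

lemma restrict_auto_eqI:
  assumes "s \<in> gal LC LF" "algebraic x" "algebraic y" "i y = s (i x)"
  shows "restrict_auto i s x = y"
  using i_inj[of "restrict_auto i s x" y] restrict_auto[OF assms(1,2)] assms(3,4) by simp

lemma restrict_auto_gal:
  assumes s: "s \<in> gal LC LF"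
  shows "restrict_auto i s \<in> gal Kbar F"
proof -
  let ?s = "restrict_auto i s"
  note rs = restrict_auto[OF s]
  have add: "?s (x + y) = ?s x + ?s y" if "algebraic x" "algebraic y" for x y
    using that by (intro restrict_auto_eqI[OF s]) (auto simp: rs i_add galD[OF s] i_closed intro: algebraic_add)
  have mult: "?s (x * y) = ?s x * ?s y" if "algebraic x" "algebraic y" for x y
    using that by (intro restrict_auto_eqI[OF s]) (auto simp: rs i_mult galD[OF s] i_closed intro: algebraic_mult)
  have fixF: "?s x = x" if "x \<in> F" for x
    using that algebraic_mem[OF that] by (intro restrict_auto_eqI[OF s]) (auto simp: galD(4)[OF s] i_F_mem)
  have hom: "?s \<in> Ring.ring_hom Kbar Kbar"
    by (rule ring_hom_memI) (use add mult fixF[OF one_mem] rs in auto)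
  have inj: "inj_on ?s (carrier Kbar)"
  proof (rule inj_onI)
    fix x y assume x: "x \<in> carrier Kbar" and y: "y \<in> carrier Kbar" and eq: "?s x = ?s y"
    then have "s (i x) = s (i y)" using rs(2)[of x] rs(2)[of y] by simp
    then have "i x = i y" using galD(5)[OF s] x y i_closed by (auto dest!: inj_onD)
    then show "x = y" using i_inj x y by simp
  qed
  \<comment> \<open>The restricted map sends the finite root set of an integer polynomial of
    \<open>b\<close> injectively into itself.\<close>
  have surj: "b \<in> ?s ` carrier Kbar" if b: "algebraic b" for b
  proof -
    obtain f where f: "\<And>n. coeff f n \<in> \<int>" "f \<noteq> 0" "poly f b = 0" using b by (elim algebraicE) blast
    have fa: "alg_coeffs f" unfolding alg_coeffs_def using f(1) int_imp_algebraic_int by blast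
    let ?Z = "{x. poly f x = 0}"
    have Z: "algebraic x" if "x \<in> ?Z" for x using f(1,2) that by (intro algebraicI) auto
    have "finite ?Z" using poly_roots_finite[OF f(2)] .
    moreover have "?s ` ?Z \<subseteq> ?Z"
    proof
      fix y assume "y \<in> ?s ` ?Z"
      then obtain x where x: "x \<in> ?Z" "y = ?s x" by blast
      have ax: "algebraic x" using Z[OF x(1)] .
      have "i (poly f y) = ieval f (s (i x))"
        unfolding x(2) using ieval_i[OF fa rs(1)[OF ax]] rs(2)[OF ax] by simp
      also have "\<dots> = s (ieval f (i x))" using gal_ieval[OF s f(1) i_closed[OF ax]] by simp
      also have "\<dots> = i 0" using ieval_i[OF fa ax] x(1) galD(4)[OF s LF_zero] by (simp add: i_zero)
      finally have "poly f y = 0"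
        using i_inj[of "poly f y" 0] alg_coeffs_poly[OF fa rs(1)[OF ax]] x(2) by simp
      then show "y \<in> ?Z" by simp
    qed
    moreover have "inj_on ?s ?Z" using inj Z by (auto simp: inj_on_def)
    ultimately have "?s ` ?Z = ?Z" by (rule endo_inj_surj)
    then have "b \<in> ?s ` ?Z" using f(3) by simp
    then show ?thesis using Z by auto
  qed
  have "bij_betw ?s (carrier Kbar) (carrier Kbar)"
    unfolding bij_betw_def using inj surj rs(1) by auto
  then show ?thesis unfolding gal_def ring_iso_def using hom fixF by (auto simp: restrict_auto_def)
qed

lemma gal_compose:
  assumes s: "s \<in> gal LC LF" and t: "t \<in> gal LC LF"
  shows "compose (carrier LC) s t \<in> gal LC LF"
proof -
  have "bij_betw (compose (carrier LC) s t) (carrier LC) (carrier LC)"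
    by (rule bij_betw_compose) (use galD[OF s] galD[OF t] in \<open>auto simp: bij_betw_def\<close>)
  moreover have "compose (carrier LC) s t \<in> Ring.ring_hom LC LC"
  proof (rule ring_hom_memI)
    show "compose (carrier LC) s t \<one>\<^bsub>LC\<^esub> = \<one>\<^bsub>LC\<^esub>"
      using galD(4)[OF s LF_one] galD(4)[OF t LF_one] by (simp add: compose_def)
  qed (use galD[OF s] galD[OF t] in \<open>auto simp: compose_def\<close>)
  moreover have "compose (carrier LC) s t x = x" if "x \<in> LF" for x
    using that galD(4)[OF s] galD(4)[OF t] LC.K_sub[OF that] by (simp add: compose_def)
  ultimately show ?thesis unfolding gal_def ring_iso_def by (auto simp: compose_def)
qed

lemma restrict_auto_compose:
  assumes s: "s \<in> gal LC LF" and t: "t \<in> gal LC LF"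
  shows "restrict_auto i (compose (carrier LC) s t) = compose (carrier Kbar) (restrict_auto i s) (restrict_auto i t)"
proof
  fix x
  show "restrict_auto i (compose (carrier LC) s t) x = compose (carrier Kbar) (restrict_auto i s) (restrict_auto i t) x"
  proof (cases "algebraic x")
    case True
    have "restrict_auto i (compose (carrier LC) s t) x = restrict_auto i s (restrict_auto i t x)"
      by (rule restrict_auto_eqI[OF gal_compose[OF s t] True])
        (use True restrict_auto[OF s] restrict_auto[OF t] i_closed[OF True] in \<open>auto simp: compose_def\<close>)
    then show ?thesis using True by (simp add: compose_def)
  qed (simp add: restrict_auto_def compose_def)
qed

text \<open>The set \<open>isog_ker\<close> is the same for every root of unity, so
  \<open>z'\<close> is left free.\<close>

lemma ker_map_i:
  assumes "algebraic a" "U \<in> isog_ker Kbar a z"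
  shows "map_point i U \<in> isog_ker LC (i a) z'"
  using assms(2) unfolding Kbar_ker_iff[OF assms(1)] LC.isog_ker_iff[OF i_closed[OF assms(1)]]
  by (auto simp: i_zero i_closed i_mult)

lemma ker_map_gal:
  assumes s: "s \<in> gal LC LF" and a: "a \<in> F" and U: "U \<in> isog_ker Kbar a z"
  shows "map_point (restrict_auto i s) U \<in> isog_ker Kbar a z"
    and "map_point i (map_point (restrict_auto i s) U) = map_point s (map_point i U)"
proof -
  note aa = algebraic_mem[OF a]
  have 0: "restrict_auto i s 0 = 0"
    by (rule restrict_auto_eqI[OF s]) (auto simp: i_zero galD(4)[OF s LF_zero])
  have sq: "restrict_auto i s y * restrict_auto i s y = a" if y: "algebraic y" "y * y = a" for y
  proof (rule i_inj)
    have "i (restrict_auto i s y * restrict_auto i s y) = s (i y) \<otimes>\<^bsub>LC\<^esub> s (i y)"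
      using restrict_auto[OF s y(1)] by (simp add: i_mult)
    also have "\<dots> = s (i a)" using galD(3)[OF s] i_closed[OF y(1)] i_mult[OF y(1) y(1)] y(2) by simp
    also have "\<dots> = i a" by (rule galD(4)[OF s i_F_mem[OF a]])
    finally show "i (restrict_auto i s y * restrict_auto i s y) = i a" .
  qed (use restrict_auto[OF s y(1)] aa algebraic_mult in auto)
  show "map_point (restrict_auto i s) U \<in> isog_ker Kbar a z"
  proof (cases "U = Infty")
    case False
    then obtain y where y: "algebraic y" "U = Affine 0 y" "y * y = a"
      using U unfolding Kbar_ker_iff[OF aa] by blast
    then show ?thesis
      unfolding Kbar_ker_iff[OF aa] using restrict_auto(1)[OF s y(1)] sq[OF y(1,3)] 0 by simp
  qed (simp add: Kbar_ker_iff[OF aa])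
  show "map_point i (map_point (restrict_auto i s) U) = map_point s (map_point i U)"
    using U restrict_auto(2)[OF s] unfolding Kbar_ker_iff[OF aa] by auto
qed

text \<open>Only kernel points are added in the cocycle identity, and for them
  \<open>kernel_add\<close> describes the sum without any division.\<close>

lemma i_pt_add:
  assumes a: "algebraic a" and U: "U \<in> isog_ker Kbar a z" and V: "V \<in> isog_ker Kbar a z"
  shows "map_point i (pt_add Kbar U V) = pt_add LC (map_point i U) (map_point i V)"
proof -
  consider "U = Infty" | "V = Infty" |
    y1 y2 where "U = Affine 0 y1" "V = Affine 0 y2" "algebraic y1" "algebraic y2" "y1 * y1 = a" "y2 * y2 = a"
    using U V unfolding Kbar_ker_iff[OF a] by auto
  then show ?thesis
  proof cases
    case 2
    then show ?thesis by (simp add: plain_field.pt_add_Infty[OF Kbar_plain] LC.pt_add_Infty)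
  next
    case 3
    have "pt_add Kbar (Affine 0 y1) (Affine 0 y2) = (if y1 = - y2 then Infty else Affine 0 (- y1))"
      using plain_field.kernel_add[OF Kbar_plain, of y1 y2] 3 by (simp add: Kbar_minus)
    moreover have "pt_add LC (Affine \<zero>\<^bsub>LC\<^esub> (i y1)) (Affine \<zero>\<^bsub>LC\<^esub> (i y2))
        = (if i y1 = \<ominus>\<^bsub>LC\<^esub> i y2 then Infty else Affine \<zero>\<^bsub>LC\<^esub> (\<ominus>\<^bsub>LC\<^esub> i y1))"
      using LC.kernel_add[of "i y1" "i y2"] 3 i_closed i_mult[of y1 y1] i_mult[of y2 y2] by simp
    moreover have "i y1 = \<ominus>\<^bsub>LC\<^esub> i y2 \<longleftrightarrow> y1 = - y2"
      using i_inj[of y1 "- y2"] 3 by (auto simp: i_minus)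
    ultimately show ?thesis using 3 by (simp add: i_zero i_minus)
  qed simp
qed

text \<open>A cocycle lies in its own class, so an equality of classes can be read as a relation
  between cocycles; for this the restriction has to be known to be a cocycle.\<close>

lemma restrict_cocycle_mem:
  assumes a: "a \<in> F" and c: "c \<in> cocycles Kbar F a z"
  shows "restrict_cocycle F Q i c \<in> cocycles LC LF (i a) z'"
proof -
  note aa = algebraic_mem[OF a]
  have cker: "c s' \<in> isog_ker Kbar a z" if "s' \<in> gal Kbar F" for s'
    using c that unfolding cocycles_def by blast
  have cid: "c (compose (carrier Kbar) s' t') = pt_add Kbar (c s') (map_point s' (c t'))"
    if "s' \<in> gal Kbar F" "t' \<in> gal Kbar F" for s' t'
    using c that unfolding cocycles_def by blast
  have ccont: "krull_continuous Kbar F c" using c unfolding cocycles_def by blast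
  let ?rc = "restrict_cocycle F Q i c"
  have rc: "?rc s = map_point i (c (restrict_auto i s))" if "s \<in> gal LC LF" for s
    using that by (simp add: restrict_cocycle_def)
  have 1: "?rc \<in> gal LC LF \<rightarrow>\<^sub>E isog_ker LC (i a) z'"
    unfolding restrict_cocycle_def using ker_map_i[OF aa cker[OF restrict_auto_gal]] by auto
  have 2: "krull_continuous LC LF ?rc"
    unfolding krull_continuous_def
  proof (intro ballI)
    fix s assume s: "s \<in> gal LC LF"
    from bspec[OF ccont[unfolded krull_continuous_def] restrict_auto_gal[OF s]]
    obtain B where B: "finite B" "B \<subseteq> carrier Kbar"
      "\<forall>t\<in>gal Kbar F. (\<forall>x\<in>B. t x = restrict_auto i s x) \<longrightarrow> c t = c (restrict_auto i s)"
      by (elim exE conjE)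
    show "\<exists>B. finite B \<and> B \<subseteq> carrier LC \<and> (\<forall>t\<in>gal LC LF. (\<forall>x\<in>B. t x = s x) \<longrightarrow> ?rc t = ?rc s)"
    \<comment> \<open>Two local automorphisms that agree on the image of \<open>B\<close> restrict
      to automorphisms that agree on \<open>B\<close>.\<close>
    proof (intro exI[of _ "i ` B"] conjI ballI impI)
      show "finite (i ` B)" using B(1) by simp
      show "i ` B \<subseteq> carrier LC" using B(2) i_closed by auto
      fix t assume t: "t \<in> gal LC LF" and eq: "\<forall>x\<in>i ` B. t x = s x"
      have "restrict_auto i t x = restrict_auto i s x" if x: "x \<in> B" for x
        by (rule restrict_auto_eqI[OF t]) (use x B(2) eq restrict_auto[OF s] in auto)
      then have "c (restrict_auto i t) = c (restrict_auto i s)" using B(3) restrict_auto_gal[OF t] by blast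
      then show "?rc t = ?rc s" using rc s t by simp
    qed
  qed
  have 3: "?rc (compose (carrier LC) s t) = pt_add LC (?rc s) (map_point s (?rc t))"
    if s: "s \<in> gal LC LF" and t: "t \<in> gal LC LF" for s t
  proof -
    let ?s = "restrict_auto i s" and ?t = "restrict_auto i t"
    note gs = restrict_auto_gal[OF s] and gt = restrict_auto_gal[OF t]
    have "?rc (compose (carrier LC) s t) = map_point i (pt_add Kbar (c ?s) (map_point ?s (c ?t)))"
      using rc[OF gal_compose[OF s t]] restrict_auto_compose[OF s t] cid[OF gs gt] by simp
    also have "\<dots> = pt_add LC (map_point i (c ?s)) (map_point i (map_point ?s (c ?t)))"
      by (rule i_pt_add[OF aa cker[OF gs] ker_map_gal(1)[OF s a cker[OF gt]]])
    finally show ?thesis using ker_map_gal(2)[OF s a cker[OF gt]] rc s t by simp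
  qed
  show ?thesis unfolding cocycles_def using 1 2 3 by blast
qed

text \<open>If the square roots of \<open>a\<close> lie in the completion, then the kernel is fixed by the local Galois
  group, so that cohomologous cocycles agree on it.\<close>

lemma gal_fixes_kernel:
  assumes s: "s \<in> gal LC LF" and a: "a \<in> carrier LC" and \<rho>: "\<rho> \<in> LF" "\<rho> \<otimes>\<^bsub>LC\<^esub> \<rho> = a"
    and T: "T \<in> isog_ker LC a z"
  shows "map_point s T = T" "pt_diff LC (map_point s T) T = Infty"
proof -
  have m: "\<ominus>\<^bsub>LC\<^esub> \<rho> \<in> LF" using subringE(5)[OF subfieldE(1)[OF LC.subfield_axioms] \<rho>(1)] .
  have fixy: "s y = y" if y: "y \<in> carrier LC" "y \<otimes>\<^bsub>LC\<^esub> y = a" for y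
  proof -
    have "y = \<rho> \<or> y = \<ominus>\<^bsub>LC\<^esub> \<rho>" by (rule LC.square_eq_cases) (use y \<rho> LC.K_sub in auto)
    then show ?thesis using galD(4)[OF s] \<rho>(1) m by auto
  qed
  show "map_point s T = T"
    using T fixy galD(4)[OF s LF_zero] unfolding LC.isog_ker_iff[OF a] by auto
  then show "pt_diff LC (map_point s T) T = Infty"
    using LC.pt_diff_self[of T] T unfolding LC.isog_ker_iff[OF a] by auto
qed

lemma restrict_auto_fixes_kernel:
  assumes s: "s \<in> gal LC LF" and a: "a \<in> F" "r * r = a" "i r \<in> LF" "algebraic r"
    and T: "T \<in> isog_ker Kbar a z"
  shows "pt_diff Kbar (map_point (restrict_auto i s) T) T = Infty"
proof -
  note aa = algebraic_mem[OF a(1)]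
  have "i r \<otimes>\<^bsub>LC\<^esub> i r = i a" using i_mult[OF a(4) a(4)] a(2) by simp
  then have "map_point s (map_point i T) = map_point i T"
    by (rule gal_fixes_kernel(1)[OF s i_closed[OF aa] a(3) _ ker_map_i[OF aa T]])
  then have "map_point i (map_point (restrict_auto i s) T) = map_point i T"
    using ker_map_gal(2)[OF s a(1) T] by simp
  moreover have "map_point (restrict_auto i s) T \<in> isog_ker Kbar a z" by (rule ker_map_gal(1)[OF s a(1) T])
  ultimately have "map_point (restrict_auto i s) T = T"
    using T i_inj unfolding Kbar_ker_iff[OF aa] by auto
  moreover have "pt_diff Kbar T T = Infty"
    using plain_field.pt_diff_self[OF Kbar_plain, of T] T unfolding Kbar_ker_iff[OF aa] by auto
  ultimately show ?thesis by simp
qed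

text \<open>The local Galois group acts trivially on the kernel, so coboundaries vanish and a local
  class is a single cocycle. The representative \<open>c\<close> of the local condition and the
  representative \<open>c'\<close> of the Kummer correspondence therefore restrict to the same
  cocycle of a point \<open>P\<close>.\<close>

lemma local_cocycle_eq:
  assumes a: "a \<in> F" "r * r = a" "i r \<in> LF" "algebraic r"
    and \<xi>: "\<xi> \<in> H1 Kbar F a z" "c \<in> \<xi>" "c' \<in> \<xi>"
    and kum: "coh_class LC LF (i a) z' (restrict_cocycle F Q i c) \<in> kummer_image LC LF (i a) z'"
  shows "\<exists>P. P \<in> curve_points LC (carrier LC) (i a) \<and> isog LC (i a) z' P \<in> curve_points LC LF (i a) \<and>
    (\<forall>s\<in>gal LC LF. map_point i (c' (restrict_auto i s)) = pt_diff LC (map_point s P) P)"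
proof -
  note aa = algebraic_mem[OF a(1)]
  obtain c1 where c1: "\<xi> = coh_class Kbar F a z c1" using \<xi>(1) by (auto simp: H1_def)
  have agree: "d (restrict_auto i s) = c1 (restrict_auto i s)" if d: "d \<in> \<xi>" and s: "s \<in> gal LC LF" for d s
  proof -
    obtain T where T: "T \<in> isog_ker Kbar a z"
      "\<forall>s\<in>gal Kbar F. d s = pt_add Kbar (c1 s) (pt_diff Kbar (map_point s T) T)"
      using d unfolding c1 coh_class_def cohomologous_def by blast
    then show ?thesis
      using restrict_auto_fixes_kernel[OF s a T(1)] restrict_auto_gal[OF s]
      by (simp add: plain_field.pt_add_Infty[OF Kbar_plain])
  qed
  let ?rc = "restrict_cocycle F Q i c"
  have "c \<in> cocycles Kbar F a z" using \<xi>(2) unfolding c1 coh_class_def by blast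
  then have rcc: "?rc \<in> cocycles LC LF (i a) z'" by (rule restrict_cocycle_mem[OF a(1)])
  have "cohomologous LC LF (i a) z' ?rc ?rc" unfolding cohomologous_def
  proof (rule bexI[of _ Infty])
    show "\<forall>s\<in>gal LC LF. ?rc s = pt_add LC (?rc s) (pt_diff LC (map_point s Infty) Infty)"
      by (simp add: pt_diff_def LC.pt_add_Infty)
    show "Infty \<in> isog_ker LC (i a) z'" using LC.isog_ker_iff[OF i_closed[OF aa]] by blast
  qed
  then have self: "?rc \<in> coh_class LC LF (i a) z' ?rc" using rcc by (simp add: coh_class_def)
  obtain P where P: "P \<in> curve_points LC (carrier LC) (i a)" "isog LC (i a) z' P \<in> curve_points LC LF (i a)"
    "coh_class LC LF (i a) z' ?rc = coh_class LC LF (i a) z' (\<lambda>s\<in>gal LC LF. pt_diff LC (map_point s P) P)"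
    using kum unfolding kummer_image_def by blast
  define kp where "kp = (\<lambda>s\<in>gal LC LF. pt_diff LC (map_point s P) P)"
  have "?rc \<in> coh_class LC LF (i a) z' kp" using self unfolding P(3) kp_def .
  then obtain T where T: "T \<in> isog_ker LC (i a) z'"
    "\<forall>s\<in>gal LC LF. ?rc s = pt_add LC (kp s) (pt_diff LC (map_point s T) T)"
    unfolding coh_class_def cohomologous_def by blast
  have rr: "i r \<otimes>\<^bsub>LC\<^esub> i r = i a" using i_mult[OF a(4) a(4)] a(2) by simp
  have "map_point i (c' (restrict_auto i s)) = pt_diff LC (map_point s P) P" if s: "s \<in> gal LC LF" for s
  proof -
    have "?rc s = pt_diff LC (map_point s P) P"
      using T(2) s gal_fixes_kernel(2)[OF s i_closed[OF aa] a(3) rr T(1)] by (simp add: LC.pt_add_Infty kp_def)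
    moreover have "?rc s = map_point i (c (restrict_auto i s))" using s by (simp add: restrict_cocycle_def)
    ultimately show ?thesis using agree[OF \<xi>(2) s] agree[OF \<xi>(3) s] by simp
  qed
  then show ?thesis using P by blast
qed

lemma LC_two: "\<one>\<^bsub>LC\<^esub> \<oplus>\<^bsub>LC\<^esub> \<one>\<^bsub>LC\<^esub> \<noteq> \<zero>\<^bsub>LC\<^esub>"
proof
  assume "\<one>\<^bsub>LC\<^esub> \<oplus>\<^bsub>LC\<^esub> \<one>\<^bsub>LC\<^esub> = \<zero>\<^bsub>LC\<^esub>"
  then have "i 2 = i 0" using i_add[of 1 1] by (simp add: i_one i_zero)
  then show False using i_inj[of 2 0] by simp
qed

text \<open>The Galois action on the function \<open>g\<close> with \<open>g\<^sup>3 = Y - r\<close> is inverse to the character of the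
  kernel that defines the Kummer correspondence.\<close>

lemma kummer_function_character:
  assumes z: "z \<in> F" "z ^ 3 = 1" "z \<noteq> 1" and a: "a \<in> F" "a \<noteq> 0" "r * r = a" "algebraic r" "i r \<in> LF"
    and U: "U \<in> isog_ker Kbar a z"
    and P: "x \<in> carrier LC" "y \<in> carrier LC" "x \<noteq> \<zero>\<^bsub>LC\<^esub>"
      "y \<otimes>\<^bsub>LC\<^esub> y = x \<otimes>\<^bsub>LC\<^esub> (x \<otimes>\<^bsub>LC\<^esub> x) \<oplus>\<^bsub>LC\<^esub> i a"
    and s: "s \<in> gal LC LF" "map_point i U = pt_diff LC (map_point s (Affine x y)) (Affine x y)"
    and g: "g = rdiv LC (y \<oplus>\<^bsub>LC\<^esub> \<ominus>\<^bsub>LC\<^esub> ((i z \<otimes>\<^bsub>LC\<^esub> i z \<oplus>\<^bsub>LC\<^esub> \<ominus>\<^bsub>LC\<^esub> i z) \<otimes>\<^bsub>LC\<^esub> i r))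
        ((\<one>\<^bsub>LC\<^esub> \<ominus>\<^bsub>LC\<^esub> i z) \<otimes>\<^bsub>LC\<^esub> x)"
  shows "i (ker_char z U r) \<otimes>\<^bsub>LC\<^esub> s g = g"
proof -
  note S = galD[OF s(1)]
  note az = algebraic_mem[OF z(1)] and aa = algebraic_mem[OF a(1)]
  define zz where "zz = i z"
  define R where "R = i r"
  define al where "al = zz \<otimes>\<^bsub>LC\<^esub> zz \<oplus>\<^bsub>LC\<^esub> \<ominus>\<^bsub>LC\<^esub> zz"
  define p where "p = \<one>\<^bsub>LC\<^esub> \<ominus>\<^bsub>LC\<^esub> zz"
  have Kring: "subring LF LC" by (rule subfieldE(1)[OF LC.subfield_axioms])
  note Kc = subringE(3)[OF Kring] subringE(5,6,7)[OF Kring]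
  have zL: "zz \<in> LF" "R \<in> LF" using i_F_mem[OF z(1)] a(5) by (auto simp: zz_def R_def)
  have alF: "al \<in> LF" and pF: "p \<in> LF" unfolding al_def p_def a_minus_def using zL Kc by auto
  have c: "zz \<in> carrier LC" "R \<in> carrier LC" "al \<in> carrier LC" "p \<in> carrier LC"
    using zL alF pF LC.K_sub by auto
  have p0: "p \<noteq> \<zero>\<^bsub>LC\<^esub>"
  proof
    assume "p = \<zero>\<^bsub>LC\<^esub>"
    then have "i 1 = i z" using c unfolding p_def zz_def i_one by simp
    then show False using i_inj[of 1 z] az z(3) by simp
  qed
  define n where "n = y \<oplus>\<^bsub>LC\<^esub> \<ominus>\<^bsub>LC\<^esub> (al \<otimes>\<^bsub>LC\<^esub> R)"
  have nc: "n \<in> carrier LC" using c P by (simp add: n_def)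
  have g_eq: "g = rdiv LC n (p \<otimes>\<^bsub>LC\<^esub> x)" unfolding g n_def p_def al_def zz_def R_def ..
  have q: "p \<otimes>\<^bsub>LC\<^esub> x \<in> carrier LC" "p \<otimes>\<^bsub>LC\<^esub> x \<noteq> \<zero>\<^bsub>LC\<^esub>" using p0 P c LC.integral_iff by auto
  have gc: "g \<in> carrier LC" unfolding g_eq by (rule LC.rdiv_closed[OF nc q])
  have gq: "(p \<otimes>\<^bsub>LC\<^esub> x) \<otimes>\<^bsub>LC\<^esub> g = n" unfolding g_eq by (rule LC.rdiv_mult[OF nc q])
  let ?x = "s x" and ?y = "s y" and ?g = "s g"
  have sc: "?x \<in> carrier LC" "?y \<in> carrier LC" "?g \<in> carrier LC" using S(1) P gc by auto
  define n' where "n' = ?y \<oplus>\<^bsub>LC\<^esub> \<ominus>\<^bsub>LC\<^esub> (al \<otimes>\<^bsub>LC\<^esub> R)"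
  have alR: "\<ominus>\<^bsub>LC\<^esub> (al \<otimes>\<^bsub>LC\<^esub> R) \<in> LF" using alF zL Kc by auto
  have sn: "s n = n'" unfolding n_def n'_def
    using S(2)[OF P(2), of "\<ominus>\<^bsub>LC\<^esub> (al \<otimes>\<^bsub>LC\<^esub> R)"] S(4)[OF alR] LC.K_sub[OF alR] by simp
  have sq: "(p \<otimes>\<^bsub>LC\<^esub> ?x) \<otimes>\<^bsub>LC\<^esub> ?g = n'"
    unfolding sn[symmetric] gq[symmetric] using S(3) S(4)[OF pF] c P gc by simp
  have sx0: "?x \<noteq> \<zero>\<^bsub>LC\<^esub>"
    using S(5) P(1,3) S(4)[OF LF_zero] LC.zero_closed by (metis inj_onD)
  have sy: "?y \<otimes>\<^bsub>LC\<^esub> ?y = ?x \<otimes>\<^bsub>LC\<^esub> (?x \<otimes>\<^bsub>LC\<^esub> ?x) \<oplus>\<^bsub>LC\<^esub> i a"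
  proof -
    have "s (y \<otimes>\<^bsub>LC\<^esub> y) = s (x \<otimes>\<^bsub>LC\<^esub> (x \<otimes>\<^bsub>LC\<^esub> x) \<oplus>\<^bsub>LC\<^esub> i a)" unfolding P(4) ..
    then show ?thesis using S(2,3) P(1,2) i_closed[OF aa] S(4)[OF i_F_mem[OF a(1)]] by simp
  qed
  have RR: "R \<otimes>\<^bsub>LC\<^esub> R = i a" unfolding R_def using i_mult[OF a(4) a(4)] a(3) by simp
  \<comment> \<open>\<open>g\<close> is the quotient of \<open>n\<close> by \<open>p * x\<close>,
    and \<open>s g\<close> that of \<open>n'\<close> by \<open>p * s x\<close>; the claim is
    compared after multiplication by both denominators.\<close>
  have conclude: "w \<otimes>\<^bsub>LC\<^esub> ?g = g"
    if w: "w \<in> carrier LC" and eq: "(w \<otimes>\<^bsub>LC\<^esub> n') \<otimes>\<^bsub>LC\<^esub> x = n \<otimes>\<^bsub>LC\<^esub> ?x" for w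
  proof -
    let ?k = "p \<otimes>\<^bsub>LC\<^esub> (x \<otimes>\<^bsub>LC\<^esub> ?x)"
    have "?k \<otimes>\<^bsub>LC\<^esub> (w \<otimes>\<^bsub>LC\<^esub> ?g) = (w \<otimes>\<^bsub>LC\<^esub> n') \<otimes>\<^bsub>LC\<^esub> x"
      unfolding sq[symmetric] using c P sc w by (simp add: LC.m_ac)
    also have "\<dots> = ?k \<otimes>\<^bsub>LC\<^esub> g"
      unfolding eq gq[symmetric] using c P sc gc by (simp add: LC.m_ac)
    finally show ?thesis
      using LC.m_lcancel[of ?k "w \<otimes>\<^bsub>LC\<^esub> ?g" g] p0 P sx0 c sc w gc LC.integral_iff by auto
  qed
  have z2: "z * z = - 1 - z"
  proof -
    have "(z - 1) * (z * z + z + 1) = z ^ 3 - 1" by (simp add: algebra_simps power3_eq_cube)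
    then have "z * z + z + 1 = 0" using z(2,3) by simp
    then show ?thesis by (simp add: eq_neg_iff_add_eq_0 algebra_simps)
  qed
  have w1: "zz \<otimes>\<^bsub>LC\<^esub> zz = \<ominus>\<^bsub>LC\<^esub> \<one>\<^bsub>LC\<^esub> \<oplus>\<^bsub>LC\<^esub> \<ominus>\<^bsub>LC\<^esub> zz"
  proof -
    have "i (z * z) = i (- 1 + - z)" using z2 by simp
    also have "\<dots> = i (- 1) \<oplus>\<^bsub>LC\<^esub> i (- z)" by (rule i_add) (use az in auto)
    finally show ?thesis using az unfolding zz_def by (simp add: i_mult i_minus i_one)
  qed
  have izinv: "i (inverse z) = zz \<otimes>\<^bsub>LC\<^esub> zz"
  proof -
    have "z * (z * z) = 1" using z(2) by (simp add: power3_eq_cube mult.assoc)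
    then have "inverse z = z * z" by (rule inverse_unique)
    then show ?thesis using az by (simp add: zz_def i_mult)
  qed
  consider "U = Infty" | "U = Affine 0 r" | "U = Affine 0 (- r)"
  proof -
    have "U = Infty \<or> (\<exists>y. algebraic y \<and> U = Affine 0 y \<and> y * y = a)"
      using U unfolding Kbar_ker_iff[OF aa] .
    moreover have "y = r \<or> y = - r" if "y * y = a" for y
      using that a(3) by (metis square_eq_iff)
    ultimately show thesis using that by blast
  qed
  then show ?thesis
  proof cases
    case 1
    then have "pt_diff LC (Affine ?x ?y) (Affine x y) = Infty" using s(2) by simp
    then have "?x = x" "?y = y" using LC.pt_diff_eq_Infty[of ?x ?y x y] P(2) by auto
    then have "(\<one>\<^bsub>LC\<^esub> \<otimes>\<^bsub>LC\<^esub> n') \<otimes>\<^bsub>LC\<^esub> x = n \<otimes>\<^bsub>LC\<^esub> ?x" using nc by (simp add: n_def n'_def)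
    then show ?thesis using conclude[of "\<one>\<^bsub>LC\<^esub>"] 1 by (simp add: i_one)
  next
    case 2
    then have d: "pt_diff LC (Affine ?x ?y) (Affine x y) = Affine \<zero>\<^bsub>LC\<^esub> R" using s(2) by (simp add: i_zero R_def)
    have "(zz \<otimes>\<^bsub>LC\<^esub> n') \<otimes>\<^bsub>LC\<^esub> x = n \<otimes>\<^bsub>LC\<^esub> ?x"
      unfolding n_def n'_def al_def
      by (rule LC.translation_by_kernel[OF P(1,2) sc(1,2) c(2,1) P(3) _ _ w1 d]) (use P(4) sy RR in simp_all)
    then show ?thesis using conclude[OF c(1)] 2 by (simp add: zz_def)
  next
    case 3
    have r0: "r \<noteq> - r" using a(2,3) by auto
    \<comment> \<open>For the opposite kernel point both the root \<open>R\<close> and the root of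
      unity are replaced, by \<open>-R\<close> and \<open>z^2\<close>. The product
      \<open>(w^2 - w) t\<close>, and with it the function \<open>g\<close>, is unchanged, while the
      character takes the inverse value.\<close>
    let ?R = "\<ominus>\<^bsub>LC\<^esub> R" and ?w = "zz \<otimes>\<^bsub>LC\<^esub> zz"
    have d: "pt_diff LC (Affine ?x ?y) (Affine x y) = Affine \<zero>\<^bsub>LC\<^esub> ?R"
      using s(2) 3 a(4) by (simp add: i_zero i_minus R_def)
    have cR: "?R \<in> carrier LC" "?w \<in> carrier LC" using c by auto
    have RR': "?R \<otimes>\<^bsub>LC\<^esub> ?R = i a" using RR c i_closed[OF aa] by (simp add: LC.l_minus LC.r_minus)
    have w2: "?w \<otimes>\<^bsub>LC\<^esub> ?w = zz"
    proof -
      have "i (z * z * (z * z)) = ?w \<otimes>\<^bsub>LC\<^esub> ?w" using az by (simp add: i_mult zz_def algebraic_mult)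
      moreover have "z * z * (z * z) = z" using z(2) by (simp add: power3_eq_cube mult.assoc[symmetric])
      ultimately show ?thesis by (simp add: zz_def)
    qed
    have w2': "?w \<otimes>\<^bsub>LC\<^esub> ?w = \<ominus>\<^bsub>LC\<^esub> \<one>\<^bsub>LC\<^esub> \<oplus>\<^bsub>LC\<^esub> \<ominus>\<^bsub>LC\<^esub> ?w"
    proof -
      have "\<ominus>\<^bsub>LC\<^esub> \<one>\<^bsub>LC\<^esub> \<oplus>\<^bsub>LC\<^esub> \<ominus>\<^bsub>LC\<^esub> (\<ominus>\<^bsub>LC\<^esub> \<one>\<^bsub>LC\<^esub> \<oplus>\<^bsub>LC\<^esub> \<ominus>\<^bsub>LC\<^esub> zz) = zz" using c(1) by algebra
      then show ?thesis unfolding w2 unfolding w1 by simp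
    qed
    have "(?w \<otimes>\<^bsub>LC\<^esub> (?y \<oplus>\<^bsub>LC\<^esub> \<ominus>\<^bsub>LC\<^esub> ((?w \<otimes>\<^bsub>LC\<^esub> ?w \<oplus>\<^bsub>LC\<^esub> \<ominus>\<^bsub>LC\<^esub> ?w) \<otimes>\<^bsub>LC\<^esub> ?R))) \<otimes>\<^bsub>LC\<^esub> x
        = (y \<oplus>\<^bsub>LC\<^esub> \<ominus>\<^bsub>LC\<^esub> ((?w \<otimes>\<^bsub>LC\<^esub> ?w \<oplus>\<^bsub>LC\<^esub> \<ominus>\<^bsub>LC\<^esub> ?w) \<otimes>\<^bsub>LC\<^esub> ?R)) \<otimes>\<^bsub>LC\<^esub> ?x"
      by (rule LC.translation_by_kernel[OF P(1,2) sc(1,2) cR P(3) _ _ w2' d]) (use P(4) sy RR' in simp_all)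
    moreover have "(?w \<otimes>\<^bsub>LC\<^esub> ?w \<oplus>\<^bsub>LC\<^esub> \<ominus>\<^bsub>LC\<^esub> ?w) \<otimes>\<^bsub>LC\<^esub> ?R = al \<otimes>\<^bsub>LC\<^esub> R"
      unfolding w2 al_def using c(1,2) by algebra
    ultimately have "(?w \<otimes>\<^bsub>LC\<^esub> n') \<otimes>\<^bsub>LC\<^esub> x = n \<otimes>\<^bsub>LC\<^esub> ?x"
      unfolding n_def n'_def by simp
    then show ?thesis using conclude[OF cR(2)] 3 r0 izinv by simp
  qed
qed

lemma gal_fixed_cube_root:
  assumes z: "z \<in> F" "z ^ 3 = 1" "z \<noteq> 1"
    and t: "t \<in> carrier LC" "t \<otimes>\<^bsub>LC\<^esub> (t \<otimes>\<^bsub>LC\<^esub> t) \<in> LF" "\<And>s. s \<in> gal LC LF \<Longrightarrow> s t = t"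
  shows "t \<in> LF"
proof (rule LC.fixed_cube_root_mem[OF t(1,2) i_F_mem[OF z(1)] _ _ LC_two])
  note az = algebraic_mem[OF z(1)]
  have "z * (z * z) = 1" using z(2) by (simp add: power3_eq_cube mult.assoc)
  then have "i (z * (z * z)) = \<one>\<^bsub>LC\<^esub>" by (simp add: i_one)
  then show "i z \<otimes>\<^bsub>LC\<^esub> (i z \<otimes>\<^bsub>LC\<^esub> i z) = \<one>\<^bsub>LC\<^esub>" using az by (simp add: i_mult algebraic_mult)
  show "i z \<noteq> \<one>\<^bsub>LC\<^esub>" using i_inj[of z 1] az z(3) i_one by auto
  show "\<forall>s\<in>ring_iso LC LC \<inter> extensional (carrier LC). (\<forall>x\<in>LF. s x = x) \<longrightarrow> s t = t"
    using t(3) by (auto simp: gal_def)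
qed

lemma iota_cube:
  assumes "t \<in> carrier LC" "t \<in> LF" "w \<in> carrier Kq" "t \<otimes>\<^bsub>LC\<^esub> (t \<otimes>\<^bsub>LC\<^esub> t) = iota w"
  shows "\<exists>c\<in>carrier Kq. w = c \<otimes>\<^bsub>Kq\<^esub> (c \<otimes>\<^bsub>Kq\<^esub> c)"
proof -
  obtain c where c: "c \<in> carrier Kq" "t = iota c" using LF_iota[OF assms(2)] .
  have "(iota (c \<otimes>\<^bsub>Kq\<^esub> (c \<otimes>\<^bsub>Kq\<^esub> c)) :: local_elem) = iota w"
    using assms(4) c by (simp add: iota_mult)
  then have "c \<otimes>\<^bsub>Kq\<^esub> (c \<otimes>\<^bsub>Kq\<^esub> c) = w" by (rule iota_inj[rotated 2]) (use c assms(3) in auto)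
  then show ?thesis using c(1) by (intro bexI[of _ c]) simp_all
qed

lemma iota_minus: "c \<in> carrier Kq \<Longrightarrow> iota (\<ominus>\<^bsub>Kq\<^esub> c) = \<ominus>\<^bsub>LC\<^esub> iota c"
proof (rule LC.minus_equality[symmetric])
  assume c: "c \<in> carrier Kq"
  have "iota (\<ominus>\<^bsub>Kq\<^esub> c) \<oplus>\<^bsub>LC\<^esub> iota c = iota \<zero>\<^bsub>Kq\<^esub>" using c by (simp add: iota_add[symmetric] Kq.l_neg)
  also have "\<dots> = \<zero>\<^bsub>LC\<^esub>" using i_F_iota[of 0] by (simp add: i_zero to_completion_zero)
  finally show "iota (\<ominus>\<^bsub>Kq\<^esub> c) \<oplus>\<^bsub>LC\<^esub> iota c = \<zero>\<^bsub>LC\<^esub>" .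
qed (auto intro: iota_closed)

lemma local_cube_trivial:
  assumes z: "z \<in> F" "z ^ 3 = 1" "z \<noteq> 1"
    and th: "algebraic \<theta>" "i (\<theta> ^ 3) = iota w" "w \<in> carrier Kq" "\<theta> \<noteq> 0"
    and ch: "\<And>s. s \<in> gal LC LF \<Longrightarrow> ker_char z Infty r = restrict_auto i s \<theta> / \<theta>"
  shows "\<exists>c\<in>carrier Kq. w = c \<otimes>\<^bsub>Kq\<^esub> (c \<otimes>\<^bsub>Kq\<^esub> c)"
proof (rule iota_cube[OF i_closed[OF th(1)] _ th(3)])
  show cube: "i \<theta> \<otimes>\<^bsub>LC\<^esub> (i \<theta> \<otimes>\<^bsub>LC\<^esub> i \<theta>) = iota w"
    using th(1,2) by (simp add: power3_eq_cube mult.assoc i_mult algebraic_mult)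
  show "i \<theta> \<in> LF"
  proof (rule gal_fixed_cube_root[OF z i_closed[OF th(1)]])
    show "i \<theta> \<otimes>\<^bsub>LC\<^esub> (i \<theta> \<otimes>\<^bsub>LC\<^esub> i \<theta>) \<in> LF" unfolding cube by (rule iota_LF[OF th(3)])
    fix s assume s: "s \<in> gal LC LF"
    then have "restrict_auto i s \<theta> = \<theta>" using ch[OF s] th(4) by simp
    then show "s (i \<theta>) = i \<theta>" using restrict_auto(2)[OF s th(1)] by simp
  qed
qed

lemma local_cube_affine:
  assumes z: "z \<in> F" "z ^ 3 = 1" "z \<noteq> 1" and a: "a \<in> F" "a \<noteq> 0" "r * r = a" "algebraic r"
    and \<rho>: "\<rho> \<in> carrier Kq" "i r = iota \<rho>"
    and th: "algebraic \<theta>" "i (\<theta> ^ 3) = iota w" "w \<in> carrier Kq" "\<theta> \<noteq> 0"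
    and U: "\<And>s. s \<in> gal LC LF \<Longrightarrow> U s \<in> isog_ker Kbar a z"
    and ch: "\<And>s. s \<in> gal LC LF \<Longrightarrow> ker_char z (U s) r = restrict_auto i s \<theta> / \<theta>"
    and P: "x \<in> carrier LC" "y \<in> carrier LC" "x \<noteq> \<zero>\<^bsub>LC\<^esub>"
      "y \<otimes>\<^bsub>LC\<^esub> y = x \<otimes>\<^bsub>LC\<^esub> (x \<otimes>\<^bsub>LC\<^esub> x) \<oplus>\<^bsub>LC\<^esub> i a"
    and s: "\<And>s. s \<in> gal LC LF \<Longrightarrow> map_point i (U s) = pt_diff LC (map_point s (Affine x y)) (Affine x y)"
    and Y: "isog LC (i a) (i z) (Affine x y) = Affine u (iota Y)" "Y \<in> carrier Kq"
  shows "\<exists>c\<in>carrier Kq. w \<otimes>\<^bsub>Kq\<^esub> (Y \<oplus>\<^bsub>Kq\<^esub> \<ominus>\<^bsub>Kq\<^esub> \<rho>) = c \<otimes>\<^bsub>Kq\<^esub> (c \<otimes>\<^bsub>Kq\<^esub> c)"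
proof -
  note az = algebraic_mem[OF z(1)] and aa = algebraic_mem[OF a(1)]
  define g where "g = rdiv LC (y \<oplus>\<^bsub>LC\<^esub> \<ominus>\<^bsub>LC\<^esub> ((i z \<otimes>\<^bsub>LC\<^esub> i z \<oplus>\<^bsub>LC\<^esub> \<ominus>\<^bsub>LC\<^esub> i z) \<otimes>\<^bsub>LC\<^esub> i r))
        ((\<one>\<^bsub>LC\<^esub> \<ominus>\<^bsub>LC\<^esub> i z) \<otimes>\<^bsub>LC\<^esub> x)"
  have rF: "i r \<in> LF" using \<rho> iota_LF by simp
  have rr: "i r \<otimes>\<^bsub>LC\<^esub> i r = i a" using i_mult[OF a(4) a(4)] a(3) by simp
  have z2: "i z \<otimes>\<^bsub>LC\<^esub> i z = \<ominus>\<^bsub>LC\<^esub> \<one>\<^bsub>LC\<^esub> \<oplus>\<^bsub>LC\<^esub> \<ominus>\<^bsub>LC\<^esub> i z"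
  proof -
    have "(z - 1) * (z * z + z + 1) = z ^ 3 - 1" by (simp add: algebra_simps power3_eq_cube)
    then have "z * z + z + 1 = 0" using z(2,3) by simp
    then have "z * z = - 1 + - z" by (simp add: eq_neg_iff_add_eq_0 algebra_simps)
    then have "i (z * z) = i (- 1) \<oplus>\<^bsub>LC\<^esub> i (- z)" using i_add[of "- 1" "- z"] az by simp
    then show ?thesis using az by (simp add: i_mult i_minus i_one)
  qed
  have p0: "\<one>\<^bsub>LC\<^esub> \<ominus>\<^bsub>LC\<^esub> i z \<noteq> \<zero>\<^bsub>LC\<^esub>"
  proof
    assume "\<one>\<^bsub>LC\<^esub> \<ominus>\<^bsub>LC\<^esub> i z = \<zero>\<^bsub>LC\<^esub>"
    then have "i 1 = i z" using i_closed[OF az] by (simp add: i_one)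
    then show False using i_inj[of 1 z] az z(3) by simp
  qed
  have g: "g \<otimes>\<^bsub>LC\<^esub> (g \<otimes>\<^bsub>LC\<^esub> g) = iota Y \<oplus>\<^bsub>LC\<^esub> \<ominus>\<^bsub>LC\<^esub> i r" "g \<in> carrier LC"
    using LC.isog_cube[OF P(1,2) i_closed[OF a(4)] i_closed[OF az] P(3) _ z2 p0 _ g_def, of u "iota Y"]
      P(4) Y(1) rr by simp_all
  let ?t = "i \<theta> \<otimes>\<^bsub>LC\<^esub> g" and ?w = "w \<otimes>\<^bsub>Kq\<^esub> (Y \<oplus>\<^bsub>Kq\<^esub> \<ominus>\<^bsub>Kq\<^esub> \<rho>)"
  have tc: "?t \<in> carrier LC" using g(2) i_closed[OF th(1)] by simp
  have wc: "?w \<in> carrier Kq" using th(3) Y(2) \<rho>(1) by simp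
  have th3: "i \<theta> \<otimes>\<^bsub>LC\<^esub> (i \<theta> \<otimes>\<^bsub>LC\<^esub> i \<theta>) = iota w"
    using th(1,2) by (simp add: power3_eq_cube mult.assoc i_mult algebraic_mult)
  have cube: "?t \<otimes>\<^bsub>LC\<^esub> (?t \<otimes>\<^bsub>LC\<^esub> ?t) = iota ?w"
  proof -
    have "?t \<otimes>\<^bsub>LC\<^esub> (?t \<otimes>\<^bsub>LC\<^esub> ?t) = (i \<theta> \<otimes>\<^bsub>LC\<^esub> (i \<theta> \<otimes>\<^bsub>LC\<^esub> i \<theta>)) \<otimes>\<^bsub>LC\<^esub> (g \<otimes>\<^bsub>LC\<^esub> (g \<otimes>\<^bsub>LC\<^esub> g))"
      using g(2) i_closed[OF th(1)] by (simp add: LC.m_ac)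
    also have "\<dots> = iota w \<otimes>\<^bsub>LC\<^esub> (iota Y \<oplus>\<^bsub>LC\<^esub> iota (\<ominus>\<^bsub>Kq\<^esub> \<rho>))" unfolding th3 g(1) iota_minus[OF \<rho>(1)] \<rho>(2) ..
    also have "\<dots> = iota ?w" using th(3) Y(2) \<rho>(1) by (simp add: iota_mult iota_add)
    finally show ?thesis .
  qed
  show ?thesis
  proof (rule iota_cube[OF tc _ wc cube])
    show "?t \<in> LF"
    proof (rule gal_fixed_cube_root[OF z tc])
      show "?t \<otimes>\<^bsub>LC\<^esub> (?t \<otimes>\<^bsub>LC\<^esub> ?t) \<in> LF" unfolding cube by (rule iota_LF[OF wc])
      fix \<sigma> assume \<sigma>: "\<sigma> \<in> gal LC LF"
      let ?c = "ker_char z (U \<sigma>) r"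
      have c: "?c \<in> F" by (cases "U \<sigma>") (use z(1) in auto)
      have "restrict_auto i \<sigma> \<theta> = ?c * \<theta>" using ch[OF \<sigma>] th(4) by simp
      then have "\<sigma> (i \<theta>) = i ?c \<otimes>\<^bsub>LC\<^esub> i \<theta>"
        using restrict_auto(2)[OF \<sigma> th(1)] i_mult[OF algebraic_mem[OF c] th(1)] by simp
      moreover have "i ?c \<otimes>\<^bsub>LC\<^esub> \<sigma> g = g"
        by (rule kummer_function_character[OF z a rF U[OF \<sigma>] P \<sigma> s[OF \<sigma>] g_def])
      moreover have "\<sigma> ?t = \<sigma> (i \<theta>) \<otimes>\<^bsub>LC\<^esub> \<sigma> g" using galD(3)[OF \<sigma>] g(2) i_closed[OF th(1)] by simp
      moreover have "\<sigma> g \<in> carrier LC" "i ?c \<in> carrier LC" using galD(1)[OF \<sigma> g(2)] i_closed[OF algebraic_mem[OF c]] by auto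
      ultimately show "\<sigma> ?t = ?t" using i_closed[OF th(1)] LC.m_ac
        by (metis LC.m_assoc LC.m_comm)
    qed
  qed
qed

end

context prime_ideal
begin

lemma dvd_lval_of_cube_product:
  assumes "W \<in> carrier Kq" "W \<noteq> \<zero>\<^bsub>Kq\<^esub>" "A \<in> carrier Kq" "A \<noteq> \<zero>\<^bsub>Kq\<^esub>" "3 dvd lval A"
    "c \<in> carrier Kq" "W \<otimes>\<^bsub>Kq\<^esub> A = c \<otimes>\<^bsub>Kq\<^esub> (c \<otimes>\<^bsub>Kq\<^esub> c)"
  shows "3 dvd lval W"
proof -
  have "c \<noteq> \<zero>\<^bsub>Kq\<^esub>"
  proof
    assume "c = \<zero>\<^bsub>Kq\<^esub>"
    then have "W \<otimes>\<^bsub>Kq\<^esub> A = \<zero>\<^bsub>Kq\<^esub>" using assms(7) by simp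
    then show False using assms Kq.integral by blast
  qed
  then have "lval W + lval A = 3 * lval c" using lval_mult[OF assms(1-4)] lval_cube[OF assms(6)] assms(7) by simp
  then show ?thesis using assms(5) by presburger
qed

lemma lval_eq_of_squares:
  assumes "A \<in> carrier Kq" "A \<noteq> \<zero>\<^bsub>Kq\<^esub>" "T \<in> carrier Kq" "T \<noteq> \<zero>\<^bsub>Kq\<^esub>" "A \<otimes>\<^bsub>Kq\<^esub> A = T \<otimes>\<^bsub>Kq\<^esub> T"
  shows "lval A = lval T"
  using lval_mult[OF assms(1,2,1,2)] lval_mult[OF assms(3,4,3,4)] assms(5) by simp

text \<open>The generic case is the product formula for \<open>Y - \<rho>\<close> and
  \<open>Y + \<rho>\<close>. If one of them is zero, the other is \<open>2 \<rho>\<close> up to sign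
  and settles one of \<open>W\<close> and \<open>W'\<close>; the sum of their valuations settles the
  other.\<close>

lemma dvd_lval_both:
  assumes W: "W \<in> carrier Kq" "W \<noteq> \<zero>\<^bsub>Kq\<^esub>" "W' \<in> carrier Kq" "W' \<noteq> \<zero>\<^bsub>Kq\<^esub>" "3 dvd lval W + lval W'"
    and k: "\<rho> \<in> carrier Kq" "Y \<in> carrier Kq" "x \<in> carrier Kq" "c \<in> carrier Kq" "c' \<in> carrier Kq"
    and T: "\<rho> \<oplus>\<^bsub>Kq\<^esub> \<rho> \<noteq> \<zero>\<^bsub>Kq\<^esub>" "3 dvd lval (\<rho> \<oplus>\<^bsub>Kq\<^esub> \<rho>)"
    and curve: "Y \<otimes>\<^bsub>Kq\<^esub> Y = x \<otimes>\<^bsub>Kq\<^esub> (x \<otimes>\<^bsub>Kq\<^esub> x) \<oplus>\<^bsub>Kq\<^esub> \<rho> \<otimes>\<^bsub>Kq\<^esub> \<rho>"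
    and cubes: "W \<otimes>\<^bsub>Kq\<^esub> (Y \<oplus>\<^bsub>Kq\<^esub> \<ominus>\<^bsub>Kq\<^esub> \<rho>) = c \<otimes>\<^bsub>Kq\<^esub> (c \<otimes>\<^bsub>Kq\<^esub> c)"
      "W' \<otimes>\<^bsub>Kq\<^esub> (Y \<oplus>\<^bsub>Kq\<^esub> \<ominus>\<^bsub>Kq\<^esub> (\<ominus>\<^bsub>Kq\<^esub> \<rho>)) = c' \<otimes>\<^bsub>Kq\<^esub> (c' \<otimes>\<^bsub>Kq\<^esub> c')"
  shows "3 dvd lval W \<and> 3 dvd lval W'"
proof -
  let ?T = "\<rho> \<oplus>\<^bsub>Kq\<^esub> \<rho>" and ?A = "Y \<oplus>\<^bsub>Kq\<^esub> \<ominus>\<^bsub>Kq\<^esub> \<rho>" and ?B = "Y \<oplus>\<^bsub>Kq\<^esub> \<ominus>\<^bsub>Kq\<^esub> (\<ominus>\<^bsub>Kq\<^esub> \<rho>)"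
  have TK: "?T \<in> carrier Kq" and AK: "?A \<in> carrier Kq" and BK: "?B \<in> carrier Kq" using k by auto
  have AT: "?A \<oplus>\<^bsub>Kq\<^esub> ?T = ?B" using k by algebra
  have AB: "?A \<otimes>\<^bsub>Kq\<^esub> ?B = x \<otimes>\<^bsub>Kq\<^esub> (x \<otimes>\<^bsub>Kq\<^esub> x)"
  proof -
    have "?A \<otimes>\<^bsub>Kq\<^esub> ?B = Y \<otimes>\<^bsub>Kq\<^esub> Y \<oplus>\<^bsub>Kq\<^esub> \<ominus>\<^bsub>Kq\<^esub> (\<rho> \<otimes>\<^bsub>Kq\<^esub> \<rho>)" using k by algebra
    also have "\<dots> = x \<otimes>\<^bsub>Kq\<^esub> (x \<otimes>\<^bsub>Kq\<^esub> x)" unfolding curve using k by algebra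
    finally show ?thesis .
  qed
  note W1 = dvd_lval_of_cube_product[OF W(1,2) AK _ _ k(4) cubes(1)]
    and W2 = dvd_lval_of_cube_product[OF W(3,4) BK _ _ k(5) cubes(2)]
  consider "?A = \<zero>\<^bsub>Kq\<^esub>" | "?B = \<zero>\<^bsub>Kq\<^esub>" "?A \<noteq> \<zero>\<^bsub>Kq\<^esub>" | "?A \<noteq> \<zero>\<^bsub>Kq\<^esub>" "?B \<noteq> \<zero>\<^bsub>Kq\<^esub>" by blast
  then show ?thesis
  proof cases
    case 1
    then have "?B = ?T" using AT TK by simp
    then have "3 dvd lval W'" using W2 T by simp
    then show ?thesis using W(5) by presburger
  next
    case 2
    \<comment> \<open>Here \<open>?A\<close> is \<open>-2 \<rho>\<close>; comparing squares avoids
      the sign in its valuation.\<close>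
    have "?A \<otimes>\<^bsub>Kq\<^esub> ?A = (?B \<oplus>\<^bsub>Kq\<^esub> \<ominus>\<^bsub>Kq\<^esub> ?T) \<otimes>\<^bsub>Kq\<^esub> (?B \<oplus>\<^bsub>Kq\<^esub> \<ominus>\<^bsub>Kq\<^esub> ?T)" using k by algebra
    also have "\<dots> = ?T \<otimes>\<^bsub>Kq\<^esub> ?T" unfolding 2(1) using k by algebra
    finally have "lval ?A = lval ?T" by (rule lval_eq_of_squares[OF AK 2(2) TK T(1)])
    then have "3 dvd lval W" using W1[OF 2(2)] T(2) by simp
    then show ?thesis using W(5) by presburger
  next
    case 3
    have "3 dvd lval ?A"
      using dvd_lval_of_product_cube[OF AK 3(1) TK T _ k(3)] 3(2) AT AB by simp
    then have "3 dvd lval W" using W1[OF 3(1)] by simp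
    then show ?thesis using W(5) by presburger
  qed
qed

end

lemma algebraic_cube_root:
  fixes x :: complex
  assumes "algebraic (x ^ 3)"
  shows "algebraic x"
proof -
  obtain p where p: "p \<noteq> 0" "poly (map_poly of_int p) (x ^ 3) = 0" using assms algebraicE' by blast
  let ?q = "pcompose (map_poly of_int p) (monom 1 3) :: complex poly"
  have 0: "map_poly of_int p \<noteq> (0 :: complex poly)" using p(1) by (subst map_poly_eq_0_iff) auto
  show ?thesis
  proof (rule algebraicI)
    show "poly ?q x = 0" using p by (simp add: poly_pcompose poly_monom)
    show "?q \<noteq> 0" using 0 by (simp add: pcompose_eq_0_iff degree_monom_eq)
    show "coeff ?q i \<in> \<int>" for i
      by (intro coeff_pcompose_semiring_closed) (auto simp: coeff_monom coeff_map_poly)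
  qed
qed

lemma selmer_elems_norm:
  assumes "(u, v) \<in> selmer_elems F a z"
  obtains c where "u \<in> F" "v \<in> F" "c \<in> F" "c \<noteq> 0" "u ^ 2 - a * v ^ 2 = c ^ 3"
  using assms unfolding selmer_elems_def by auto

lemma selmer_elems_nonzero:
  assumes "(u, v) \<in> selmer_elems F a z" "t * t = a"
  shows "u + v * t \<noteq> 0"
proof
  obtain c where c: "u \<in> F" "v \<in> F" "c \<in> F" "c \<noteq> 0" "u ^ 2 - a * v ^ 2 = c ^ 3"
    using selmer_elems_norm[OF assms(1)] .
  assume "u + v * t = 0"
  moreover have "(u + v * t) * (u - v * t) = c ^ 3"
    unfolding c(5)[symmetric] assms(2)[symmetric] by (simp add: algebra_simps power2_eq_square)
  ultimately show False using c(4) by simp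
qed

context local_embedding
begin

lemma selmer_pair_val:
  assumes z: "z \<in> F" "z ^ 3 = 1" "z \<noteq> 1" and a: "a \<in> F" "a \<noteq> 0" "r * r = a" "algebraic r"
    and \<rho>: "\<rho> \<in> carrier Kq" "i r = iota \<rho>" and uv: "u \<in> F" "v \<in> F"
    and W_def: "W = to_completion F Q u \<oplus>\<^bsub>Kq\<^esub> to_completion F Q v \<otimes>\<^bsub>Kq\<^esub> \<rho>"
      "W' = to_completion F Q u \<oplus>\<^bsub>Kq\<^esub> to_completion F Q v \<otimes>\<^bsub>Kq\<^esub> (\<ominus>\<^bsub>Kq\<^esub> \<rho>)"
    and W: "W \<noteq> \<zero>\<^bsub>Kq\<^esub>" "W' \<noteq> \<zero>\<^bsub>Kq\<^esub>" "3 dvd lval W + lval W'"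
    and T: "\<rho> \<oplus>\<^bsub>Kq\<^esub> \<rho> \<noteq> \<zero>\<^bsub>Kq\<^esub>" "3 dvd lval (\<rho> \<oplus>\<^bsub>Kq\<^esub> \<rho>)"
    and th: "\<And>t. t * t = a \<Longrightarrow> \<theta> t ^ 3 = u + v * t" "\<And>t. t * t = a \<Longrightarrow> u + v * t \<noteq> 0"
    and ch: "\<And>s t. s \<in> gal Kbar F \<Longrightarrow> t * t = a \<Longrightarrow> ker_char z (c s) (s t) = s (\<theta> t) / \<theta> (s t)"
    and c: "c \<in> cocycles Kbar F a z"
    and P: "P \<in> curve_points LC (carrier LC) (i a)" "isog LC (i a) (i z) P \<in> curve_points LC LF (i a)"
      "\<And>s. s \<in> gal LC LF \<Longrightarrow> map_point i (c (restrict_auto i s)) = pt_diff LC (map_point s P) P"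
  shows "3 dvd lval W \<and> 3 dvd lval W'"
proof -
  let ?tc = "to_completion F Q"
  let ?U = "\<lambda>s. c (restrict_auto i s)"
  let ?w = "\<lambda>\<rho>. ?tc u \<oplus>\<^bsub>Kq\<^esub> ?tc v \<otimes>\<^bsub>Kq\<^esub> \<rho>"
  note tc = to_completion_mem[OF uv(1)] to_completion_mem[OF uv(2)]
  note aa = algebraic_mem[OF a(1)]
  have U: "?U s \<in> isog_ker Kbar a z" if "s \<in> gal LC LF" for s
    using c restrict_auto_gal[OF that] unfolding cocycles_def by auto
  \<comment> \<open>Stated for an arbitrary root so that it serves both \<open>r\<close> with
    \<open>\<rho>\<close> and \<open>-r\<close> with \<open>-\<rho>\<close>: the two coordinates of
    the algebra over the completion.\<close>
  have root: "algebraic (\<theta> t) \<and> i (\<theta> t ^ 3) = iota (?w \<rho>') \<and> ?w \<rho>' \<in> carrier Kq \<and> \<theta> t \<noteq> 0 \<and> i t \<in> LF \<and>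
      (\<forall>s\<in>gal LC LF. ker_char z (?U s) t = restrict_auto i s (\<theta> t) / \<theta> t)"
    if t: "t * t = a" "algebraic t" "\<rho>' \<in> carrier Kq" "i t = iota \<rho>'" for t \<rho>'
  proof (intro conjI ballI)
    have alg: "algebraic (u + v * t)" using t(2) uv by (simp add: algebraic_add algebraic_mult algebraic_mem)
    have "algebraic (\<theta> t ^ 3)" unfolding th(1)[OF t(1)] by (rule alg)
    then show "algebraic (\<theta> t)" by (rule algebraic_cube_root)
    show wc: "?w \<rho>' \<in> carrier Kq" using tc t(3) by simp
    have "i (u + v * t) = iota (?tc u) \<oplus>\<^bsub>LC\<^esub> iota (?tc v) \<otimes>\<^bsub>LC\<^esub> iota \<rho>'"
      using t(2,4) uv by (simp add: i_add i_mult algebraic_mult algebraic_mem i_F_iota)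
    also have "\<dots> = iota (?w \<rho>')" using tc t(3) by (simp add: iota_add iota_mult)
    finally show "i (\<theta> t ^ 3) = iota (?w \<rho>')" unfolding th(1)[OF t(1)] .
    show "\<theta> t \<noteq> 0" using th[OF t(1)] by auto
    show LF: "i t \<in> LF" unfolding t(4) by (rule iota_LF[OF t(3)])
    fix s assume s: "s \<in> gal LC LF"
    have "restrict_auto i s t = t" by (rule restrict_auto_eqI[OF s t(2,2)]) (use galD(4)[OF s LF] in simp)
    then show "ker_char z (?U s) t = restrict_auto i s (\<theta> t) / \<theta> t"
      using ch[OF restrict_auto_gal[OF s] t(1)] by simp
  qed
  have rm: "- r * - r = a" "algebraic (- r)" "\<ominus>\<^bsub>Kq\<^esub> \<rho> \<in> carrier Kq" "i (- r) = iota (\<ominus>\<^bsub>Kq\<^esub> \<rho>)"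
    using a \<rho> by (simp_all add: i_minus iota_minus)
  note R = root[OF a(3,4) \<rho>] and R' = root[OF rm]
  have WK: "W \<in> carrier Kq" "W' \<in> carrier Kq" unfolding W_def using R R' by simp_all
  have rr: "i r \<otimes>\<^bsub>LC\<^esub> i r = i a" using i_mult[OF a(4) a(4)] a(3) by simp
  have ia: "i a \<in> carrier LC" by (rule i_closed[OF aa])
  show ?thesis
  proof (cases "\<forall>s\<in>gal LC LF. ?U s = Infty")
    case True
    have "\<exists>c\<in>carrier Kq. ?w \<rho> = c \<otimes>\<^bsub>Kq\<^esub> (c \<otimes>\<^bsub>Kq\<^esub> c)"
      by (rule local_cube_trivial[OF z, of "\<theta> r" _ r]) (use R True in auto)
    moreover have "\<exists>c\<in>carrier Kq. ?w (\<ominus>\<^bsub>Kq\<^esub> \<rho>) = c \<otimes>\<^bsub>Kq\<^esub> (c \<otimes>\<^bsub>Kq\<^esub> c)"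
      by (rule local_cube_trivial[OF z, of "\<theta> (- r)" _ "- r"]) (use R' True in auto)
    ultimately obtain c1 c2 where c1: "c1 \<in> carrier Kq" "W = c1 \<otimes>\<^bsub>Kq\<^esub> (c1 \<otimes>\<^bsub>Kq\<^esub> c1)"
      and c2: "c2 \<in> carrier Kq" "W' = c2 \<otimes>\<^bsub>Kq\<^esub> (c2 \<otimes>\<^bsub>Kq\<^esub> c2)" unfolding W_def by auto
    have "c1 \<noteq> \<zero>\<^bsub>Kq\<^esub>" "c2 \<noteq> \<zero>\<^bsub>Kq\<^esub>" using W(1,2) c1 c2 by auto
    then show ?thesis using lval_cube c1 c2 by simp
  next
    case False
    \<comment> \<open>A kernel point has the trivial cocycle, which the other case covers. So
      \<open>P\<close> is affine with nonzero abscissa, where \<open>g\<close> is defined.\<close>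
    have nk: "P \<notin> isog_ker LC (i a) (i z)"
    proof
      assume k: "P \<in> isog_ker LC (i a) (i z)"
      have "?U s = Infty" if s: "s \<in> gal LC LF" for s
      proof -
        have "map_point i (?U s) = Infty"
          unfolding P(3)[OF s] by (rule gal_fixes_kernel(2)[OF s ia _ rr k]) (use R in simp)
        then show ?thesis by (cases "?U s") auto
      qed
      then show False using False by simp
    qed
    obtain x y where xy: "P = Affine x y" "x \<noteq> \<zero>\<^bsub>LC\<^esub>"
      using nk P(1) unfolding isog_ker_def by (cases P) (auto split: if_splits)
    have P': "x \<in> carrier LC" "y \<in> carrier LC" "y \<otimes>\<^bsub>LC\<^esub> y = x \<otimes>\<^bsub>LC\<^esub> (x \<otimes>\<^bsub>LC\<^esub> x) \<oplus>\<^bsub>LC\<^esub> i a"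
      using P(1) unfolding xy curve_points_def by (auto simp: LC.pow2 LC.pow3)
    obtain x1 y1 where XY: "isog LC (i a) (i z) (Affine x y) = Affine x1 y1" using xy(2) by (simp add: Let_def)
    have LFs: "x1 \<in> LF" "y1 \<in> LF" and
      "y1 [^]\<^bsub>LC\<^esub> (2::nat) = x1 [^]\<^bsub>LC\<^esub> (3::nat) \<oplus>\<^bsub>LC\<^esub> i a"
      using P(2) unfolding xy(1) XY curve_points_def by auto
    obtain x0 where x0: "x0 \<in> carrier Kq" "x1 = iota x0" using LF_iota[OF LFs(1)] .
    obtain y0 where y0: "y0 \<in> carrier Kq" "y1 = iota y0" using LF_iota[OF LFs(2)] .
    have "iota y0 \<otimes>\<^bsub>LC\<^esub> iota y0 = iota x0 \<otimes>\<^bsub>LC\<^esub> (iota x0 \<otimes>\<^bsub>LC\<^esub> iota x0) \<oplus>\<^bsub>LC\<^esub> iota \<rho> \<otimes>\<^bsub>LC\<^esub> iota \<rho>"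
      using \<open>y1 [^]\<^bsub>LC\<^esub> (2::nat) = _\<close> iota_closed[OF x0(1)] iota_closed[OF y0(1)]
      unfolding x0(2) y0(2) \<rho>(2)[symmetric] rr by (simp add: LC.pow2 LC.pow3)
    then have "(iota (y0 \<otimes>\<^bsub>Kq\<^esub> y0) :: local_elem) = iota (x0 \<otimes>\<^bsub>Kq\<^esub> (x0 \<otimes>\<^bsub>Kq\<^esub> x0) \<oplus>\<^bsub>Kq\<^esub> \<rho> \<otimes>\<^bsub>Kq\<^esub> \<rho>)"
      using x0(1) y0(1) \<rho>(1) by (simp add: iota_add iota_mult)
    then have curve: "y0 \<otimes>\<^bsub>Kq\<^esub> y0 = x0 \<otimes>\<^bsub>Kq\<^esub> (x0 \<otimes>\<^bsub>Kq\<^esub> x0) \<oplus>\<^bsub>Kq\<^esub> \<rho> \<otimes>\<^bsub>Kq\<^esub> \<rho>"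
      by (rule iota_inj[rotated 2]) (use x0(1) y0(1) \<rho>(1) in auto)
    note iso = XY[unfolded y0(2)] and act = P(3)[unfolded xy(1)]
    have "\<exists>c\<in>carrier Kq. W \<otimes>\<^bsub>Kq\<^esub> (y0 \<oplus>\<^bsub>Kq\<^esub> \<ominus>\<^bsub>Kq\<^esub> \<rho>) = c \<otimes>\<^bsub>Kq\<^esub> (c \<otimes>\<^bsub>Kq\<^esub> c)"
      unfolding W_def
      by (rule local_cube_affine[OF z a \<rho> _ _ _ _ U _ P'(1,2) xy(2) P'(3) act iso y0(1)]) (use R in auto)
    then obtain c1 where c1: "c1 \<in> carrier Kq" "W \<otimes>\<^bsub>Kq\<^esub> (y0 \<oplus>\<^bsub>Kq\<^esub> \<ominus>\<^bsub>Kq\<^esub> \<rho>) = c1 \<otimes>\<^bsub>Kq\<^esub> (c1 \<otimes>\<^bsub>Kq\<^esub> c1)" ..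
    have "\<exists>c\<in>carrier Kq. W' \<otimes>\<^bsub>Kq\<^esub> (y0 \<oplus>\<^bsub>Kq\<^esub> \<ominus>\<^bsub>Kq\<^esub> (\<ominus>\<^bsub>Kq\<^esub> \<rho>)) = c \<otimes>\<^bsub>Kq\<^esub> (c \<otimes>\<^bsub>Kq\<^esub> c)"
      unfolding W_def
      by (rule local_cube_affine[OF z a(1,2) rm _ _ _ _ U _ P'(1,2) xy(2) P'(3) act iso y0(1)]) (use R' in auto)
    then obtain c2 where c2: "c2 \<in> carrier Kq" "W' \<otimes>\<^bsub>Kq\<^esub> (y0 \<oplus>\<^bsub>Kq\<^esub> \<ominus>\<^bsub>Kq\<^esub> (\<ominus>\<^bsub>Kq\<^esub> \<rho>)) = c2 \<otimes>\<^bsub>Kq\<^esub> (c2 \<otimes>\<^bsub>Kq\<^esub> c2)" ..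
    show ?thesis
      by (rule dvd_lval_both[OF WK(1) W(1) WK(2) W(2,3) \<rho>(1) y0(1) x0(1) c1(1) c2(1) T curve c1(2) c2(2)])
  qed
qed

end

context prime_ideal
begin

lemma selmer_local_val:
  assumes z: "z \<in> F" "z ^ 3 = 1" "z \<noteq> 1" and a: "a \<in> F" "a \<noteq> 0" "r * r = a" "algebraic r"
    and uv: "(u, v) \<in> selmer_elems F a z"
    and \<rho>0: "\<rho>0 \<in> carrier Kq" "to_completion F Q a = \<rho>0 \<otimes>\<^bsub>Kq\<^esub> \<rho>0" and six: "6 dvd val F Q (4 * a)"
  shows "\<exists>\<rho>\<in>carrier Kq. \<rho> \<otimes>\<^bsub>Kq\<^esub> \<rho> = to_completion F Q a \<and>
    to_completion F Q u \<oplus>\<^bsub>Kq\<^esub> to_completion F Q v \<otimes>\<^bsub>Kq\<^esub> \<rho> \<noteq> \<zero>\<^bsub>Kq\<^esub> \<and>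
    to_completion F Q u \<oplus>\<^bsub>Kq\<^esub> to_completion F Q v \<otimes>\<^bsub>Kq\<^esub> (\<ominus>\<^bsub>Kq\<^esub> \<rho>) \<noteq> \<zero>\<^bsub>Kq\<^esub> \<and>
    3 dvd lval (to_completion F Q u \<oplus>\<^bsub>Kq\<^esub> to_completion F Q v \<otimes>\<^bsub>Kq\<^esub> \<rho>) \<and>
    3 dvd lval (to_completion F Q u \<oplus>\<^bsub>Kq\<^esub> to_completion F Q v \<otimes>\<^bsub>Kq\<^esub> (\<ominus>\<^bsub>Kq\<^esub> \<rho>))"
proof -
  let ?tc = "to_completion F Q"
  obtain c0 \<xi> c where c0: "u \<in> F" "v \<in> F" "c0 \<in> F" "c0 \<noteq> 0" "u ^ 2 - a * v ^ 2 = c0 ^ 3"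
    and \<xi>: "\<xi> \<in> selmer F a z" "c \<in> \<xi>" "kummer_corresponds F a z (u, v) c"
    using uv unfolding selmer_elems_def by auto
  obtain \<theta> where th: "\<And>t. t * t = a \<Longrightarrow> \<theta> t ^ 3 = u + v * t"
    and ch: "\<And>s t. s \<in> gal Kbar F \<Longrightarrow> t * t = a \<Longrightarrow> ker_char z (c s) (s t) = s (\<theta> t) / \<theta> (s t)"
    using \<xi>(3) unfolding kummer_corresponds_def by (auto simp: power2_eq_square)
  note nz = selmer_elems_nonzero[OF uv]
  have H: "\<xi> \<in> H1 Kbar F a z" using \<xi>(1) by (simp add: selmer_def)
  obtain i c' where i: "i \<in> closure_embeddings F Q" and c': "c' \<in> \<xi>" and
    loc: "coh_class (local_closure F Q) (local_field F Q) (to_local F Q a) (to_local F Q z)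
            (restrict_cocycle F Q i c')
          \<in> kummer_image (local_closure F Q) (local_field F Q) (to_local F Q a) (to_local F Q z)"
    using \<xi>(1) prime unfolding selmer_def by auto
  interpret local_embedding F Q i by unfold_locales (rule i)
  have cc: "c \<in> cocycles Kbar F a z" using H \<xi>(2) unfolding H1_def coh_class_def by auto
  have rr: "i r \<otimes>\<^bsub>LC\<^esub> i r = i a" using i_mult[OF a(4) a(4)] a(3) by simp
  have "i r \<otimes>\<^bsub>LC\<^esub> i r = iota \<rho>0 \<otimes>\<^bsub>LC\<^esub> iota \<rho>0"
    unfolding rr i_F_iota[OF a(1)] \<rho>0(2) by (rule iota_mult[OF \<rho>0(1) \<rho>0(1)])
  then have "i r = iota \<rho>0 \<or> i r = \<ominus>\<^bsub>LC\<^esub> iota \<rho>0"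
    using LC.square_eq_cases[OF i_closed[OF a(4)] iota_closed[OF \<rho>0(1)]] by simp
  \<comment> \<open>The local root is matched with the global root \<open>r\<close>, since \<theta>
    is indexed by the global roots; the given \<open>\<rho>0\<close> may have the opposite
    sign.\<close>
  then obtain \<rho> where \<rho>: "\<rho> \<in> carrier Kq" "i r = iota \<rho>" "\<rho> \<otimes>\<^bsub>Kq\<^esub> \<rho> = ?tc a"
  proof
    assume "i r = iota \<rho>0" then show ?thesis using that \<rho>0 by simp
  next
    assume *: "i r = \<ominus>\<^bsub>LC\<^esub> iota \<rho>0"
    have "\<ominus>\<^bsub>Kq\<^esub> \<rho>0 \<otimes>\<^bsub>Kq\<^esub> \<ominus>\<^bsub>Kq\<^esub> \<rho>0 = \<rho>0 \<otimes>\<^bsub>Kq\<^esub> \<rho>0" using \<rho>0(1) by algebra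
    then show ?thesis using that[of "\<ominus>\<^bsub>Kq\<^esub> \<rho>0"] * \<rho>0 by (simp add: iota_minus)
  qed
  note tc = to_completion_mem[OF c0(1)] to_completion_mem[OF c0(2)] to_completion_mem[OF c0(3)] to_completion_mem[OF a(1)]
  define W where "W = ?tc u \<oplus>\<^bsub>Kq\<^esub> ?tc v \<otimes>\<^bsub>Kq\<^esub> \<rho>"
  define W' where "W' = ?tc u \<oplus>\<^bsub>Kq\<^esub> ?tc v \<otimes>\<^bsub>Kq\<^esub> (\<ominus>\<^bsub>Kq\<^esub> \<rho>)"
  have WK: "W \<in> carrier Kq" "W' \<in> carrier Kq" unfolding W_def W'_def using tc \<rho>(1) by auto
  have prod: "W \<otimes>\<^bsub>Kq\<^esub> W' = ?tc c0 \<otimes>\<^bsub>Kq\<^esub> (?tc c0 \<otimes>\<^bsub>Kq\<^esub> ?tc c0)"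
  proof -
    have c3: "u * u = c0 * (c0 * c0) + v * (v * a)"
      using c0(5) by (simp add: power2_eq_square power3_eq_cube algebra_simps)
    have "?tc u \<otimes>\<^bsub>Kq\<^esub> ?tc u = ?tc (u * u)" using c0 by (simp add: to_completion_mult)
    also have "\<dots> = ?tc c0 \<otimes>\<^bsub>Kq\<^esub> (?tc c0 \<otimes>\<^bsub>Kq\<^esub> ?tc c0) \<oplus>\<^bsub>Kq\<^esub> ?tc v \<otimes>\<^bsub>Kq\<^esub> (?tc v \<otimes>\<^bsub>Kq\<^esub> ?tc a)"
      unfolding c3 using c0 a by (simp add: to_completion_mult to_completion_add mult_mem)
    finally have uu: "?tc u \<otimes>\<^bsub>Kq\<^esub> ?tc u = \<dots>" .
    have "W \<otimes>\<^bsub>Kq\<^esub> W' = ?tc u \<otimes>\<^bsub>Kq\<^esub> ?tc u \<oplus>\<^bsub>Kq\<^esub> \<ominus>\<^bsub>Kq\<^esub> (?tc v \<otimes>\<^bsub>Kq\<^esub> (?tc v \<otimes>\<^bsub>Kq\<^esub> (\<rho> \<otimes>\<^bsub>Kq\<^esub> \<rho>)))"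
      unfolding W_def W'_def using tc \<rho>(1) by algebra
    also have "\<dots> = ?tc c0 \<otimes>\<^bsub>Kq\<^esub> (?tc c0 \<otimes>\<^bsub>Kq\<^esub> ?tc c0)" unfolding uu \<rho>(3) using tc by algebra
    finally show ?thesis .
  qed
  have c00: "?tc c0 \<noteq> \<zero>\<^bsub>Kq\<^esub>" by (rule lval_to_completion(2)[OF c0(3,4)])
  have "W \<otimes>\<^bsub>Kq\<^esub> W' \<noteq> \<zero>\<^bsub>Kq\<^esub>" unfolding prod using c00 tc(3) by (simp add: Kq.integral_iff)
  then have W0: "W \<noteq> \<zero>\<^bsub>Kq\<^esub>" "W' \<noteq> \<zero>\<^bsub>Kq\<^esub>" using WK by (auto simp: Kq.integral_iff)
  have "lval W + lval W' = 3 * lval (?tc c0)"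
    using lval_mult[OF WK(1) W0(1) WK(2) W0(2)] lval_cube[OF tc(3) c00] prod by simp
  then have W3: "3 dvd lval W + lval W'" by simp
  let ?T = "\<rho> \<oplus>\<^bsub>Kq\<^esub> \<rho>"
  have TK: "?T \<in> carrier Kq" using \<rho>(1) by simp
  have TT: "?T \<otimes>\<^bsub>Kq\<^esub> ?T = ?tc (4 * a)"
  proof -
    have "4 * a = (a + a) + (a + a)" by simp
    then have "?tc (4 * a) = (?tc a \<oplus>\<^bsub>Kq\<^esub> ?tc a) \<oplus>\<^bsub>Kq\<^esub> (?tc a \<oplus>\<^bsub>Kq\<^esub> ?tc a)"
      using a(1) by (simp only: to_completion_add add_mem)
    also have "\<dots> = ?T \<otimes>\<^bsub>Kq\<^esub> ?T" unfolding \<rho>(3)[symmetric] using \<rho>(1) by algebra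
    finally show ?thesis ..
  qed
  have a4: "4 * a \<in> F" "4 * a \<noteq> 0" using a by (auto intro!: closed)
  have T0: "?T \<noteq> \<zero>\<^bsub>Kq\<^esub>" using TT lval_to_completion(2)[OF a4] TK by auto
  have "2 * lval ?T = val F Q (4 * a)"
    using lval_mult[OF TK T0 TK T0] TT lval_to_completion(1)[OF a4] by simp
  then have T3: "3 dvd lval ?T" using six by presburger
  obtain P where P: "P \<in> curve_points LC (carrier LC) (i a)" "isog LC (i a) (i z) P \<in> curve_points LC LF (i a)"
      "\<forall>s\<in>gal LC LF. map_point i (c (restrict_auto i s)) = pt_diff LC (map_point s P) P"
    using local_cocycle_eq[OF a(1,3) _ a(4) H c' \<xi>(2), of "i z"] loc \<rho>(2) iota_LF[OF \<rho>(1)]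
    unfolding i_F[OF a(1)] i_F[OF z(1)] by auto
  have "3 dvd lval W \<and> 3 dvd lval W'"
    by (rule selmer_pair_val[OF z a \<rho>(1,2) c0(1,2) W_def W'_def W0 W3 T0 T3 th nz ch cc P(1,2)]) (use P(3) in auto)
  then show ?thesis using \<rho>(1,3) W0 unfolding W_def W'_def by (intro bexI[of _ \<rho>]) simp_all
qed

end


section \<open>Quadratic extensions\<close>

lemma CC_field: "field CC"
  by (rule field_from_type_algebra)

lemma CC_uminus: "\<ominus>\<^bsub>CC\<^esub> x = - x"
proof -
  interpret field CC by (rule CC_field)
  show ?thesis by (rule minus_equality) auto
qed

lemma CC_inverse: "x \<noteq> 0 \<Longrightarrow> inv\<^bsub>CC\<^esub> x = inverse x"
proof -
  assume "x \<noteq> 0"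
  interpret field CC by (rule CC_field)
  show ?thesis by (rule comm_inv_char) (use \<open>x \<noteq> 0\<close> in auto)
qed

lemma csubfield_generate: "csubfield (generate_field CC H)"
proof
  show "1 \<in> generate_field CC H" using generate_field.one[of CC H] by simp
  show "x + y \<in> generate_field CC H" "x * y \<in> generate_field CC H"
    if "x \<in> generate_field CC H" "y \<in> generate_field CC H" for x y
    using generate_field.eng_add[OF that] generate_field.eng_mult[OF that] by simp_all
  show "- x \<in> generate_field CC H" if "x \<in> generate_field CC H" for x
    using generate_field.a_inv[OF that] by (simp add: CC_uminus)
  show "inverse x \<in> generate_field CC H" if "x \<in> generate_field CC H" for x
  proof (cases "x = 0")
    case False
    then show ?thesis using generate_field.m_inv[OF that] by (simp add: CC_inverse)
  qed (use that in simp)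
qed

lemma generate_field_least:
  assumes "csubfield E" "H \<subseteq> E"
  shows "generate_field CC H \<subseteq> E"
proof
  interpret csubfield E by fact
  fix x assume "x \<in> generate_field CC H"
  then show "x \<in> E"
    by induction (use assms(2) in \<open>auto simp: CC_uminus CC_inverse\<close>)
qed

lemma number_field_generate:
  assumes "finite H" "\<And>x. x \<in> H \<Longrightarrow> algebraic x"
  shows "number_field (generate_field CC H)"
proof -
  obtain E where E: "number_field E" "range of_rat \<union> H \<subseteq> E"
    using number_field.number_field_adjoin[OF number_field_Rats assms] by blast
  interpret E: number_field E by fact
  have "generate_field CC H \<subseteq> E" using generate_field_least[OF E.csubfield_axioms] E(2) by simp
  then show ?thesis by (rule number_field_subset[OF E(1) csubfield_generate])
qed

lemma number_field_pure_cubic_closure: "number_field (pure_cubic_closure m)"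
  unfolding pure_cubic_closure_def
proof (rule number_field_generate)
  show "finite ({z :: complex. z ^ 3 = 1} \<union> {complex_of_real (root 3 (real_of_int m))})"
    using finite_roots_unity[of 3] by simp
  fix x :: complex assume "x \<in> {z. z ^ 3 = 1} \<union> {complex_of_real (root 3 (real_of_int m))}"
  then have "x ^ 3 \<in> \<int>"
    by (auto simp: of_real_power[symmetric] odd_real_root_pow simp del: of_real_power)
  then have "algebraic (x ^ 3)" by (elim Ints_cases) simp
  then show "algebraic x" by (rule algebraic_cube_root)
qed

lemma square_root_coefficients_unique:
  assumes "csubfield K" "r \<notin> K" "u \<in> K" "v \<in> K" "u' \<in> K" "v' \<in> K" "u + v * r = u' + v' * (r :: complex)"
  shows "u = u'" "v = v'"
proof -
  interpret csubfield K by fact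
  show "v = v'"
  proof (rule ccontr)
    assume "v \<noteq> v'"
    moreover have "(v - v') * r = u' - u" using assms(7) by (simp add: algebra_simps)
    ultimately have "r = (u' - u) / (v - v')" by (simp add: field_simps)
    also have "\<dots> \<in> K" using assms by (intro closed)
    finally show False using assms(2) by simp
  qed
  then show "u = u'" using assms(7) by simp
qed

locale quadratic_extension = K: number_field K for K +
  fixes a r :: complex
  assumes a_ints: "a \<in> ints_of K" and r_square: "r * r = a" and r_notin: "r \<notin> K"
begin

abbreviation L where "L \<equiv> adjoin K r"

lemma a_mem: "a \<in> K" using a_ints by auto

lemma a_nonzero: "a \<noteq> 0" using r_square r_notin by auto

lemma r_algebraic_int: "algebraic_int r"
proof (rule algebraic_int_root)
  show "algebraic_int a" using a_ints by (simp add: ints_of_def)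
  show "poly (monom 1 2) r = a" by (simp add: poly_monom power2_eq_square r_square)
qed (auto simp: degree_monom_eq coeff_monom)

lemma ext_nonzero: "u \<in> K \<Longrightarrow> v \<in> K \<Longrightarrow> u + v * r = 0 \<Longrightarrow> u = 0 \<and> v = 0"
  using square_root_coefficients_unique[OF K.csubfield_axioms r_notin, of u v 0 0] by simp

lemma csubfield_L: "csubfield L"
  unfolding adjoin_def by (rule csubfield_generate)

lemma K_subset: "K \<subseteq> L" and r_mem: "r \<in> L"
  unfolding adjoin_def using generate_field.incl[of _ "insert r K"] by auto

lemma number_field_L: "number_field L"
proof -
  obtain E where E: "number_field E" "K \<union> {r} \<subseteq> E"
    using K.number_field_adjoin[of "{r}"] r_algebraic_int by auto
  interpret E: number_field E by fact
  have "L \<subseteq> E" unfolding adjoin_def using generate_field_least[OF E.csubfield_axioms] E(2) by simp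
  then show ?thesis by (rule number_field_subset[OF E(1) csubfield_L])
qed

sublocale L: number_field L by (rule number_field_L)

lemma K_mem [intro]: "x \<in> K \<Longrightarrow> x \<in> L"
  using K_subset by auto

lemma norm_nonzero:
  assumes "u \<in> K" "v \<in> K" "u + v * r \<noteq> 0"
  shows "u * u - v * v * a \<noteq> 0"
proof
  assume 0: "u * u - v * v * a = 0"
  have "(u + v * r) * (u - v * r) = 0"
    using 0 unfolding r_square[symmetric] by (simp add: algebra_simps)
  then have "u + - v * r = 0" using assms(3) by simp
  then have "u = 0 \<and> - v = 0" using assms by (intro ext_nonzero K.closed)
  then show False using assms(3) by simp
qed

text \<open>The elements \<open>u + v * r\<close> are closed under inversion, by division by the
  norm, so they already form a field containing the generators.\<close>

lemma L_cases:
  assumes "x \<in> L"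
  obtains u v where "u \<in> K" "v \<in> K" "x = u + v * r"
proof -
  let ?E = "{u + v * r | u v. u \<in> K \<and> v \<in> K}"
  have "csubfield ?E"
  proof
    show "1 \<in> ?E" by (intro CollectI exI[of _ 1] exI[of _ 0]) auto
    fix x assume "x \<in> ?E"
    then obtain u v where x: "u \<in> K" "v \<in> K" "x = u + v * r" by auto
    show "- x \<in> ?E" by (intro CollectI exI[of _ "- u"] exI[of _ "- v"]) (use x in auto)
    show "inverse x \<in> ?E"
    proof (cases "x = 0")
      case True then show ?thesis by (intro CollectI exI[of _ 0] exI[of _ 0]) auto
    next
      case False
      let ?d = "u * u - v * v * a"
      have d: "?d \<noteq> 0" "?d \<in> K" using norm_nonzero[of u v] x False a_mem by (auto intro!: K.closed)
      have "x * (u / ?d + (- v / ?d) * r) = ((u + v * r) * (u - v * r)) / ?d"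
        unfolding x(3) by (simp add: diff_divide_distrib right_diff_distrib)
      also have "(u + v * r) * (u - v * r) = ?d" unfolding r_square[symmetric] by (simp add: algebra_simps)
      also have "?d / ?d = 1" using d(1) by simp
      finally have "inverse x = u / ?d + (- v / ?d) * r" by (rule inverse_unique)
      then show ?thesis using x d by (intro CollectI exI[of _ "u / ?d"] exI[of _ "- v / ?d"]) (auto intro!: K.closed)
    qed
    fix y assume "y \<in> ?E"
    then obtain u' v' where y: "u' \<in> K" "v' \<in> K" "y = u' + v' * r" by auto
    show "x + y \<in> ?E"
      by (intro CollectI exI[of _ "u + u'"] exI[of _ "v + v'"]) (use x y in \<open>auto simp: algebra_simps\<close>)
    have "x * y = (u * u' + v * v' * a) + (u * v' + v * u') * r"
      unfolding x(3) y(3) r_square[symmetric] by (simp add: algebra_simps)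
    then show "x * y \<in> ?E" using x y a_mem
      by (intro CollectI exI[of _ "u * u' + v * v' * a"] exI[of _ "u * v' + v * u'"]) (auto intro!: K.closed)
  qed
  moreover have "insert r K \<subseteq> ?E"
  proof
    fix x assume "x \<in> insert r K"
    then show "x \<in> ?E"
    proof
      assume "x = r" then show ?thesis by (intro CollectI exI[of _ 0] exI[of _ 1]) auto
    next
      assume "x \<in> K" then show ?thesis by (intro CollectI exI[of _ x] exI[of _ 0]) auto
    qed
  qed
  ultimately have "L \<subseteq> ?E" unfolding adjoin_def by (rule generate_field_least)
  then show thesis using assms that by auto
qed

text \<open>The nontrivial automorphism of \<open>L\<close> over \<open>K\<close>, read off from the
  coordinates with respect to 1 and \<open>r\<close>; it is meaningful on \<open>L\<close>
  only.\<close>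

definition conjg :: "complex \<Rightarrow> complex" where
  "conjg x = (THE y. \<exists>u\<in>K. \<exists>v\<in>K. x = u + v * r \<and> y = u - v * r)"

lemma conjg_eq:
  assumes "u \<in> K" "v \<in> K"
  shows "conjg (u + v * r) = u - v * r"
  unfolding conjg_def
proof (rule the_equality)
  fix y assume "\<exists>u'\<in>K. \<exists>v'\<in>K. u + v * r = u' + v' * r \<and> y = u' - v' * r"
  then obtain u' v' where "u' \<in> K" "v' \<in> K" "u + v * r = u' + v' * r" "y = u' - v' * r" by auto
  then show "y = u - v * r"
    using square_root_coefficients_unique[OF K.csubfield_axioms r_notin assms, of u' v'] by simp
qed (use assms in auto)

lemma conjg_K: "x \<in> K \<Longrightarrow> conjg x = x"
  using conjg_eq[of x 0] by simp

lemma conjg_mem [intro]: "x \<in> L \<Longrightarrow> conjg x \<in> L"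
  by (erule L_cases) (auto simp: conjg_eq intro!: L.closed r_mem)

lemma conjg_conjg: "x \<in> L \<Longrightarrow> conjg (conjg x) = x"
proof (erule L_cases)
  fix u v assume uv: "u \<in> K" "v \<in> K" "x = u + v * r"
  have "conjg (u + - v * r) = u - - v * r" using uv by (intro conjg_eq) auto
  then show ?thesis using uv by (simp add: conjg_eq)
qed

lemma conjg_add: "x \<in> L \<Longrightarrow> y \<in> L \<Longrightarrow> conjg (x + y) = conjg x + conjg y"
  and conjg_mult: "x \<in> L \<Longrightarrow> y \<in> L \<Longrightarrow> conjg (x * y) = conjg x * conjg y"
proof -
  assume "x \<in> L" "y \<in> L"
  then obtain u v u' v' where x: "u \<in> K" "v \<in> K" "x = u + v * r" and y: "u' \<in> K" "v' \<in> K" "y = u' + v' * r"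
    by (elim L_cases)
  have "x + y = (u + u') + (v + v') * r" using x y by (simp add: algebra_simps)
  then have "conjg (x + y) = (u + u') - (v + v') * r" using conjg_eq[OF K.add_mem K.add_mem] x y by metis
  also have "\<dots> = (u - v * r) + (u' - v' * r)" by (simp add: algebra_simps)
  also have "\<dots> = conjg x + conjg y" unfolding x(3) y(3) using x y by (simp add: conjg_eq)
  finally show "conjg (x + y) = conjg x + conjg y" .
  have "x * y = (u * u' + v * v' * a) + (u * v' + v * u') * r"
    unfolding x(3) y(3) r_square[symmetric] by (simp add: algebra_simps)
  also have "conjg \<dots> = (u * u' + v * v' * a) - (u * v' + v * u') * r"
    using x y a_mem by (intro conjg_eq K.closed)
  also have "\<dots> = (u - v * r) * (u' - v' * r)" unfolding r_square[symmetric] by (simp add: algebra_simps)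
  also have "\<dots> = conjg x * conjg y" unfolding x(3) y(3) using x y by (simp add: conjg_eq)
  finally show "conjg (x * y) = conjg x * conjg y" .
qed

lemma conjg_nonzero: "x \<in> L \<Longrightarrow> x \<noteq> 0 \<Longrightarrow> conjg x \<noteq> 0"
  using conjg_conjg[of x] conjg_K[of 0] by auto

lemma mult_conjg_mem:
  assumes "x \<in> L"
  shows "x * conjg x \<in> K"
  using assms
proof (rule L_cases)
  fix u v assume uv: "u \<in> K" "v \<in> K" "x = u + v * r"
  then have "x * conjg x = (u + v * r) * (u - v * r)" by (simp add: conjg_eq)
  also have "\<dots> = u * u - v * v * a" unfolding r_square[symmetric] by (simp add: algebra_simps)
  also have "\<dots> \<in> K" using uv a_mem by (intro K.closed)
  finally show ?thesis .
qed

lemma conjg_poly: "x \<in> L \<Longrightarrow> conjg (poly (map_poly of_int p) x) = poly (map_poly of_int p) (conjg x)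
    \<and> poly (map_poly of_int p) x \<in> L"
  by (induction p) (auto simp: map_poly_pCons conjg_add conjg_mult conjg_K L.mult_mem L.add_mem)

lemma conjg_ints: "x \<in> ints_of L \<Longrightarrow> conjg x \<in> ints_of L"
proof -
  assume x: "x \<in> ints_of L"
  then obtain p :: "int poly" where p: "lead_coeff p = 1" "poly (map_poly of_int p) x = 0"
    unfolding ints_of_def algebraic_int_altdef_ipoly by blast
  have "poly (map_poly of_int p) (conjg x) = 0" using conjg_poly[of x p] p(2) x conjg_K[of 0] by auto
  then have "algebraic_int (conjg x)" unfolding algebraic_int_altdef_ipoly using p(1) by blast
  then show ?thesis using x by (auto simp: ints_of_def)
qed

lemma ints_K: "x \<in> K \<Longrightarrow> x \<in> ints_of L \<longleftrightarrow> x \<in> ints_of K"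
  by (auto simp: ints_of_def)

lemma r_ints: "r \<in> ints_of L"
  using r_mem r_algebraic_int by (simp add: ints_of_def)

text \<open>Membership in \<open>L\<close> is carried along because additivity and multiplicativity
  of \<open>conjg\<close> hold on \<open>L\<close> only.\<close>

lemma conjg_pow:
  assumes x: "x \<in> ideal_pow (ints_of L) Q n" and Q: "Q \<subseteq> ints_of L" "conjg ` Q \<subseteq> Q'"
  shows "conjg x \<in> ideal_pow (ints_of L) Q' n \<and> x \<in> L"
  using x
proof (induction n arbitrary: x)
  case 0
  then show ?case using conjg_ints by auto
next
  case (Suc n)
  from Suc.prems have "x \<in> ideal_mult Q (ideal_pow (ints_of L) Q n)" by simp
  then show ?case
  proof (induction rule: ideal_mult_induct)
    case zero
    show ?case using conjg_K[of 0] by (simp add: ideal_mult_zero)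
  next
    case (add x y)
    then show ?case by (auto simp: conjg_add intro: ideal_mult_add)
  next
    case (prod x y)
    have "x \<in> L" using prod(1) Q(1) by auto
    moreover have "y \<in> L" using Suc.IH[OF prod(2)] by simp
    moreover have "conjg x \<in> Q'" using prod(1) Q(2) by auto
    ultimately show ?case using Suc.IH[OF prod(2)] by (auto simp: conjg_mult intro!: ideal_mult_prod)
  qed
qed

lemma conjg_prime:
  assumes "Q \<in> fin_primes L"
  shows "conjg ` Q \<in> fin_primes L"
proof -
  interpret Q: prime_ideal L Q by (rule L.prime_idealI[OF assms])
  have mem: "x \<in> conjg ` Q \<longleftrightarrow> conjg x \<in> Q" if "x \<in> ints_of L" for x
  proof
    assume "x \<in> conjg ` Q"
    then obtain y where "y \<in> Q" "x = conjg y" by auto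
    then show "conjg x \<in> Q" using conjg_conjg[of y] Q.Q_ints L.ints_mem by simp
  next
    assume "conjg x \<in> Q"
    then show "x \<in> conjg ` Q" using conjg_conjg[of x] L.ints_mem[OF that] by (intro image_eqI) simp_all
  qed
  have sub: "x \<in> ints_of L" if "x \<in> conjg ` Q" for x using that Q.Q_ints conjg_ints by auto
  have "L.is_ideal (conjg ` Q)" unfolding L.is_ideal_def
  proof (intro conjI ballI)
    show "conjg ` Q \<subseteq> ints_of L" using sub by auto
    show "0 \<in> conjg ` Q" using mem[of 0] conjg_K[of 0] L.ideal_zero[OF Q.Q_ideal] by simp
    show "x + y \<in> conjg ` Q" if "x \<in> conjg ` Q" "y \<in> conjg ` Q" for x y
    proof -
      have "conjg x + conjg y \<in> Q" using that mem sub by (intro L.ideal_add[OF Q.Q_ideal]) auto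
      then have "conjg (x + y) \<in> Q" using sub[OF that(1)] sub[OF that(2)] by (simp add: conjg_add L.ints_mem)
      then show ?thesis using sub[OF that(1)] sub[OF that(2)] by (simp add: mem L.ints_add)
    qed
    show "x * y \<in> conjg ` Q" if "x \<in> ints_of L" "y \<in> conjg ` Q" for x y
    proof -
      have "conjg x * conjg y \<in> Q" using that mem sub conjg_ints by (intro L.ideal_scale[OF Q.Q_ideal]) auto
      then have "conjg (x * y) \<in> Q" using that(1) sub[OF that(2)] by (simp add: conjg_mult L.ints_mem)
      then show ?thesis using that(1) sub[OF that(2)] by (simp add: mem L.ints_mult)
    qed
  qed
  moreover have "conjg ` Q \<noteq> {0}"
  proof -
    obtain x where x: "x \<in> Q" "x \<noteq> 0" "x \<in> ints_of L" using L.nonzero_ideal_elt[OF Q.Q_ideal Q.Q_nonzero] .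
    then have "conjg x \<noteq> 0" by (intro conjg_nonzero) auto
    then show ?thesis using x(1) by blast
  qed
  moreover have "1 \<notin> conjg ` Q" using mem[of 1] conjg_K[of 1] Q.one_notin by simp
  moreover have "x \<in> conjg ` Q \<or> y \<in> conjg ` Q"
    if "x \<in> ints_of L" "y \<in> ints_of L" "x * y \<in> conjg ` Q" for x y
  proof -
    have "conjg (x * y) \<in> Q" using that mem by (simp add: L.ints_mult)
    then have "conjg x * conjg y \<in> Q" using that by (simp add: conjg_mult L.ints_mem)
    then show ?thesis using Q.prime_cases conjg_ints that mem by blast
  qed
  ultimately show ?thesis unfolding L.fin_primes_iff L.is_prime_def by blast
qed

text \<open>Conjugation preserves the powers of a stable prime, which gives one inequality on
  integers; applying it to the conjugate gives the other, and fractions follow.\<close>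

lemma val_conjg:
  assumes Q: "Q \<in> fin_primes L" "conjg ` Q = Q" and x: "x \<in> L" "x \<noteq> 0"
  shows "val L Q (conjg x) = val L Q x"
proof -
  interpret Q: prime_ideal L Q by (rule L.prime_idealI[OF Q(1)])
  have *: "val L Q y \<le> val L Q (conjg y)" if y: "y \<in> ints_of L" "y \<noteq> 0" for y
  proof -
    let ?n = "nat (val L Q y)"
    have "y \<in> Q.pow ?n" using Q.pow_iff_val[OF y] Q.val_nonneg_ints[OF y] by simp
    then have "conjg y \<in> Q.pow ?n" using conjg_pow[of y Q ?n Q] Q(2) Q.Q_ints by auto
    then show ?thesis
      using Q.pow_iff_val[OF conjg_ints[OF y(1)] conjg_nonzero[OF _ y(2)], of ?n] y
      by (auto simp: L.ints_mem split: if_splits)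
  qed
  have eq: "val L Q (conjg y) = val L Q y" if y: "y \<in> ints_of L" "y \<noteq> 0" for y
    using *[OF y] *[OF conjg_ints[OF y(1)] conjg_nonzero[OF _ y(2)]] y conjg_conjg[of y] by fastforce
  obtain b c where bc: "b \<in> ints_of L" "c \<in> ints_of L" "c \<noteq> 0" "x = b / c" using Q.fraction[OF x(1)] .
  have b: "b \<noteq> 0" using bc x by auto
  have L: "b \<in> L" "c \<in> L" "conjg c \<noteq> 0" "conjg b \<noteq> 0" using bc b conjg_nonzero by auto
  have "conjg x * conjg c = conjg (x * c)" using x L by (simp only: conjg_mult)
  also have "x * c = b" using bc by simp
  finally have "conjg x = conjg b / conjg c" using L by (simp add: eq_divide_eq)
  then have "val L Q (conjg x) = val L Q (conjg b) - val L Q (conjg c)" using L by (simp add: Q.val_divide conjg_mem)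
  also have "\<dots> = val L Q x" unfolding bc(4) using eq bc b L by (simp add: Q.val_divide)
  finally show ?thesis .
qed

end

section \<open>Comparison of a prime of \<open>L\<close> with the prime of \<open>K\<close> below
  it\<close>

locale quadratic_extension_prime = quadratic_extension K a r + Q: prime_ideal "adjoin K r" Q for K a r Q
begin

abbreviation q where "q \<equiv> Q \<inter> K"

lemma q_fin_prime: "q \<in> fin_primes K"
proof -
  have "x * y \<in> Q" if "x \<in> ints_of K" "y \<in> Q" for x y
    using that ints_K by (intro L.ideal_scale[OF Q.Q_ideal]) auto
  then have "K.is_ideal q" unfolding K.is_ideal_def
    using Q.Q_ints ints_K L.ideal_zero[OF Q.Q_ideal] L.ideal_add[OF Q.Q_ideal] by auto
  moreover have "q \<noteq> {0}"
  proof -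
    obtain x where x: "x \<in> Q" "x \<noteq> 0" "x \<in> ints_of L" using L.nonzero_ideal_elt[OF Q.Q_ideal Q.Q_nonzero] .
    \<comment> \<open>The norm of a nonzero element of \<open>Q\<close> is a nonzero element of the
      prime below.\<close>
    then have "x * conjg x \<in> q" "x * conjg x \<noteq> 0"
      using L.ideal_scale'[OF Q.Q_ideal x(1) conjg_ints] mult_conjg_mem[of x] conjg_nonzero[of x] by auto
    then show ?thesis by blast
  qed
  moreover have "x \<in> q \<or> y \<in> q" if "x \<in> ints_of K" "y \<in> ints_of K" "x * y \<in> q" for x y
    using Q.prime_cases[of x y] that ints_K by auto
  ultimately show ?thesis unfolding K.fin_primes_iff K.is_prime_def using Q.one_notin by blast
qed

sublocale q: prime_ideal K q by (rule K.prime_idealI[OF q_fin_prime])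

text \<open>The ramification index is the valuation at \<open>Q\<close> of a uniformiser \<pi> of
  \<open>q\<close>. Units at \<open>q\<close> are quotients of integers of \<open>K\<close> outside
  \<open>q\<close>, which are also outside \<open>Q\<close>, and every element is a unit times a
  power of \<pi>.\<close>

lemma ramification:
  "\<exists>e\<ge>1. \<forall>x\<in>K - {0}. val L Q x = e * val K q x"
proof -
  obtain \<pi> where \<pi>: "\<pi> \<in> K" "\<pi> \<noteq> 0" "val K q \<pi> = 1" using q.val_surj_one by blast
  define e where "e = val L Q \<pi>"
  have zero: "val L Q x = 0" if x: "x \<in> K" "x \<noteq> 0" "val K q x = 0" for x
  proof -
    obtain b c where bc: "b \<in> ints_of K" "c \<in> ints_of K" "b \<notin> q" "c \<notin> q" "x = b / c"
      using q.val_zero_fraction[OF x] .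
    have v: "y \<in> L \<and> y \<noteq> 0 \<and> val L Q y = 0" if y: "y \<in> ints_of K" "y \<notin> q" for y
    proof -
      have y': "y \<in> ints_of L" "y \<notin> Q" using y ints_K by auto
      then have "y \<noteq> 0" using L.ideal_zero[OF Q.Q_ideal] by auto
      then show ?thesis using y' Q.mem_iff_val[of y] Q.val_nonneg_ints[of y] by auto
    qed
    show ?thesis using v[OF bc(1,3)] v[OF bc(2,4)] unfolding bc(5) by (simp add: Q.val_divide)
  qed
  have eq: "val L Q x = e * val K q x" if x: "x \<in> K" "x \<noteq> 0" for x
  proof -
    define k where "k = val K q x"
    define m n where "m = nat k" and "n = nat (- k)"
    have k: "k = int m - int n" unfolding m_def n_def by simp
    have pm: "\<pi> ^ m \<in> K" "\<pi> ^ m \<noteq> 0" "\<pi> ^ n \<in> K" "\<pi> ^ n \<noteq> 0" using \<pi> by auto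
    have xn: "x * \<pi> ^ n \<in> K" "x * \<pi> ^ n \<noteq> 0" using x pm by auto
    have "val K q (x * \<pi> ^ n / \<pi> ^ m) = 0"
      using q.val_divide[OF xn pm(1,2)] q.val_mult[OF x pm(3,4)] \<pi> k
      by (simp add: q.val_power k_def)
    then have "val L Q (x * \<pi> ^ n / \<pi> ^ m) = 0" using xn pm by (intro zero) (auto intro!: K.closed)
    moreover have "val L Q (x * \<pi> ^ n / \<pi> ^ m) = val L Q x + int n * e - int m * e"
    proof -
      have "val L Q (x * \<pi> ^ n / \<pi> ^ m) = val L Q (x * \<pi> ^ n) - val L Q (\<pi> ^ m)"
        using pm xn by (intro Q.val_divide) auto
      moreover have "val L Q (x * \<pi> ^ n) = val L Q x + val L Q (\<pi> ^ n)"
        using pm x by (intro Q.val_mult) auto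
      ultimately show ?thesis using \<pi> unfolding e_def by (simp add: Q.val_power K_mem)
    qed
    ultimately show ?thesis unfolding k_def[symmetric] k by (simp add: algebra_simps)
  qed
  have "e \<ge> 1"
  proof -
    obtain x where x: "x \<in> q" "x \<noteq> 0" "x \<in> ints_of K" using K.nonzero_ideal_elt[OF q.Q_ideal q.Q_nonzero] .
    have "1 \<le> val K q x" "1 \<le> val L Q x"
      using x q.mem_iff_val[of x] Q.mem_iff_val[of x] ints_K by auto
    moreover have "val L Q x = e * val K q x" using x by (intro eq) auto
    ultimately have "0 < e * val K q x" "0 < val K q x" by auto
    then show ?thesis by (auto simp: zero_less_mult_iff)
  qed
  then show ?thesis using eq by blast
qed

text \<open>A local square root of \<open>a\<close> at \<open>q\<close> is a limit of elements of \<open>K\<close>, which converge at \<open>Q\<close> to \<open>r\<close>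
  or to \<open>-r\<close>.\<close>

lemma val_of_local_square:
  assumes \<rho>: "\<rho> \<in> carrier q.Kq" "\<rho> \<otimes>\<^bsub>q.Kq\<^esub> \<rho> = to_completion K q a" and uv: "u \<in> K" "v \<in> K"
    and W: "to_completion K q u \<oplus>\<^bsub>q.Kq\<^esub> to_completion K q v \<otimes>\<^bsub>q.Kq\<^esub> \<rho> = W" "W \<noteq> \<zero>\<^bsub>q.Kq\<^esub>"
    and W': "to_completion K q u \<oplus>\<^bsub>q.Kq\<^esub> to_completion K q v \<otimes>\<^bsub>q.Kq\<^esub> (\<ominus>\<^bsub>q.Kq\<^esub> \<rho>) = W'" "W' \<noteq> \<zero>\<^bsub>q.Kq\<^esub>"
  shows "\<exists>e. val L Q (u + v * r) = e * q.lval W \<or> val L Q (u + v * r) = e * q.lval W'"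
proof -
  obtain e where e: "e \<ge> 1" "\<And>x. x \<in> K \<Longrightarrow> x \<noteq> 0 \<Longrightarrow> val L Q x = e * val K q x" using ramification by auto
  obtain s where s: "s \<in> carrier q.CR" "\<rho> = q.cls s" using q.cls_surj[OF \<rho>(1)] .
  have sK: "s n \<in> K" for n by (rule q.CR_mem[OF s(1)])
  have s': "(\<lambda>n. - s n) \<in> carrier q.CR" by (rule q.CR_uminus[OF s(1)])
  have "\<ominus>\<^bsub>q.Kq\<^esub> \<rho> = q.cls (\<lambda>n. - s n)"
    unfolding s(2) using q.cls.hom_a_inv[OF s(1)] q.CR_minus[OF s(1)] by simp
  then have cls: "W = q.cls (\<lambda>n. u + v * s n)" "W' = q.cls (\<lambda>n. u + v * - s n)"
    unfolding W(1)[symmetric] W'(1)[symmetric] s(2) q.to_completion_eq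
    using s(1) s' uv by (simp_all add: q.cls_mult q.cls_add q.CR_const q.CR_mult del: mult_minus_right add_uminus_conv_diff)
  have CR: "(\<lambda>n. u + v * s n) \<in> carrier q.CR" "(\<lambda>n. u + v * - s n) \<in> carrier q.CR"
    by (intro q.CR_add q.CR_mult q.CR_const s s' uv)+
  obtain M1 where M1: "\<And>n. n \<ge> M1 \<Longrightarrow> u + v * s n \<noteq> 0 \<and> val K q (u + v * s n) = q.lval W"
    using q.cls_nonzero[OF CR(1)] W(2) unfolding cls by blast
  obtain M2 where M2: "\<And>n. n \<ge> M2 \<Longrightarrow> u + v * - s n \<noteq> 0 \<and> val K q (u + v * - s n) = q.lval W'"
    using q.cls_nonzero[OF CR(2)] W'(2) unfolding cls by blast
  have "q.cls (\<lambda>n. s n * s n) = q.cls (\<lambda>_. a)"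
    using \<rho>(2) s by (simp add: q.to_completion_eq q.cls_mult)
  then have "(\<lambda>n. s n * s n - a) \<in> q.NS"
    using q.cls_eq_iff[OF q.CR_mult[OF s(1,1)] q.CR_const[OF a_mem]] by simp
  then have null: "\<exists>M. \<forall>n\<ge>M. val_ge K q (s n * s n - a) N" for N by (simp add: q.NS_iff)
  define d where "d = val L Q (2 * r)"
  \<comment> \<open>\<open>N\<close> exceeds \<open>2 * d\<close>, so one of \<open>s n - r\<close>
    and \<open>s n + r\<close> has valuation above \<open>d\<close>, hence at least
    \<open>N - d\<close>. The remaining terms make its product with \<open>v\<close> smaller than
    \<open>u + v * s n\<close>, respectively \<open>u - v * s n\<close>.\<close>
  define N where "N = 1 + 2 * \<bar>d\<bar> + \<bar>d\<bar> + \<bar>val L Q v\<bar> + \<bar>e * q.lval W\<bar> + \<bar>e * q.lval W'\<bar>"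
  obtain M3 where M3: "\<And>n. n \<ge> M3 \<Longrightarrow> val_ge K q (s n * s n - a) N" using null by blast
  define n where "n = max M1 (max M2 M3)"
  have "n \<ge> M1" "n \<ge> M2" "n \<ge> M3" by (auto simp: n_def)
  note M = M1[OF this(1)] M2[OF this(2)] M3[OF this(3)]
  define x where "x = s n - r"
  define y where "y = s n + r"
  have xy: "x \<in> L" "y \<in> L" "2 * r \<in> L" using sK r_mem by (auto simp: x_def y_def intro!: L.closed)
  have nz: "x \<noteq> 0" "y \<noteq> 0" "2 * r \<noteq> 0"
    using sK[of n] K.uminus_mem[OF sK[of n]] r_notin by (auto simp: x_def y_def eq_neg_iff_add_eq_0[symmetric])
  have prod: "x * y = s n * s n - a" unfolding x_def y_def r_square[symmetric] by (simp add: algebra_simps)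
  have "val L Q x + val L Q y \<ge> N"
  proof -
    have K: "x * y \<in> K" "x * y \<noteq> 0" unfolding prod using sK[of n] a_mem nz prod by (auto simp: mult_eq_0_iff)
    then have "val K q (x * y) \<ge> N" using M(3) unfolding prod[symmetric] val_ge_def by simp
    moreover have "N \<ge> 0" by (simp add: N_def)
    ultimately have "val L Q (x * y) \<ge> N"
      unfolding e(2)[OF K] using e(1) mult_right_mono[of 1 e "val K q (x * y)"] by simp
    then show ?thesis using xy nz by (simp add: Q.val_mult)
  qed
  \<comment> \<open>The difference of \<open>y\<close> and \<open>x\<close> is \<open>2 * r\<close>,
    so if one of them is closer to zero than \<open>2 * r\<close>, the other has exactly the
    valuation of \<open>2 * r\<close>.\<close>
  moreover have "val L Q y = d" if "val L Q x > d"
    using Q.val_close(2)[OF xy(3) nz(3) xy(2)] Q.val_ge_uminus[OF xy(1), of "d + 1"] that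
    by (simp add: x_def y_def d_def val_ge_def)
  moreover have "val L Q x = d" if "val L Q y > d"
  proof -
    have "val_ge L Q (2 * r - - x) (val L Q (2 * r) + 1)"
      using that by (simp add: x_def y_def d_def val_ge_def add.commute)
    then show ?thesis
      using Q.val_close(2)[OF xy(3) nz(3) L.uminus_mem[OF xy(1)]] Q.val_uminus[OF xy(1) nz(1)]
      by (simp add: d_def)
  qed
  ultimately have large: "val L Q x \<ge> N - d \<or> val L Q y \<ge> N - d" unfolding N_def by linarith
  have ur: "u + v * r \<in> L" using uv r_mem by (auto intro!: L.closed)
  have scale: "val_ge L Q (v * t) (val L Q v + val L Q t)" if "t \<in> L" for t
    using Q.val_ge_mult[of v t "val L Q v" "val L Q t"] that uv by (auto simp: val_ge_def)
  from large show ?thesis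
  proof
    assume l: "val L Q x \<ge> N - d"
    let ?w = "u + v * s n"
    have w: "?w \<in> K" "?w \<noteq> 0" using uv sK M by (auto intro!: K.closed)
    have eq: "val L Q ?w = e * q.lval W" using e(2)[OF w] M(1) by simp
    have "val_ge L Q (?w - (u + v * r)) (val L Q ?w + 1)"
      using Q.val_ge_mono[OF scale[OF xy(1)], of "val L Q ?w + 1"] l unfolding eq
      by (simp add: x_def N_def algebra_simps)
    then have "val L Q (u + v * r) = val L Q ?w" using w ur by (intro Q.val_close(2)) auto
    then show ?thesis using eq by auto
  next
    assume l: "val L Q y \<ge> N - d"
    let ?w = "u + v * - s n"
    have w: "?w \<in> K" "?w \<noteq> 0" using uv sK M by (auto intro!: K.closed)
    have eq: "val L Q ?w = e * q.lval W'" using e(2)[OF w] M(2) by simp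
    have vy: "v * y \<in> L" using uv xy by auto
    have "val_ge L Q (- (v * y)) (val L Q ?w + 1)"
      using Q.val_ge_uminus[OF vy Q.val_ge_mono[OF scale[OF xy(2)], of "val L Q ?w + 1"]] l unfolding eq
      by (simp add: N_def)
    moreover have "- (v * y) = ?w - (u + v * r)" by (simp add: y_def algebra_simps)
    ultimately have "val_ge L Q (?w - (u + v * r)) (val L Q ?w + 1)" by (simp only:)
    then have "val L Q (u + v * r) = val L Q ?w" using w ur by (intro Q.val_close(2)) auto
    then show ?thesis using eq by auto
  qed
qed

text \<open>If \<open>q\<close> splits, the elements of \<open>K\<close> that approximate \<open>r\<close> at \<open>Q\<close> are found by the Chinese remainder
  theorem: for \<open>B\<close> close to \<open>1\<close> at \<open>Q\<close> and to \<open>0\<close> at the conjugate of \<open>Q\<close>, take \<open>r\<close> times the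
  difference of \<open>B\<close> and its conjugate.\<close>

lemma local_square_of_split:
  assumes "conjg ` Q \<noteq> Q"
  shows "\<exists>\<rho>\<in>carrier q.Kq. \<rho> \<otimes>\<^bsub>q.Kq\<^esub> \<rho> = to_completion K q a"
proof -
  let ?P = "conjg ` Q"
  interpret P: prime_ideal L ?P by (rule L.prime_idealI[OF conjg_prime[OF Q.prime]])
  obtain e where e: "e \<ge> 1" "\<And>x. x \<in> K \<Longrightarrow> x \<noteq> 0 \<Longrightarrow> val L Q x = e * val K q x" using ramification by auto
  obtain s where s: "s \<in> Q" "s \<notin> ?P" "s \<in> ints_of L" using P.prime_notin[OF Q.prime] assms by metis
  obtain t p where tp: "t \<in> ints_of L" "p \<in> ?P" "t * s + p = 1" using L.prime_maximal[OF P.is_prime s(3,2)] .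
  define \<alpha> where "\<alpha> = t * s"
  have \<alpha>: "\<alpha> \<in> Q" "1 - \<alpha> \<in> ?P"
    using tp s L.ideal_scale[OF Q.Q_ideal tp(1) s(1)] by (auto simp: \<alpha>_def algebra_simps)
  have \<alpha>O: "\<alpha> \<in> ints_of L" using \<alpha>(1) by (rule Q.Q_ints)
  \<comment> \<open>Since \<alpha> lies in \<open>Q\<close> and \<open>1 - \<alpha>\<close> in its
    conjugate, \<open>1 - B n\<close> is divisible by \<open>\<alpha> ^ n\<close> and
    \<open>B n\<close> by \<open>(1 - \<alpha>) ^ n\<close>: one formula gives both approximations
    to order \<open>n\<close>.\<close>
  define B where "B n = (1 - \<alpha> ^ n) ^ n" for n
  have BO: "B n \<in> ints_of L" for n unfolding B_def using \<alpha>O by (intro L.ints_closed) auto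
  have BQ: "1 - B n \<in> Q.pow n" for n
  proof -
    have "1 - B n = \<alpha> ^ n * (\<Sum>i<n. (1 - \<alpha> ^ n) ^ i)"
      unfolding B_def using one_diff_power_eq[of "1 - \<alpha> ^ n" n] by simp
    also have "\<dots> \<in> Q.pow n"
      using \<alpha>O by (intro L.ideal_scale'[OF Q.pow_ideal Q.pow_elt[OF \<alpha>(1)]] L.ints_closed) auto
    finally show ?thesis .
  qed
  have BP: "conjg (B n) \<in> Q.pow n" for n
  proof -
    have "1 - \<alpha> ^ n = (1 - \<alpha>) * (\<Sum>i<n. \<alpha> ^ i)" by (rule one_diff_power_eq)
    also have "\<dots> \<in> ?P" using \<alpha>O by (intro L.ideal_scale'[OF P.Q_ideal \<alpha>(2)] L.ints_closed) auto
    finally have "B n \<in> P.pow n" unfolding B_def by (rule P.pow_elt)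
    moreover have "conjg ` ?P \<subseteq> Q" using conjg_conjg Q.Q_ints by (auto simp: L.ints_mem)
    ultimately show ?thesis using conjg_pow[of "B n" ?P n Q] P.Q_ints by auto
  qed
  define w where "w n = r * (B n - conjg (B n))" for n
  \<comment> \<open>The difference of an element and its conjugate is a multiple of \<open>r\<close>
    by an element of \<open>K\<close>; the extra factor \<open>r\<close> turns it into a multiple of
    \<open>a\<close>.\<close>
  have wK: "w n \<in> K" for n
  proof -
    obtain u v where uv: "u \<in> K" "v \<in> K" "B n = u + v * r" using L_cases[OF L.ints_mem[OF BO]] .
    have "w n = 2 * v * a" unfolding w_def uv(3) conjg_eq[OF uv(1,2)] r_square[symmetric] by (simp add: algebra_simps)
    then show ?thesis using uv a_mem by (auto intro!: K.closed)
  qed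
  have wO: "w n \<in> ints_of L" for n unfolding w_def using BO conjg_ints r_ints by (intro L.ints_closed) auto
  have wr: "w n - r \<in> Q.pow n" for n
  proof -
    have "- r * ((1 - B n) + conjg (B n)) \<in> Q.pow n"
      using BQ BP r_ints by (intro L.ideal_scale[OF Q.pow_ideal] L.ideal_add[OF Q.pow_ideal]) auto
    moreover have "- r * ((1 - B n) + conjg (B n)) = w n - r" unfolding w_def by (simp add: algebra_simps)
    ultimately show ?thesis by simp
  qed
  \<comment> \<open>Valuations at \<open>Q\<close> of elements of \<open>K\<close> are
    \<open>e\<close> times those at \<open>q\<close>, hence the exponent
    \<open>e * N\<close>.\<close>
  have small: "val_ge K q x N" if x: "x \<in> K" "x \<in> Q.pow n" "int n \<ge> e * N" for x n N
  proof (cases "x = 0")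
    case False
    have "x \<in> ints_of L" by (rule L.ideal_ints[OF Q.pow_ideal x(2)])
    then have "int n \<le> e * val K q x" using Q.pow_iff_val[of x n] e(2)[OF x(1) False] False x(2) by simp
    then have "e * N \<le> e * val K q x" using x(3) by simp
    then show ?thesis using e(1) by (simp add: val_ge_def)
  qed simp
  have CR: "w \<in> carrier q.CR" unfolding q.CR_iff
  proof (intro conjI allI)
    fix N
    have "val_ge K q (w i - w j) N" if "i \<ge> nat (e * N)" "j \<ge> nat (e * N)" for i j
    proof (rule small)
      show "w i - w j \<in> K" using wK by auto
      have "w i - r \<in> Q.pow (nat (e * N))" "w j - r \<in> Q.pow (nat (e * N))"
        using wr Q.pow_mono that by blast+
      then have "(w i - r) - (w j - r) \<in> Q.pow (nat (e * N))" by (rule L.ideal_diff[OF Q.pow_ideal])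
      then show "w i - w j \<in> Q.pow (nat (e * N))" by simp
    qed simp
    then show "\<exists>M. \<forall>i\<ge>M. \<forall>j\<ge>M. val_ge K q (w i - w j) N" by blast
  qed (rule wK)
  have sq: "(\<lambda>n. w n * w n - a) \<in> q.NS" unfolding q.NS_iff
  proof (intro conjI allI)
    show "(\<lambda>n. w n * w n - a) \<in> carrier q.CR"
      using q.CR_add[OF q.CR_mult[OF CR CR] q.CR_uminus[OF q.CR_const[OF a_mem]]] by simp
    fix N
    have "val_ge K q (w n * w n - a) N" if "n \<ge> nat (e * N)" for n
    proof (rule small)
      show "w n * w n - a \<in> K" using wK a_mem by auto
      have "(w n - r) * (w n + r) \<in> Q.pow n"
        using wO r_ints by (intro L.ideal_scale'[OF Q.pow_ideal wr]) auto
      moreover have "(w n - r) * (w n + r) = w n * w n - a"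
        unfolding r_square[symmetric] by (simp add: algebra_simps)
      ultimately show "w n * w n - a \<in> Q.pow n" by simp
    qed (use that in simp)
    then show "\<exists>M. \<forall>n\<ge>M. val_ge K q (w n * w n - a) N" by blast
  qed
  show ?thesis
  proof (rule bexI[of _ "q.cls w"])
    show "q.cls w \<otimes>\<^bsub>q.Kq\<^esub> q.cls w = to_completion K q a"
      unfolding q.to_completion_eq q.cls_mult[OF CR CR]
      using q.cls_eq_iff[OF q.CR_mult[OF CR CR] q.CR_const[OF a_mem]] sq by simp
  qed (rule q.cls_mem[OF CR])
qed

end

context prime_ideal
begin

lemma S_primes_local:
  assumes "a \<in> F" "a \<noteq> 0" "Q \<notin> S_primes F a" "\<rho> \<in> carrier Kq" "\<rho> \<otimes>\<^bsub>Kq\<^esub> \<rho> = to_completion F Q a"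
  shows "6 dvd val F Q (4 * a)"
proof -
  have "\<rho> \<otimes>\<^bsub>Kq\<^esub> \<rho> \<noteq> \<zero>\<^bsub>Kq\<^esub>" unfolding assms(5) by (rule lval_to_completion(2)[OF assms(1,2)])
  then have "\<rho> \<noteq> \<zero>\<^bsub>Kq\<^esub>" using assms(4) Kq.integral_iff by blast
  moreover have "to_completion F Q a = \<rho> [^]\<^bsub>Kq\<^esub> (2::nat)"
    using assms(4,5) by (simp add: numeral_2_eq_2)
  ultimately have "val F Q (4 * a) mod 6 = 0" using assms(3,4) prime unfolding S_primes_def by blast
  then show ?thesis by presburger
qed

end

lemma (in quadratic_extension_prime) selmer_val:
  assumes z: "z \<in> K" "z ^ 3 = 1" "z \<noteq> 1" and uv: "(u, v) \<in> selmer_elems K a z" and S: "q \<notin> S_primes K a"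
  shows "3 dvd val L Q (u + v * r)"
proof -
  obtain c where c: "u \<in> K" "v \<in> K" "c \<in> K" "c \<noteq> 0" "u ^ 2 - a * v ^ 2 = c ^ 3"
    using selmer_elems_norm[OF uv] .
  show ?thesis
  proof (cases "\<exists>\<rho>\<in>carrier q.Kq. \<rho> \<otimes>\<^bsub>q.Kq\<^esub> \<rho> = to_completion K q a")
    case True
    then obtain \<rho>0 where \<rho>0: "\<rho>0 \<in> carrier q.Kq" "\<rho>0 \<otimes>\<^bsub>q.Kq\<^esub> \<rho>0 = to_completion K q a" ..
    have six: "6 dvd val K q (4 * a)" by (rule q.S_primes_local[OF a_mem a_nonzero S \<rho>0])
    have alg: "algebraic r" using r_algebraic_int by auto
    obtain \<rho> where \<rho>: "\<rho> \<in> carrier q.Kq" "\<rho> \<otimes>\<^bsub>q.Kq\<^esub> \<rho> = to_completion K q a"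
      and W: "to_completion K q u \<oplus>\<^bsub>q.Kq\<^esub> to_completion K q v \<otimes>\<^bsub>q.Kq\<^esub> \<rho> \<noteq> \<zero>\<^bsub>q.Kq\<^esub>"
        "to_completion K q u \<oplus>\<^bsub>q.Kq\<^esub> to_completion K q v \<otimes>\<^bsub>q.Kq\<^esub> (\<ominus>\<^bsub>q.Kq\<^esub> \<rho>) \<noteq> \<zero>\<^bsub>q.Kq\<^esub>"
        "3 dvd q.lval (to_completion K q u \<oplus>\<^bsub>q.Kq\<^esub> to_completion K q v \<otimes>\<^bsub>q.Kq\<^esub> \<rho>)"
        "3 dvd q.lval (to_completion K q u \<oplus>\<^bsub>q.Kq\<^esub> to_completion K q v \<otimes>\<^bsub>q.Kq\<^esub> (\<ominus>\<^bsub>q.Kq\<^esub> \<rho>))"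
      using q.selmer_local_val[OF z a_mem a_nonzero r_square alg uv \<rho>0(1) \<rho>0(2)[symmetric] six] by auto
    show ?thesis using val_of_local_square[OF \<rho> c(1,2) refl W(1) refl W(2)] W(3,4) by auto
  next
    case False
    \<comment> \<open>A prime different from its conjugate would provide a square root of
      \<open>a\<close> in the completion below.\<close>
    then have Q: "conjg ` Q = Q" using local_square_of_split by blast
    let ?x = "u + v * r"
    have conj: "conjg ?x = u - v * r" by (rule conjg_eq[OF c(1,2)])
    have norm: "?x * conjg ?x = c * c ^ 2"
      unfolding conj using c(5) r_square by (simp add: power2_eq_square power3_eq_cube algebra_simps)
    then have nz: "?x \<noteq> 0" "conjg ?x \<noteq> 0" using c(4) by auto
    have L: "?x \<in> L" "conjg ?x \<in> L" "c \<in> L" "c ^ 2 \<in> L" using c r_mem by (auto intro!: L.closed)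
    have "val L Q (?x * conjg ?x) = 2 * val L Q ?x"
      using Q.val_mult[OF L(1) nz(1) L(2) nz(2)] val_conjg[OF Q.prime Q L(1) nz(1)] by simp
    moreover have "val L Q (?x * conjg ?x) = 3 * val L Q c"
      unfolding norm using Q.val_mult[OF L(3) c(4) L(4)] Q.val_power[OF L(3) c(4), of 2] c(4) by simp
    ultimately show ?thesis by presburger
  qed
qed

lemma (in prime_ideal) selmer_val_split:
  assumes z: "z \<in> F" "z ^ 3 = 1" "z \<noteq> 1" and a: "a \<in> F" "a \<noteq> 0" and r: "r \<in> F" "r * r = a"
    and uv: "(u, v) \<in> selmer_elems F a z" and S: "Q \<notin> S_primes F a"
  shows "3 dvd val F Q (u + v * r)"
proof -
  let ?tc = "to_completion F Q"
  obtain c where c: "u \<in> F" "v \<in> F" "c \<in> F" "c \<noteq> 0" "u ^ 2 - a * v ^ 2 = c ^ 3"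
    using selmer_elems_norm[OF uv] .
  have tc: "?tc r \<in> carrier Kq" "?tc r \<otimes>\<^bsub>Kq\<^esub> ?tc r = ?tc a"
    using r by (simp_all add: to_completion_mem to_completion_mult[symmetric])
  have six: "6 dvd val F Q (4 * a)" by (rule S_primes_local[OF a S tc])
  have ur: "u + v * r \<in> F" "u + v * r \<noteq> 0"
    using c r selmer_elems_nonzero[OF uv r(2)] by (auto intro!: closed)
  have eq: "?tc u \<oplus>\<^bsub>Kq\<^esub> ?tc v \<otimes>\<^bsub>Kq\<^esub> ?tc r = ?tc (u + v * r)"
    using c r by (simp add: to_completion_mult to_completion_add mult_mem)
  obtain \<rho> where \<rho>: "\<rho> \<in> carrier Kq" "\<rho> \<otimes>\<^bsub>Kq\<^esub> \<rho> = ?tc a"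
    and W: "3 dvd lval (?tc u \<oplus>\<^bsub>Kq\<^esub> ?tc v \<otimes>\<^bsub>Kq\<^esub> \<rho>)" "3 dvd lval (?tc u \<oplus>\<^bsub>Kq\<^esub> ?tc v \<otimes>\<^bsub>Kq\<^esub> (\<ominus>\<^bsub>Kq\<^esub> \<rho>))"
    using selmer_local_val[OF z a r(2) algebraic_mem[OF r(1)] uv tc(1) tc(2)[symmetric] six] by auto
  have "plain_field Kq" by (simp add: plain_field_def completion_field)
  \<comment> \<open>The local root may be either sign of the image of \<open>r\<close>; the
    divisibility is available for both.\<close>
  then have "?tc r = \<rho> \<or> ?tc r = \<ominus>\<^bsub>Kq\<^esub> \<rho>"
    using plain_field.square_eq_cases[of Kq "?tc r" \<rho>] tc \<rho> by simp
  then have "3 dvd lval (?tc (u + v * r))" using W unfolding eq[symmetric] by auto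
  then show ?thesis by (simp add: lval_to_completion(1)[OF ur])
qed

theorem theorem3p8:
  fixes m a :: int and \<zeta> r :: complex and K :: "complex set"
  assumes "cube_free m" and "\<nexists>n. m = n ^ 3"
    and "K = pure_cubic_closure m"
    and "\<zeta> ^ 3 = 1" and "\<zeta> \<noteq> 1"
    and "a \<noteq> 0" and "sixth_power_free_in K (of_int a)"
    and "r ^ 2 = of_int a"
  shows "((\<nexists>b. b \<in> K \<and> b ^ 2 = of_int a) \<longrightarrow>
            selmer_classes K (adjoin K r) (of_int a) \<zeta> r
              \<subseteq> N_group (adjoin K r) (primes_above K (adjoin K r) (S_primes K (of_int a)))) \<and>
         ((\<exists>b. b \<in> K \<and> b ^ 2 = of_int a) \<longrightarrow>
            selmer_classes K K (of_int a) \<zeta> r \<subseteq> N_group K (S_primes K (of_int a)))"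
proof -
  interpret K: number_field K unfolding assms(3) by (rule number_field_pure_cubic_closure)
  have z: "\<zeta> \<in> K"
    unfolding assms(3) pure_cubic_closure_def using assms(4) by (intro generate_field.incl) simp
  have a: "(of_int a :: complex) \<in> K" "(of_int a :: complex) \<noteq> 0" using assms(6) by simp_all
  have rr: "r * r = of_int a" using assms(8) by (simp add: power2_eq_square)
  note nz = selmer_elems_nonzero[OF _ rr]
  show ?thesis
  proof (intro conjI impI subsetI)
    assume ns: "\<nexists>b. b \<in> K \<and> b ^ 2 = of_int a"
    interpret quadratic_extension K "of_int a" r
      by unfold_locales (use ns assms(8) rr in auto)
    fix C assume "C \<in> selmer_classes K (adjoin K r) (of_int a) \<zeta> r"
    then obtain u v where uv: "(u, v) \<in> selmer_elems K (of_int a) \<zeta>" and C: "C = cube_class L (u + v * r)"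
      unfolding selmer_classes_def by auto
    have "u \<in> K" "v \<in> K" using selmer_elems_norm[OF uv] by auto
    then have ur: "u + v * r \<in> L" using r_mem by (auto intro!: L.closed)
    show "C \<in> N_group (adjoin K r) (primes_above K (adjoin K r) (S_primes K (of_int a)))"
      unfolding C
    proof (rule L.N_groupI[OF ur nz[OF uv]])
      fix Q assume Q: "Q \<in> fin_primes L - primes_above K L (S_primes K (of_int a))"
      interpret Q: quadratic_extension_prime K "of_int a" r Q by unfold_locales (use Q in simp)
      show "3 dvd val L Q (u + v * r)"
        by (rule Q.selmer_val[OF z assms(4,5) uv]) (use Q in \<open>auto simp: primes_above_def\<close>)
    qed
  next
    assume "\<exists>b. b \<in> K \<and> b ^ 2 = of_int a"
    then obtain b where b: "b \<in> K" "b ^ 2 = of_int a" by blast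
    then have "r = b \<or> r = - b" using assms(8) by (simp add: power2_eq_iff[symmetric])
    then have r: "r \<in> K" using b(1) by auto
    fix C assume "C \<in> selmer_classes K K (of_int a) \<zeta> r"
    then obtain u v where uv: "(u, v) \<in> selmer_elems K (of_int a) \<zeta>" and C: "C = cube_class K (u + v * r)"
      unfolding selmer_classes_def by auto
    have "u \<in> K" "v \<in> K" using selmer_elems_norm[OF uv] by auto
    then have ur: "u + v * r \<in> K" using r by (auto intro!: K.closed)
    show "C \<in> N_group K (S_primes K (of_int a))" unfolding C
    proof (rule K.N_groupI[OF ur nz[OF uv]])
      fix Q assume Q: "Q \<in> fin_primes K - S_primes K (of_int a)"
      interpret Q: prime_ideal K Q by (rule K.prime_idealI) (use Q in simp)
      show "3 dvd val K Q (u + v * r)"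
        by (rule Q.selmer_val_split[OF z assms(4,5) a r rr uv]) (use Q in simp)
    qed
  qed
qed

end
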